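(* Let $k\ge1$ be an integer and $b\in(-1,1)$. If $n+1+b>2k$, then the trace map $U\mapsto\mathrm{Tr}(U):=U(\cdot,0)$, $U\in C^k_{c;\mathbf e}(\mathbb R^{n+1})$, can be uniquely extended to a continuous operator $$\mathrm{Tr}:\mathcal D^{k;b}_{\mathbf e}(\mathbb R^{n+1})\to\mathcal D^{k-\frac{1+b}2}(\mathbb R^n).$$
   Context: Points of $\mathbb R^{n+1}=\mathbb R^n\times\mathbb R$ are written $z=(x,y)$. The fractional Laplacian is defined by $\widehat{(-\Delta)^su}=|\xi|^{2s}\hat u$ (unitary Fourier transform on $\mathbb R^n$). For $n>2s>0$, $\mathcal D^s(\mathbb R^n)=\{u\in L^2(\mathbb R^n;|x|^{-2s}dx):(-\Delta)^{s/2}u\in L^2(\mathbb R^n)\}$ is a Hilbert space with scalar product $\int_{\mathbb R^n}(-\Delta)^{s/2}u\,(-\Delta)^{s/2}v\,dx$. For $b\in(-1,1)$ put $\Delta_b=\Delta+b\,y^{-1}\partial_y$ ($\Delta$ the Laplacian on $\mathbb R^{n+1}$); $\nabla_b^j=\Delta_b^{j/2}$ if $j$ is even and $\nabla_b^j=\nabla\Delta_b^{(j-1)/2}$ if $j$ is odd. $C^k_{c;\mathbf e}(\mathbb R^{n+1})$ is the space of compactly supported $C^k$ functions on $\mathbb R^{n+1}$ that are even in $y$ ($k\le\infty$). The Hilbert space $\mathcal D^{k;b}_{\mathbf e}(\mathbb R^{n+1})$ is the completion of $C^\infty_{c;\mathbf e}(\mathbb R^{n+1})$ in $L^2(\mathbb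 R^{n+1};|y|^b|z|^{-2k}dz)$ with respect to the norm with square $\sum_{j=0}^k\iint_{\mathbb R^{n+1}}|y|^b|z|^{-2(k-j)}|\nabla_b^jU|^2dz$; it is endowed with the equivalent norm $\big(\iint_{\mathbb R^{n+1}}|y|^b|\nabla_b^kU|^2dz\big)^{1/2}$, with $\nabla_b^kU$ defined by density. One has $C^k_{c;\mathbf e}(\mathbb R^{n+1})\subset\mathcal D^{k;b}_{\mathbf e}(\mathbb R^{n+1})$. *)

theory Defs
  imports "HOL-Analysis.Analysis"
begin

text \<open>
  The space of dimension \<open>n\<close> is \<open>real^'n\<close> with \<open>n = CARD('n)\<close>, and that of dimension \<open>n + 1\<close> is
  \<open>(real^'n) \<times> real\<close>, whose norm and Lebesgue measure are the Euclidean ones. All function spaces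
  consist of real-valued functions. Elements of Lebesgue spaces are represented by Borel functions;
  \<open>ae_eq\<close> is the identification of representatives.
\<close>

definition ae_eq :: "('a::euclidean_space \<Rightarrow> 'b) \<Rightarrow> ('a \<Rightarrow> 'b) \<Rightarrow> bool" where
  "ae_eq f g \<longleftrightarrow> (AE z in lborel. f z = g z)"

definition weighted_L2 :: "('a::euclidean_space \<Rightarrow> real) \<Rightarrow> ('a \<Rightarrow> 'b::euclidean_space) set" where
  "weighted_L2 w = {f \<in> borel_measurable lborel. integrable lborel (\<lambda>z. w z * (norm (f z))\<^sup>2)}"

definition weighted_L2_norm :: "('a::euclidean_space \<Rightarrow> real) \<Rightarrow> ('a \<Rightarrow> 'b::euclidean_space) \<Rightarrow> real"
  where
  "weighted_L2_norm w f = sqrt (LINT z|lborel. w z * (norm (f z))\<^sup>2)"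

subsection \<open>Classical differentiability\<close>

definition partial_deriv ::
    "'a::euclidean_space \<Rightarrow> ('a \<Rightarrow> 'b::real_normed_vector) \<Rightarrow> 'a \<Rightarrow> 'b" where
  "partial_deriv e f z = frechet_derivative f (at z) e"

primrec Ck :: "nat \<Rightarrow> ('a::euclidean_space \<Rightarrow> 'b::real_normed_vector) \<Rightarrow> bool" where
  "Ck 0 f \<longleftrightarrow> continuous_on UNIV f"
| "Ck (Suc k) f \<longleftrightarrow> f differentiable_on UNIV \<and> (\<forall>e\<in>Basis. Ck k (partial_deriv e f))"

definition grad :: "('a::euclidean_space \<Rightarrow> real) \<Rightarrow> 'a \<Rightarrow> 'a" where
  "grad f z = (\<Sum>e\<in>Basis. partial_deriv e f z *\<^sub>R e)"

definition laplacian :: "('a::euclidean_space \<Rightarrow> real) \<Rightarrow> 'a \<Rightarrow> real" where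
  "laplacian f z = (\<Sum>e\<in>Basis. partial_deriv e (partial_deriv e f) z)"

subsection \<open>Fourier transform and fractional Laplacian\<close>

definition schwartz :: "('a::euclidean_space \<Rightarrow> complex) \<Rightarrow> bool" where
  "schwartz \<phi> \<longleftrightarrow> (\<forall>k. Ck k \<phi>) \<and>
     (\<forall>N es. set es \<subseteq> Basis \<longrightarrow>
        bounded (range (\<lambda>x. (1 + norm x) ^ N *\<^sub>R foldr partial_deriv es \<phi> x)))"

definition fourier :: "('a::euclidean_space \<Rightarrow> complex) \<Rightarrow> 'a \<Rightarrow> complex" where
  "fourier f \<xi> =
     of_real ((2 * pi) powr (- real DIM('a) / 2)) * (LINT x|lborel. cis (- (\<xi> \<bullet> x)) * f x)"

text \<open>
  \<open>has_fourier u v\<close>: the functions \<open>u\<close> and \<open>v\<close> define tempered distributions, and the Fourier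
  transform of the first, in the sense of tempered distributions, is the second.
\<close>

definition has_fourier :: "('a::euclidean_space \<Rightarrow> complex) \<Rightarrow> ('a \<Rightarrow> complex) \<Rightarrow> bool" where
  "has_fourier u v \<longleftrightarrow>
     u \<in> borel_measurable lborel \<and> v \<in> borel_measurable lborel \<and>
     (\<forall>\<phi>. schwartz \<phi> \<longrightarrow>
        integrable lborel (\<lambda>x. u x * fourier \<phi> x) \<and>
        integrable lborel (\<lambda>\<xi>. v \<xi> * \<phi> \<xi>) \<and>
        (LINT x|lborel. u x * fourier \<phi> x) = (LINT \<xi>|lborel. v \<xi> * \<phi> \<xi>))"

text \<open>
  \<open>has_frac_laplacian \<sigma> u w\<close> means \<open>(-\<Delta>)\<^sup>\<sigma> u = w\<close>. The multiplier is not smooth at the origin, so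
  its product with the Fourier transform of \<open>u\<close> is understood for a transform that is a function.
\<close>

definition has_frac_laplacian ::
    "real \<Rightarrow> ('a::euclidean_space \<Rightarrow> real) \<Rightarrow> ('a \<Rightarrow> real) \<Rightarrow> bool" where
  "has_frac_laplacian \<sigma> u w \<longleftrightarrow>
     (\<exists>v. has_fourier (\<lambda>x. of_real (u x)) v \<and>
          has_fourier (\<lambda>x. of_real (w x)) (\<lambda>\<xi>. of_real (norm \<xi> powr (2 * \<sigma>)) * v \<xi>))"

definition Ds :: "real \<Rightarrow> ('a::euclidean_space \<Rightarrow> real) set" where
  "Ds s = {u \<in> weighted_L2 (\<lambda>x. norm x powr (- 2 * s)).
             \<exists>w \<in> weighted_L2 (\<lambda>_. 1). has_frac_laplacian (s / 2) u w}"

text \<open>The function chosen here is unique up to a null set.\<close>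

definition half_frac_laplacian :: "real \<Rightarrow> ('a::euclidean_space \<Rightarrow> real) \<Rightarrow> 'a \<Rightarrow> real" where
  "half_frac_laplacian s u =
     (SOME w. w \<in> weighted_L2 (\<lambda>_. 1) \<and> has_frac_laplacian (s / 2) u w)"

definition Ds_inner ::
    "real \<Rightarrow> ('a::euclidean_space \<Rightarrow> real) \<Rightarrow> ('a \<Rightarrow> real) \<Rightarrow> real" where
  "Ds_inner s u v = (LINT x|lborel. half_frac_laplacian s u x * half_frac_laplacian s v x)"

definition Ds_norm :: "real \<Rightarrow> ('a::euclidean_space \<Rightarrow> real) \<Rightarrow> real" where
  "Ds_norm s u = sqrt (Ds_inner s u u)"

subsection \<open>Spaces on the \<open>(n + 1)\<close>-dimensional space\<close>

definition Cke :: "nat \<Rightarrow> ((real^'n) \<times> real \<Rightarrow> real) set" where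
  "Cke k = {U. Ck k U \<and> compact (closure {z. U z \<noteq> 0}) \<and> (\<forall>x y. U (x, - y) = U (x, y))}"

definition Cinfe :: "((real^'n) \<times> real \<Rightarrow> real) set" where
  "Cinfe = (\<Inter>k. Cke k)"

text \<open>
  On the hyperplane \<open>y = 0\<close> the quotient \<open>\<partial>\<^sub>yU / y\<close> is replaced by its limit \<open>\<partial>\<^sub>y\<partial>\<^sub>yU\<close> (\<open>U\<close> being even
  in \<open>y\<close>), so that \<open>\<Delta>_b\<close> maps \<open>Cinfe\<close> to itself and can be iterated classically.
\<close>

definition Lap_b :: "real \<Rightarrow> ((real^'n) \<times> real \<Rightarrow> real) \<Rightarrow> (real^'n) \<times> real \<Rightarrow> real" where
  "Lap_b b U z = laplacian U z +
     b * (if snd z = 0 then partial_deriv (0, 1) (partial_deriv (0, 1) U) z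
          else partial_deriv (0, 1) U z / snd z)"

text \<open>
  \<open>\<nabla>_b^j\<close> is scalar for even \<open>j\<close> and vector-valued for odd \<open>j\<close>. Both cases are placed in the
  orthogonal sum of the two target spaces, which leaves the Euclidean norm unchanged.
\<close>

definition nabla_b ::
    "real \<Rightarrow> nat \<Rightarrow> ((real^'n) \<times> real \<Rightarrow> real) \<Rightarrow> (real^'n) \<times> real \<Rightarrow> real \<times> ((real^'n) \<times> real)"
  where
  "nabla_b b j U z =
     (if even j then ((Lap_b b ^^ (j div 2)) U z, 0)
      else (0, grad ((Lap_b b ^^ ((j - 1) div 2)) U) z))"

definition weight :: "real \<Rightarrow> nat \<Rightarrow> (real^'n) \<times> real \<Rightarrow> real" where
  "weight b i z = \<bar>snd z\<bar> powr b / norm z ^ (2 * i)"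

definition full_norm :: "nat \<Rightarrow> real \<Rightarrow> ((real^'n) \<times> real \<Rightarrow> real) \<Rightarrow> real" where
  "full_norm k b U =
     sqrt (\<Sum>j\<le>k. LINT z|lborel. weight b (k - j) z * (norm (nabla_b b j U z))\<^sup>2)"

text \<open>
  \<open>approximates k b \<phi> U\<close>: \<open>\<phi>\<close> is a Cauchy sequence of test functions with respect to \<open>full_norm\<close>,
  and the element of the completion that it defines is \<open>U\<close>, its limit in the ambient \<open>L\<^sup>2\<close> space.
\<close>

definition approximates ::
    "nat \<Rightarrow> real \<Rightarrow> (nat \<Rightarrow> (real^'n) \<times> real \<Rightarrow> real) \<Rightarrow> ((real^'n) \<times> real \<Rightarrow> real) \<Rightarrow> bool" where
  "approximates k b \<phi> U \<longleftrightarrow>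
     (\<forall>m. \<phi> m \<in> Cinfe) \<and>
     (\<forall>\<epsilon>>0. \<exists>N. \<forall>m\<ge>N. \<forall>p\<ge>N. full_norm k b (\<lambda>z. \<phi> m z - \<phi> p z) < \<epsilon>) \<and>
     U \<in> weighted_L2 (weight b k) \<and>
     (\<lambda>m. weighted_L2_norm (weight b k) (\<lambda>z. \<phi> m z - U z)) \<longlonglongrightarrow> 0"

definition Dkb :: "nat \<Rightarrow> real \<Rightarrow> ((real^'n) \<times> real \<Rightarrow> real) set" where
  "Dkb k b = {U. \<exists>\<phi>. approximates k b \<phi> U}"

text \<open>
  \<open>\<nabla>_b^k U\<close> for \<open>U \<in> Dkb k b\<close>, defined by density: the limit of \<open>\<nabla>_b^k\<close> along an approximating
  sequence. It is unique up to a null set.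
\<close>

definition nabla_ext ::
    "nat \<Rightarrow> real \<Rightarrow> ((real^'n) \<times> real \<Rightarrow> real) \<Rightarrow> (real^'n) \<times> real \<Rightarrow> real \<times> ((real^'n) \<times> real)"
  where
  "nabla_ext k b U = (SOME G. G \<in> weighted_L2 (weight b 0) \<and>
     (\<exists>\<phi>. approximates k b \<phi> U \<and>
          (\<lambda>m. weighted_L2_norm (weight b 0) (\<lambda>z. nabla_b b k (\<phi> m) z - G z)) \<longlonglongrightarrow> 0))"

definition Dkb_norm :: "nat \<Rightarrow> real \<Rightarrow> ((real^'n) \<times> real \<Rightarrow> real) \<Rightarrow> real" where
  "Dkb_norm k b U = weighted_L2_norm (weight b 0) (nabla_ext k b U)"

subsection \<open>Continuous operators\<close>

text \<open>
  A continuous linear operator from \<open>X\<close> to \<open>Y\<close>, normed by \<open>NX\<close> and \<open>NY\<close>, whose elements are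
  functions modulo \<open>ae_eq\<close>; hence the operator must respect \<open>ae_eq\<close>, and is linear modulo \<open>ae_eq\<close>.
\<close>

definition continuous_operator ::
    "('a::euclidean_space \<Rightarrow> real) set \<Rightarrow> (('a \<Rightarrow> real) \<Rightarrow> real) \<Rightarrow>
     ('c::euclidean_space \<Rightarrow> real) set \<Rightarrow> (('c \<Rightarrow> real) \<Rightarrow> real) \<Rightarrow>
     (('a \<Rightarrow> real) \<Rightarrow> ('c \<Rightarrow> real)) \<Rightarrow> bool" where
  "continuous_operator X NX Y NY T \<longleftrightarrow>
     (\<forall>U\<in>X. T U \<in> Y) \<and>
     (\<forall>U\<in>X. \<forall>V\<in>X. ae_eq U V \<longrightarrow> ae_eq (T U) (T V)) \<and>
     (\<forall>U\<in>X. \<forall>V\<in>X. \<forall>c d. ae_eq (T (\<lambda>z. c * U z + d * V z)) (\<lambda>x. c * T U x + d * T V x)) \<and>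
     (\<forall>U\<in>X. \<forall>\<epsilon>>0. \<exists>\<delta>>0. \<forall>V\<in>X.
        NX (\<lambda>z. V z - U z) < \<delta> \<longrightarrow> NY (\<lambda>x. T V x - T U x) < \<epsilon>)"

definition trace_map :: "((real^'n) \<times> real \<Rightarrow> real) \<Rightarrow> real^'n \<Rightarrow> real" where
  "trace_map U = (\<lambda>x. U (x, 0))"

text \<open>\<open>T\<close> is a continuous extension of the trace map on \<open>Cke k\<close> (a subspace of \<open>Dkb k b\<close>).\<close>

definition trace_extension ::
    "nat \<Rightarrow> real \<Rightarrow> (((real^'n) \<times> real \<Rightarrow> real) \<Rightarrow> real^'n \<Rightarrow> real) \<Rightarrow> bool" where
  "trace_extension k b T \<longleftrightarrow>
     continuous_operator (Dkb k b) (Dkb_norm k b)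
       (Ds (real k - (1 + b) / 2)) (Ds_norm (real k - (1 + b) / 2)) T \<and>
     (\<forall>U \<in> Cke k. ae_eq (T U) (trace_map U))"

end

theory Submission
  imports Defs "HOL-Probability.Probability"
begin

text \<open>
  All estimates are first proved for test functions and then passed to the limit. A weighted
  Hardy-type inequality on the half lines \<open>{x} \<times> [0, \<infinity>)\<close>, with a free parameter \<open>\<theta>\<close>, bounds the trace in
  \<open>L\<^sup>2(|x|\<^sup>-\<^sup>2\<^sup>s dx)\<close>; since \<open>\<theta>\<close> can be sent to \<open>0\<close>, the trace of a Cauchy sequence depends only on the limit
  of the sequence in the ambient weighted \<open>L\<^sup>2\<close> space.

  For the \<open>Ds\<close> bound, the partial Fourier transform in \<open>x\<close> turns \<open>\<Delta>_b\<close> into \<open>A - |\<xi>|\<^sup>2\<close>, where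
  \<open>A f = f'' + (b / y) f'\<close>. Integrating by parts, \<open>\<parallel>A f - r f\<parallel>\<^sup>2 \<ge> r (\<parallel>f'\<parallel>\<^sup>2 + r \<parallel>f\<parallel>\<^sup>2)\<close> with respect to the
  weight \<open>|y|\<^sup>b\<close>; iterating this with \<open>r = |\<xi>|\<^sup>2\<close> reduces the bound to the one-dimensional trace inequality on
  an interval of length \<open>1 / |\<xi>|\<close>, followed by Bessel's inequality and integration over \<open>\<xi>\<close>.

  Uniqueness requires that \<open>\<nabla>_b^k\<close> be closable, and this is tested against \<open>y\<^sup>2\<close> times Gaussians, for
  which the singular coefficient \<open>b / y\<close> does no harm; moreover the \<open>Ds\<close> norm must separate points, which
  holds because Gaussians are stable under the Fourier transform and determine a function.
\<close>

subsection \<open>Weighted \<open>L\<^sup>2\<close> spaces\<close>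

text \<open>Two norms are in play. Cauchy sequences are taken in \<open>full_norm\<close>, which
  produces the limits, whereas \<open>Dkb_norm\<close> sees only the term of order k. The Fourier
  bound for the trace involves exactly that top term, so it survives the limit as a bound by
  \<open>Dkb_norm\<close>, and continuity follows from linearity.

  The main obstacle is that an element of \<open>Dkb k b\<close> carries no derivatives of its own:
  \<open>nabla_ext\<close> is chosen along some unknown sequence, and the trace along another. Two
  closability statements remove the dependence on the sequence, one for the trace and one for the
  operators \<open>nabla_b b j\<close> with j \<le> k.

  Evenness in y acts at the boundary y = 0. It makes \<partial>_y U vanish there, which turns the
  quotient by y into a smooth function and kills the boundary term of the integration by parts for
  every b > -1. The Fourier estimates are carried out in [0, \<infinity>], so that Fubini and Fatou
  apply before finiteness is known.\<close>

lemma weighted_L2D: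
  assumes "f \<in> weighted_L2 w"
  shows "f \<in> borel_measurable borel" "integrable lborel (\<lambda>z. w z * (norm (f z))\<^sup>2)"
  using assms by (auto simp: weighted_L2_def)

lemma weighted_L2_norm_nonneg:
  assumes "\<And>z. w z \<ge> 0"
  shows "weighted_L2_norm w f \<ge> 0"
  unfolding weighted_L2_norm_def using assms by (simp add: integral_nonneg_AE)

lemma weighted_L2_norm_sq:
  assumes "\<And>z. w z \<ge> 0"
  shows "(weighted_L2_norm w f)\<^sup>2 = (LINT z|lborel. w z * (norm (f z))\<^sup>2)"
  unfolding weighted_L2_norm_def using assms by (simp add: integral_nonneg_AE)

lemma nn_integral_weighted_L2:
  assumes "\<And>z. w z \<ge> 0" "f \<in> weighted_L2 w"
  shows "(\<integral>\<^sup>+z. ennreal (w z * (norm (f z))\<^sup>2) \<partial>lborel) = ennreal ((weighted_L2_norm w f)\<^sup>2)"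
  using assms weighted_L2D[OF assms(2)]
  by (simp add: weighted_L2_norm_sq nn_integral_eq_integral)

text \<open>Estimates below are made in [0, \<infinity>]; this converts a finished bound into
  membership together with a real inequality.\<close>

lemma weighted_L2_boundI:
  assumes w: "\<And>z. w z \<ge> 0" "w \<in> borel_measurable borel" and f: "f \<in> borel_measurable borel"
    and le: "(\<integral>\<^sup>+z. ennreal (w z * (norm (f z))\<^sup>2) \<partial>lborel) \<le> ennreal C" and C: "C \<ge> 0"
  shows "f \<in> weighted_L2 w" "(weighted_L2_norm w f)\<^sup>2 \<le> C"
proof -
  have i: "integrable lborel (\<lambda>z. w z * (norm (f z))\<^sup>2)"
    by (rule integrableI_bounded) (use w f le in \<open>auto intro: le_less_trans\<close>)
  then show "f \<in> weighted_L2 w" using f by (simp add: weighted_L2_def)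
  from nn_integral_weighted_L2[OF w(1) this] le C show "(weighted_L2_norm w f)\<^sup>2 \<le> C"
    by simp
qed

lemma norm_mult_le_sum_squares:
  "norm x * norm y \<le> (norm x)\<^sup>2 + (norm y)\<^sup>2"
proof -
  have "0 \<le> norm x * norm y" by simp
  with sum_squares_bound[of "norm x" "norm y"] show ?thesis by linarith
qed

lemma L2_Cauchy_Schwarz:
  fixes f :: "'a \<Rightarrow> 'b::euclidean_space" and g :: "'a \<Rightarrow> 'c::euclidean_space"
  assumes [measurable]: "f \<in> borel_measurable M" "g \<in> borel_measurable M"
    and F: "integrable M (\<lambda>x. (norm (f x))\<^sup>2)" and G: "integrable M (\<lambda>x. (norm (g x))\<^sup>2)"
  shows "integrable M (\<lambda>x. norm (f x) * norm (g x))"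
    "(LINT x|M. norm (f x) * norm (g x)) \<le>
       sqrt (LINT x|M. (norm (f x))\<^sup>2) * sqrt (LINT x|M. (norm (g x))\<^sup>2)"
proof -
  show I: "integrable M (\<lambda>x. norm (f x) * norm (g x))"
    by (rule Bochner_Integration.integrable_bound[OF Bochner_Integration.integrable_add[OF F G]])
      (auto intro!: AE_I2 norm_mult_le_sum_squares)
  have "(\<integral>\<^sup>+x. ennreal (norm (f x)) * ennreal (norm (g x)) \<partial>M)\<^sup>2 \<le>
     (\<integral>\<^sup>+x. (ennreal (norm (f x)))^2 \<partial>M) * (\<integral>\<^sup>+x. (ennreal (norm (g x)))^2 \<partial>M)"
    by (rule Cauchy_Schwarz_nn_integral) auto
  then have "(ennreal (LINT x|M. norm (f x) * norm (g x)))\<^sup>2 \<le>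
     ennreal (LINT x|M. (norm (f x))\<^sup>2) * ennreal (LINT x|M. (norm (g x))\<^sup>2)"
    using nn_integral_eq_integral[OF I] nn_integral_eq_integral[OF F] nn_integral_eq_integral[OF G]
    by (simp add: ennreal_mult[symmetric] ennreal_power)
  then have "(LINT x|M. norm (f x) * norm (g x))\<^sup>2 \<le> (LINT x|M. (norm (f x))\<^sup>2) * (LINT x|M. (norm (g x))\<^sup>2)"
    by (simp add: ennreal_mult[symmetric] ennreal_power integral_nonneg_AE)
  then show "(LINT x|M. norm (f x) * norm (g x)) \<le>
       sqrt (LINT x|M. (norm (f x))\<^sup>2) * sqrt (LINT x|M. (norm (g x))\<^sup>2)"
    by (simp add: real_le_rsqrt real_sqrt_mult[symmetric])
qed

text \<open>Splitting the product as \<open>sqrt (w z) *\<^sub>R f z\<close> against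
  \<open>(1 / sqrt (w z)) *\<^sub>R g z\<close> puts the dual weight 1 / w on the test function. The
  pairings of weighted limits with Schwartz functions and Gaussians go through this form.\<close>

lemma weighted_L2_Cauchy_Schwarz:
  fixes f :: "'a::euclidean_space \<Rightarrow> 'b::euclidean_space" and g :: "'a \<Rightarrow> 'c::euclidean_space"
  assumes w: "\<And>z. w z \<ge> 0" "w \<in> borel_measurable borel" "AE z in lborel. w z > 0"
    and f: "f \<in> weighted_L2 w" and g: "g \<in> borel_measurable borel"
      "integrable lborel (\<lambda>z. (norm (g z))\<^sup>2 / w z)"
  shows "integrable lborel (\<lambda>z. norm (f z) * norm (g z))"
    "(LINT z|lborel. norm (f z) * norm (g z)) \<le>
       weighted_L2_norm w f * sqrt (LINT z|lborel. (norm (g z))\<^sup>2 / w z)"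
proof -
  note [measurable] = w(2) g(1) weighted_L2D(1)[OF f]
  let ?f = "\<lambda>z. sqrt (w z) *\<^sub>R f z" and ?g = "\<lambda>z. (1 / sqrt (w z)) *\<^sub>R g z"
  have 1: "(\<lambda>z. (norm (?f z))\<^sup>2) = (\<lambda>z. w z * (norm (f z))\<^sup>2)"
    "(\<lambda>z. (norm (?g z))\<^sup>2) = (\<lambda>z. (norm (g z))\<^sup>2 / w z)"
    using w(1) by (auto simp: fun_eq_iff power_mult_distrib power_divide)
  have 2: "AE z in lborel. norm (?f z) * norm (?g z) = norm (f z) * norm (g z)"
    using w(3) by eventually_elim auto
  have "integrable lborel (\<lambda>z. (norm (?f z))\<^sup>2)" "integrable lborel (\<lambda>z. (norm (?g z))\<^sup>2)"
    unfolding 1 by (fact weighted_L2D(2)[OF f] g(2))+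
  note L2_Cauchy_Schwarz[OF _ _ this, simplified measurable_lborel2]
  then have "integrable lborel (\<lambda>z. norm (?f z) * norm (?g z))"
    "(LINT z|lborel. norm (?f z) * norm (?g z)) \<le>
       sqrt (LINT x|lborel. (norm (?f x))\<^sup>2) * sqrt (LINT x|lborel. (norm (?g x))\<^sup>2)"
    by measurable
  moreover have "(LINT z|lborel. norm (?f z) * norm (?g z)) = (LINT z|lborel. norm (f z) * norm (g z))"
    by (rule integral_cong_AE) (use 2 in auto)
  moreover have "integrable lborel (\<lambda>z. norm (?f z) * norm (?g z)) = integrable lborel (\<lambda>z. norm (f z) * norm (g z))"
    by (rule integrable_cong_AE) (use 2 in auto)
  ultimately show "integrable lborel (\<lambda>z. norm (f z) * norm (g z))"
    "(LINT z|lborel. norm (f z) * norm (g z)) \<le>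
       weighted_L2_norm w f * sqrt (LINT z|lborel. (norm (g z))\<^sup>2 / w z)"
    unfolding 1 weighted_L2_norm_def by auto
qed

text \<open>Minkowski's inequality by expanding the square; the cross term is Cauchy-Schwarz for
  sqrt w f and sqrt w g.\<close>

lemma weighted_L2_add:
  assumes w: "\<And>z. w z \<ge> 0" "w \<in> borel_measurable borel"
    and f: "f \<in> weighted_L2 w" and g: "g \<in> weighted_L2 w"
  shows "(\<lambda>z. f z + g z) \<in> weighted_L2 w"
    "weighted_L2_norm w (\<lambda>z. f z + g z) \<le> weighted_L2_norm w f + weighted_L2_norm w g"
proof -
  note [measurable] = w(2) weighted_L2D(1)[OF f] weighted_L2D(1)[OF g]
  let ?f = "\<lambda>z. sqrt (w z) *\<^sub>R f z" and ?g = "\<lambda>z. sqrt (w z) *\<^sub>R g z"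
  have 1: "(\<lambda>z. (norm (?f z))\<^sup>2) = (\<lambda>z. w z * (norm (f z))\<^sup>2)"
    "(\<lambda>z. (norm (?g z))\<^sup>2) = (\<lambda>z. w z * (norm (g z))\<^sup>2)"
    using w(1) by (auto simp: fun_eq_iff power_mult_distrib power_divide)
  have 2: "integrable lborel (\<lambda>z. (norm (?f z))\<^sup>2)" "integrable lborel (\<lambda>z. (norm (?g z))\<^sup>2)"
    unfolding 1 by (fact weighted_L2D(2)[OF f] weighted_L2D(2)[OF g])+
  have i: "integrable lborel (\<lambda>z. norm (?f z) * norm (?g z))"
    by (rule L2_Cauchy_Schwarz(1)[OF _ _ 2]) auto
  have cs: "(LINT z|lborel. norm (?f z) * norm (?g z)) \<le> weighted_L2_norm w f * weighted_L2_norm w g"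
    unfolding weighted_L2_norm_def 1[symmetric]
    by (rule L2_Cauchy_Schwarz(2)[OF _ _ 2]) auto
  let ?h = "\<lambda>z. w z * (norm (f z))\<^sup>2 + 2 * (norm (?f z) * norm (?g z)) + w z * (norm (g z))\<^sup>2"
  have I: "integrable lborel ?h"
    using i weighted_L2D(2)[OF f] weighted_L2D(2)[OF g] by auto
  have le: "w z * (norm (f z + g z))\<^sup>2 \<le> ?h z" for z
  proof -
    have "(norm (f z + g z))\<^sup>2 \<le> (norm (f z) + norm (g z))\<^sup>2"
      by (intro power_mono norm_triangle_ineq) auto
    from mult_left_mono[OF this w(1)[of z]]
    have "w z * (norm (f z + g z))\<^sup>2 \<le> w z * (norm (f z) + norm (g z))\<^sup>2" .
    also have "\<dots> = w z * (norm (f z))\<^sup>2 + (sqrt (w z) * sqrt (w z)) * (2 * (norm (f z) * norm (g z)))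
        + w z * (norm (g z))\<^sup>2"
      using w(1)[of z] by (simp add: power2_sum algebra_simps)
    also have "\<dots> = ?h z" using w(1)[of z] by (simp add: algebra_simps)
    finally show ?thesis .
  qed
  show m: "(\<lambda>z. f z + g z) \<in> weighted_L2 w"
    unfolding weighted_L2_def using le w(1)
    by (auto intro!: Bochner_Integration.integrable_bound[OF I] AE_I2 simp: abs_mult)
  have "(weighted_L2_norm w (\<lambda>z. f z + g z))\<^sup>2 \<le> (LINT z|lborel. ?h z)"
    unfolding weighted_L2_norm_sq[OF w(1)]
    by (rule integral_mono[OF _ I le]) (use weighted_L2D(2)[OF m] in auto)
  also have "\<dots> = (weighted_L2_norm w f)\<^sup>2 + 2 * (LINT z|lborel. norm (?f z) * norm (?g z)) + (weighted_L2_norm w g)\<^sup>2"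
    unfolding weighted_L2_norm_sq[OF w(1)]
    using i weighted_L2D(2)[OF f] weighted_L2D(2)[OF g] by simp
  also have "\<dots> \<le> (weighted_L2_norm w f + weighted_L2_norm w g)\<^sup>2"
    using cs by (simp add: power2_sum)
  finally show "weighted_L2_norm w (\<lambda>z. f z + g z) \<le> weighted_L2_norm w f + weighted_L2_norm w g"
    by (rule power2_le_imp_le) (simp add: weighted_L2_norm_nonneg w)
qed

lemma weighted_L2_scale:
  assumes w: "\<And>z. w z \<ge> 0" and f: "f \<in> weighted_L2 w"
  shows "(\<lambda>z. c *\<^sub>R f z) \<in> weighted_L2 w"
    "weighted_L2_norm w (\<lambda>z. c *\<^sub>R f z) = \<bar>c\<bar> * weighted_L2_norm w f"
proof -
  have 1: "(\<lambda>z. w z * (norm (c *\<^sub>R f z))\<^sup>2) = (\<lambda>z. c\<^sup>2 * (w z * (norm (f z))\<^sup>2))"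
    by (auto simp: power_mult_distrib)
  show "(\<lambda>z. c *\<^sub>R f z) \<in> weighted_L2 w"
    unfolding weighted_L2_def using 1 weighted_L2D[OF f] by simp
  show "weighted_L2_norm w (\<lambda>z. c *\<^sub>R f z) = \<bar>c\<bar> * weighted_L2_norm w f"
    unfolding weighted_L2_norm_def 1 by (simp add: real_sqrt_mult)
qed

lemma weighted_L2_diff:
  assumes w: "\<And>z. w z \<ge> 0" "w \<in> borel_measurable borel"
    and f: "f \<in> weighted_L2 w" and g: "g \<in> weighted_L2 w"
  shows "(\<lambda>z. f z - g z) \<in> weighted_L2 w"
    "weighted_L2_norm w (\<lambda>z. f z - g z) \<le> weighted_L2_norm w f + weighted_L2_norm w g"
  using weighted_L2_add[OF w f weighted_L2_scale(1)[OF w(1) g, of "-1"]]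
    weighted_L2_scale(2)[OF w(1) g, of "-1"] by auto

lemma weighted_L2_norm_cong_AE:
  assumes "w \<in> borel_measurable borel" "f \<in> borel_measurable borel" "g \<in> borel_measurable borel"
    and "ae_eq f g"
  shows "weighted_L2_norm w f = weighted_L2_norm w g"
proof -
  have "AE z in lborel. w z * (norm (f z))\<^sup>2 = w z * (norm (g z))\<^sup>2"
    using assms(4) unfolding ae_eq_def by eventually_elim simp
  from integral_cong_AE[OF _ _ this] show ?thesis
    using assms(1-3) unfolding weighted_L2_norm_def by simp
qed

lemma weighted_L2_norm_eq_0:
  assumes w: "\<And>z. w z \<ge> 0" "AE z in lborel. w z > 0" and f: "f \<in> weighted_L2 w"
    and 0: "weighted_L2_norm w f = 0"
  shows "AE z in lborel. f z = 0"
proof -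
  have "(LINT z|lborel. w z * (norm (f z))\<^sup>2) = 0"
    using 0 w(1) by (simp add: weighted_L2_norm_def)
  then have "AE z in lborel. w z * (norm (f z))\<^sup>2 = 0"
    using w(1) weighted_L2D(2)[OF f] by (subst (asm) integral_nonneg_eq_0_iff_AE) auto
  with w(2) show ?thesis by eventually_elim auto
qed

text \<open>Riesz-Fischer for a weight that may vanish somewhere. Along a subsequence with steps
  below 2^(-i) the squared increments stay summable in the mean even after multiplication by 2^i, so
  the subsequence converges almost everywhere on w > 0; Fatou then gives convergence in
  norm.\<close>

lemma weighted_L2_complete:
  fixes F :: "nat \<Rightarrow> 'a::euclidean_space \<Rightarrow> 'b::euclidean_space"
  assumes w: "\<And>z. w z \<ge> 0" "w \<in> borel_measurable borel" and F: "\<And>m. F m \<in> weighted_L2 w"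
    and Cauchy: "\<And>\<epsilon>. \<epsilon> > 0 \<Longrightarrow> \<exists>N. \<forall>m\<ge>N. \<forall>p\<ge>N. weighted_L2_norm w (\<lambda>z. F m z - F p z) < \<epsilon>"
  obtains f where "f \<in> weighted_L2 w" "(\<lambda>m. weighted_L2_norm w (\<lambda>z. F m z - f z)) \<longlonglongrightarrow> 0"
proof -
  note [measurable] = w(2) weighted_L2D(1)[OF F]
  let ?n = "weighted_L2_norm w"
  have D: "(\<lambda>z. F m z - F p z) \<in> weighted_L2 w" for m p
    by (intro weighted_L2_diff w F)
  have "\<exists>N. \<forall>m\<ge>N. \<forall>p\<ge>N. ?n (\<lambda>z. F m z - F p z) < (1/2) ^ i" for i :: nat
    by (rule Cauchy) simp
  then obtain N where N: "\<And>i m p. m \<ge> N i \<Longrightarrow> p \<ge> N i \<Longrightarrow> ?n (\<lambda>z. F m z - F p z) < (1/2) ^ i"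
    by metis
  \<comment> \<open>Summing the \<open>N j\<close> makes \<open>r\<close> nondecreasing and at least
    \<open>N i\<close>; the summand i makes it unbounded.\<close>
  define r where "r i = (\<Sum>j\<le>i. N j) + i" for i
  have rN: "r i \<ge> N i" for i
    unfolding r_def by (simp add: trans_le_add1 member_le_sum)
  have rS: "r i \<le> r (Suc i)" for i by (simp add: r_def)
  have rinf: "r i \<ge> i" for i by (simp add: r_def)
  define d where "d i z = w z * (norm (F (r (Suc i)) z - F (r i) z))\<^sup>2" for i z
  have d0: "d i z \<ge> 0" for i z using w(1) by (simp add: d_def)
  have dint: "(\<integral>\<^sup>+z. ennreal (d i z) \<partial>lborel) \<le> ennreal ((1/4)^i)" for i
  proof -
    have "(\<integral>\<^sup>+z. ennreal (d i z) \<partial>lborel) = ennreal ((?n (\<lambda>z. F (r (Suc i)) z - F (r i) z))\<^sup>2)"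
      unfolding d_def by (rule nn_integral_weighted_L2[OF w(1) D])
    also have "\<dots> \<le> ennreal (((1/2)^i)\<^sup>2)"
      using N[of i "r (Suc i)" "r i"] rN[of i] rS[of i] weighted_L2_norm_nonneg[of w, OF w(1)]
      by (intro ennreal_leI power_mono[OF less_imp_le]) auto
    also have "((1/2::real)^i)\<^sup>2 = (1/4)^i" by (simp add: power2_eq_square flip: power_mult_distrib)
    finally show ?thesis .
  qed
  have "(\<integral>\<^sup>+z. (\<Sum>i. ennreal (2^i * d i z)) \<partial>lborel) = (\<Sum>i. \<integral>\<^sup>+z. ennreal (2^i * d i z) \<partial>lborel)"
    by (rule nn_integral_suminf) (simp add: d_def)
  also have "\<dots> \<le> (\<Sum>i. ennreal ((1/2)^i))"
  proof (rule suminf_le[OF _ summableI summableI])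
    fix i
    have "(\<integral>\<^sup>+z. ennreal (2^i * d i z) \<partial>lborel) = ennreal (2^i) * (\<integral>\<^sup>+z. ennreal (d i z) \<partial>lborel)"
      by (simp add: ennreal_mult d0 nn_integral_cmult d_def w(1))
    also have "\<dots> \<le> ennreal (2^i) * ennreal ((1/4)^i)"
      by (intro mult_left_mono dint) auto
    also have "\<dots> = ennreal ((1/2)^i)" by (simp add: ennreal_mult[symmetric] flip: power_mult_distrib)
    finally show "(\<integral>\<^sup>+z. ennreal (2^i * d i z) \<partial>lborel) \<le> ennreal ((1/2)^i)" .
  qed
  also have "\<dots> = ennreal (\<Sum>i. (1/2)^i)"
    by (rule suminf_ennreal2) (auto intro: summable_geometric)
  finally have fin: "(\<integral>\<^sup>+z. (\<Sum>i. ennreal (2^i * d i z)) \<partial>lborel) \<noteq> \<infinity>"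
    by (auto simp: top_unique)
  have "AE z in lborel. (\<Sum>i. ennreal (2^i * d i z)) \<noteq> \<infinity>"
    by (rule nn_integral_PInf_AE[OF _ fin]) (simp add: d_def)
  then have conv: "AE z in lborel. w z > 0 \<longrightarrow> convergent (\<lambda>i. F (r i) z)"
  proof eventually_elim
    case (elim z)
    then have s: "summable (\<lambda>i. 2^i * d i z)"
      by (intro summable_suminf_not_top) (auto simp: d0)
    show ?case
    proof
      assume wz: "w z > 0"
      have "summable (\<lambda>i. F (r (Suc i)) z - F (r i) z)"
      proof (rule summable_comparison_test'[where N=0])
        show "summable (\<lambda>i. (1 / sqrt (w z)) * (2^i * d i z + (1/2)^i))"
          by (intro summable_mult summable_add s summable_geometric) auto
        fix i :: nat
        let ?x = "sqrt (w z) * norm (F (r (Suc i)) z - F (r i) z)"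
        have d: "d i z = ?x\<^sup>2" using wz by (simp add: d_def power_mult_distrib)
        \<comment> \<open>A completed square: x \<le> 2^i x^2 + 2^(-i) turns summability of the
          weighted squares into absolute summability of the increments.\<close>
        have "0 \<le> (2^i * ?x - 1)\<^sup>2 + 2^i * ?x * 2 - 2^i * ?x" using wz by auto
        then have "2^i * ?x \<le> (2^i * ?x)\<^sup>2 + 1" by (simp add: power2_eq_square algebra_simps)
        then have "?x \<le> 2^i * ?x\<^sup>2 + (1/2)^i"
          by (simp add: power_divide power2_eq_square field_simps)
        then show "norm (F (r (Suc i)) z - F (r i) z) \<le> (1 / sqrt (w z)) * (2^i * d i z + (1/2)^i)"
          unfolding d using wz by (simp add: field_simps)
      qed
      then have "convergent (\<lambda>n. F (r n) z - F (r 0) z)"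
        by (simp add: summable_iff_convergent sum_lessThan_telescope[of "\<lambda>i. F (r i) z"])
      then have "convergent (\<lambda>n. (F (r n) z - F (r 0) z) + F (r 0) z)"
        by (intro convergent_add convergent_const)
      then show "convergent (\<lambda>i. F (r i) z)" by simp
    qed
  qed
  \<comment> \<open>Where w z = 0 the sequence may diverge and \<open>lim\<close> is arbitrary; the
    weight makes that value invisible.\<close>
  define f where "f z = lim (\<lambda>i. F (r i) z)" for z
  have [measurable]: "f \<in> borel_measurable borel"
    unfolding f_def by measurable
  have lim: "AE z in lborel. (\<lambda>i. w z * (norm (F m z - F (r i) z))\<^sup>2) \<longlonglongrightarrow> w z * (norm (F m z - f z))\<^sup>2" for m
    using conv
  proof eventually_elim
    case (elim z)
    show ?case
    proof (cases "w z > 0")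
      case True
      with elim have "(\<lambda>i. F (r i) z) \<longlonglongrightarrow> f z" by (simp add: f_def convergent_LIMSEQ_iff)
      then show ?thesis by (intro tendsto_intros)
    next
      case False
      with w(1)[of z] show ?thesis by simp
    qed
  qed
  \<comment> \<open>Fatou along the subsequence: for i \<ge> \<open>N j\<close> also r i \<ge>
    \<open>N j\<close>, so all the distances from F m to F (r i) are below 2^(-j).\<close>
  have bd: "(\<integral>\<^sup>+z. ennreal (w z * (norm (F m z - f z))\<^sup>2) \<partial>lborel) \<le> ennreal (((1/2)^j)\<^sup>2)" if m: "m \<ge> N j" for m j
  proof -
    have "(\<integral>\<^sup>+z. ennreal (w z * (norm (F m z - f z))\<^sup>2) \<partial>lborel)
       = (\<integral>\<^sup>+z. liminf (\<lambda>i. ennreal (w z * (norm (F m z - F (r i) z))\<^sup>2)) \<partial>lborel)"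
      by (rule nn_integral_cong_AE, use lim[of m] in eventually_elim)
         (metis lim_imp_Liminf sequentially_bot tendsto_ennrealI)
    also have "\<dots> \<le> liminf (\<lambda>i. \<integral>\<^sup>+z. ennreal (w z * (norm (F m z - F (r i) z))\<^sup>2) \<partial>lborel)"
      by (rule nn_integral_liminf) simp
    also have "\<dots> \<le> ennreal (((1/2)^j)\<^sup>2)"
    proof (subst Liminf_const[OF sequentially_bot, symmetric], rule Liminf_mono, rule eventually_sequentiallyI[of "N j"])
      fix i assume "i \<ge> N j"
      with rinf[of i] have "r i \<ge> N j" by simp
      with N[OF m this] show "(\<integral>\<^sup>+z. ennreal (w z * (norm (F m z - F (r i) z))\<^sup>2) \<partial>lborel) \<le> ennreal (((1/2)^j)\<^sup>2)"
        unfolding nn_integral_weighted_L2[OF w(1) D]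
        using weighted_L2_norm_nonneg[of w, OF w(1)] by (intro ennreal_leI power_mono[OF less_imp_le]) auto
    qed
    finally show ?thesis .
  qed
  have mem: "(\<lambda>z. F m z - f z) \<in> weighted_L2 w" and nb: "?n (\<lambda>z. F m z - f z) \<le> (1/2)^j"
    if m: "m \<ge> N j" for m j
  proof -
    note * = weighted_L2_boundI[OF w _ bd[OF m]]
    show "(\<lambda>z. F m z - f z) \<in> weighted_L2 w" by (rule *) auto
    have "(?n (\<lambda>z. F m z - f z))\<^sup>2 \<le> ((1/2)^j)\<^sup>2" by (rule *) auto
    then show "?n (\<lambda>z. F m z - f z) \<le> (1/2)^j" by (rule power2_le_imp_le) simp
  qed
  have "(\<lambda>z. F (N 0) z - (F (N 0) z - f z)) \<in> weighted_L2 w"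
    by (intro weighted_L2_diff w F mem[of 0]) simp
  then have "f \<in> weighted_L2 w" by simp
  moreover have "(\<lambda>m. ?n (\<lambda>z. F m z - f z)) \<longlonglongrightarrow> 0"
  proof (rule LIMSEQ_I)
    fix e :: real assume "e > 0"
    then obtain j where j: "(1/2)^j < e" using real_arch_pow_inv[of e "1/2"] by auto
    show "\<exists>no. \<forall>n\<ge>no. norm (?n (\<lambda>z. F n z - f z) - 0) < e"
    proof (intro exI allI impI)
      fix n assume "n \<ge> N j"
      from nb[OF this] j show "norm (?n (\<lambda>z. F n z - f z) - 0) < e"
        by (simp add: weighted_L2_norm_nonneg[of w, OF w(1)])
    qed
  qed
  ultimately show thesis by (rule that)
qed

section \<open>Integrals of products over the coordinates, powers of the norm, and decay\<close>

lemma
  fixes f :: "'a::euclidean_space \<Rightarrow> real \<Rightarrow> 'c::{real_normed_field,banach,second_countable_topology}"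
  assumes f: "\<And>b. b \<in> Basis \<Longrightarrow> integrable lborel (f b)"
  shows integrable_lborel_prod: "integrable lborel (\<lambda>x::'a. \<Prod>b\<in>Basis. f b (x \<bullet> b))"
    and integral_lborel_prod: "(LINT x|lborel. (\<Prod>b\<in>Basis. f b (x \<bullet> b))) = (\<Prod>b\<in>Basis. LINT t|lborel. f b t)"
proof -
  interpret product_sigma_finite "\<lambda>_::'a. lborel :: real measure" ..
  note [measurable] = borel_measurable_integrable[OF f]
  have [measurable]: "(\<lambda>f. \<Sum>b\<in>Basis. f b *\<^sub>R b) \<in> measurable (\<Pi>\<^sub>M b\<in>(Basis::'a set). lborel) borel"
    by measurable
  have m: "(\<lambda>x. \<Prod>b\<in>Basis. f b (x \<bullet> b)) \<in> borel_measurable borel"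
    by (intro borel_measurable_prod) auto
  have e: "(\<Prod>b\<in>Basis. f b ((\<Sum>b\<in>Basis. g b *\<^sub>R b) \<bullet> b)) = (\<Prod>b\<in>Basis. f b (g b))" for g
    by (intro prod.cong) auto
  show "integrable lborel (\<lambda>x::'a. \<Prod>b\<in>Basis. f b (x \<bullet> b))"
    unfolding lborel_eq[where 'a='a]
    by (subst integrable_distr_eq, (use m in \<open>auto simp: e\<close>)[2])
       (simp add: e product_integrable_prod f)
  show "(LINT x|lborel. (\<Prod>b\<in>Basis. f b (x \<bullet> b))) = (\<Prod>b\<in>Basis. LINT t|lborel. f b t)"
    unfolding lborel_eq[where 'a='a]
    by (subst integral_distr, (use m in \<open>auto simp: e\<close>)[2])
       (simp add: e product_integral_prod f)
qed

lemma integrable_inverse_one_plus_square: "integrable lborel (\<lambda>t::real. 1 / (1 + t\<^sup>2))"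
proof -
  have "set_integrable lborel (einterval (-\<infinity>) \<infinity>) (\<lambda>x. inverse (1 + x^2))"
    by (rule integrable_inverse_1_plus_square)
  then show ?thesis by (simp add: set_integrable_def inverse_eq_divide)
qed

text \<open>The exponent 2 * DIM is dictated by the majorant: each factor 1 + (x \<bullet> b)^2 is
  at most (1 + norm x)^2, and the product of the functions 1 / (1 + t^2) is integrable coordinate by
  coordinate.\<close>

lemma integrable_decay:
  assumes "N \<ge> 2 * DIM('a::euclidean_space)"
  shows "integrable lborel (\<lambda>x::'a. 1 / (1 + norm x) ^ N)"
proof -
  have "integrable lborel (\<lambda>x::'a. \<Prod>b\<in>Basis. 1 / (1 + (x \<bullet> b)\<^sup>2))"
    by (intro integrable_lborel_prod integrable_inverse_one_plus_square)
  then show ?thesis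
  proof (rule Bochner_Integration.integrable_bound, measurable, intro AE_I2)
    fix x :: 'a
    have "(\<Prod>b\<in>(Basis::'a set). 1 + (x \<bullet> b)\<^sup>2) \<le> (\<Prod>b\<in>(Basis::'a set). (1 + norm x)\<^sup>2)"
    proof (intro prod_mono conjI)
      fix b :: 'a assume b: "b \<in> Basis"
      have "(x \<bullet> b)\<^sup>2 \<le> (norm x)\<^sup>2" using Basis_le_norm[OF b, of x] by (metis abs_le_square_iff abs_norm_cancel)
      moreover have "(1 + norm x)\<^sup>2 = 1 + (norm x)\<^sup>2 + 2 * norm x" by (simp add: power2_sum)
      ultimately show "1 + (x \<bullet> b)\<^sup>2 \<le> (1 + norm x)\<^sup>2"
        using norm_ge_zero[of x] by linarith
    qed auto
    also have "\<dots> = (1 + norm x) ^ (2 * DIM('a))" by (simp flip: power_mult)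
    also have "\<dots> \<le> (1 + norm x) ^ N" using assms by (intro power_increasing) auto
    finally have "1 / (1 + norm x) ^ N \<le> 1 / (\<Prod>b\<in>(Basis::'a set). 1 + (x \<bullet> b)\<^sup>2)"
      by (intro divide_left_mono prod_pos mult_pos_pos) (auto simp: add_pos_nonneg)
    then show "norm (1 / (1 + norm x) ^ N) \<le> norm (\<Prod>b\<in>Basis. 1 / (1 + (x \<bullet> b)\<^sup>2))"
      by (simp add: prod_dividef abs_prod)
  qed
qed

lemma integrable_powr_interval:
  fixes a :: real
  assumes "a > -1"
  shows "integrable lborel (\<lambda>t::real. indicator {-R..R} t * \<bar>t\<bar> powr a)"
proof (cases "R \<ge> 0")
  case True
  have "(\<lambda>t. t powr a) absolutely_integrable_on {0..R}"
    by (rule nonnegative_absolutely_integrable_1[OF integrable_on_powr_from_0[OF assms True]]) auto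
  then have 1: "set_integrable lborel {0..R} (\<lambda>t. t powr a)"
    unfolding set_integrable_def by (subst (asm) integrable_completion) auto
  then have A: "integrable lborel (\<lambda>t::real. indicator {0..R} t * \<bar>t\<bar> powr a)"
    unfolding set_integrable_def
    by (rule Bochner_Integration.integrable_cong[THEN iffD1, rotated 2]) (auto simp: indicator_def)
  from lborel_integrable_real_affine[OF this, of "-1" 0]
  have B: "integrable lborel (\<lambda>t::real. indicator {0..R} (-t) * \<bar>t\<bar> powr a)" by simp
  show ?thesis
    by (rule Bochner_Integration.integrable_bound[OF Bochner_Integration.integrable_add[OF A B]])
      (auto simp: indicator_def)
qed auto

lemma integrable_prod_powr_box:
  fixes c :: "'a::euclidean_space \<Rightarrow> real"
  assumes "\<And>b. b \<in> Basis \<Longrightarrow> c b > -1"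
  shows "integrable lborel (\<lambda>x::'a. \<Prod>b\<in>Basis. indicator {-R..R} (x \<bullet> b) * \<bar>x \<bullet> b\<bar> powr c b)"
  by (intro integrable_lborel_prod integrable_powr_interval assms)

lemma AE_inner_nonzero:
  "AE x in lborel. \<forall>b\<in>Basis. (x::'a::euclidean_space) \<bullet> b \<noteq> 0"
  by (simp add: AE_lborel_inner_neq AE_ball_countable countable_finite)

text \<open>Because |x \<bullet> b| \<le> norm x and the exponent is nonpositive, each of DIM equal
  factors may be enlarged to a coordinate power. The exponent a / DIM exceeds -1 exactly when a >
  -DIM, so singularities at the origin are handled by product integrals in place of polar
  coordinates.\<close>

lemma powr_norm_le_prod:
  fixes x :: "'a::euclidean_space"
  assumes x: "\<forall>b\<in>Basis. x \<bullet> b \<noteq> 0" and a: "a \<le> 0"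
  shows "norm x powr a \<le> (\<Prod>b\<in>Basis. \<bar>x \<bullet> b\<bar> powr (a / DIM('a)))"
proof -
  have nx: "norm x > 0" using x nonempty_Basis by fastforce
  have "norm x powr a = (\<Prod>b\<in>(Basis::'a set). norm x powr (a / DIM('a)))"
    using nx by (simp add: powr_powr flip: powr_realpow)
  also have "\<dots> \<le> (\<Prod>b\<in>Basis. \<bar>x \<bullet> b\<bar> powr (a / DIM('a)))"
    using x a nx by (intro prod_mono conjI powr_mono2') (auto simp: Basis_le_norm divide_nonpos_pos)
  finally show ?thesis .
qed

declare powr_real_measurable[measurable (raw)]

lemma borel_measurable_indicator_cball[measurable]:
  "indicator (cball c R) \<in> borel_measurable (borel :: 'a::euclidean_space measure)"
  by (intro borel_measurable_indicator borel_closed closed_cball)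

lemma integrable_norm_powr_cball:
  fixes a :: real
  assumes a: "a > - real DIM('a::euclidean_space)"
  shows "integrable lborel (\<lambda>x::'a. indicator (cball 0 R) x * norm x powr a)"
proof -
  \<comment> \<open>For a > 0 there is no singularity and \<open>R powr a\<close> bounds the
    function, so only the negative part of the exponent is distributed over the coordinates.\<close>
  define a' where "a' = min a 0"
  have "integrable lborel (\<lambda>x::'a. max 1 (R powr a) * (\<Prod>b\<in>Basis. indicator {-R..R} (x \<bullet> b) * \<bar>x \<bullet> b\<bar> powr (a' / DIM('a))))"
    using a by (intro integrable_mult_right integrable_prod_powr_box) (auto simp: a'_def min_def field_simps)
  then show ?thesis
  proof (rule Bochner_Integration.integrable_bound)
    show "(\<lambda>x::'a. indicator (cball 0 R) x * norm x powr a) \<in> borel_measurable lborel"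
      using borel_measurable_indicator_cball[of 0 R]
      by (intro borel_measurable_times powr_real_measurable) auto
    show "AE x::'a in lborel. norm (indicator (cball 0 R) x * norm x powr a)
       \<le> norm (max 1 (R powr a) * (\<Prod>b\<in>Basis. indicator {-R..R} (x \<bullet> b) * \<bar>x \<bullet> b\<bar> powr (a' / DIM('a))))"
      using AE_inner_nonzero
    proof eventually_elim
      case (elim x)
      have nx: "norm x > 0" using elim nonempty_Basis by fastforce
      show ?case
      proof (cases "x \<in> cball 0 R")
        case True
        then have xR: "\<bar>x \<bullet> b\<bar> \<le> R" if "b \<in> Basis" for b
          using Basis_le_norm[OF that, of x] by simp
        have i: "indicator {-R..R} (x \<bullet> b) = (1::real)" if "b \<in> Basis" for b
          using xR[OF that] by (auto simp: indicator_def)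
        have "norm x powr a \<le> max 1 (R powr a) * norm x powr a'"
        proof (cases "a \<le> 0")
          case True then show ?thesis
            by (auto simp: a'_def mult_le_cancel_right1)
        next
          case False
          then have "norm x powr a \<le> R powr a" using True by (intro powr_mono2) auto
          then show ?thesis using False nx by (simp add: a'_def)
        qed
        also have "\<dots> \<le> max 1 (R powr a) * (\<Prod>b\<in>Basis. \<bar>x \<bullet> b\<bar> powr (a' / DIM('a)))"
          using powr_norm_le_prod[OF elim, of a'] by (intro mult_left_mono) (auto simp: a'_def)
        also have "(\<Prod>b\<in>Basis. \<bar>x \<bullet> b\<bar> powr (a' / DIM('a))) =
            (\<Prod>b\<in>Basis. indicator {-R..R} (x \<bullet> b) * \<bar>x \<bullet> b\<bar> powr (a' / DIM('a)))" (is "_ = ?P")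
          by (rule prod.cong) (auto simp: i)
        finally have le: "norm x powr a \<le> max 1 (R powr a) * ?P" .
        moreover have "0 \<le> max 1 (R powr a)" by simp
        moreover have "0 \<le> ?P" by (intro prod_nonneg) auto
        ultimately have nn: "0 \<le> max 1 (R powr a) * ?P" by (intro mult_nonneg_nonneg)
        show ?thesis
          using le by (simp only: real_norm_def abs_of_nonneg[OF nn] indicator_simps(1)[OF True]
              mult_1 abs_of_nonneg[OF powr_ge_zero])
      qed auto
    qed
  qed
qed

text \<open>Inside the unit ball the power is integrable by itself; outside, it is at most (1 + norm
  x)^|a|, and the surplus of N over 2 * DIM pays for it.\<close>

lemma integrable_norm_powr_decay:
  fixes a :: real
  assumes a: "a > - real DIM('a::euclidean_space)" and N: "real N \<ge> 2 * DIM('a) + \<bar>a\<bar> + 1"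
  shows "integrable lborel (\<lambda>x::'a. norm x powr a * (1 / (1 + norm x) ^ N))"
proof -
  define M where "M = 2 * DIM('a)"
  have "integrable lborel (\<lambda>x::'a. indicator (cball 0 1) x * norm x powr a + 1 / (1 + norm x) ^ M)"
    by (intro Bochner_Integration.integrable_add integrable_norm_powr_cball[OF a] integrable_decay) (simp add: M_def)
  then show ?thesis
  proof (rule Bochner_Integration.integrable_bound, measurable, intro AE_I2)
    fix x :: 'a
    show "norm (norm x powr a * (1 / (1 + norm x) ^ N)) \<le>
       norm (indicator (cball 0 1) x * norm x powr a + 1 / (1 + norm x) ^ M)"
    proof (cases "norm x \<le> 1")
      case True
      have "1 \<le> (1 + norm x) ^ N" by (intro one_le_power) simp
      then have "1 / (1 + norm x) ^ N \<le> 1" by (subst divide_le_eq_1_pos) (auto intro!: zero_less_power add_pos_nonneg)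
      then have "norm x powr a * (1 / (1 + norm x) ^ N) \<le> norm x powr a * 1"
        by (rule mult_left_mono) simp
      also have "\<dots> \<le> norm x powr a + 1 / (1 + norm x) ^ M" by simp
      finally show ?thesis using True by (simp add: abs_mult)
    next
      case False
      have "norm x powr a \<le> (1 + norm x) powr a'" if "a' = \<bar>a\<bar>" for a'
      proof -
        have "norm x powr a \<le> norm x powr a'" using False that by (intro powr_mono) auto
        also have "\<dots> \<le> (1 + norm x) powr a'" using that by (intro powr_mono2) auto
        finally show ?thesis .
      qed
      then have "norm x powr a * (1 + norm x) ^ M \<le> (1 + norm x) powr \<bar>a\<bar> * (1 + norm x) ^ M"
        by (intro mult_right_mono) auto
      also have "\<dots> = (1 + norm x) powr (\<bar>a\<bar> + M)"
        by (simp add: powr_add powr_realpow add_pos_nonneg)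
      also have "\<dots> \<le> (1 + norm x) powr N"
        using N by (intro powr_mono) (auto simp: M_def)
      also have "\<dots> = (1 + norm x) ^ N" by (simp add: powr_realpow add_pos_nonneg)
      finally have "norm x powr a * (1 / (1 + norm x) ^ N) \<le> 1 / (1 + norm x) ^ M"
        by (simp add: field_simps add_pos_nonneg)
      then show ?thesis using False by (simp add: abs_mult)
    qed
  qed
qed

subsection \<open>Gaussians\<close>

lemma borel_measurable_cis[measurable (raw)]:
  "f \<in> borel_measurable M \<Longrightarrow> (\<lambda>x. cis (f x)) \<in> borel_measurable M"
  by (rule measurable_compose[where g=cis]) (auto intro!: borel_measurable_continuous_onI continuous_intros)

text \<open>Rescaling the variable by sqrt (2 * t) reduces the claim to the characteristic function
  of the standard normal distribution.\<close>

lemma gaussian_fourier_real: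
  fixes t \<xi> :: real
  assumes t: "t > 0"
  shows "integrable lborel (\<lambda>x. of_real (exp (- t * x\<^sup>2)) * cis (- (\<xi> * x)))"
    "(LINT x|lborel. of_real (exp (- t * x\<^sup>2)) * cis (- (\<xi> * x))) =
       of_real (sqrt (pi / t) * exp (- \<xi>\<^sup>2 / (4 * t)))"
proof -
  have 0: "integrable lborel (\<lambda>x. of_real (std_normal_density x) * cis (\<zeta> * x))" for \<zeta>
    by (rule Bochner_Integration.integrable_bound[OF integrable_normal_density[of 1 0]])
       (auto simp: norm_mult)
  have 1: "(LINT x|lborel. of_real (std_normal_density x) * cis (\<zeta> * x)) = of_real (exp (- \<zeta>\<^sup>2 / 2))" for \<zeta>
  proof -
    have "char std_normal_distribution \<zeta> = (LINT x|lborel. std_normal_density x *\<^sub>R cis (\<zeta> * x))"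
      unfolding char_def by (subst integral_density) (auto simp: cis_conv_exp normal_density_nonneg)
    then show ?thesis by (simp add: char_std_normal_distribution scaleR_conv_of_real)
  qed
  define c where "c = sqrt (2 * t)"
  have c: "c \<noteq> 0" "c\<^sup>2 = 2 * t" "c > 0" using t by (auto simp: c_def)
  have e: "of_real (std_normal_density (0 + c * x)) * cis ((- \<xi> / c) * (0 + c * x)) =
     of_real (1 / sqrt (2 * pi)) * (of_real (exp (- t * x\<^sup>2)) * cis (- (\<xi> * x)))" for x
    using c by (simp add: std_normal_density_def power_mult_distrib)
  have I: "integrable lborel (\<lambda>x. of_real (1 / sqrt (2 * pi)) * (of_real (exp (- t * x\<^sup>2)) * cis (- (\<xi> * x))))"
    using lborel_integrable_real_affine[OF 0[of "- \<xi> / c"] c(1), of 0] unfolding e .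
  show "integrable lborel (\<lambda>x. of_real (exp (- t * x\<^sup>2)) * cis (- (\<xi> * x)))"
    using integrable_mult_right[OF I, of "of_real (sqrt (2 * pi))"] by simp
  have "of_real (exp (- (- \<xi> / c)\<^sup>2 / 2)) = \<bar>c\<bar> *\<^sub>R (LINT x|lborel. of_real (1 / sqrt (2 * pi)) * (of_real (exp (- t * x\<^sup>2)) * cis (- (\<xi> * x))))"
    unfolding e[symmetric] 1[symmetric] by (rule lborel_integral_real_affine[OF c(1)])
  also have "\<dots> = of_real (c / sqrt (2 * pi)) * (LINT x|lborel. of_real (exp (- t * x\<^sup>2)) * cis (- (\<xi> * x)))"
    using c by (simp add: scaleR_conv_of_real del: of_real_exp)
  finally have "(LINT x|lborel. of_real (exp (- t * x\<^sup>2)) * cis (- (\<xi> * x))) =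
     of_real (sqrt (2 * pi) / c) * of_real (exp (- (- \<xi> / c)\<^sup>2 / 2))"
    using c by (simp add: field_simps)
  also have "sqrt (2 * pi) / c = sqrt (pi / t)" by (simp add: c_def real_sqrt_divide[symmetric])
  also have "- (- \<xi> / c)\<^sup>2 / 2 = - \<xi>\<^sup>2 / (4 * t)" using c by (simp add: power_divide)
  finally show "(LINT x|lborel. of_real (exp (- t * x\<^sup>2)) * cis (- (\<xi> * x))) =
       of_real (sqrt (pi / t) * exp (- \<xi>\<^sup>2 / (4 * t)))" by simp
qed

lemma cis_sum: "finite A \<Longrightarrow> cis (\<Sum>a\<in>A. f a) = (\<Prod>a\<in>A. cis (f a))"
  by (induction A rule: finite_induct) (auto simp: cis_mult[symmetric])

lemma norm_sq_eq_sum: "(norm (x::'a::euclidean_space))\<^sup>2 = (\<Sum>b\<in>Basis. (x \<bullet> b)\<^sup>2)"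
  unfolding power2_norm_eq_inner by (subst euclidean_inner) (simp add: power2_eq_square)

lemma gaussian_fourier:
  fixes \<xi> :: "'a::euclidean_space"
  assumes t: "t > 0"
  shows "integrable lborel (\<lambda>x. of_real (exp (- t * (norm x)\<^sup>2)) * cis (- (\<xi> \<bullet> x)))"
    "(LINT x|lborel. of_real (exp (- t * (norm x)\<^sup>2)) * cis (- (\<xi> \<bullet> x))) =
       of_real (sqrt (pi / t) ^ DIM('a) * exp (- (norm \<xi>)\<^sup>2 / (4 * t)))"
proof -
  have e: "of_real (exp (- t * (norm x)\<^sup>2)) * cis (- (\<xi> \<bullet> x)) =
     (\<Prod>b\<in>Basis. of_real (exp (- t * (x \<bullet> b)\<^sup>2)) * cis (- ((\<xi> \<bullet> b) * (x \<bullet> b))))" for x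
    unfolding norm_sq_eq_sum euclidean_inner[of \<xi> x] prod.distrib
    by (simp add: sum_distrib_left exp_sum cis_sum flip: sum_negf of_real_prod del: of_real_exp)
  show "integrable lborel (\<lambda>x. of_real (exp (- t * (norm x)\<^sup>2)) * cis (- (\<xi> \<bullet> x)))"
    unfolding e by (intro integrable_lborel_prod gaussian_fourier_real[OF t])
  have "(LINT x|lborel. of_real (exp (- t * (norm x)\<^sup>2)) * cis (- (\<xi> \<bullet> x))) =
    (\<Prod>b\<in>(Basis::'a set). of_real (sqrt (pi / t) * exp (- (\<xi> \<bullet> b)\<^sup>2 / (4 * t))))"
    unfolding e by (subst integral_lborel_prod) (simp_all only: gaussian_fourier_real[OF t])
  also have "\<dots> = of_real (sqrt (pi / t) ^ DIM('a) * exp (- (norm \<xi>)\<^sup>2 / (4 * t)))"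
    unfolding of_real_prod[symmetric]
    by (simp add: prod.distrib norm_sq_eq_sum exp_sum sum_divide_distrib flip: sum_negf)
  finally show "(LINT x|lborel. of_real (exp (- t * (norm x)\<^sup>2)) * cis (- (\<xi> \<bullet> x))) =
       of_real (sqrt (pi / t) ^ DIM('a) * exp (- (norm \<xi>)\<^sup>2 / (4 * t)))" .
qed

lemma gaussian_integral:
  assumes t: "t > 0"
  shows "integrable lborel (\<lambda>x::'a::euclidean_space. exp (- t * (norm x)\<^sup>2))"
    "(LINT x|lborel. exp (- t * (norm (x::'a))\<^sup>2)) = sqrt (pi / t) ^ DIM('a)"
proof -
  have "integrable lborel (\<lambda>x::'a. complex_of_real (exp (- t * (norm x)\<^sup>2)))"
    and *: "(LINT x|lborel. complex_of_real (exp (- t * (norm (x::'a))\<^sup>2))) = complex_of_real (sqrt (pi / t) ^ DIM('a))"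
    using gaussian_fourier[OF t, of "0::'a"] by simp_all
  then show "integrable lborel (\<lambda>x::'a. exp (- t * (norm x)\<^sup>2))"
    by (subst (asm) complex_of_real_integrable_eq)
  show "(LINT x|lborel. exp (- t * (norm (x::'a))\<^sup>2)) = sqrt (pi / t) ^ DIM('a)"
    using * by (simp only: integral_complex_of_real of_real_eq_iff)
qed

lemma lborel_integral_affine:
  fixes f :: "'a::euclidean_space \<Rightarrow> 'b::euclidean_space"
  assumes c: "c \<noteq> 0" and f[measurable]: "f \<in> borel_measurable borel"
  shows "(LINT x|lborel. f x) = \<bar>c\<bar> ^ DIM('a) *\<^sub>R (LINT x|lborel. f (t + c *\<^sub>R x))"
    "integrable lborel f \<Longrightarrow> integrable lborel (\<lambda>x. f (t + c *\<^sub>R x))"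
proof -
  have e: "lborel = density (distr lborel borel (\<lambda>x::'a. t + c *\<^sub>R x)) (\<lambda>_. ennreal (\<bar>c\<bar>^DIM('a)))"
    using lborel_affine[OF c, of t] by (simp add: ennreal_power)
  show "(LINT x|lborel. f x) = \<bar>c\<bar> ^ DIM('a) *\<^sub>R (LINT x|lborel. f (t + c *\<^sub>R x))"
    by (subst e, subst integral_density) (auto simp: integral_distr)
  assume "integrable lborel f"
  then have "integrable (density (distr lborel borel (\<lambda>x::'a. t + c *\<^sub>R x)) (\<lambda>_. ennreal (\<bar>c\<bar>^DIM('a)))) f"
    by (subst e[symmetric])
  then have "integrable lborel (\<lambda>x. \<bar>c\<bar> ^ DIM('a) *\<^sub>R f (t + c *\<^sub>R x))"
    by (subst (asm) integrable_density) (auto simp: integrable_distr_eq)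
  then have "integrable lborel (\<lambda>x. inverse (\<bar>c\<bar> ^ DIM('a)) *\<^sub>R \<bar>c\<bar> ^ DIM('a) *\<^sub>R f (t + c *\<^sub>R x))"
    by (rule integrable_scaleR_right)
  then show "integrable lborel (\<lambda>x. f (t + c *\<^sub>R x))"
    using c by simp
qed

text \<open>The positive and negative parts of g are densities of two measures that agree on boxes.
  Boxes form an intersection-stable generator, so the measures coincide, and with them their
  densities almost everywhere.\<close>

lemma AE_zero_if_box_integrals_zero:
  fixes g :: "'a::euclidean_space \<Rightarrow> real"
  assumes g: "integrable lborel g" and box: "\<And>l u. (LINT x|lborel. indicator (box l u) x * g x) = 0"
  shows "AE x in lborel. g x = 0"
proof -
  note [measurable] = borel_measurable_integrable[OF g]
  let ?M = "density lborel (\<lambda>x. ennreal (max 0 (g x)))" and ?N = "density lborel (\<lambda>x. ennreal (max 0 (- g x)))"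
  have ip: "integrable lborel (\<lambda>x. indicator A x * max 0 (g x))" and im: "integrable lborel (\<lambda>x. indicator A x * max 0 (- g x))"
    if [measurable]: "A \<in> sets borel" for A
    by (rule Bochner_Integration.integrable_bound[OF g]; auto simp: indicator_def)+
  have eP: "emeasure ?M A = ennreal (LINT x|lborel. indicator A x * max 0 (g x))"
    and eM: "emeasure ?N A = ennreal (LINT x|lborel. indicator A x * max 0 (- g x))"
    if [measurable]: "A \<in> sets borel" for A
    using nn_integral_eq_integral[OF ip[OF that]] nn_integral_eq_integral[OF im[OF that]]
    by (auto simp: emeasure_density mult.commute indicator_mult_ennreal ennreal_mult' ennreal_indicator)
  have "?M = ?N"
  proof (rule measure_eqI_generator_eq)
    let ?E = "range (\<lambda>(a, b). box a b::'a set)"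
    show "Int_stable ?E" by (auto simp: Int_stable_def box_Int_box)
    show "?E \<subseteq> Pow UNIV" "sets ?M = sigma_sets UNIV ?E" "sets ?N = sigma_sets UNIV ?E"
      by (simp_all add: borel_eq_box)
    let ?A = "\<lambda>n::nat. box (- (real n *\<^sub>R One)) (real n *\<^sub>R One) :: 'a set"
    show "range ?A \<subseteq> ?E" "(\<Union>i. ?A i) = UNIV"
      unfolding UN_box_eq_UNIV by auto
    show "emeasure ?M (?A i) \<noteq> \<infinity>" for i by (subst eP) auto
    fix X assume "X \<in> ?E"
    then obtain l u where X: "X = box l u" by auto
    have "(LINT x|lborel. indicator X x * max 0 (g x)) - (LINT x|lborel. indicator X x * max 0 (- g x))
       = (LINT x|lborel. indicator X x * max 0 (g x) - indicator X x * max 0 (- g x))"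
      by (rule Bochner_Integration.integral_diff[symmetric]; rule ip im; simp add: X)
    also have "\<dots> = (LINT x|lborel. indicator X x * g x)"
      by (rule Bochner_Integration.integral_cong) (auto simp: indicator_def)
    finally show "emeasure ?M X = emeasure ?N X"
      using box[of l u] by (simp only: X eP[OF borel_open[OF open_box]] eM[OF borel_open[OF open_box]] ennreal_inj) simp
  qed
  then have "AE x in lborel. ennreal (max 0 (g x)) = ennreal (max 0 (- g x))"
    by (intro sigma_finite_measure.density_unique[OF sigma_finite_lborel]) auto
  then show ?thesis by eventually_elim (auto simp: max_def split: if_splits)
qed

text \<open>After rescaling, the kernel is a fixed Gaussian and the indicator is evaluated at z + x
  / (m + 1). Dominated convergence applies wherever the indicator is locally constant, that is, off
  the boundary of the box.\<close>

lemma gaussian_average_tendsto_indicator: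
  fixes z :: "'a::euclidean_space"
  assumes z: "z \<notin> cbox l u - box l u"
  shows "(\<lambda>m. (LINT a|lborel. indicator (box l u) a * exp (- (real (Suc m))\<^sup>2 * (norm (z - a))\<^sup>2)) * (real (Suc m)) ^ DIM('a))
     \<longlonglongrightarrow> sqrt pi ^ DIM('a) * indicator (box l u) z"
proof -
  have e: "(LINT a|lborel. indicator (box l u) a * exp (- (real (Suc m))\<^sup>2 * (norm (z - a))\<^sup>2)) * (real (Suc m)) ^ DIM('a)
     = (LINT x|lborel. indicator (box l u) (z + (1 / real (Suc m)) *\<^sub>R x) * exp (- (norm x)\<^sup>2))" for m
  proof -
    let ?c = "1 / real (Suc m)"
    have "(LINT a|lborel. indicator (box l u) a * exp (- (real (Suc m))\<^sup>2 * (norm (z - a))\<^sup>2)) =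
     \<bar>?c\<bar> ^ DIM('a) *\<^sub>R (LINT x|lborel. indicator (box l u) (z + ?c *\<^sub>R x) * exp (- (real (Suc m))\<^sup>2 * (norm (z - (z + ?c *\<^sub>R x)))\<^sup>2))"
      by (rule lborel_integral_affine) auto
    moreover have "(real (Suc m))\<^sup>2 * (norm (z - (z + ?c *\<^sub>R x)))\<^sup>2 = (norm x)\<^sup>2" for x
      by (simp add: power_mult_distrib power_divide del: of_nat_Suc)
    ultimately show ?thesis by (simp add: power_divide del: of_nat_Suc)
  qed
  have lim: "(\<lambda>m. indicator (box l u) (z + (1 / real (Suc m)) *\<^sub>R x) * exp (- (norm x)\<^sup>2)) \<longlonglongrightarrow>
     indicator (box l u) z * exp (- (norm x)\<^sup>2)" for x
  proof -
    have "(\<lambda>m. z + (1 / real (Suc m)) *\<^sub>R x) \<longlonglongrightarrow> z + 0 *\<^sub>R x"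
      by (intro tendsto_intros LIMSEQ_Suc[OF lim_1_over_n])
    then have L: "(\<lambda>m. z + (1 / real (Suc m)) *\<^sub>R x) \<longlonglongrightarrow> z" by simp
    have "\<forall>\<^sub>F m in sequentially. indicator (box l u) (z + (1 / real (Suc m)) *\<^sub>R x) = (indicator (box l u) z :: real)"
    proof (cases "z \<in> box l u")
      case True
      from topological_tendstoD[OF L open_box this] show ?thesis
        by eventually_elim (use True in auto)
    next
      case False
      then have "z \<in> - cbox l u" using z by auto
      from topological_tendstoD[OF L _ this] show ?thesis
        by (auto simp: open_Compl closed_cbox elim!: eventually_mono) (use False box_subset_cbox in \<open>auto simp: indicator_def\<close>)
    qed
    then show ?thesis
      by (intro tendsto_eventually tendsto_mult_right) (auto elim: eventually_mono)
  qed
  have "(\<lambda>m. LINT x|lborel. indicator (box l u) (z + (1 / real (Suc m)) *\<^sub>R x) * exp (- (norm x)\<^sup>2)) \<longlonglongrightarrow>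
     (LINT x|lborel. indicator (box l u) z * exp (- (norm (x::'a))\<^sup>2))"
    by (rule integral_dominated_convergence[where w="\<lambda>x. exp (- (norm x)\<^sup>2)"])
       (use gaussian_integral(1)[of 1, where 'a='a] lim in \<open>auto simp: indicator_def\<close>)
  then show ?thesis unfolding e using gaussian_integral(2)[of 1, where 'a='a] by (simp add: mult.commute)
qed

lemma integrable_lborel_pair:
  fixes f :: "'a::euclidean_space \<Rightarrow> 'c::{real_normed_field,banach,second_countable_topology}"
    and g :: "'b::euclidean_space \<Rightarrow> 'c"
  assumes f: "integrable lborel f" and g: "integrable lborel g"
  shows "integrable (lborel \<Otimes>\<^sub>M lborel) (\<lambda>(x, y). f x * g y)"
proof -
  note [measurable] = borel_measurable_integrable[OF f] borel_measurable_integrable[OF g]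
  show ?thesis
    by (rule lborel_pair.Fubini_integrable) (use f g in \<open>auto simp: norm_mult\<close>)
qed

text \<open>Integrating the vanishing averages over all centres \<open>a\<close> in a box gives, by
  Fubini, the integral of g against a mollified indicator of the box. Sharpening the Gaussians
  yields vanishing integrals over boxes.\<close>

lemma gaussian_uniqueness_L1:
  fixes g :: "'a::euclidean_space \<Rightarrow> real"
  assumes g: "integrable lborel g"
    and 0: "\<And>t a. t > 0 \<Longrightarrow> (LINT z|lborel. g z * exp (- t * (norm (z - a))\<^sup>2)) = 0"
  shows "AE z in lborel. g z = 0"
proof (rule AE_zero_if_box_integrals_zero[OF g])
  fix l u :: 'a
  note [measurable] = borel_measurable_integrable[OF g]
  let ?K = "\<lambda>m z. (LINT a|lborel. indicator (box l u) a * exp (- (real (Suc m))\<^sup>2 * (norm (z - a))\<^sup>2)) * (real (Suc m)) ^ DIM('a)"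
  have Kint: "(LINT z|lborel. g z * ?K m z) = 0" for m
  proof -
    let ?t = "(real (Suc m))\<^sup>2"
    have I: "integrable (lborel \<Otimes>\<^sub>M lborel) (\<lambda>(z, a). g z * (indicator (box l u) a * exp (- ?t * (norm (z - a))\<^sup>2)))"
    proof (rule Bochner_Integration.integrable_bound)
      show "integrable (lborel \<Otimes>\<^sub>M lborel) (\<lambda>(z, a). g z * indicator (box l u) a)"
        by (rule integrable_lborel_pair[OF g]) (use emeasure_lborel_box_finite[of l u] in \<open>auto simp: integrable_indicator_iff less_top\<close>)
    qed (auto simp: abs_mult indicator_def split: prod.splits intro!: AE_I2 mult_left_le)
    have "(LINT z|lborel. g z * ?K m z) = real (Suc m) ^ DIM('a) *
       (LINT z|lborel. LINT a|lborel. g z * (indicator (box l u) a * exp (- ?t * (norm (z - a))\<^sup>2)))"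
      unfolding integral_mult_right_zero[symmetric] integral_mult_left_zero[symmetric]
      by (intro Bochner_Integration.integral_cong refl) (simp only: mult_ac)
    also have "(LINT z|lborel. LINT a|lborel. g z * (indicator (box l u) a * exp (- ?t * (norm (z - a))\<^sup>2)))
       = (LINT a|lborel. LINT z|lborel. g z * (indicator (box l u) a * exp (- ?t * (norm (z - a))\<^sup>2)))"
      using lborel_pair.Fubini_integral[OF I] by simp
    also have "\<dots> = (LINT a|lborel. indicator (box l u) a * (LINT z|lborel. g z * exp (- ?t * (norm (z - a))\<^sup>2)))"
      unfolding integral_mult_right_zero[symmetric]
      by (intro Bochner_Integration.integral_cong refl) (simp only: mult_ac)
    also have "\<dots> = 0" by (subst 0) auto
    finally show ?thesis by simp
  qed
  have Kb: "\<bar>?K m z\<bar> \<le> sqrt pi ^ DIM('a)" for m z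
  proof -
    let ?f = "\<lambda>a. exp (- (real (Suc m))\<^sup>2 * (norm (z - a))\<^sup>2)"
    have fi: "integrable lborel ?f" 
      using lborel_integral_affine(2)[OF _ _ gaussian_integral(1)[of "(real (Suc m))\<^sup>2"], of "-1" z] by simp
    have f: "(LINT a|lborel. ?f a) = sqrt (pi / (real (Suc m))\<^sup>2) ^ DIM('a)"
      using lborel_integral_affine(1)[of "-1" ?f z] gaussian_integral(2)[of "(real (Suc m))\<^sup>2", where 'a='a] by simp
    let ?I = "LINT a|lborel. indicator (box l u) a * ?f a"
    have le: "?I \<le> sqrt (pi / (real (Suc m))\<^sup>2) ^ DIM('a)" unfolding f[symmetric]
      by (rule integral_mono[OF Bochner_Integration.integrable_bound[OF fi] fi]) (auto simp: indicator_def)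
    have nn: "0 \<le> ?I" by (auto intro!: integral_nonneg_AE)
    have "\<bar>?K m z\<bar> = ?I * real (Suc m) ^ DIM('a)"
      by (subst abs_of_nonneg) (use nn in \<open>simp_all only: mult_nonneg_nonneg zero_le_power of_nat_0_le_iff\<close>)
    also have "\<dots> \<le> sqrt (pi / (real (Suc m))\<^sup>2) ^ DIM('a) * real (Suc m) ^ DIM('a)"
      by (rule mult_right_mono[OF le]) simp
    also have "\<dots> = sqrt pi ^ DIM('a)"
      by (simp add: real_sqrt_divide flip: power_mult_distrib)
    finally show ?thesis .
  qed
  have "(\<lambda>m. LINT z|lborel. g z * ?K m z) \<longlonglongrightarrow> (LINT z|lborel. g z * (sqrt pi ^ DIM('a) * indicator (box l u) z))"
  proof (rule integral_dominated_convergence[where w="\<lambda>z. \<bar>g z\<bar> * sqrt pi ^ DIM('a)"])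
    show "AE z in lborel. (\<lambda>m. g z * ?K m z) \<longlonglongrightarrow> g z * (sqrt pi ^ DIM('a) * indicator (box l u) z)"
      using AE_not_in[OF null_sets_cbox_Diff_box]
      by eventually_elim (intro tendsto_mult_left gaussian_average_tendsto_indicator)
    show "AE z in lborel. norm (g z * ?K m z) \<le> \<bar>g z\<bar> * sqrt pi ^ DIM('a)" for m
      unfolding real_norm_def abs_mult[of "g _"] by (intro AE_I2 mult_left_mono Kb) auto
  qed (use g in auto)
  then have "(LINT z|lborel. g z * (sqrt pi ^ DIM('a) * indicator (box l u) z)) = 0"
    unfolding Kint by (simp add: LIMSEQ_const_iff)
  moreover have "(LINT z|lborel. g z * (sqrt pi ^ DIM('a) * indicator (box l u) z)) = sqrt pi ^ DIM('a) * (LINT z|lborel. indicator (box l u) z * g z)"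
    unfolding integral_mult_right_zero[symmetric]
    by (intro Bochner_Integration.integral_cong refl) (simp only: mult_ac)
  ultimately show "(LINT x|lborel. indicator (box l u) x * g x) = 0" by simp
qed

text \<open>Here g may grow, so it is first damped by one fixed Gaussian. A product of two Gaussians
  is a multiple of a third, hence the hypotheses pass to the integrable components of the damped
  function.\<close>

lemma gaussian_uniqueness:
  fixes g :: "'a::euclidean_space \<Rightarrow> 'b::euclidean_space"
  assumes g[measurable]: "g \<in> borel_measurable borel"
    and i: "\<And>t a. t > 0 \<Longrightarrow> integrable lborel (\<lambda>z. exp (- t * (norm (z - a))\<^sup>2) *\<^sub>R g z)"
    and 0: "\<And>t a. t > 0 \<Longrightarrow> (LINT z|lborel. exp (- t * (norm (z - a))\<^sup>2) *\<^sub>R g z) = 0"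
  shows "AE z in lborel. g z = 0"
proof -
  have "AE z in lborel. g z \<bullet> b = 0" if b: "b \<in> Basis" for b
  proof -
    have "AE z in lborel. exp (- 1 * (norm (z - 0))\<^sup>2) * (g z \<bullet> b) = 0"
    proof (rule gaussian_uniqueness_L1)
      show "integrable lborel (\<lambda>z. exp (- 1 * (norm (z - 0))\<^sup>2) * (g z \<bullet> b))"
        using integrable_inner_left[OF i[of 1 0], of b] by simp
      fix t :: real and a :: 'a assume t: "t > 0"
      \<comment> \<open>The centre obtained by completing the square in |z|^2 + t |z - a|^2, whose
        leading coefficient is t + 1.\<close>
      define p where "p = (t / (t + 1)) *\<^sub>R a"
      have e: "exp (- 1 * (norm (z - 0))\<^sup>2) * exp (- t * (norm (z - a))\<^sup>2) =
         exp ((t + 1) * (norm p)\<^sup>2 - t * (norm a)\<^sup>2) * exp (- (t + 1) * (norm (z - p))\<^sup>2)" for z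
      proof -
        have "(t + 1) * (z \<bullet> p) = t * (z \<bullet> a)" using t by (simp add: p_def field_simps)
        then show ?thesis
          by (simp add: exp_add[symmetric] power2_norm_eq_inner inner_diff_left inner_diff_right
             inner_commute algebra_simps flip: exp_add)
      qed
      have "(LINT z|lborel. exp (- 1 * (norm (z - 0))\<^sup>2) * (g z \<bullet> b) * exp (- t * (norm (z - a))\<^sup>2))
         = (LINT z|lborel. exp ((t + 1) * (norm p)\<^sup>2 - t * (norm a)\<^sup>2) * ((exp (- (t + 1) * (norm (z - p))\<^sup>2) *\<^sub>R g z) \<bullet> b))"
        by (rule Bochner_Integration.integral_cong) (use e in \<open>auto simp: mult_ac\<close>)
      also have "\<dots> = exp ((t + 1) * (norm p)\<^sup>2 - t * (norm a)\<^sup>2) * ((LINT z|lborel. exp (- (t + 1) * (norm (z - p))\<^sup>2) *\<^sub>R g z) \<bullet> b)"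
        unfolding integral_mult_right_zero
        by (subst integral_inner_left) (use i[of "t+1" p] t in \<open>auto\<close>)
      also have "\<dots> = 0" using 0[of "t+1" p] t by simp
      finally show "(LINT z|lborel. exp (- 1 * (norm (z - 0))\<^sup>2) * (g z \<bullet> b) * exp (- t * (norm (z - a))\<^sup>2)) = 0" .
    qed
    then show ?thesis by eventually_elim auto
  qed
  then have "AE z in lborel. \<forall>b\<in>Basis. g z \<bullet> b = 0"
    by (intro AE_finite_allI) auto
  then show ?thesis by eventually_elim (simp add: euclidean_all_zero_iff)
qed

subsection \<open>Calculus of \<open>Ck\<close> functions\<close>

lemma partial_deriv_eqI:
  assumes "(f has_derivative D) (at z)"
  shows "partial_deriv e f z = D e"
  using frechet_derivative_at[OF assms] by (simp add: partial_deriv_def)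

lemma has_derivative_partial:
  fixes f :: "'a::euclidean_space \<Rightarrow> 'b::real_normed_vector"
  assumes "f differentiable at z"
  shows "(f has_derivative (\<lambda>h. \<Sum>e\<in>Basis. (h \<bullet> e) *\<^sub>R partial_deriv e f z)) (at z)"
proof -
  have D: "(f has_derivative frechet_derivative f (at z)) (at z)"
    using assms by (simp add: frechet_derivative_works)
  interpret linear "frechet_derivative f (at z)"
    by (rule has_derivative_linear[OF D])
  have "frechet_derivative f (at z) h = (\<Sum>e\<in>Basis. (h \<bullet> e) *\<^sub>R partial_deriv e f z)" for h
    by (subst euclidean_representation[of h, symmetric]) (simp add: partial_deriv_def sum scaleR del: euclidean_representation)
  then show ?thesis using D by (metis (no_types, lifting) ext)
qed

lemma Ck_SucD:
  assumes "Ck (Suc k) f"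
  shows "f differentiable at z" "e \<in> Basis \<Longrightarrow> Ck k (partial_deriv e f)"
  using assms by (auto simp: differentiable_on_def)

lemma Ck_SucI:
  assumes "\<And>z. f differentiable at z" "\<And>e. e \<in> Basis \<Longrightarrow> Ck k (partial_deriv e f)"
  shows "Ck (Suc k) f"
  using assms by (auto simp: differentiable_on_def differentiable_at_withinI)

lemma Ck_continuous: "Ck k f \<Longrightarrow> continuous_on UNIV f"
  by (cases k) (auto intro: differentiable_imp_continuous_on)

lemma Ck_Suc_imp: "Ck (Suc k) f \<Longrightarrow> Ck k f"
proof (induction k arbitrary: f)
  case 0
  then show ?case by (simp add: Ck_continuous del: Ck.simps(2))
next
  case (Suc k)
  show ?case by (rule Ck_SucI) (use Suc in \<open>auto simp del: Ck.simps intro: Ck_SucD\<close>)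
qed

lemma Ck_mono: "Ck k f \<Longrightarrow> j \<le> k \<Longrightarrow> Ck j f"
  by (induction k) (auto simp del: Ck.simps simp: le_Suc_eq dest: Ck_Suc_imp)

lemma Ck_1_continuous_partial: "Ck k f \<Longrightarrow> k \<ge> 1 \<Longrightarrow> e \<in> Basis \<Longrightarrow> continuous_on UNIV (partial_deriv e f)"
  using Ck_SucD(2)[of "k - 1" f e] by (auto intro: Ck_continuous simp del: Ck.simps)

lemma Ck_1_differentiable: "Ck k f \<Longrightarrow> k \<ge> 1 \<Longrightarrow> f differentiable at z"
  using Ck_SucD(1)[of "k - 1" f z] by (auto simp del: Ck.simps)

lemma partial_deriv_linear:
  fixes f :: "'a::euclidean_space \<Rightarrow> 'b::real_normed_vector" and L :: "'b \<Rightarrow> 'c::real_normed_vector"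
  assumes "bounded_linear L" "f differentiable at z"
  shows "partial_deriv e (\<lambda>z. L (f z)) z = L (partial_deriv e f z)"
  unfolding partial_deriv_def
  using assms(2) by (subst frechet_derivative_at[OF bounded_linear.has_derivative[OF assms(1)], symmetric])
     (auto simp: frechet_derivative_works)

lemma partial_deriv_add:
  fixes f g :: "'a::euclidean_space \<Rightarrow> 'b::real_normed_vector"
  assumes "f differentiable at z" "g differentiable at z"
  shows "partial_deriv e (\<lambda>z. f z + g z) z = partial_deriv e f z + partial_deriv e g z"
  using assms by (intro partial_deriv_eqI) (auto simp: frechet_derivative_works partial_deriv_def intro!: derivative_eq_intros)

lemma Ck_linear:
  fixes f :: "'a::euclidean_space \<Rightarrow> 'b::real_normed_vector" and L :: "'b \<Rightarrow> 'c::real_normed_vector"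
  assumes L: "bounded_linear L"
  shows "Ck k f \<Longrightarrow> Ck k (\<lambda>z. L (f z))"
proof (induction k arbitrary: f)
  case 0
  then show ?case
    using bounded_linear.continuous_on[OF L] by simp
next
  case (Suc k)
  show ?case
  proof (rule Ck_SucI)
    show "(\<lambda>z. L (f z)) differentiable at z" for z
      using bounded_linear.has_derivative[OF L] Ck_SucD(1)[OF Suc.prems, of z]
      by (auto simp: differentiable_def)
    fix e :: 'a assume "e \<in> Basis"
    with Suc have "Ck k (\<lambda>z. L (partial_deriv e f z))" by (auto simp del: Ck.simps intro: Ck_SucD)
    moreover have "partial_deriv e (\<lambda>z. L (f z)) = (\<lambda>z. L (partial_deriv e f z))"
      using partial_deriv_linear[OF L Ck_SucD(1)[OF Suc.prems]] by auto
    ultimately show "Ck k (partial_deriv e (\<lambda>z. L (f z)))" by simp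
  qed
qed

lemma Ck_add:
  fixes f g :: "'a::euclidean_space \<Rightarrow> 'b::real_normed_vector"
  shows "Ck k f \<Longrightarrow> Ck k g \<Longrightarrow> Ck k (\<lambda>z. f z + g z)"
proof (induction k arbitrary: f g)
  case 0
  then show ?case by (auto intro: continuous_intros)
next
  case (Suc k)
  show ?case
  proof (rule Ck_SucI)
    show "(\<lambda>z. f z + g z) differentiable at z" for z
      by (intro differentiable_add Ck_SucD(1)[OF Suc.prems(1)] Ck_SucD(1)[OF Suc.prems(2)])
    fix e :: 'a assume "e \<in> Basis"
    with Suc have "Ck k (\<lambda>z. partial_deriv e f z + partial_deriv e g z)"
      by (auto simp del: Ck.simps intro: Ck_SucD)
    moreover have "partial_deriv e (\<lambda>z. f z + g z) = (\<lambda>z. partial_deriv e f z + partial_deriv e g z)"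
      by (intro ext partial_deriv_add Ck_SucD(1)[OF Suc.prems(1)] Ck_SucD(1)[OF Suc.prems(2)])
    ultimately show "Ck k (partial_deriv e (\<lambda>z. f z + g z))" by simp
  qed
qed

lemma Ck_0: "Ck k (\<lambda>_. 0)"
proof (induction k)
  case (Suc k)
  have "partial_deriv e (\<lambda>_. 0::'b) = (\<lambda>_::'a. 0)" for e
    by (auto simp: partial_deriv_def)
  with Suc show ?case by simp
qed auto

lemma Ck_scaleR: "Ck k f \<Longrightarrow> Ck k (\<lambda>z. c *\<^sub>R f z)"
  by (rule Ck_linear[OF bounded_linear_scaleR_right])

lemma Ck_cmult: "Ck k f \<Longrightarrow> Ck k (\<lambda>z. (c::real) * f z)"
  by (rule Ck_linear[OF bounded_linear_mult_right])

lemma Ck_sum: "finite A \<Longrightarrow> (\<And>a. a \<in> A \<Longrightarrow> Ck k (f a)) \<Longrightarrow> Ck k (\<lambda>z. \<Sum>a\<in>A. f a z)"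
  by (induction A rule: finite_induct) (auto simp: Ck_0 intro!: Ck_add)

lemma partial_deriv_affine:
  fixes f :: "'a::euclidean_space \<Rightarrow> 'b::real_normed_vector" and A :: "'c::euclidean_space \<Rightarrow> 'a"
  assumes A: "bounded_linear A" and f: "f differentiable at (c + A z)"
  shows "((\<lambda>z. f (c + A z)) has_derivative (\<lambda>h. \<Sum>b\<in>Basis. (A h \<bullet> b) *\<^sub>R partial_deriv b f (c + A z))) (at z)"
    "partial_deriv e (\<lambda>z. f (c + A z)) z = (\<Sum>b\<in>Basis. (A e \<bullet> b) *\<^sub>R partial_deriv b f (c + A z))"
proof -
  have "((\<lambda>z. c + A z) has_derivative A) (at z)"
    by (rule has_derivative_eq_rhs[OF has_derivative_add[OF has_derivative_const bounded_linear_imp_has_derivative[OF A]]]) simp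
  from diff_chain_at[OF this has_derivative_partial[OF f]]
  show "((\<lambda>z. f (c + A z)) has_derivative (\<lambda>h. \<Sum>b\<in>Basis. (A h \<bullet> b) *\<^sub>R partial_deriv b f (c + A z))) (at z)"
    by (simp add: o_def)
  from partial_deriv_eqI[OF this]
  show "partial_deriv e (\<lambda>z. f (c + A z)) z = (\<Sum>b\<in>Basis. (A e \<bullet> b) *\<^sub>R partial_deriv b f (c + A z))" .
qed

lemma Ck_affine:
  fixes f :: "'a::euclidean_space \<Rightarrow> 'b::real_normed_vector" and A :: "'c::euclidean_space \<Rightarrow> 'a"
  assumes A: "bounded_linear A"
  shows "Ck k f \<Longrightarrow> Ck k (\<lambda>z. f (c + A z))"
proof (induction k arbitrary: f)
  case 0
  then show ?case
    using bounded_linear.continuous_on[OF A continuous_on_id, of UNIV]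
    by (auto intro!: continuous_intros intro: continuous_on_compose2)
next
  case (Suc k)
  note * = partial_deriv_affine[OF A Ck_SucD(1)[OF Suc.prems]]
  show ?case
  proof (rule Ck_SucI)
    show "(\<lambda>z. f (c + A z)) differentiable at z" for z
      using *(1) by (auto simp: differentiable_def)
    fix e :: 'c assume "e \<in> Basis"
    show "Ck k (partial_deriv e (\<lambda>z. f (c + A z)))"
      unfolding *(2) by (intro Ck_sum Ck_scaleR Suc.IH Ck_SucD(2)[OF Suc.prems] finite_Basis)
  qed
qed

subsection \<open>The averages \<open>\<integral>\<^sub>0\<^sup>1 t\<^sup>p W(x, t y) dt\<close>\<close>

text \<open>For smooth V odd in y, the quotient V / y is the average with p = 0 of \<partial>_y V.
  Higher p occur because every y-derivative of W(x, t y) brings out a factor t, so the family over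
  all p is closed under differentiation.\<close>

definition dil_avg :: "nat \<Rightarrow> ('a::euclidean_space \<times> real \<Rightarrow> real) \<Rightarrow> 'a \<times> real \<Rightarrow> real" where
  "dil_avg p W z = integral (cbox 0 1) (\<lambda>t. t ^ p * W (fst z, t * snd z))"

lemma continuous_dil:
  fixes W :: "'a::euclidean_space \<times> real \<Rightarrow> real"
  assumes "continuous_on UNIV W"
  shows "continuous_on S (\<lambda>(z, t). t ^ p * W (fst z, t * snd z))"
proof -
  have "continuous_on S (\<lambda>q. W (fst (fst q), snd q * snd (fst q)))"
    by (rule continuous_on_compose2[OF assms]) (auto intro!: continuous_intros)
  then show ?thesis
    unfolding case_prod_beta by (intro continuous_on_mult continuous_on_power continuous_on_snd continuous_on_id)
qed

lemma dil_avg_integrable: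
  fixes W :: "'a::euclidean_space \<times> real \<Rightarrow> real"
  assumes "continuous_on UNIV W"
  shows "(\<lambda>t. t ^ p * W (fst z, t * snd z)) integrable_on cbox 0 1"
proof -
  have "continuous_on (cbox 0 1) (\<lambda>t. W (fst z, t * snd z))"
    by (rule continuous_on_compose2[OF assms]) (auto intro!: continuous_intros)
  then show ?thesis
    by (intro integrable_continuous continuous_on_mult continuous_on_power continuous_on_id)
qed

lemma dil_avg_has_derivative:
  fixes W :: "'a::euclidean_space \<times> real \<Rightarrow> real"
  assumes W: "Ck (Suc 0) W"
  shows "(dil_avg p W has_derivative
    (\<lambda>h. \<Sum>e\<in>Basis. (h \<bullet> e) * dil_avg (p + (if e = (0, 1) then 1 else 0)) (partial_deriv e W) z)) (at z)"
proof -
  define q where "q e = p + (if e = (0, 1) then 1 else 0)" for e :: "'a \<times> real"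
  let ?g = "\<lambda>e (z::'a \<times> real) (t::real). t ^ q e * partial_deriv e W (fst z, t * snd z)"
  \<comment> \<open>The derivative in z is packaged as a bounded linear functional depending
    continuously on (z, t), the form in which the Leibniz rule accepts it.\<close>
  define fx where "fx z t = (\<Sum>e\<in>Basis. ?g e z t *\<^sub>R blinfun_inner_right e)" for z t
  have c: "continuous_on UNIV (partial_deriv e W)" if "e \<in> Basis" for e
    using Ck_SucD(2)[OF W that] by simp
  have ap: "blinfun_apply (fx z t) h = (\<Sum>e\<in>Basis. (h \<bullet> e) * ?g e z t)" for z t h
    by (simp add: fx_def blinfun.sum_left blinfun.scaleR_left inner_commute mult_ac)
  have "((\<lambda>z. integral (cbox 0 1) (\<lambda>t. t ^ p * W (fst z, t * snd z))) has_derivative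
     blinfun_apply (integral (cbox 0 1) (fx z))) (at z within UNIV)"
  proof (rule leibniz_rule)
    show "(\<lambda>t. t ^ p * W (fst x, t * snd x)) integrable_on cbox 0 1" for x
      by (rule dil_avg_integrable) (rule Ck_continuous[OF W])
    show "continuous_on (UNIV \<times> cbox 0 1) (\<lambda>(x, t). fx x t)"
      unfolding fx_def case_prod_beta
      by (intro continuous_on_sum continuous_on_scaleR continuous_on_const)
         (use continuous_dil[OF c] in \<open>auto simp: case_prod_beta\<close>)
    fix x :: "'a \<times> real" and t :: real
    let ?A = "\<lambda>z::'a \<times> real. (fst z, t * snd z)"
    have A: "bounded_linear ?A"
      by (intro bounded_linear_intros)
    have e: "(?A h \<bullet> e) * t ^ p = (h \<bullet> e) * t ^ q e" if "e \<in> Basis" for h e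
      using that by (cases h) (auto simp: Basis_prod_def q_def)
    have "((\<lambda>z. W (0 + ?A z)) has_derivative (\<lambda>h. \<Sum>b\<in>Basis. (?A h \<bullet> b) *\<^sub>R partial_deriv b W (0 + ?A x))) (at x)"
      by (rule partial_deriv_affine[OF A Ck_SucD(1)[OF W]])
    then have "((\<lambda>z. t ^ p * W (?A z)) has_derivative (\<lambda>h. t ^ p * (\<Sum>b\<in>Basis. (?A h \<bullet> b) * partial_deriv b W (?A x)))) (at x)"
      by (auto intro!: derivative_eq_intros)
    moreover have "t ^ p * (\<Sum>b\<in>Basis. (?A h \<bullet> b) * partial_deriv b W (?A x)) = blinfun_apply (fx x t) h" for h
      unfolding ap sum_distrib_left
      by (intro sum.cong refl) (use e in \<open>simp add: mult_ac\<close>)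
    ultimately show "((\<lambda>x. t ^ p * W (?A x)) has_derivative blinfun_apply (fx x t)) (at x within UNIV)"
      by (metis (no_types, lifting) ext)
  qed auto
  moreover have "blinfun_apply (integral (cbox 0 1) (fx z)) h = (\<Sum>e\<in>Basis. (h \<bullet> e) * dil_avg (q e) (partial_deriv e W) z)" for h
  proof -
    have "fx z integrable_on cbox 0 1"
      unfolding fx_def
    proof (intro integrable_continuous continuous_on_sum continuous_on_scaleR continuous_on_const
        continuous_on_mult continuous_on_power continuous_on_id)
      fix e :: "'a \<times> real" assume e: "e \<in> Basis"
      show "continuous_on (cbox 0 1) (\<lambda>t. partial_deriv e W (fst z, t * snd z))"
        by (rule continuous_on_compose2[OF c[OF e]]) (auto intro!: continuous_intros)
    qed
    then have "blinfun_apply (integral (cbox 0 1) (fx z)) h = integral (cbox 0 1) (\<lambda>t. blinfun_apply (fx z t) h)"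
      by (rule blinfun_apply_integral)
    also have "\<dots> = (\<Sum>e\<in>Basis. integral (cbox 0 1) (\<lambda>t. (h \<bullet> e) * ?g e z t))"
      unfolding ap by (intro integral_sum finite_Basis integrable_on_mult_right dil_avg_integrable c)
    finally show ?thesis by (simp add: dil_avg_def)
  qed
  ultimately show ?thesis unfolding dil_avg_def q_def
    by (metis (no_types, lifting) ext)
qed

text \<open>Differentiation replaces p by p or p + 1 and W by a partial derivative, so the induction
  runs over all p and W simultaneously.\<close>

lemma Ck_dil_avg:
  fixes W :: "'a::euclidean_space \<times> real \<Rightarrow> real"
  shows "Ck k W \<Longrightarrow> Ck k (dil_avg p W)"
proof (induction k arbitrary: p W)
  case 0
  have "continuous_on UNIV (\<lambda>z. integral (cbox 0 1) (\<lambda>t. t ^ p * W (fst z, t * snd z)))"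
    by (rule integral_continuous_on_param) (use 0 in \<open>auto intro!: continuous_dil\<close>)
  then show ?case by (simp add: dil_avg_def[abs_def])
next
  case (Suc k)
  have "Ck (Suc 0) W" using Suc.prems by (rule Ck_mono) simp
  note D = dil_avg_has_derivative[OF this]
  have "partial_deriv e (dil_avg p W) = dil_avg (p + (if e = (0, 1) then 1 else 0)) (partial_deriv e W)"
    if "e \<in> Basis" for e
  proof
    fix z
    have "partial_deriv e (dil_avg p W) z = (\<Sum>e'\<in>Basis. (e \<bullet> e') * dil_avg (p + (if e' = (0, 1) then 1 else 0)) (partial_deriv e' W) z)"
      by (rule partial_deriv_eqI[OF D])
    also have "\<dots> = (\<Sum>e'\<in>Basis. if e' = e then dil_avg (p + (if e' = (0, 1) then 1 else 0)) (partial_deriv e' W) z else 0)"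
      using that by (intro sum.cong) (auto simp: inner_Basis)
    finally show "partial_deriv e (dil_avg p W) z = dil_avg (p + (if e = (0, 1) then 1 else 0)) (partial_deriv e W) z"
      using that by (simp add: sum.delta)
  qed
  note pd = this
  show ?case
  proof (rule Ck_SucI)
    show "dil_avg p W differentiable at z" for z
      using D unfolding differentiable_def by blast
    fix e :: "'a \<times> real" assume e: "e \<in> Basis"
    show "Ck k (partial_deriv e (dil_avg p W))"
      unfolding pd[OF e] by (intro Suc.IH Ck_SucD(2)[OF Suc.prems e])
  qed
qed

subsection \<open>The operator \<open>\<Delta>_b\<close> on test functions\<close>

lemma e_y_Basis [simp]: "(0, 1) \<in> (Basis :: ('a::euclidean_space \<times> real) set)"
  by (simp add: Basis_prod_def)

text \<open>Chain rule for the reflection. The factor \<open>s\<close> treats even and odd functions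
  together: a y-derivative flips the parity, and the second derivatives in \<open>Lap_b\<close> are
  reached by applying the lemma twice.\<close>

lemma partial_deriv_reflect:
  fixes U :: "'a::euclidean_space \<times> real \<Rightarrow> real"
  assumes even: "\<And>x y. U (x, - y) = s * U (x, y)" and U: "\<And>z. U differentiable at z" and e: "e \<in> Basis"
  shows "partial_deriv e U (x, - y) = (if e = (0, 1) then - s else s) * partial_deriv e U (x, y)"
proof -
  let ?A = "\<lambda>z::'a \<times> real. (fst z, - snd z)"
  have A: "bounded_linear ?A"
    by (intro bounded_linear_Pair bounded_linear_fst bounded_linear_minus bounded_linear_snd)
  have "partial_deriv e (\<lambda>z. U (0 + ?A z)) (x, y) = (\<Sum>b\<in>Basis. (?A e \<bullet> b) *\<^sub>R partial_deriv b U (0 + ?A (x, y)))"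
    by (rule partial_deriv_affine(2)[OF A U])
  also have "\<dots> = (\<Sum>b\<in>Basis. if b = e then (if e = (0, 1) then - 1 else 1) * partial_deriv b U (?A (x, y)) else 0)"
    using e by (intro sum.cong refl) (auto simp: Basis_prod_def inner_Basis split: if_splits)
  also have "\<dots> = (if e = (0, 1) then - 1 else 1) * partial_deriv e U (x, - y)"
    using e by (simp add: sum.delta)
  finally have 1: "partial_deriv e (\<lambda>z. U (0 + ?A z)) (x, y) = (if e = (0, 1) then - 1 else 1) * partial_deriv e U (x, - y)" .
  have "(\<lambda>z. U (0 + ?A z)) = (\<lambda>z. s * U z)" using even by auto
  with 1 partial_deriv_linear[OF bounded_linear_mult_right U, of e s "(x, y)"]
  show ?thesis by (auto split: if_splits)
qed

lemma partial_deriv_support: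
  assumes "z \<notin> closure {z. f z \<noteq> 0}"
  shows "partial_deriv e f z = 0"
proof -
  have "(f has_derivative (\<lambda>_. 0)) (at z)"
    by (rule has_derivative_transform_within_open[OF has_derivative_const[of 0], of "- closure {z. f z \<noteq> 0}"])
       (use assms closure_subset[of "{z. f z \<noteq> 0}"] in \<open>auto simp: closed_closure\<close>)
  from partial_deriv_eqI[OF this] show ?thesis .
qed

lemma closure_partial_support: "closure {z. partial_deriv e f z \<noteq> 0} \<subseteq> closure {z. f z \<noteq> 0}"
  by (rule closure_minimal) (use partial_deriv_support in auto)

lemma compact_closure_subset: "compact (closure T) \<Longrightarrow> S \<subseteq> closure T \<Longrightarrow> compact (closure S)"
  by (metis closed_closure closure_minimal compact_Int_closed inf.absorb_iff2)

lemma Cke_iff: "U \<in> Cke k \<longleftrightarrow> Ck k U \<and> compact (closure {z. U z \<noteq> 0}) \<and> (\<forall>x y. U (x, - y) = U (x, y))"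
  by (simp add: Cke_def)

lemma CinfeD:
  assumes "U \<in> Cinfe"
  shows "Ck k U" "compact (closure {z. U z \<noteq> 0})" "U (x, - y) = U (x, y)"
  using assms unfolding Cinfe_def INT_iff Cke_iff by blast+

lemma CinfeI:
  assumes "\<And>k. Ck k U" "compact (closure {z. U z \<noteq> 0})" "\<And>x y. U (x, - y) = U (x, y)"
  shows "U \<in> Cinfe"
  using assms unfolding Cinfe_def INT_iff Cke_iff by blast

lemma Cinfe_Cke: "U \<in> Cinfe \<Longrightarrow> U \<in> Cke k"
  unfolding Cinfe_def by blast

lemma Cke_lin:
  assumes "U \<in> Cke k" "V \<in> Cke k"
  shows "(\<lambda>z. c * U z + d * V z) \<in> Cke k"
proof -
  have "compact (closure ({z. U z \<noteq> 0} \<union> {z. V z \<noteq> 0}))"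
    using assms by (simp add: Cke_iff compact_Un)
  then have "compact (closure {z. c * U z + d * V z \<noteq> 0})"
    by (rule compact_closure_subset) (rule order_trans[OF _ closure_subset], auto)
  then show ?thesis using assms by (simp add: Cke_iff Ck_add Ck_cmult)
qed

lemma Cinfe_lin: "U \<in> Cinfe \<Longrightarrow> V \<in> Cinfe \<Longrightarrow> (\<lambda>z. c * U z + d * V z) \<in> Cinfe"
  unfolding Cinfe_def INT_iff using Cke_lin by blast

lemma Cinfe_diff: "U \<in> Cinfe \<Longrightarrow> V \<in> Cinfe \<Longrightarrow> (\<lambda>z. U z - V z) \<in> Cinfe"
  using Cinfe_lin[of U V 1 "-1"] by simp

lemma Ck_partial: "(\<And>k. Ck k U) \<Longrightarrow> e \<in> Basis \<Longrightarrow> Ck k (partial_deriv e U)"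
  using Ck_SucD(2)[of k U e] by blast

lemma partial_y_odd:
  assumes "U \<in> Cke k" "k \<ge> 1"
  shows "partial_deriv (0, 1) U (x, 0) = 0"
proof -
  have "partial_deriv (0, 1) U (x, - 0) = - 1 * partial_deriv (0, 1) U (x, 0)"
    using assms partial_deriv_reflect[of U 1 "(0, 1)" x 0, OF _ Ck_1_differentiable[of k]]
    by (simp add: Cke_iff)
  then show ?thesis by simp
qed

lemma has_vector_derivative_slice:
  fixes V :: "'a::euclidean_space \<times> real \<Rightarrow> real"
  assumes "V differentiable at (x, y)"
  shows "((\<lambda>y. V (x, y)) has_real_derivative partial_deriv (0, 1) V (x, y)) (at y)"
proof -
  have "bounded_linear (\<lambda>y::real. (0::'a, y))" by (intro bounded_linear_intros)
  from partial_deriv_affine(1)[OF this, of V "(x, 0)" y] assms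
  have "((\<lambda>y. V (x, y)) has_derivative (\<lambda>h. \<Sum>b\<in>Basis. ((0, h) \<bullet> b) * partial_deriv b V (x, y))) (at y)"
    by simp
  moreover have "(\<Sum>b\<in>Basis. ((0::'a, h) \<bullet> b) * partial_deriv b V (x, y)) = partial_deriv (0, 1) V (x, y) * h" for h :: real
  proof -
    have "(\<Sum>b\<in>Basis. ((0::'a, h) \<bullet> b) * partial_deriv b V (x, y)) =
       (\<Sum>b\<in>Basis. if b = (0, 1) then h * partial_deriv b V (x, y) else 0)"
      by (intro sum.cong refl) (auto simp: Basis_prod_def)
    then show ?thesis by (simp add: sum.delta)
  qed
  ultimately show ?thesis by (simp add: has_field_derivative_def)
qed

text \<open>Evenness makes \<partial>_y U vanish on y = 0, so the fundamental theorem of calculus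
  along t \<mapsto> (x, t y) exhibits it as y times an average of \<partial>_y\<partial>_y U. On y =
  0 the average is that of a constant and reproduces the value prescribed in \<open>Lap_b\<close>;
  both cases together show that the singular term is smooth.\<close>

lemma Lap_b_quotient:
  assumes U: "U \<in> Cinfe"
  shows "(if snd z = 0 then partial_deriv (0, 1) (partial_deriv (0, 1) U) z
          else partial_deriv (0, 1) U z / snd z) = dil_avg 0 (partial_deriv (0, 1) (partial_deriv (0, 1) U)) z"
proof (cases z)
  case (Pair x y)
  let ?V = "partial_deriv (0, 1) U"
  let ?W = "partial_deriv (0, 1) ?V"
  have V: "?V differentiable at z" for z
    using Ck_partial[OF CinfeD(1)[OF U], of "(0,1)" 1] by (intro Ck_1_differentiable[of 1]) auto
  show ?thesis
  proof (cases "y = 0")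
    case True
    then show ?thesis by (simp add: Pair dil_avg_def)
  next
    case False
    have "((\<lambda>t. ?W (x, t * y) * y) has_integral ?V (x, 1 * y) - ?V (x, 0 * y)) {0..1}"
    proof (rule fundamental_theorem_of_calculus)
      fix t :: real
      have "((\<lambda>t. ?V (x, t * y)) has_real_derivative ?W (x, t * y) * y) (at t)"
        by (rule DERIV_chain2[OF has_vector_derivative_slice[OF V]]) (auto intro!: derivative_eq_intros)
      then show "((\<lambda>t. ?V (x, t * y)) has_vector_derivative ?W (x, t * y) * y) (at t within {0..1})"
        by (simp add: has_real_derivative_iff_has_vector_derivative has_vector_derivative_at_within)
    qed simp
    then have "((\<lambda>t. ?W (x, t * y) * y) has_integral ?V (x, y)) {0..1}"
      using partial_y_odd[OF Cinfe_Cke[OF U, of 1]] by simp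
    from integral_unique[OF this] have "integral {0..1} (\<lambda>t. ?W (x, t * y)) * y = ?V (x, y)"
      by simp
    then show ?thesis using False by (simp add: Pair dil_avg_def field_simps)
  qed
qed

lemma Lap_b_support:
  assumes "z \<notin> closure {z. V z \<noteq> 0}"
  shows "Lap_b b V z = 0"
proof -
  have "partial_deriv e (partial_deriv e' V) z = 0" for e e'
    using assms closure_partial_support[of e' V] by (intro partial_deriv_support) auto
  moreover have "partial_deriv e V z = 0" for e
    using assms by (rule partial_deriv_support)
  ultimately show ?thesis by (simp add: Lap_b_def laplacian_def)
qed

lemma Lap_b_Cinfe:
  assumes U: "U \<in> Cinfe"
  shows "Lap_b b U \<in> Cinfe"
proof (rule CinfeI)
  have sm: "Ck k (partial_deriv e U)" if "e \<in> Basis" for e k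
    using U that by (intro Ck_partial CinfeD) auto
  have sm2: "Ck k (partial_deriv e (partial_deriv e' U))" if "e \<in> Basis" "e' \<in> Basis" for e e' k
    using that by (intro Ck_partial sm) auto
  have eq: "Lap_b b U = (\<lambda>z. (\<Sum>e\<in>Basis. partial_deriv e (partial_deriv e U) z) + b * dil_avg 0 (partial_deriv (0, 1) (partial_deriv (0, 1) U)) z)"
    by (rule ext) (simp only: Lap_b_def laplacian_def Lap_b_quotient[OF U])
  show "Ck k (Lap_b b U)" for k
    unfolding eq by (intro Ck_add Ck_sum Ck_cmult Ck_dil_avg sm2) auto
  have "{z. Lap_b b U z \<noteq> 0} \<subseteq> closure {z. U z \<noteq> 0}"
    using Lap_b_support by auto
  then show "compact (closure {z. Lap_b b U z \<noteq> 0})"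
    by (rule compact_closure_subset[OF CinfeD(2)[OF U]])
  fix x y
  have d: "U differentiable at z" for z
    using CinfeD(1)[OF U, of 1] by (intro Ck_1_differentiable[of 1]) auto
  have d': "partial_deriv e U differentiable at z" if "e \<in> Basis" for e z
    using sm[OF that, of 1] by (intro Ck_1_differentiable[of 1]) auto
  have 1: "partial_deriv e U (x, - y) = (if e = (0, 1) then - 1 else 1) * partial_deriv e U (x, y)" if "e \<in> Basis" for e x y
    by (rule partial_deriv_reflect) (use U that d in \<open>auto simp: CinfeD\<close>)
  have 2: "partial_deriv e (partial_deriv e U) (x, - y) = partial_deriv e (partial_deriv e U) (x, y)" if "e \<in> Basis" for e x y
    using partial_deriv_reflect[OF 1 d', OF that that that] by simp
  show "Lap_b b U (x, - y) = Lap_b b U (x, y)"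
    unfolding Lap_b_def laplacian_def using 1[of "(0,1)" x y] 2 by simp
qed

lemma Lap_b_lin:
  assumes U: "U \<in> Cinfe" and V: "V \<in> Cinfe"
  shows "Lap_b b (\<lambda>z. c * U z + d * V z) = (\<lambda>z. c * Lap_b b U z + d * Lap_b b V z)"
proof -
  have lin: "partial_deriv e (\<lambda>z. c * f z + d * g z) = (\<lambda>z. c * partial_deriv e f z + d * partial_deriv e g z)"
    if "\<And>z. f differentiable at z" "\<And>z. g differentiable at z" for f g :: "(real^'a) \<times> real \<Rightarrow> real" and e
  proof
    fix z
    have "partial_deriv e (\<lambda>z. c * f z + d * g z) z = partial_deriv e (\<lambda>z. c * f z) z + partial_deriv e (\<lambda>z. d * g z) z"
      by (rule partial_deriv_add) (use that in \<open>auto intro: differentiable_mult\<close>)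
    then show "partial_deriv e (\<lambda>z. c * f z + d * g z) z = c * partial_deriv e f z + d * partial_deriv e g z"
      by (simp add: partial_deriv_linear[OF bounded_linear_mult_right] that)
  qed
  have dU: "U differentiable at z" "V differentiable at z" for z
    using CinfeD(1)[OF U, of 1] CinfeD(1)[OF V, of 1] by (auto intro!: Ck_1_differentiable[of 1] simp del: One_nat_def)
  have d': "partial_deriv e U differentiable at z" "partial_deriv e V differentiable at z" if "e \<in> Basis" for e z
    using Ck_partial[OF CinfeD(1)[OF U] that, of 1] Ck_partial[OF CinfeD(1)[OF V] that, of 1] by (auto intro!: Ck_1_differentiable[of 1] simp del: One_nat_def)
  have 2: "partial_deriv e (partial_deriv e (\<lambda>z. c * U z + d * V z)) = (\<lambda>z. c * partial_deriv e (partial_deriv e U) z + d * partial_deriv e (partial_deriv e V) z)" if "e \<in> Basis" for e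
    unfolding lin[OF dU] by (rule lin[OF d', OF that that])
  show ?thesis
    unfolding Lap_b_def laplacian_def using 2
    by (auto simp: lin[OF dU] sum.distrib sum_distrib_left algebra_simps add_divide_distrib)
qed

lemma Lap_b_iter_Cinfe: "U \<in> Cinfe \<Longrightarrow> (Lap_b b ^^ j) U \<in> Cinfe"
  by (induction j) (auto intro: Lap_b_Cinfe)

lemma Lap_b_iter_lin:
  assumes "U \<in> Cinfe" "V \<in> Cinfe"
  shows "(Lap_b b ^^ j) (\<lambda>z. c * U z + d * V z) = (\<lambda>z. c * (Lap_b b ^^ j) U z + d * (Lap_b b ^^ j) V z)"
  by (induction j) (auto simp: Lap_b_lin assms Lap_b_iter_Cinfe)

lemma grad_lin:
  assumes "f differentiable at z" "g differentiable at z"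
  shows "grad (\<lambda>z. c * f z + d * g z) z = c *\<^sub>R grad f z + d *\<^sub>R grad g z"
proof -
  have "partial_deriv e (\<lambda>z. c * f z + d * g z) z = c * partial_deriv e f z + d * partial_deriv e g z" for e
  proof -
    have "partial_deriv e (\<lambda>z. c * f z + d * g z) z = partial_deriv e (\<lambda>z. c * f z) z + partial_deriv e (\<lambda>z. d * g z) z"
      by (rule partial_deriv_add) (use assms in \<open>auto intro: differentiable_mult\<close>)
    then show ?thesis
      by (simp add: partial_deriv_linear[OF bounded_linear_mult_right] assms)
  qed
  then show ?thesis
    by (simp add: grad_def sum.distrib scaleR_add_left scaleR_sum_right)
qed

lemma Cinfe_differentiable: "U \<in> Cinfe \<Longrightarrow> U differentiable at z"
  by (rule Ck_1_differentiable[of 1, OF CinfeD(1)]) auto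

lemma nabla_b_lin:
  assumes "U \<in> Cinfe" "V \<in> Cinfe"
  shows "nabla_b b j (\<lambda>z. c * U z + d * V z) z = c *\<^sub>R nabla_b b j U z + d *\<^sub>R nabla_b b j V z"
  by (simp add: nabla_b_def Lap_b_iter_lin[OF assms] grad_lin Cinfe_differentiable Lap_b_iter_Cinfe assms)

lemma norm_grad: "(norm (grad f z))\<^sup>2 = (\<Sum>e\<in>Basis. (partial_deriv e f z)\<^sup>2)"
  unfolding power2_norm_eq_inner
  by (subst euclidean_inner) (simp add: grad_def inner_sum_left inner_Basis if_distrib sum.delta power2_eq_square cong: if_cong)

lemma continuous_grad:
  assumes "Ck k f" "k \<ge> 1"
  shows "continuous_on UNIV (grad f)"
  unfolding grad_def[abs_def] using assms by (intro continuous_intros Ck_1_continuous_partial)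

lemma continuous_nabla_b:
  assumes "U \<in> Cinfe"
  shows "continuous_on UNIV (nabla_b b j U)"
proof (cases "even j")
  case True
  then show ?thesis unfolding nabla_b_def[abs_def]
    using Ck_continuous[OF CinfeD(1)[OF Lap_b_iter_Cinfe[OF assms]]] by (auto intro!: continuous_intros)
next
  case False
  then show ?thesis unfolding nabla_b_def[abs_def]
    using continuous_grad[OF CinfeD(1)[OF Lap_b_iter_Cinfe[OF assms], of 1]] by (auto intro!: continuous_intros)
qed

lemma nabla_b_support:
  assumes "U \<in> Cinfe"
  shows "{z. nabla_b b j U z \<noteq> 0} \<subseteq> closure {z. U z \<noteq> 0}"
proof -
  have L: "closure {z. Lap_b b V z \<noteq> 0} \<subseteq> closure {z. V z \<noteq> 0}" for V
    by (rule closure_minimal) (use Lap_b_support in auto)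
  have I: "closure {z. (Lap_b b ^^ i) U z \<noteq> 0} \<subseteq> closure {z. U z \<noteq> 0}" for i
    by (induction i) (use L in \<open>auto dest: subsetD\<close>)
  have G: "{z. grad V z \<noteq> 0} \<subseteq> closure {z. V z \<noteq> 0}" for V
    unfolding grad_def using partial_deriv_support[of _ V] by (auto intro!: sum.neutral)
  have I': "{z. (Lap_b b ^^ i) U z \<noteq> 0} \<subseteq> closure {z. U z \<noteq> 0}" for i
    using I[of i] closure_subset by (rule order_trans[rotated])
  show ?thesis
  proof (cases "even j")
    case True
    then show ?thesis using I'[of "j div 2"] by (simp add: nabla_b_def zero_prod_def)
  next
    case False
    then show ?thesis using order_trans[OF G I, of "(j - 1) div 2"] by (simp add: nabla_b_def zero_prod_def)
  qed
qed

subsection \<open>The Fourier transform of integrable functions\<close>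

lemma norm_cis_mult [simp]: "norm (cis t * z) = norm z"
  by (simp add: norm_mult)

lemma borel_measurable_cnj [measurable (raw)]:
  "f \<in> borel_measurable M \<Longrightarrow> (\<lambda>x. cnj (f x)) \<in> borel_measurable M"
  by (rule measurable_compose[where g=cnj]) (auto intro!: borel_measurable_continuous_onI continuous_intros)

lemma lebesgue_integral_cnj:
  assumes "integrable M f"
  shows "(LINT x|M. cnj (f x)) = cnj (LINT x|M. f x)"
  by (rule integral_bounded_linear[OF bounded_linear_cnj assms])

lemma integrable_cis_mult:
  assumes "integrable M f" "g \<in> borel_measurable M"
  shows "integrable M (\<lambda>x. cis (g x) * f x)"
  by (rule Bochner_Integration.integrable_bound[OF assms(1)])
     (use assms in \<open>auto intro!: AE_I2 borel_measurable_times borel_measurable_cis\<close>)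

lemma integrable_fourier_kernel:
  assumes "integrable lborel (f :: 'a::euclidean_space \<Rightarrow> complex)"
  shows "integrable lborel (\<lambda>x. cis (- (\<xi> \<bullet> x)) * f x)"
  by (rule integrable_cis_mult[OF assms]) simp

lemma borel_measurable_fourier [measurable]:
  assumes [measurable]: "f \<in> borel_measurable (borel :: 'a::euclidean_space measure)"
  shows "fourier f \<in> borel_measurable borel"
  unfolding fourier_def[abs_def] by measurable

definition fconst :: "'a::euclidean_space itself \<Rightarrow> real" where
  "fconst _ = (2 * pi) powr (- real DIM('a) / 2)"

lemma fconst_pos [simp]: "fconst TYPE('a::euclidean_space) > 0"
  by (simp add: fconst_def)

lemma fourier_eq: "fourier f \<xi> = of_real (fconst TYPE('a)) * (LINT x|lborel. cis (- (\<xi> \<bullet> x)) * f x)"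
  for f :: "'a::euclidean_space \<Rightarrow> complex"
  by (simp add: fourier_def fconst_def)

lemma fconst_sq: "(fconst TYPE('a::euclidean_space))\<^sup>2 = 1 / (2 * pi) ^ DIM('a)"
proof -
  have "(fconst TYPE('a))\<^sup>2 = (2 * pi) powr (- real DIM('a))"
    unfolding fconst_def power2_eq_square by (simp flip: powr_add)
  then show ?thesis by (simp add: powr_minus powr_realpow divide_inverse)
qed

lemma norm_fourier_le:
  fixes f :: "'a::euclidean_space \<Rightarrow> complex"
  shows "norm (fourier f \<xi>) \<le> fconst TYPE('a) * (LINT x|lborel. norm (f x))"
proof -
  have "norm (LINT x|lborel. cis (- (\<xi> \<bullet> x)) * f x) \<le> (LINT x|lborel. norm (cis (- (\<xi> \<bullet> x)) * f x))"
    by (rule integral_norm_bound)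
  then show ?thesis unfolding fourier_eq by (simp add: norm_mult less_imp_le)
qed

lemma fourier_lin:
  assumes "integrable lborel f" "integrable lborel g"
  shows "fourier (\<lambda>x. c * f x + d * g x) \<xi> = c * fourier f \<xi> + d * fourier g \<xi>"
proof -
  have "(LINT x|lborel. cis (- (\<xi> \<bullet> x)) * (c * f x + d * g x)) =
     (LINT x|lborel. c * (cis (- (\<xi> \<bullet> x)) * f x) + d * (cis (- (\<xi> \<bullet> x)) * g x))"
    by (intro Bochner_Integration.integral_cong) (auto simp: algebra_simps)
  also have "\<dots> = c * (LINT x|lborel. cis (- (\<xi> \<bullet> x)) * f x) + d * (LINT x|lborel. cis (- (\<xi> \<bullet> x)) * g x)"
    using integrable_fourier_kernel[OF assms(1), of \<xi>] integrable_fourier_kernel[OF assms(2), of \<xi>]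
    by (subst Bochner_Integration.integral_add) auto
  finally show ?thesis by (simp add: fourier_eq algebra_simps)
qed

text \<open>Fubini for the kernel cis (- (x \<bullet> y)), which is symmetric in its two
  arguments.\<close>

lemma fourier_multiplication:
  fixes f g :: "'a::euclidean_space \<Rightarrow> complex"
  assumes f: "integrable lborel f" and g: "integrable lborel g"
  shows "(LINT x|lborel. f x * fourier g x) = (LINT x|lborel. fourier f x * g x)"
proof -
  note [measurable] = borel_measurable_integrable[OF f] borel_measurable_integrable[OF g]
  have I: "integrable (lborel \<Otimes>\<^sub>M lborel) (\<lambda>(x, y). cis (- (x \<bullet> y)) * (f x * g y))"
    by (rule Bochner_Integration.integrable_bound[OF integrable_lborel_pair[OF f g]])
       (auto simp: case_prod_beta)
  have "(LINT x|lborel. f x * fourier g x) =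
     (LINT x|lborel. of_real (fconst TYPE('a)) * (LINT y|lborel. cis (- (x \<bullet> y)) * (f x * g y)))"
    unfolding fourier_eq integral_mult_right_zero[symmetric]
    by (intro Bochner_Integration.integral_cong refl) (simp only: mult_ac)
  also have "\<dots> = of_real (fconst TYPE('a)) * (LINT y|lborel. LINT x|lborel. cis (- (x \<bullet> y)) * (f x * g y))"
    using lborel_pair.Fubini_integral[OF I] by simp
  also have "\<dots> = (LINT x|lborel. fourier f x * g x)"
    unfolding fourier_eq integral_mult_right_zero[symmetric] integral_mult_left_zero[symmetric]
    by (intro Bochner_Integration.integral_cong refl) (simp only: mult_ac inner_commute)
  finally show ?thesis .
qed

text \<open>The width is parametrized by its dual: as m grows, the function tends to a pure phase
  while its transform concentrates at \<open>a\<close>. This is how cutoffs in frequency are removed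
  later.\<close>

lemma fourier_gaussian:
  fixes a :: "'a::euclidean_space"
  assumes m: "m > 0"
  shows "integrable lborel (\<lambda>\<xi>. cis (\<xi> \<bullet> a) * of_real (exp (- (norm \<xi>)\<^sup>2 / (4 * m\<^sup>2))))"
    "fourier (\<lambda>\<xi>. cis (\<xi> \<bullet> a) * of_real (exp (- (norm \<xi>)\<^sup>2 / (4 * m\<^sup>2)))) y =
       of_real (fconst TYPE('a) * (2 * m * sqrt pi) ^ DIM('a) * exp (- m\<^sup>2 * (norm (y - a))\<^sup>2))"
proof -
  let ?t = "1 / (4 * m\<^sup>2)"
  have t: "?t > 0" using m by simp
  have e: "cis (- (y \<bullet> x)) * (cis (x \<bullet> a) * of_real (exp (- (norm x)\<^sup>2 / (4 * m\<^sup>2)))) =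
     of_real (exp (- ?t * (norm x)\<^sup>2)) * cis (- ((y - a) \<bullet> x))" for x y
    by (simp add: cis_mult mult.assoc[symmetric] inner_diff_left inner_commute algebra_simps)
  have s: "sqrt (pi / ?t) = 2 * m * sqrt pi"
    using m by (simp add: real_sqrt_mult field_simps)
  have e0: "cis (x \<bullet> a) * of_real (exp (- (norm x)\<^sup>2 / (4 * m\<^sup>2))) =
      of_real (exp (- ?t * (norm x)\<^sup>2)) * cis (- ((- a) \<bullet> x))" for x :: 'a
    by (simp add: inner_commute)
  show "integrable lborel (\<lambda>\<xi>. cis (\<xi> \<bullet> a) * of_real (exp (- (norm \<xi>)\<^sup>2 / (4 * m\<^sup>2))))"
    unfolding e0 by (rule gaussian_fourier(1)[OF t])
  show "fourier (\<lambda>\<xi>. cis (\<xi> \<bullet> a) * of_real (exp (- (norm \<xi>)\<^sup>2 / (4 * m\<^sup>2)))) y =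
       of_real (fconst TYPE('a) * (2 * m * sqrt pi) ^ DIM('a) * exp (- m\<^sup>2 * (norm (y - a))\<^sup>2))"
    unfolding fourier_eq e gaussian_fourier(2)[OF t] s using m by simp
qed

text \<open>The heat kernel at time 1 / (4 m^2), normalized to total mass one.\<close>

definition heat :: "real \<Rightarrow> 'a::euclidean_space \<Rightarrow> real" where
  "heat m x = (m / sqrt pi) ^ DIM('a) * exp (- m\<^sup>2 * (norm x)\<^sup>2)"

lemma heat_eq:
  "m > 0 \<Longrightarrow> heat m (x :: 'a::euclidean_space) = (fconst TYPE('a))\<^sup>2 * (2 * m * sqrt pi) ^ DIM('a) * exp (- m\<^sup>2 * (norm x)\<^sup>2)"
proof -
  have "1 / (2 * pi) * (2 * m * sqrt pi) = m / sqrt pi"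
    by (simp add: field_simps)
  then have "(m / sqrt pi) ^ DIM('a) = 1 / (2 * pi) ^ DIM('a) * (2 * m * sqrt pi) ^ DIM('a)"
    by (metis power_mult_distrib power_one_over)
  then show ?thesis by (simp add: heat_def fconst_sq)
qed

lemma heat_nonneg [simp]: "m > 0 \<Longrightarrow> heat m x \<ge> 0"
  by (simp add: heat_def)

lemma borel_measurable_heat [measurable]: "heat m \<in> borel_measurable (borel :: 'a::euclidean_space measure)"
  unfolding heat_def[abs_def] by measurable

lemma heat_integral:
  assumes m: "m > 0"
  shows "integrable lborel (\<lambda>y. heat m (y - x))" "(LINT y|lborel. heat m (y - x)) = 1"
    "integrable lborel (\<lambda>y. heat m (x - y))" "(LINT y|lborel. heat m (x - y)) = 1"
proof -
  have m2: "m\<^sup>2 > 0" using m by simp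
  have i: "integrable lborel (heat m :: 'a \<Rightarrow> real)"
    unfolding heat_def[abs_def] using gaussian_integral(1)[OF m2, where 'a='a] by simp
  have s: "sqrt (pi / m\<^sup>2) = sqrt pi / m" using m by (simp add: real_sqrt_divide)
  have v: "(LINT y|lborel. heat m (y::'a)) = 1"
    unfolding heat_def[abs_def] using gaussian_integral(2)[OF m2, where 'a='a] m
    by (simp add: s flip: power_mult_distrib)
  show "integrable lborel (\<lambda>y. heat m (y - x))" 
    using lborel_integral_affine(2)[of 1 "heat m" "- x"] i by simp
  show "(LINT y|lborel. heat m (y - x)) = 1"
    using lborel_integral_affine(1)[of 1 "heat m" "- x"] v by simp
  show "integrable lborel (\<lambda>y. heat m (x - y))"
    using lborel_integral_affine(2)[of "- 1" "heat m" "x"] i by simp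
  show "(LINT y|lborel. heat m (x - y)) = 1"
    using lborel_integral_affine(1)[of "- 1" "heat m" "x"] v by simp
qed

text \<open>A Gaussian cutoff in frequency is an average against the heat kernel in space: the
  multiplication formula moves the transform from f to the explicit Gaussian, so f itself only has
  to be integrable.\<close>

lemma fourier_cutoff:
  fixes f :: "'a::euclidean_space \<Rightarrow> complex"
  assumes f: "integrable lborel f" and m: "m > 0"
  shows "of_real (fconst TYPE('a)) * (LINT \<xi>|lborel. fourier f \<xi> * (cis (\<xi> \<bullet> x) * of_real (exp (- (norm \<xi>)\<^sup>2 / (4 * m\<^sup>2))))) =
     (LINT y|lborel. f y * of_real (heat m (y - x)))"
proof -
  have "(LINT \<xi>|lborel. fourier f \<xi> * (cis (\<xi> \<bullet> x) * of_real (exp (- (norm \<xi>)\<^sup>2 / (4 * m\<^sup>2))))) =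
     (LINT y|lborel. f y * of_real (fconst TYPE('a) * (2 * m * sqrt pi) ^ DIM('a) * exp (- m\<^sup>2 * (norm (y - x))\<^sup>2)))"
    by (subst fourier_multiplication[OF f fourier_gaussian(1)[OF m], symmetric]) (simp only: fourier_gaussian(2)[OF m])
  moreover have "of_real (fconst TYPE('a)) * (f y * of_real (fconst TYPE('a) * (2 * m * sqrt pi) ^ DIM('a) * exp (- m\<^sup>2 * (norm (y - x))\<^sup>2)))
     = f y * of_real (heat m (y - x))" for y
    unfolding heat_eq[OF m] by (simp add: power2_eq_square mult_ac)
  ultimately show ?thesis by (simp only: integral_mult_right_zero[symmetric])
qed

text \<open>Both sides of \<open>fourier_cutoff\<close> converge as the cutoff is removed: the
  frequency side is dominated by \<open>fourier f\<close>, and the space side is an average of the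
  bounded continuous f at scale 1 / (m + 1).\<close>

lemma fourier_inversion:
  fixes f :: "'a::euclidean_space \<Rightarrow> complex"
  assumes f: "integrable lborel f" and F: "integrable lborel (fourier f)"
    and c: "continuous_on UNIV f" and b: "\<And>x. norm (f x) \<le> B"
  shows "of_real (fconst TYPE('a)) * (LINT \<xi>|lborel. cis (\<xi> \<bullet> x) * fourier f \<xi>) = f x"
proof -
  note [measurable] = borel_measurable_integrable[OF f]
  let ?I = "\<lambda>m. of_real (fconst TYPE('a)) * (LINT \<xi>|lborel. fourier f \<xi> * (cis (\<xi> \<bullet> x) * of_real (exp (- (norm \<xi>)\<^sup>2 / (4 * (real (Suc m))\<^sup>2)))))"
  have minf: "(\<lambda>m. 1 / real (Suc m)) \<longlonglongrightarrow> 0" by (rule LIMSEQ_Suc[OF lim_1_over_n])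
  have "(\<lambda>m. LINT \<xi>|lborel. fourier f \<xi> * (cis (\<xi> \<bullet> x) * of_real (exp (- (norm \<xi>)\<^sup>2 / (4 * (real (Suc m))\<^sup>2)))))
     \<longlonglongrightarrow> (LINT \<xi>|lborel. cis (\<xi> \<bullet> x) * fourier f \<xi>)"
  proof (rule integral_dominated_convergence[where w="\<lambda>\<xi>. norm (fourier f \<xi>)"])
    show "AE \<xi> in lborel. (\<lambda>m. fourier f \<xi> * (cis (\<xi> \<bullet> x) * of_real (exp (- (norm \<xi>)\<^sup>2 / (4 * (real (Suc m))\<^sup>2)))))
       \<longlonglongrightarrow> cis (\<xi> \<bullet> x) * fourier f \<xi>"
    proof (rule AE_I2)
      fix \<xi> :: 'a
      have "(\<lambda>m. fourier f \<xi> * (cis (\<xi> \<bullet> x) * of_real (exp (- ((norm \<xi>)\<^sup>2 / 4 * (1 / real (Suc m))\<^sup>2)))))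
        \<longlonglongrightarrow> fourier f \<xi> * (cis (\<xi> \<bullet> x) * of_real (exp (- ((norm \<xi>)\<^sup>2 / 4 * 0\<^sup>2))))"
        by (intro tendsto_intros minf)
      then show "(\<lambda>m. fourier f \<xi> * (cis (\<xi> \<bullet> x) * of_real (exp (- (norm \<xi>)\<^sup>2 / (4 * (real (Suc m))\<^sup>2)))))
       \<longlonglongrightarrow> cis (\<xi> \<bullet> x) * fourier f \<xi>"
        by (simp add: power_divide mult.commute)
    qed
    show "AE \<xi> in lborel. norm (fourier f \<xi> * (cis (\<xi> \<bullet> x) * of_real (exp (- (norm \<xi>)\<^sup>2 / (4 * (real (Suc m))\<^sup>2))))) \<le> norm (fourier f \<xi>)" for m
      by (intro AE_I2) (auto simp: norm_mult intro!: mult_left_le)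
  qed (use F in auto)
  then have 1: "?I \<longlonglongrightarrow> of_real (fconst TYPE('a)) * (LINT \<xi>|lborel. cis (\<xi> \<bullet> x) * fourier f \<xi>)"
    by (intro tendsto_mult_left)
  have e: "?I m = (LINT z|lborel. f (x + (1 / real (Suc m)) *\<^sub>R z) * of_real (heat 1 z))" for m
  proof -
    let ?c = "1 / real (Suc m)"
    have "?I m = (LINT y|lborel. f y * of_real (heat (real (Suc m)) (y - x)))"
      by (rule fourier_cutoff[OF f]) simp
    also have "\<dots> = \<bar>?c\<bar> ^ DIM('a) *\<^sub>R (LINT z|lborel. f (x + ?c *\<^sub>R z) * of_real (heat (real (Suc m)) ((x + ?c *\<^sub>R z) - x)))"
      by (rule lborel_integral_affine) auto
    also have "\<dots> = (LINT z|lborel. f (x + ?c *\<^sub>R z) * of_real (heat 1 z))"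
    proof -
      have "heat (real (Suc m)) ((x + ?c *\<^sub>R z) - x) = real (Suc m) ^ DIM('a) * heat 1 z" for z
        by (simp add: heat_def power_mult_distrib power_divide del: of_nat_Suc)
      then have "f (x + ?c *\<^sub>R z) * of_real (heat (real (Suc m)) ((x + ?c *\<^sub>R z) - x)) =
         of_real (real (Suc m) ^ DIM('a)) * (f (x + ?c *\<^sub>R z) * of_real (heat 1 z))" for z
        by (simp add: mult_ac)
      then show ?thesis
        by (simp only: integral_mult_right_zero) (simp add: scaleR_conv_of_real power_divide del: of_nat_Suc)
    qed
    finally show ?thesis .
  qed
  have h1: "integrable lborel (heat 1 :: 'a \<Rightarrow> real)" "(LINT z|lborel. heat 1 (z::'a)) = 1"
    using heat_integral[of 1 "0::'a"] by auto
  have "(\<lambda>m. LINT z|lborel. f (x + (1 / real (Suc m)) *\<^sub>R z) * of_real (heat 1 z)) \<longlonglongrightarrow> (LINT z|lborel. f x * of_real (heat 1 (z::'a)))"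
  proof (rule integral_dominated_convergence[where w="\<lambda>z. B * heat 1 z"])
    have "(\<lambda>m. f (x + (1 / real (Suc m)) *\<^sub>R z)) \<longlonglongrightarrow> f x" for z
    proof -
      have "isCont f x" using c by (simp add: continuous_on_eq_continuous_at)
      moreover have "(\<lambda>m. x + (1 / real (Suc m)) *\<^sub>R z) \<longlonglongrightarrow> x + 0 *\<^sub>R z"
        by (intro tendsto_intros minf)
      ultimately show ?thesis by (intro isCont_tendsto_compose[of x f]) auto
    qed
    then show "AE z in lborel. (\<lambda>m. f (x + (1 / real (Suc m)) *\<^sub>R z) * of_real (heat 1 z)) \<longlonglongrightarrow> f x * of_real (heat 1 z)"
      by (intro AE_I2 tendsto_mult_right)
    show "AE z in lborel. norm (f (x + (1 / real (Suc m)) *\<^sub>R z) * of_real (heat 1 z)) \<le> B * heat 1 z" for m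
      by (intro AE_I2) (auto simp: norm_mult intro!: mult_right_mono b)
  qed (use h1 in auto)
  then have 2: "?I \<longlonglongrightarrow> f x" unfolding e using h1 by (simp add: integral_complex_of_real)
  show ?thesis by (rule LIMSEQ_unique[OF 1 2])
qed

lemma ennreal_mult3:
  assumes "0 \<le> a" "0 \<le> b" "0 \<le> c"
  shows "ennreal (a * (b * c)) = ennreal a * ennreal b * ennreal c"
  using assms by (simp only: ennreal_mult mult_nonneg_nonneg mult.assoc)

text \<open>Let \<open>g\<close> be the conjugate of the cut-off \<open>fourier f\<close>. The
  multiplication formula turns the left side into the pairing of f with \<open>fourier g\<close>,
  which is the conjugate of f averaged by the heat kernel. Schur's test finishes, since the kernel
  has mass one in each variable.\<close>

lemma bessel_cutoff:
  fixes f :: "'a::euclidean_space \<Rightarrow> complex"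
  assumes f: "integrable lborel f" and m: "m > 0"
  shows "(\<integral>\<^sup>+\<xi>. ennreal ((norm (fourier f \<xi>))\<^sup>2 * exp (- (norm \<xi>)\<^sup>2 / (4 * m\<^sup>2))) \<partial>lborel)
    \<le> (\<integral>\<^sup>+x. ennreal ((norm (f x))\<^sup>2) \<partial>lborel)"
proof -
  note [measurable] = borel_measurable_integrable[OF f]
  let ?e = "\<lambda>\<xi>::'a. exp (- (norm \<xi>)\<^sup>2 / (4 * m\<^sup>2))"
  have ei: "integrable lborel ?e"
    using gaussian_integral(1)[of "1 / (4 * m\<^sup>2)", where 'a='a] m by simp
  define C where "C = fconst TYPE('a) * (LINT x|lborel. norm (f x))"
  have fb: "norm (fourier f \<xi>) \<le> C" for \<xi> unfolding C_def by (rule norm_fourier_le)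
  define g where "g \<xi> = cnj (fourier f \<xi>) * of_real (?e \<xi>)" for \<xi>
  have [measurable]: "g \<in> borel_measurable borel"
    unfolding g_def[abs_def] by measurable
  have gi: "integrable lborel g"
    by (rule Bochner_Integration.integrable_bound[OF integrable_mult_right[OF ei, of C]])
       (auto simp: g_def norm_mult abs_mult intro!: AE_I2 mult_right_mono order_trans[OF fb])
  have e: "fourier f \<xi> * g \<xi> = of_real ((norm (fourier f \<xi>))\<^sup>2 * ?e \<xi>)" for \<xi>
    unfolding g_def of_real_mult complex_norm_square by (simp only: mult.assoc)
  have hint: "integrable lborel (\<lambda>y. f y * of_real (heat m (y - x)))" for x
  proof (rule Bochner_Integration.integrable_bound[OF integrable_mult_right[OF f, of "of_real ((m / sqrt pi) ^ DIM('a))"]])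
    show "AE y in lborel. norm (f y * of_real (heat m (y - x))) \<le> norm (of_real ((m / sqrt pi) ^ DIM('a)) * f y)"
      using m by (intro AE_I2) (auto simp: norm_mult heat_def abs_mult mult.commute[of "norm (f _)"]
         mult.assoc norm_power norm_divide intro!: mult_left_mono mult_left_le_one_le)
  qed simp
  have gf: "fourier g x = (LINT y|lborel. cnj (f y) * of_real (heat m (y - x)))" for x
  proof -
    have "cnj (fourier g x) = of_real (fconst TYPE('a)) * (LINT \<xi>|lborel. cnj (cis (- (x \<bullet> \<xi>)) * g \<xi>))"
      by (subst lebesgue_integral_cnj[OF integrable_fourier_kernel[OF gi]]) (simp add: fourier_eq)
    also have "(LINT \<xi>|lborel. cnj (cis (- (x \<bullet> \<xi>)) * g \<xi>)) = (LINT \<xi>|lborel. fourier f \<xi> * (cis (\<xi> \<bullet> x) * of_real (?e \<xi>)))"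
      by (intro Bochner_Integration.integral_cong refl) (simp add: g_def cis_cnj inner_commute mult_ac)
    also have "of_real (fconst TYPE('a)) * \<dots> = (LINT y|lborel. f y * of_real (heat m (y - x)))"
      by (rule fourier_cutoff[OF f m])
    finally have "fourier g x = cnj \<dots>" by (metis complex_cnj_cnj)
    also have "\<dots> = (LINT y|lborel. cnj (f y * of_real (heat m (y - x))))"
      by (rule lebesgue_integral_cnj[symmetric, OF hint])
    finally show ?thesis by simp
  qed
  let ?h = "\<lambda>\<xi>. (norm (fourier f \<xi>))\<^sup>2 * ?e \<xi>"
  have hi: "integrable lborel ?h"
    by (rule Bochner_Integration.integrable_bound[OF integrable_mult_right[OF ei, of "C\<^sup>2"]])
       (auto simp: abs_mult intro!: AE_I2 mult_right_mono power_mono fb)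
  have "(\<integral>\<^sup>+\<xi>. ennreal (?h \<xi>) \<partial>lborel) = ennreal (LINT \<xi>|lborel. ?h \<xi>)"
    by (rule nn_integral_eq_integral[OF hi]) auto
  also have "(LINT \<xi>|lborel. ?h \<xi>) = norm (LINT \<xi>|lborel. fourier f \<xi> * g \<xi>)"
    unfolding e integral_complex_of_real norm_of_real by (simp add: integral_nonneg_AE)
  also have "(LINT \<xi>|lborel. fourier f \<xi> * g \<xi>) = (LINT x|lborel. f x * fourier g x)"
    by (rule fourier_multiplication[OF f gi, symmetric])
  also have "ennreal (norm (LINT x|lborel. f x * fourier g x)) \<le> (\<integral>\<^sup>+x. ennreal (norm (f x * fourier g x)) \<partial>lborel)"
    by (rule integral_norm_bound_ennreal[OF Bochner_Integration.integrable_bound[OF integrable_mult_right[OF f, of "fconst TYPE('a) * (LINT x|lborel. norm (g x))"]]])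
       (auto simp: norm_mult mult.commute[of "norm (f _)"] abs_of_nonneg less_imp_le integral_nonneg_AE
         intro!: AE_I2 mult_right_mono norm_fourier_le)
  \<comment> \<open>Schur's test: |f(x)| |f(y)| is at most half the sum of the squares, and in each
    half the free variable integrates the kernel to one.\<close>
  also have "\<dots> \<le> (\<integral>\<^sup>+x. \<integral>\<^sup>+y. ennreal (1/2 * ((norm (f x))\<^sup>2 * heat m (y - x)) + 1/2 * ((norm (f y))\<^sup>2 * heat m (y - x))) \<partial>lborel \<partial>lborel)"
  proof (rule nn_integral_mono)
    fix x :: 'a
    have b: "norm (fourier g x) \<le> (\<integral>\<^sup>+y. ennreal (norm (f y) * heat m (y - x)) \<partial>lborel)"
    proof -
      have "integrable lborel (\<lambda>y. cnj (f y) * of_real (heat m (y - x)))"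
        using integrable_bounded_linear[OF bounded_linear_cnj hint[of x]] by simp
      from integral_norm_bound_ennreal[OF this] show ?thesis
        using m by (simp add: gf norm_mult)
    qed
    have "ennreal (norm (f x * fourier g x)) = ennreal (norm (f x)) * ennreal (norm (fourier g x))"
      by (simp add: norm_mult ennreal_mult)
    also have "\<dots> \<le> ennreal (norm (f x)) * (\<integral>\<^sup>+y. ennreal (norm (f y) * heat m (y - x)) \<partial>lborel)"
      by (intro mult_left_mono b) auto
    also have "\<dots> = (\<integral>\<^sup>+y. ennreal (norm (f x) * (norm (f y) * heat m (y - x))) \<partial>lborel)"
      using m by (subst nn_integral_cmult[symmetric]) (auto simp: ennreal_mult)
    also have "\<dots> \<le> (\<integral>\<^sup>+y. ennreal (1/2 * ((norm (f x))\<^sup>2 * heat m (y - x)) + 1/2 * ((norm (f y))\<^sup>2 * heat m (y - x))) \<partial>lborel)"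
    proof (intro nn_integral_mono ennreal_leI)
      fix y
      have "norm (f x) * norm (f y) \<le> 1/2 * (norm (f x))\<^sup>2 + 1/2 * (norm (f y))\<^sup>2"
        using sum_squares_bound[of "norm (f x)" "norm (f y)"] by simp
      from mult_right_mono[OF this heat_nonneg[OF m, of "y - x"]]
      show "norm (f x) * (norm (f y) * heat m (y - x)) \<le> 1/2 * ((norm (f x))\<^sup>2 * heat m (y - x)) + 1/2 * ((norm (f y))\<^sup>2 * heat m (y - x))"
        by (simp only: distrib_right mult.assoc)
    qed
    finally show "ennreal (norm (f x * fourier g x)) \<le> \<dots>" .
  qed
  also have "\<dots> = (\<integral>\<^sup>+x. \<integral>\<^sup>+y. ennreal (1/2 * ((norm (f x))\<^sup>2 * heat m (y - x))) \<partial>lborel \<partial>lborel)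
     + (\<integral>\<^sup>+x. \<integral>\<^sup>+y. ennreal (1/2 * ((norm (f y))\<^sup>2 * heat m (y - x))) \<partial>lborel \<partial>lborel)"
    using m by (simp add: nn_integral_add ennreal_plus[symmetric] del: ennreal_plus flip: nn_integral_add)
  also have "(\<integral>\<^sup>+x. \<integral>\<^sup>+y. ennreal (1/2 * ((norm (f y))\<^sup>2 * heat m (y - x))) \<partial>lborel \<partial>lborel) =
     (\<integral>\<^sup>+y. \<integral>\<^sup>+x. ennreal (1/2 * ((norm (f y))\<^sup>2 * heat m (y - x))) \<partial>lborel \<partial>lborel)"
    by (rule lborel_pair.Fubini') measurable
  also have "(\<integral>\<^sup>+x. \<integral>\<^sup>+y. ennreal (1/2 * ((norm (f x))\<^sup>2 * heat m (y - x))) \<partial>lborel \<partial>lborel) =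
     (\<integral>\<^sup>+x. ennreal (1/2) * ennreal ((norm (f x))\<^sup>2) \<partial>lborel)"
  proof (rule nn_integral_cong)
    fix x
    have "(\<integral>\<^sup>+y. ennreal (1/2 * ((norm (f x))\<^sup>2 * heat m (y - x))) \<partial>lborel) =
       (\<integral>\<^sup>+y. (ennreal (1/2) * ennreal ((norm (f x))\<^sup>2)) * ennreal (heat m (y - x)) \<partial>lborel)"
      using m by (intro nn_integral_cong ennreal_mult3) auto
    also have "\<dots> = (ennreal (1/2) * ennreal ((norm (f x))\<^sup>2)) * ennreal 1"
      using nn_integral_eq_integral[OF heat_integral(1)[OF m, of x]] heat_integral(2)[OF m, of x] m
      by (subst nn_integral_cmult) auto
    finally show "(\<integral>\<^sup>+y. ennreal (1/2 * ((norm (f x))\<^sup>2 * heat m (y - x))) \<partial>lborel) = ennreal (1/2) * ennreal ((norm (f x))\<^sup>2)"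
      by simp
  qed
  also have "(\<integral>\<^sup>+y. \<integral>\<^sup>+x. ennreal (1/2 * ((norm (f y))\<^sup>2 * heat m (y - x))) \<partial>lborel \<partial>lborel) =
     (\<integral>\<^sup>+y. ennreal (1/2) * ennreal ((norm (f y))\<^sup>2) \<partial>lborel)"
  proof (rule nn_integral_cong)
    fix y
    have "(\<integral>\<^sup>+x. ennreal (1/2 * ((norm (f y))\<^sup>2 * heat m (y - x))) \<partial>lborel) =
       (\<integral>\<^sup>+x. (ennreal (1/2) * ennreal ((norm (f y))\<^sup>2)) * ennreal (heat m (y - x)) \<partial>lborel)"
      using m by (intro nn_integral_cong ennreal_mult3) auto
    also have "\<dots> = (ennreal (1/2) * ennreal ((norm (f y))\<^sup>2)) * ennreal 1"
      using nn_integral_eq_integral[OF heat_integral(3)[OF m, of y]] heat_integral(4)[OF m, of y] m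
      by (subst nn_integral_cmult) auto
    finally show "(\<integral>\<^sup>+x. ennreal (1/2 * ((norm (f y))\<^sup>2 * heat m (y - x))) \<partial>lborel) = ennreal (1/2) * ennreal ((norm (f y))\<^sup>2)"
      by simp
  qed
  also have "(\<integral>\<^sup>+x. ennreal (1/2) * ennreal ((norm (f x))\<^sup>2) \<partial>lborel) + (\<integral>\<^sup>+x. ennreal (1/2) * ennreal ((norm (f x))\<^sup>2) \<partial>lborel)
     = (\<integral>\<^sup>+x. ennreal ((norm (f x))\<^sup>2) \<partial>lborel)"
  proof (subst nn_integral_add[symmetric]; (measurable)?)
    have "ennreal (1/2) * ennreal a + ennreal (1/2) * ennreal a = ennreal a" if "a \<ge> 0" for a
      using that by (subst (1 2) ennreal_mult[symmetric]) (auto simp: ennreal_plus[symmetric] simp del: ennreal_plus)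
    then show "(\<integral>\<^sup>+x. ennreal (1/2) * ennreal ((norm (f x))\<^sup>2) + ennreal (1/2) * ennreal ((norm (f x))\<^sup>2) \<partial>lborel)
     = (\<integral>\<^sup>+x. ennreal ((norm (f x))\<^sup>2) \<partial>lborel)"
      by (intro nn_integral_cong) simp
  qed
  finally show ?thesis .
qed

text \<open>Fatou's lemma removes the cutoff: the cut-off integrands converge pointwise and the
  bound is uniform in m.\<close>

lemma bessel:
  fixes f :: "'a::euclidean_space \<Rightarrow> complex"
  assumes f: "integrable lborel f"
  shows "(\<integral>\<^sup>+\<xi>. ennreal ((norm (fourier f \<xi>))\<^sup>2) \<partial>lborel) \<le> (\<integral>\<^sup>+x. ennreal ((norm (f x))\<^sup>2) \<partial>lborel)"
proof -
  note [measurable] = borel_measurable_integrable[OF f]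
  let ?e = "\<lambda>m \<xi>. (norm (fourier f \<xi>))\<^sup>2 * exp (- (norm \<xi>)\<^sup>2 / (4 * (real (Suc m))\<^sup>2))"
  have lim: "(\<lambda>m. ?e m \<xi>) \<longlonglongrightarrow> (norm (fourier f \<xi>))\<^sup>2" for \<xi>
  proof -
    have "(\<lambda>m. (norm (fourier f \<xi>))\<^sup>2 * exp (- ((norm \<xi>)\<^sup>2 / 4 * (1 / real (Suc m))\<^sup>2))) \<longlonglongrightarrow>
      (norm (fourier f \<xi>))\<^sup>2 * exp (- ((norm \<xi>)\<^sup>2 / 4 * 0\<^sup>2))"
      by (intro tendsto_intros LIMSEQ_Suc[OF lim_1_over_n])
    then show ?thesis by (simp add: power_divide)
  qed
  have "(\<integral>\<^sup>+\<xi>. ennreal ((norm (fourier f \<xi>))\<^sup>2) \<partial>lborel) = (\<integral>\<^sup>+\<xi>. liminf (\<lambda>m. ennreal (?e m \<xi>)) \<partial>lborel)"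
    by (intro nn_integral_cong lim_imp_Liminf[symmetric] tendsto_ennrealI lim) simp
  also have "\<dots> \<le> liminf (\<lambda>m. \<integral>\<^sup>+\<xi>. ennreal (?e m \<xi>) \<partial>lborel)"
    by (rule nn_integral_liminf) measurable
  also have "\<dots> \<le> (\<integral>\<^sup>+x. ennreal ((norm (f x))\<^sup>2) \<partial>lborel)"
    by (subst Liminf_const[OF sequentially_bot, symmetric], rule Liminf_mono)
       (intro always_eventually allI bessel_cutoff[OF f], simp)
  finally show ?thesis .
qed

subsection \<open>Rapidly decaying functions\<close>

text \<open>Decay of every order without smoothness. Unlike \<open>schwartz\<close>, the class is
  stable under multiplication by \<open>norm \<xi> powr s\<close> with s > 0, which in general is
  not smooth at the origin.\<close>

definition rapid :: "('a::euclidean_space \<Rightarrow> complex) \<Rightarrow> bool" where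
  "rapid f \<longleftrightarrow> f \<in> borel_measurable borel \<and> (\<forall>N. \<exists>C. \<forall>x. norm (f x) * (1 + norm x) ^ N \<le> C)"

lemma rapid_measurable: "rapid f \<Longrightarrow> f \<in> borel_measurable borel"
  by (simp add: rapid_def)

lemma rapidE:
  assumes "rapid f"
  obtains C where "C \<ge> 0" "\<And>x. norm (f x) \<le> C * (1 / (1 + norm x) ^ N)"
proof -
  obtain C where C: "\<And>x. norm (f x) * (1 + norm x) ^ N \<le> C"
    using assms unfolding rapid_def by blast
  have "0 \<le> norm (f 0) * (1 + norm (0::'a)) ^ N" by simp
  with C[of 0] have "C \<ge> 0" by linarith
  moreover have "norm (f x) \<le> C * (1 / (1 + norm x) ^ N)" for x
    using C[of x] by (simp add: field_simps add_pos_nonneg)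
  ultimately show thesis by (rule that)
qed

lemma rapid_bounded:
  assumes "rapid f"
  obtains C where "\<And>x. norm (f x) \<le> C"
  using rapidE[OF assms, of 0] by (metis div_by_1 mult.right_neutral power_0)

lemma rapid_integrable:
  assumes "rapid f"
  shows "integrable lborel f"
proof -
  obtain C where C: "C \<ge> 0" "\<And>x. norm (f x) \<le> C * (1 / (1 + norm x) ^ (2 * DIM('a)))"
    using rapidE[OF assms] by blast
  show ?thesis
    by (rule Bochner_Integration.integrable_bound[OF integrable_mult_right[OF integrable_decay[of "2 * DIM('a)"], of C]])
       (use C rapid_measurable[OF assms] in \<open>auto intro!: AE_I2 simp: abs_of_nonneg\<close>)
qed

lemma norm_of_nonneg: "0 \<le> (x::real) \<Longrightarrow> norm x = x"
  by simp

lemma norm_ge_self: "(x::real) \<le> norm x"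
  by simp

text \<open>One factor of the square is bounded, the other supplies decay, and the condition on a
  makes the singularity of the power integrable. In applications the power is the dual of a weight,
  so that rapid functions can be paired with weighted limits.\<close>

lemma rapid_integrable_sq:
  fixes f :: "'a::euclidean_space \<Rightarrow> complex"
  assumes f: "rapid f" and a: "a > - real DIM('a)"
  shows "integrable lborel (\<lambda>x. norm x powr a * (norm (f x))\<^sup>2)"
proof -
  define N where "N = nat \<lceil>2 * DIM('a) + \<bar>a\<bar> + 1\<rceil>"
  have N: "real N \<ge> 2 * DIM('a) + \<bar>a\<bar> + 1" unfolding N_def by linarith
  obtain C where C: "C \<ge> 0" "\<And>x. norm (f x) \<le> C * (1 / (1 + norm x) ^ N)"
    using rapidE[OF f] by blast
  obtain B where B: "\<And>x. norm (f x) \<le> B" using rapid_bounded[OF f] by blast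
  have B0: "B \<ge> 0" using B[of 0] norm_ge_zero order_trans by blast
  show ?thesis
  proof (rule Bochner_Integration.integrable_bound[OF integrable_mult_right[OF integrable_norm_powr_decay[OF a N], of "B * C"]])
    show "(\<lambda>x. norm x powr a * (norm (f x))\<^sup>2) \<in> borel_measurable lborel"
      using rapid_measurable[OF f] by measurable
    have "norm x powr a * (norm (f x))\<^sup>2 \<le> B * C * (norm x powr a * (1 / (1 + norm x) ^ N))" for x
    proof -
      have "(norm (f x))\<^sup>2 \<le> B * (C * (1 / (1 + norm x) ^ N))"
        unfolding power2_eq_square by (intro mult_mono B C) (use B0 in auto)
      from mult_left_mono[OF this, of "norm x powr a"] show ?thesis by (simp add: mult_ac)
    qed
    then show "AE x in lborel. norm (norm x powr a * (norm (f x))\<^sup>2) \<le> norm (B * C * (norm x powr a * (1 / (1 + norm x) ^ N)))"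
      by (intro AE_I2 order_trans[OF eq_refl[OF norm_of_nonneg] order_trans[OF _ norm_ge_self]]) auto
  qed
qed

lemma rapid_compact:
  fixes f :: "'a::euclidean_space \<Rightarrow> complex"
  assumes c: "continuous_on UNIV f" and K: "compact (closure {x. f x \<noteq> 0})"
  shows "rapid f"
  unfolding rapid_def
proof (intro conjI allI)
  show "f \<in> borel_measurable borel" using c by (rule borel_measurable_continuous_onI)
  fix N
  have "continuous_on (closure {x. f x \<noteq> 0}) (\<lambda>x. norm (f x) * (1 + norm x) ^ N)"
    using continuous_on_subset[OF c] by (intro continuous_intros) auto
  from compact_imp_bounded[OF compact_continuous_image[OF this K]]
  obtain B where B: "\<And>x. x \<in> closure {x. f x \<noteq> 0} \<Longrightarrow> norm (norm (f x) * (1 + norm x) ^ N) \<le> B"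
    unfolding bounded_iff by auto
  have "norm (f x) * (1 + norm x) ^ N \<le> \<bar>B\<bar>" for x
    using B[of x] closure_subset[of "{x. f x \<noteq> 0}"] by (cases "f x = 0") (auto simp: abs_mult)
  then show "\<exists>C. \<forall>x. norm (f x) * (1 + norm x) ^ N \<le> C" by blast
qed

lemma rapid_cis_mult:
  assumes "rapid f" and g: "g \<in> borel_measurable borel"
  shows "rapid (\<lambda>x. cis (g x) * f x)"
  using assms unfolding rapid_def by (auto simp: norm_mult)

lemma rapid_lin:
  assumes f: "rapid f" and g: "rapid g"
  shows "rapid (\<lambda>x. c * f x + d * g x)"
  unfolding rapid_def
proof (intro conjI allI)
  show "(\<lambda>x. c * f x + d * g x) \<in> borel_measurable borel"
    using f[THEN rapid_measurable] g[THEN rapid_measurable] by measurable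
  fix N
  obtain C D where C: "\<And>x. norm (f x) * (1 + norm x) ^ N \<le> C" and D: "\<And>x. norm (g x) * (1 + norm x) ^ N \<le> D"
    using f g unfolding rapid_def by blast
  have "norm (c * f x + d * g x) * (1 + norm x) ^ N \<le> norm c * C + norm d * D" for x
  proof -
    have "norm (c * f x + d * g x) * (1 + norm x) ^ N \<le> (norm c * norm (f x) + norm d * norm (g x)) * (1 + norm x) ^ N"
      by (intro mult_right_mono) (auto intro: order_trans[OF norm_triangle_ineq] simp: norm_mult)
    also have "\<dots> = norm c * (norm (f x) * (1 + norm x) ^ N) + norm d * (norm (g x) * (1 + norm x) ^ N)"
      by (simp add: algebra_simps)
    also have "\<dots> \<le> norm c * C + norm d * D"
      by (intro add_mono mult_left_mono C D) auto
    finally show ?thesis .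
  qed
  then show "\<exists>C. \<forall>x. norm (c * f x + d * g x) * (1 + norm x) ^ N \<le> C" by blast
qed

lemma schwartz_Ck: "schwartz \<phi> \<Longrightarrow> Ck k \<phi>"
  by (simp add: schwartz_def)

lemma schwartz_bounded:
  assumes "schwartz \<phi>" "set es \<subseteq> Basis"
  shows "bounded (range (\<lambda>x. (1 + norm x) ^ N *\<^sub>R foldr partial_deriv es \<phi> x))"
  using assms unfolding schwartz_def by blast

lemma schwartz_rapid:
  assumes "schwartz \<phi>"
  shows "rapid \<phi>"
  unfolding rapid_def
proof (intro conjI allI)
  show "\<phi> \<in> borel_measurable borel"
    using schwartz_Ck[OF assms, of 0] by (simp add: borel_measurable_continuous_onI)
  fix N
  have "bounded (range (\<lambda>x. (1 + norm x) ^ N *\<^sub>R foldr partial_deriv [] \<phi> x))"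
    by (rule schwartz_bounded[OF assms]) simp
  then obtain B where "\<And>x. norm ((1 + norm x) ^ N *\<^sub>R \<phi> x) \<le> B"
    unfolding bounded_iff by auto
  then show "\<exists>C. \<forall>x. norm (\<phi> x) * (1 + norm x) ^ N \<le> C"
    by (auto simp: mult.commute)
qed

lemma schwartz_partial:
  assumes "schwartz \<phi>" "e \<in> Basis"
  shows "schwartz (partial_deriv e \<phi>)"
  unfolding schwartz_def
proof (intro conjI allI impI)
  show "Ck k (partial_deriv e \<phi>)" for k
    using Ck_SucD(2)[OF schwartz_Ck[OF assms(1)] assms(2)] .
  fix N and es :: "'a list" assume "set es \<subseteq> Basis"
  then have "set (es @ [e]) \<subseteq> Basis" using assms(2) by simp
  from schwartz_bounded[OF assms(1) this]
  have "bounded (range (\<lambda>x. (1 + norm x) ^ N *\<^sub>R foldr partial_deriv (es @ [e]) \<phi> x))" .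
  then show "bounded (range (\<lambda>x. (1 + norm x) ^ N *\<^sub>R foldr partial_deriv es (partial_deriv e \<phi>) x))"
    by simp
qed

subsection \<open>Integration by parts\<close>

lemma shift_le: "a \<le> c + 1 \<Longrightarrow> 0 \<le> c \<Longrightarrow> 1 + a \<le> 2 * (1 + c)" for a c :: real
  by simp

text \<open>By translation invariance the difference quotients have integral zero, and they converge
  to the derivative under a common integrable majorant.\<close>

lemma integral_partial_zero:
  fixes H :: "'a::euclidean_space \<Rightarrow> complex"
  assumes d: "\<And>x. H differentiable at x" and H: "integrable lborel H"
    and r: "rapid (partial_deriv e H)" and e: "e \<in> Basis"
  shows "(LINT x|lborel. partial_deriv e H x) = 0"
proof -
  note [measurable] = borel_measurable_integrable[OF H] rapid_measurable[OF r]
  let ?N = "2 * DIM('a)"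
  obtain C where C: "C \<ge> 0" "\<And>x. norm (partial_deriv e H x) \<le> C * (1 / (1 + norm x) ^ ?N)"
    using rapidE[OF r] by blast
  define q where "q m x = real (Suc m) *\<^sub>R (H (x + (1 / real (Suc m)) *\<^sub>R e) - H x)" for m x
  have ne: "norm e = 1" using e by simp
  have q0: "(LINT x|lborel. q m x) = 0" for m
  proof -
    have i: "integrable lborel (\<lambda>x. H (x + (1 / real (Suc m)) *\<^sub>R e))"
      using lborel_integral_affine(2)[of 1 H "(1 / real (Suc m)) *\<^sub>R e"] H by (simp add: add.commute)
    have "(LINT x|lborel. H (x + (1 / real (Suc m)) *\<^sub>R e)) = (LINT x|lborel. H x)"
      using lborel_integral_affine(1)[of 1 H "(1 / real (Suc m)) *\<^sub>R e"] by (simp add: add.commute)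
    then show ?thesis unfolding q_def using i H by simp
  qed
  have "(\<lambda>m. LINT x|lborel. q m x) \<longlonglongrightarrow> (LINT x|lborel. partial_deriv e H x)"
  \<comment> \<open>The majorant comes from the mean value inequality on a segment of length at most
    1: moving along it changes 1 + norm by at most the factor 2, hence
    \<open>2 ^ ?N\<close>.\<close>
  proof (rule integral_dominated_convergence[where w="\<lambda>x. C * 2 ^ ?N * (1 / (1 + norm x) ^ ?N)"])
    show "integrable lborel (\<lambda>x::'a. C * 2 ^ ?N * (1 / (1 + norm x) ^ ?N))"
      by (intro integrable_mult_right integrable_decay) simp
    show "q m \<in> borel_measurable lborel" for m
      unfolding q_def[abs_def] by measurable
    show "AE x::'a in lborel. (\<lambda>m. q m x) \<longlonglongrightarrow> partial_deriv e H x"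
    proof (rule AE_I2)
      fix x
      have D: "(H has_derivative frechet_derivative H (at x)) (at x)"
        using d by (simp add: frechet_derivative_works)
      then have lim: "((\<lambda>y. norm (H y - H x - frechet_derivative H (at x) (y - x)) / norm (y - x)) \<longlongrightarrow> 0) (at x)"
        by (simp add: has_derivative_iff_norm)
      interpret L: linear "frechet_derivative H (at x)" by (rule has_derivative_linear[OF D])
      have "filterlim (\<lambda>m. x + (1 / real (Suc m)) *\<^sub>R e) (at x) sequentially"
        unfolding filterlim_at
      proof
        have "(\<lambda>m. x + (1 / real (Suc m)) *\<^sub>R e) \<longlonglongrightarrow> x + 0 *\<^sub>R e"
          by (intro tendsto_intros LIMSEQ_Suc[OF lim_1_over_n])
        then show "(\<lambda>m. x + (1 / real (Suc m)) *\<^sub>R e) \<longlonglongrightarrow> x" by simp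
      qed (use e in \<open>auto simp: nonzero_Basis\<close>)
      from filterlim_compose[OF lim this]
      have "(\<lambda>m. norm (q m x - partial_deriv e H x)) \<longlonglongrightarrow> 0"
      proof (rule Lim_transform_eventually, intro always_eventually allI)
        fix m
        have "q m x - partial_deriv e H x = real (Suc m) *\<^sub>R
           (H (x + (1 / real (Suc m)) *\<^sub>R e) - H x - frechet_derivative H (at x) (x + (1 / real (Suc m)) *\<^sub>R e - x))"
          by (simp add: q_def partial_deriv_def L.scale scaleR_diff_right del: of_nat_Suc)
        then show "norm (H (x + (1 / real (Suc m)) *\<^sub>R e) - H x - frechet_derivative H (at x) (x + (1 / real (Suc m)) *\<^sub>R e - x)) /
          norm (x + (1 / real (Suc m)) *\<^sub>R e - x) = norm (q m x - partial_deriv e H x)"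
          by (simp add: ne mult.commute del: of_nat_Suc)
      qed
      then show "(\<lambda>m. q m x) \<longlonglongrightarrow> partial_deriv e H x"
        by (simp add: tendsto_norm_zero_iff LIM_zero_iff)
    qed
    show "AE x::'a in lborel. norm (q m x) \<le> C * 2 ^ ?N * (1 / (1 + norm x) ^ ?N)" for m
    proof (rule AE_I2)
      fix x :: 'a
      let ?h = "1 / real (Suc m)"
      let ?B = "C * 2 ^ ?N * (1 / (1 + norm x) ^ ?N)"
      have "norm (H (x + ?h *\<^sub>R e) - H (x + 0 *\<^sub>R e)) \<le> ?B * norm (?h - 0)"
      proof (rule differentiable_bound[where S="{0..?h}" and f="\<lambda>s. H (x + s *\<^sub>R e)" and f'="\<lambda>s h. h *\<^sub>R partial_deriv e H (x + s *\<^sub>R e)"])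
        fix s assume s: "s \<in> {0..?h}"
        have D: "(H has_derivative frechet_derivative H (at (x + s *\<^sub>R e))) (at (x + s *\<^sub>R e))"
          using d by (simp add: frechet_derivative_works)
        interpret L: linear "frechet_derivative H (at (x + s *\<^sub>R e))" by (rule has_derivative_linear[OF D])
        have "((\<lambda>s. x + s *\<^sub>R e) has_derivative (\<lambda>h. h *\<^sub>R e)) (at s within {0..?h})"
          by (auto intro!: derivative_eq_intros)
        from has_derivative_compose[OF this D]
        show "((\<lambda>s. H (x + s *\<^sub>R e)) has_derivative (\<lambda>h. h *\<^sub>R partial_deriv e H (x + s *\<^sub>R e))) (at s within {0..?h})"
          by (simp add: L.scale partial_deriv_def)
        have n: "norm (partial_deriv e H (x + s *\<^sub>R e)) \<le> ?B"
        proof -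
          have "?h \<le> 1" by simp
          then have "\<bar>s\<bar> \<le> 1" using s unfolding atLeastAtMost_iff by linarith
          moreover have "norm x \<le> norm (x + s *\<^sub>R e) + norm (s *\<^sub>R e)" by (metis norm_triangle_ineq4 add_diff_cancel)
          ultimately have "norm x \<le> norm (x + s *\<^sub>R e) + 1" by (simp add: ne)
          then have "1 + norm x \<le> 2 * (1 + norm (x + s *\<^sub>R e))"
            by (rule shift_le) simp
          then have "(1 + norm x) ^ ?N \<le> (2 * (1 + norm (x + s *\<^sub>R e))) ^ ?N"
            by (intro power_mono) auto
          then have "1 / (1 + norm (x + s *\<^sub>R e)) ^ ?N \<le> 2 ^ ?N * (1 / (1 + norm x) ^ ?N)"
            unfolding power_mult_distrib by (simp add: field_simps add_pos_nonneg)
          from mult_left_mono[OF this C(1)] C(2)[of "x + s *\<^sub>R e"]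
          show ?thesis by (simp add: mult.assoc)
        qed
        show "onorm (\<lambda>h. h *\<^sub>R partial_deriv e H (x + s *\<^sub>R e)) \<le> ?B"
        proof (rule onorm_le)
          fix h :: real
          show "norm (h *\<^sub>R partial_deriv e H (x + s *\<^sub>R e)) \<le> ?B * norm h"
            using mult_left_mono[OF n, of "\<bar>h\<bar>"] by (simp add: mult.commute)
        qed
      qed auto
      then have "norm (q m x) \<le> real (Suc m) * (?B * ?h)"
        unfolding q_def norm_scaleR by (intro mult_mono) simp_all
      then show "norm (q m x) \<le> ?B" by (simp del: of_nat_Suc)
    qed
  qed simp
  with q0 show ?thesis by (simp add: LIMSEQ_const_iff)
qed

lemma partial_deriv_mult:
  fixes f g :: "'a::euclidean_space \<Rightarrow> 'b::real_normed_algebra"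
  assumes "f differentiable at x" "g differentiable at x"
  shows "partial_deriv e (\<lambda>x. f x * g x) x = f x * partial_deriv e g x + partial_deriv e f x * g x"
    "(\<lambda>x. f x * g x) differentiable at x"
proof -
  have "((\<lambda>x. f x * g x) has_derivative (\<lambda>h. f x * frechet_derivative g (at x) h + frechet_derivative f (at x) h * g x)) (at x)"
    by (intro has_derivative_mult) (use assms in \<open>simp_all add: frechet_derivative_works\<close>)
  then show "partial_deriv e (\<lambda>x. f x * g x) x = f x * partial_deriv e g x + partial_deriv e f x * g x"
    "(\<lambda>x. f x * g x) differentiable at x"
    by (auto dest: partial_deriv_eqI simp: partial_deriv_def differentiable_def)
qed

lemma has_derivative_cis_inner:
  fixes \<xi> :: "'a::euclidean_space"
  shows "((\<lambda>x. cis (\<xi> \<bullet> x)) has_derivative (\<lambda>h. \<i> * of_real (\<xi> \<bullet> h) * cis (\<xi> \<bullet> x))) (at x)"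
proof -
  have 1: "((\<lambda>x. \<i> * of_real (\<xi> \<bullet> x)) has_derivative (\<lambda>h. \<i> * of_real (\<xi> \<bullet> h))) (at x)"
    by (auto intro!: derivative_eq_intros bounded_linear_imp_has_derivative bounded_linear_intros
         bounded_linear_compose[OF bounded_linear_mult_right] bounded_linear_inner_right bounded_linear_compose[OF bounded_linear_of_real])
  have "(exp has_derivative (\<lambda>h. h * exp (\<i> * of_real (\<xi> \<bullet> x)))) (at (\<i> * of_real (\<xi> \<bullet> x)))"
    using DERIV_exp[of "\<i> * of_real (\<xi> \<bullet> x)"] by (simp add: has_field_derivative_def mult_commute_abs)
  from has_derivative_compose[OF 1 this] show ?thesis
    by (simp add: cis_conv_exp mult_ac)
qed

lemma fourier_partial:
  fixes f :: "'a::euclidean_space \<Rightarrow> complex"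
  assumes d: "\<And>x. f differentiable at x" and f: "rapid f" and r: "rapid (partial_deriv e f)" and e: "e \<in> Basis"
  shows "fourier (partial_deriv e f) \<xi> = \<i> * of_real (\<xi> \<bullet> e) * fourier f \<xi>"
proof -
  let ?c = "\<lambda>x. cis ((- \<xi>) \<bullet> x)"
  let ?H = "\<lambda>x. ?c x * f x"
  have dc: "?c differentiable at x" for x
    using has_derivative_cis_inner[of "- \<xi>" x] unfolding differentiable_def by blast
  have pc: "partial_deriv e ?c x = \<i> * of_real ((- \<xi>) \<bullet> e) * ?c x" for x
    by (rule partial_deriv_eqI[OF has_derivative_cis_inner])
  have pH: "partial_deriv e ?H x = 1 * (?c x * partial_deriv e f x) + \<i> * of_real ((- \<xi>) \<bullet> e) * (?c x * f x)" for x
    by (subst partial_deriv_mult(1)[OF dc d]) (simp only: pc mult.assoc mult_1)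
  have i: "integrable lborel (\<lambda>x. ?c x * f x)" "integrable lborel (\<lambda>x. ?c x * partial_deriv e f x)"
    by (intro rapid_integrable rapid_cis_mult f r; simp)+
  have "(LINT x|lborel. partial_deriv e ?H x) = 0"
  proof (rule integral_partial_zero[OF _ _ _ e])
    show "rapid (partial_deriv e ?H)"
      unfolding pH[abs_def] by (intro rapid_lin rapid_cis_mult f r) simp_all
  qed (use i partial_deriv_mult(2)[OF dc d] in auto)
  also have "(LINT x|lborel. partial_deriv e ?H x) = (LINT x|lborel. ?c x * partial_deriv e f x) + \<i> * of_real ((- \<xi>) \<bullet> e) * (LINT x|lborel. ?c x * f x)"
    unfolding pH using i by (subst Bochner_Integration.integral_add) auto
  finally have "(LINT x|lborel. ?c x * partial_deriv e f x) = \<i> * of_real (\<xi> \<bullet> e) * (LINT x|lborel. ?c x * f x)"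
    by (simp add: add_eq_0_iff)
  then show ?thesis unfolding fourier_eq by (simp add: mult_ac)
qed

text \<open>The largest of 1 and the coordinates controls 1 + norm up to the factor 1 + DIM. Decay
  can thus be tested with pure powers of single coordinates, which correspond to repeated
  derivatives in one direction.\<close>

lemma one_plus_norm_power_le:
  fixes \<xi> :: "'a::euclidean_space"
  shows "(1 + norm \<xi>) ^ N \<le> (1 + DIM('a)) ^ N * (1 + (\<Sum>e\<in>Basis. \<bar>\<xi> \<bullet> e\<bar> ^ N))"
proof -
  define M where "M = Max (insert 1 ((\<lambda>e. \<bar>\<xi> \<bullet> e\<bar>) ` Basis))"
  have M1: "1 \<le> M" unfolding M_def by (intro Max_ge) auto
  have Me: "\<bar>\<xi> \<bullet> e\<bar> \<le> M" if "e \<in> Basis" for e unfolding M_def using that by (intro Max_ge) auto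
  have "M \<in> insert 1 ((\<lambda>e. \<bar>\<xi> \<bullet> e\<bar>) ` Basis)" unfolding M_def by (intro Max_in) auto
  then have MN: "M ^ N \<le> 1 + (\<Sum>e\<in>Basis. \<bar>\<xi> \<bullet> e\<bar> ^ N)"
  proof
    assume "M = 1" then show ?thesis by (simp add: sum_nonneg)
  next
    assume "M \<in> (\<lambda>e. \<bar>\<xi> \<bullet> e\<bar>) ` Basis"
    then obtain e where e: "e \<in> Basis" "M = \<bar>\<xi> \<bullet> e\<bar>" by auto
    then have "M ^ N \<le> (\<Sum>e\<in>Basis. \<bar>\<xi> \<bullet> e\<bar> ^ N)"
      using member_le_sum[of e Basis "\<lambda>e. \<bar>\<xi> \<bullet> e\<bar> ^ N"] by simp
    then show ?thesis by simp
  qed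
  have "norm \<xi> \<le> (\<Sum>e\<in>(Basis::'a set). \<bar>\<xi> \<bullet> e\<bar>)" by (rule norm_le_l1)
  also have "\<dots> \<le> (\<Sum>e\<in>(Basis::'a set). M)" by (intro sum_mono Me)
  finally have "1 + norm \<xi> \<le> (1 + DIM('a)) * M" using M1 by (simp add: algebra_simps)
  then have "(1 + norm \<xi>) ^ N \<le> ((1 + DIM('a)) * M) ^ N" by (intro power_mono) auto
  also have "\<dots> = (1 + DIM('a)) ^ N * M ^ N" by (simp add: power_mult_distrib)
  also have "\<dots> \<le> (1 + DIM('a)) ^ N * (1 + (\<Sum>e\<in>Basis. \<bar>\<xi> \<bullet> e\<bar> ^ N))"
    by (intro mult_left_mono MN) auto
  finally show ?thesis by simp
qed

lemma schwartz_fourier_rapid: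
  fixes \<phi> :: "'a::euclidean_space \<Rightarrow> complex"
  assumes s: "schwartz \<phi>"
  shows "rapid (fourier \<phi>)"
  unfolding rapid_def
proof (intro conjI allI)
  note [measurable] = rapid_measurable[OF schwartz_rapid[OF s]]
  show "fourier \<phi> \<in> borel_measurable borel" by measurable
  fix N
  have it: "schwartz ((partial_deriv e ^^ k) \<phi>) \<and>
     (\<forall>\<xi>. fourier ((partial_deriv e ^^ k) \<phi>) \<xi> = (\<i> * of_real (\<xi> \<bullet> e)) ^ k * fourier \<phi> \<xi>)" if e: "e \<in> Basis" for e k
  proof (induction k)
    case (Suc k)
    let ?f = "(partial_deriv e ^^ k) \<phi>"
    have sp: "schwartz (partial_deriv e ?f)" using Suc schwartz_partial e by blast
    have "fourier (partial_deriv e ?f) \<xi> = \<i> * of_real (\<xi> \<bullet> e) * fourier ?f \<xi>" for \<xi>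
      using Suc sp schwartz_Ck[of ?f 1]
      by (intro fourier_partial Ck_1_differentiable[of 1] schwartz_rapid e) auto
    with Suc sp show ?case by simp
  qed (use s in simp)
  define B where "B e = fconst TYPE('a) * (LINT x|lborel. norm ((partial_deriv e ^^ N) \<phi> x))" for e
  define B0 where "B0 = fconst TYPE('a) * (LINT x|lborel. norm (\<phi> x))"
  have b: "\<bar>\<xi> \<bullet> e\<bar> ^ N * norm (fourier \<phi> \<xi>) \<le> B e" if "e \<in> Basis" for e \<xi>
    using norm_fourier_le[of "(partial_deriv e ^^ N) \<phi>" \<xi>] it[OF that, of N]
    by (simp add: B_def norm_mult norm_power)
  have "norm (fourier \<phi> \<xi>) * (1 + norm \<xi>) ^ N \<le> (1 + DIM('a)) ^ N * (B0 + (\<Sum>e\<in>Basis. B e))" for \<xi>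
  proof -
    have "norm (fourier \<phi> \<xi>) * (1 + norm \<xi>) ^ N \<le> norm (fourier \<phi> \<xi>) * ((1 + DIM('a)) ^ N * (1 + (\<Sum>e\<in>Basis. \<bar>\<xi> \<bullet> e\<bar> ^ N)))"
      by (intro mult_left_mono one_plus_norm_power_le) simp
    also have "\<dots> = (1 + DIM('a)) ^ N * (norm (fourier \<phi> \<xi>) + (\<Sum>e\<in>Basis. \<bar>\<xi> \<bullet> e\<bar> ^ N * norm (fourier \<phi> \<xi>)))"
      by (simp add: algebra_simps sum_distrib_left)
    also have "\<dots> \<le> (1 + DIM('a)) ^ N * (B0 + (\<Sum>e\<in>Basis. B e))"
      using norm_fourier_le[of \<phi> \<xi>] by (intro mult_left_mono add_mono sum_mono b) (auto simp: B0_def)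
    finally show ?thesis .
  qed
  then show "\<exists>C. \<forall>x. norm (fourier \<phi> x) * (1 + norm x) ^ N \<le> C" by blast
qed

lemma schwartz_inversion:
  fixes \<phi> :: "'a::euclidean_space \<Rightarrow> complex"
  assumes s: "schwartz \<phi>"
  shows "of_real (fconst TYPE('a)) * (LINT \<xi>|lborel. cis (\<xi> \<bullet> x) * fourier \<phi> \<xi>) = \<phi> x"
proof -
  obtain B where "\<And>x. norm (\<phi> x) \<le> B" using rapid_bounded[OF schwartz_rapid[OF s]] by blast
  then show ?thesis
    using schwartz_Ck[OF s, of 0]
    by (intro fourier_inversion rapid_integrable schwartz_rapid schwartz_fourier_rapid s) auto
qed

lemma integral_reflect:
  fixes f :: "'a::euclidean_space \<Rightarrow> 'b::euclidean_space"
  assumes "f \<in> borel_measurable borel"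
  shows "(LINT x|lborel. f (- x)) = (LINT x|lborel. f x)"
    "integrable lborel f \<Longrightarrow> integrable lborel (\<lambda>x. f (- x))"
  using lborel_integral_affine[of "-1" f 0] assms by simp_all

lemma nn_integral_reflect:
  fixes f :: "'a::euclidean_space \<Rightarrow> ennreal"
  assumes [measurable]: "f \<in> borel_measurable borel"
  shows "(\<integral>\<^sup>+x. f (- x) \<partial>lborel) = (\<integral>\<^sup>+x. f x \<partial>lborel)"
proof -
  have e: "(lborel :: 'a measure) = distr lborel borel uminus"
    using lborel_affine[of "-1" "0::'a"] by (simp add: density_1)
  show ?thesis by (subst (2) e) (simp add: nn_integral_distr)
qed

text \<open>By inversion, the transform of the reflected \<open>fourier \<phi>\<close> is \<phi>
  again; the multiplication formula then identifies h as the distributional transform of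
  \<open>\<lambda>x. fourier h (- x)\<close>.\<close>

lemma inverse_fourier_pairing:
  fixes \<phi> :: "'a::euclidean_space \<Rightarrow> complex"
  assumes h: "integrable lborel h" and s: "schwartz \<phi>"
  shows "(LINT x|lborel. fourier h (- x) * fourier \<phi> x) = (LINT \<xi>|lborel. h \<xi> * \<phi> \<xi>)"
proof -
  note [measurable] = borel_measurable_integrable[OF h] rapid_measurable[OF schwartz_rapid[OF s]]
  let ?g = "\<lambda>x. fourier \<phi> (- x)"
  have gi: "integrable lborel ?g"
    by (intro integral_reflect rapid_integrable schwartz_fourier_rapid s) simp
  have "fourier ?g \<xi> = \<phi> \<xi>" for \<xi>
  proof -
    have "(LINT x|lborel. cis (- (\<xi> \<bullet> x)) * ?g x) = (LINT x|lborel. cis (- (\<xi> \<bullet> (- x))) * ?g (- x))"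
      by (rule integral_reflect(1)[symmetric]) simp
    then show ?thesis unfolding fourier_eq[of ?g] using schwartz_inversion[OF s, of \<xi>] by (simp add: inner_commute)
  qed
  note 1 = this
  have "(LINT x|lborel. fourier h (- x) * fourier \<phi> x) = (LINT x|lborel. fourier h (- (- x)) * fourier \<phi> (- x))"
    by (rule integral_reflect(1)[symmetric]) simp
  also have "\<dots> = (LINT x|lborel. fourier h x * ?g x)" by simp
  also have "\<dots> = (LINT \<xi>|lborel. h \<xi> * \<phi> \<xi>)"
    by (subst fourier_multiplication[OF h gi, symmetric]) (simp only: 1)
  finally show ?thesis .
qed

subsection \<open>Gaussian test functions\<close>

text \<open>These polynomials serve as coefficients of Gaussians. Closure under differentiation and
  polynomial growth are what the Schwartz property of such products rests on, and both follow by
  rule induction.\<close>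

inductive cpoly :: "('a::euclidean_space \<Rightarrow> complex) \<Rightarrow> bool" where
  const: "cpoly (\<lambda>_. c)"
| coord: "cpoly (\<lambda>x. of_real (x \<bullet> b))"
| add: "cpoly p \<Longrightarrow> cpoly q \<Longrightarrow> cpoly (\<lambda>x. p x + q x)"
| mult: "cpoly p \<Longrightarrow> cpoly q \<Longrightarrow> cpoly (\<lambda>x. p x * q x)"

lemma cpoly_deriv:
  assumes "cpoly p"
  shows "(\<forall>x. p differentiable at x) \<and> cpoly (partial_deriv e p)"
  using assms
proof induction
  case (const c)
  have "partial_deriv e (\<lambda>_. c) = (\<lambda>_::'a. 0)" by (auto simp: partial_deriv_def)
  then show ?case by (auto intro: cpoly.const)
next
  case (coord b)
  have D: "((\<lambda>x::'a. complex_of_real (x \<bullet> b)) has_derivative (\<lambda>h. of_real (h \<bullet> b))) (at x)" for x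
    by (intro bounded_linear_imp_has_derivative bounded_linear_compose[OF bounded_linear_of_real] bounded_linear_inner_left)
  then have "partial_deriv e (\<lambda>x::'a. complex_of_real (x \<bullet> b)) = (\<lambda>_. of_real (e \<bullet> b))"
    by (auto dest: partial_deriv_eqI)
  then show ?case using D by (auto simp: differentiable_def intro: cpoly.const)
next
  case (add p q)
  then have "partial_deriv e (\<lambda>x. p x + q x) = (\<lambda>x. partial_deriv e p x + partial_deriv e q x)"
    by (auto intro!: partial_deriv_add)
  with add show ?case by (auto intro: cpoly.add differentiable_add)
next
  case (mult p q)
  then have "partial_deriv e (\<lambda>x. p x * q x) = (\<lambda>x. p x * partial_deriv e q x + partial_deriv e p x * q x)"
    by (auto intro!: partial_deriv_mult)
  with mult show ?case by (auto intro!: cpoly.add cpoly.mult partial_deriv_mult(2))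
qed

lemma cpoly_bound:
  assumes "cpoly p"
  shows "\<exists>C N. C \<ge> 0 \<and> (\<forall>x. norm (p x) \<le> C * (1 + norm x) ^ N)"
  using assms
proof induction
  case (const c)
  show ?case by (intro exI[of _ "norm c"] exI[of _ 0]) simp
next
  case (coord b)
  have "norm (complex_of_real (x \<bullet> b)) \<le> norm b * (1 + norm x) ^ 1" for x
    using Cauchy_Schwarz_ineq2[of x b] by (simp add: algebra_simps add_increasing)
  then show ?case by (intro exI[of _ "norm b"] exI[of _ 1]) auto
next
  case (add p q)
  then obtain C N D M where C: "C \<ge> 0" "\<And>x. norm (p x) \<le> C * (1 + norm x) ^ N"
    and D: "D \<ge> 0" "\<And>x. norm (q x) \<le> D * (1 + norm x) ^ M" by blast
  have "norm (p x + q x) \<le> (C + D) * (1 + norm x) ^ (N + M)" for x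
  proof -
    have "norm (p x + q x) \<le> C * (1 + norm x) ^ N + D * (1 + norm x) ^ M"
      by (intro order_trans[OF norm_triangle_ineq] add_mono C D)
    also have "\<dots> \<le> C * (1 + norm x) ^ (N + M) + D * (1 + norm x) ^ (N + M)"
      using C(1) D(1) by (intro add_mono mult_left_mono power_increasing) auto
    finally show ?thesis by (simp add: distrib_right)
  qed
  then show ?case using C(1) D(1) by (intro exI[of _ "C + D"] exI[of _ "N + M"]) auto
next
  case (mult p q)
  then obtain C N D M where C: "C \<ge> 0" "\<And>x. norm (p x) \<le> C * (1 + norm x) ^ N"
    and D: "D \<ge> 0" "\<And>x. norm (q x) \<le> D * (1 + norm x) ^ M" by blast
  have "norm (p x * q x) \<le> (C * D) * (1 + norm x) ^ (N + M)" for x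
  proof -
    have "norm (p x * q x) \<le> (C * (1 + norm x) ^ N) * (D * (1 + norm x) ^ M)"
      unfolding norm_mult using C(1) by (intro mult_mono C D) auto
    then show ?thesis by (simp add: power_add mult_ac)
  qed
  then show ?case using C(1) D(1) by (intro exI[of _ "C * D"] exI[of _ "N + M"]) auto
qed

text \<open>The real linear part d produces, up to a constant, the translate with centre c when d =
  2 t c; the phase produces modulations. The two separation lemmas below take one each.\<close>

definition cgauss :: "real \<Rightarrow> 'a::euclidean_space \<Rightarrow> 'a \<Rightarrow> 'a \<Rightarrow> complex" where
  "cgauss t d a x = exp (of_real (- t * (x \<bullet> x) + d \<bullet> x) + \<i> * of_real (a \<bullet> x))"

lemma cgauss_has_derivative:
  "(cgauss t d a has_derivative (\<lambda>h. (of_real (- 2 * t * (x \<bullet> h) + d \<bullet> h) + \<i> * of_real (a \<bullet> h)) * cgauss t d a x)) (at x)"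
proof -
  let ?q = "\<lambda>x. complex_of_real (- t * (x \<bullet> x) + d \<bullet> x) + \<i> * of_real (a \<bullet> x)"
  have 1: "((\<lambda>x. complex_of_real (- t * (x \<bullet> x) + d \<bullet> x)) has_derivative (\<lambda>h. of_real (- 2 * t * (x \<bullet> h) + d \<bullet> h))) (at x)"
    by (rule bounded_linear.has_derivative[OF bounded_linear_of_real])
       (auto intro!: derivative_eq_intros simp: inner_commute algebra_simps)
  have 2: "((\<lambda>x. \<i> * complex_of_real (a \<bullet> x)) has_derivative (\<lambda>h. \<i> * of_real (a \<bullet> h))) (at x)"
    by (intro bounded_linear_imp_has_derivative bounded_linear_compose[OF bounded_linear_mult_right]
        bounded_linear_compose[OF bounded_linear_of_real] bounded_linear_inner_right)
  have 3: "(exp has_derivative (\<lambda>h. h * exp (?q x))) (at (?q x))"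
    using DERIV_exp[of "?q x"] by (simp add: has_field_derivative_def mult_commute_abs)
  from has_derivative_compose[OF has_derivative_add[OF 1 2] 3] show ?thesis
    by (simp add: cgauss_def[abs_def])
qed

lemma cgauss_partial:
  "\<exists>q. cpoly q \<and> partial_deriv e (cgauss t d a) = (\<lambda>x. q x * cgauss t d a x)"
proof (intro exI conjI)
  let ?q = "\<lambda>x. of_real (- 2 * t) * of_real (x \<bullet> e) + complex_of_real (d \<bullet> e) + \<i> * of_real (a \<bullet> e)"
  show "cpoly ?q" by (intro cpoly.intros)
  show "partial_deriv e (cgauss t d a) = (\<lambda>x. ?q x * cgauss t d a x)"
    by (rule ext, subst partial_deriv_eqI[OF cgauss_has_derivative]) simp
qed

lemma cgauss_mult_partial:
  assumes "cpoly p"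
  shows "(\<lambda>x. p x * cgauss t d a x) differentiable at x"
    "\<exists>q. cpoly q \<and> partial_deriv e (\<lambda>x. p x * cgauss t d a x) = (\<lambda>x. q x * cgauss t d a x)"
proof -
  have d: "cgauss t d a differentiable at x" for x
    using cgauss_has_derivative unfolding differentiable_def by blast
  note p = cpoly_deriv[OF assms]
  show "(\<lambda>x. p x * cgauss t d a x) differentiable at x"
    using p d by (intro partial_deriv_mult(2)) auto
  obtain q where q: "cpoly q" "partial_deriv e (cgauss t d a) = (\<lambda>x. q x * cgauss t d a x)"
    using cgauss_partial by blast
  have "partial_deriv e (\<lambda>x. p x * cgauss t d a x) = (\<lambda>x. (p x * q x + partial_deriv e p x) * cgauss t d a x)"
    using p d by (auto simp: fun_eq_iff partial_deriv_mult q algebra_simps)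
  moreover have "cpoly (\<lambda>x. p x * q x + partial_deriv e p x)"
    using p[of e] q assms by (intro cpoly.intros) auto
  ultimately show "\<exists>q. cpoly q \<and> partial_deriv e (\<lambda>x. p x * cgauss t d a x) = (\<lambda>x. q x * cgauss t d a x)"
    by blast
qed

lemma power_le_exp:
  assumes "r \<ge> 0"
  shows "(1 + r) ^ N \<le> real (Suc N) ^ N * exp r"
proof (cases "N = 0")
  case False
  have "1 + r \<le> real (Suc N) * (1 + r / real N)" using False assms by (simp add: field_simps)
  then have "(1 + r) ^ N \<le> (real (Suc N) * (1 + r / real N)) ^ N" using assms by (intro power_mono) auto
  also have "\<dots> = real (Suc N) ^ N * (1 + r / real N) ^ N" by (rule power_mult_distrib)
  also have "\<dots> \<le> real (Suc N) ^ N * exp r"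
    using False assms by (intro mult_left_mono exp_ge_one_plus_x_over_n_power_n) auto
  finally show ?thesis .
qed (use assms in auto)

lemma cgauss_decay:
  assumes t: "t > 0"
  shows "\<exists>C. \<forall>x. (1 + norm x) ^ N * norm (cgauss t d a x) \<le> C"
proof -
  \<comment> \<open>The maximum over real r of - t r^2 + (norm d + 1) r. The surplus 1 leaves a
    factor exp (- norm x), which absorbs the polynomial.\<close>
  define K where "K = (norm d + 1)\<^sup>2 / (4 * t)"
  have "(1 + norm x) ^ N * norm (cgauss t d a x) \<le> real (Suc N) ^ N * exp K" for x
  proof -
    have "- t * (norm x)\<^sup>2 + (norm d + 1) * norm x \<le> K"
    proof -
      have "0 \<le> (2 * t * norm x - (norm d + 1))\<^sup>2" by simp
      then have "4 * t * (- t * (norm x)\<^sup>2 + (norm d + 1) * norm x) \<le> (norm d + 1)\<^sup>2"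
        by (simp add: power2_eq_square algebra_simps)
      then show ?thesis using t by (simp add: K_def field_simps)
    qed
    moreover have "d \<bullet> x \<le> norm d * norm x" by (rule norm_cauchy_schwarz)
    ultimately have "- t * (x \<bullet> x) + d \<bullet> x \<le> K - norm x"
      by (simp add: power2_norm_eq_inner algebra_simps)
    then have "norm (cgauss t d a x) \<le> exp (K - norm x)"
      by (simp add: cgauss_def)
    then have "(1 + norm x) ^ N * norm (cgauss t d a x) \<le> (real (Suc N) ^ N * exp (norm x)) * exp (K - norm x)"
      by (intro mult_mono power_le_exp) auto
    also have "\<dots> = real (Suc N) ^ N * exp K" by (simp add: exp_diff)
    finally show ?thesis .
  qed
  then show ?thesis by blast
qed

lemma schwartz_cgauss:
  assumes t: "t > 0" and p: "cpoly p"
  shows "schwartz (\<lambda>x. p x * cgauss t d a x)"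
  unfolding schwartz_def
proof (intro conjI allI impI)
  show "Ck k (\<lambda>x. p x * cgauss t d a x)" for k
    using p
  proof (induction k arbitrary: p)
    case 0
    then show ?case using cgauss_mult_partial(1)[OF 0]
      by (auto simp: continuous_on_eq_continuous_at intro: differentiable_imp_continuous_within)
  next
    case (Suc k)
    show ?case
    proof (rule Ck_SucI)
      fix e :: 'a
      obtain q where "cpoly q" "partial_deriv e (\<lambda>x. p x * cgauss t d a x) = (\<lambda>x. q x * cgauss t d a x)"
        using cgauss_mult_partial(2)[OF Suc.prems] by blast
      then show "Ck k (partial_deriv e (\<lambda>x. p x * cgauss t d a x))" using Suc.IH by simp
    qed (rule cgauss_mult_partial(1)[OF Suc.prems])
  qed
  fix N and es :: "'a list"
  have "\<exists>q. cpoly q \<and> foldr partial_deriv es (\<lambda>x. p x * cgauss t d a x) = (\<lambda>x. q x * cgauss t d a x)"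
  proof (induction es)
    case (Cons e es)
    then show ?case using cgauss_mult_partial(2) by fastforce
  qed (use p in auto)
  then obtain q where q: "cpoly q" "foldr partial_deriv es (\<lambda>x. p x * cgauss t d a x) = (\<lambda>x. q x * cgauss t d a x)"
    by blast
  obtain C M where C: "C \<ge> 0" "\<And>x. norm (q x) \<le> C * (1 + norm x) ^ M" using cpoly_bound[OF q(1)] by blast
  obtain D where D: "\<And>x::'a. (1 + norm x) ^ (N + M) * norm (cgauss t d a x) \<le> D" using cgauss_decay[OF t] by blast
  have "norm ((1 + norm x) ^ N *\<^sub>R (q x * cgauss t d a x)) \<le> C * D" for x
  proof -
    have "norm ((1 + norm x) ^ N *\<^sub>R (q x * cgauss t d a x)) = (1 + norm x) ^ N * norm (q x) * norm (cgauss t d a x)"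
      by (simp add: norm_mult norm_power mult.assoc)
    also have "\<dots> \<le> (1 + norm x) ^ N * (C * (1 + norm x) ^ M) * norm (cgauss t d a x)"
      by (intro mult_right_mono mult_left_mono C) auto
    also have "\<dots> = C * ((1 + norm x) ^ (N + M) * norm (cgauss t d a x))" by (simp add: power_add mult_ac)
    also have "\<dots> \<le> C * D" by (intro mult_left_mono C D)
    finally show ?thesis .
  qed
  then show "bounded (range (\<lambda>x. (1 + norm x) ^ N *\<^sub>R foldr partial_deriv es (\<lambda>x. p x * cgauss t d a x) x))"
    unfolding q(2) bounded_iff by blast
qed

text \<open>Translated Gaussians are Schwartz functions: expanding |z - a|^2 leaves a constant and
  the linear exponent d = 2 t a.\<close>

lemma schwartz_separates:
  fixes v :: "'a::euclidean_space \<Rightarrow> complex"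
  assumes [measurable]: "v \<in> borel_measurable borel"
    and v: "\<And>\<phi>. schwartz \<phi> \<Longrightarrow> integrable lborel (\<lambda>x. v x * \<phi> x)"
      "\<And>\<phi>. schwartz \<phi> \<Longrightarrow> (LINT x|lborel. v x * \<phi> x) = 0"
  shows "AE x in lborel. v x = 0"
proof (rule gaussian_uniqueness)
  fix t :: real and a :: 'a assume t: "t > 0"
  let ?\<phi> = "\<lambda>x. of_real (exp (- t * (a \<bullet> a))) * cgauss t ((2 * t) *\<^sub>R a) 0 x"
  have "schwartz ?\<phi>" by (intro schwartz_cgauss t cpoly.const)
  note * = v[OF this]
  have "exp (- t * (norm (z - a))\<^sup>2) *\<^sub>R v z = v z * ?\<phi> z" for z
  proof -
    have "?\<phi> z = of_real (exp (- t * (a \<bullet> a)) * exp (- t * (z \<bullet> z) + ((2 * t) *\<^sub>R a) \<bullet> z))"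
      by (simp only: cgauss_def of_real_mult exp_of_real inner_zero_left of_real_0 mult_zero_right add_0_right)
    also have "exp (- t * (a \<bullet> a)) * exp (- t * (z \<bullet> z) + ((2 * t) *\<^sub>R a) \<bullet> z) = exp (- t * (norm (z - a))\<^sup>2)"
      unfolding exp_add[symmetric] power2_norm_eq_inner
      by (simp add: inner_diff_left inner_diff_right inner_commute algebra_simps)
    finally show ?thesis by (simp add: scaleR_conv_of_real mult.commute)
  qed
  with * show "integrable lborel (\<lambda>z. exp (- t * (norm (z - a))\<^sup>2) *\<^sub>R v z)"
    "(LINT z|lborel. exp (- t * (norm (z - a))\<^sup>2) *\<^sub>R v z) = 0" by simp_all
qed simp

text \<open>Up to the factor \<open>K\<close>, each translated Gaussian is the transform of a
  modulated Gaussian, which is a Schwartz function; so pairings with transforms already reach all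
  Gaussian averages.\<close>

lemma schwartz_fourier_separates:
  fixes w :: "'a::euclidean_space \<Rightarrow> complex"
  assumes [measurable]: "w \<in> borel_measurable borel"
    and w: "\<And>\<phi>. schwartz \<phi> \<Longrightarrow> integrable lborel (\<lambda>x. w x * fourier \<phi> x)"
      "\<And>\<phi>. schwartz \<phi> \<Longrightarrow> (LINT x|lborel. w x * fourier \<phi> x) = 0"
  shows "AE x in lborel. w x = 0"
proof (rule gaussian_uniqueness)
  fix t :: real and a :: 'a assume t: "t > 0"
  define m where "m = sqrt t"
  have m: "m > 0" "m\<^sup>2 = t" using t by (auto simp: m_def)
  define K where "K = fconst TYPE('a) * (2 * m * sqrt pi) ^ DIM('a)"
  have K: "K > 0" unfolding K_def using m by simp
  let ?\<phi> = "\<lambda>\<xi>. cis (\<xi> \<bullet> a) * of_real (exp (- (norm \<xi>)\<^sup>2 / (4 * m\<^sup>2)))"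
  have "?\<phi> = (\<lambda>x. 1 * cgauss (1 / (4 * m\<^sup>2)) 0 a x)"
  proof
    fix x
    have "cgauss (1 / (4 * m\<^sup>2)) 0 a x = exp (of_real (- (norm x)\<^sup>2 / (4 * m\<^sup>2))) * exp (\<i> * of_real (x \<bullet> a))"
      unfolding cgauss_def exp_add[symmetric] by (simp add: power2_norm_eq_inner inner_commute)
    then show "?\<phi> x = 1 * cgauss (1 / (4 * m\<^sup>2)) 0 a x"
      by (simp only: cis_conv_exp exp_of_real mult_1 mult.commute)
  qed
  moreover have "schwartz (\<lambda>x. 1 * cgauss (1 / (4 * m\<^sup>2)) 0 a x)"
    using m by (intro schwartz_cgauss cpoly.const) auto
  ultimately have "schwartz ?\<phi>" by simp
  note * = w[OF this, unfolded fourier_gaussian(2)[OF m(1)]]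
  have e: "exp (- t * (norm (z - a))\<^sup>2) *\<^sub>R w z =
     of_real (1 / K) * (w z * of_real (fconst TYPE('a) * (2 * m * sqrt pi) ^ DIM('a) * exp (- m\<^sup>2 * (norm (z - a))\<^sup>2)))" for z
    using K by (simp add: scaleR_conv_of_real m(2) K_def[symmetric])
  show "integrable lborel (\<lambda>z. exp (- t * (norm (z - a))\<^sup>2) *\<^sub>R w z)"
    unfolding e by (intro integrable_mult_right *)
  show "(LINT z|lborel. exp (- t * (norm (z - a))\<^sup>2) *\<^sub>R w z) = 0"
    unfolding e integral_mult_right_zero * by simp
qed simp

subsection \<open>Fourier transforms of tempered functions\<close>

lemma has_fourierD:
  assumes "has_fourier u v"
  shows "u \<in> borel_measurable borel" "v \<in> borel_measurable borel"
    "schwartz \<phi> \<Longrightarrow> integrable lborel (\<lambda>x. u x * fourier \<phi> x)"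
    "schwartz \<phi> \<Longrightarrow> integrable lborel (\<lambda>x. v x * \<phi> x)"
    "schwartz \<phi> \<Longrightarrow> (LINT x|lborel. u x * fourier \<phi> x) = (LINT x|lborel. v x * \<phi> x)"
  using assms unfolding has_fourier_def by auto

lemma has_fourier_lin:
  assumes 1: "has_fourier u v" and 2: "has_fourier u' v'"
  shows "has_fourier (\<lambda>x. c * u x + d * u' x) (\<lambda>x. c * v x + d * v' x)"
  unfolding has_fourier_def
proof (intro conjI allI impI)
  note [measurable] = has_fourierD(1,2)[OF 1] has_fourierD(1,2)[OF 2]
  show "(\<lambda>x. c * u x + d * u' x) \<in> borel_measurable lborel" "(\<lambda>x. c * v x + d * v' x) \<in> borel_measurable lborel"
    by measurable
  fix \<phi> :: "'a \<Rightarrow> complex" assume s: "schwartz \<phi>"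
  note i = has_fourierD(3-5)[OF 1 s] has_fourierD(3-5)[OF 2 s]
  have e: "(c * u x + d * u' x) * fourier \<phi> x = c * (u x * fourier \<phi> x) + d * (u' x * fourier \<phi> x)"
    "(c * v x + d * v' x) * \<phi> x = c * (v x * \<phi> x) + d * (v' x * \<phi> x)" for x
    by (simp_all add: algebra_simps)
  show "integrable lborel (\<lambda>x. (c * u x + d * u' x) * fourier \<phi> x)" "integrable lborel (\<lambda>x. (c * v x + d * v' x) * \<phi> x)"
    unfolding e using i by auto
  show "(LINT x|lborel. (c * u x + d * u' x) * fourier \<phi> x) = (LINT x|lborel. (c * v x + d * v' x) * \<phi> x)"
    unfolding e using i by simp
qed

text \<open>Injectivity in both directions: the pairing identity transfers vanishing from one
  function to the other, and Schwartz functions as well as their transforms separate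
  functions.\<close>

lemma has_fourier_zero_iff:
  assumes "has_fourier u v"
  shows "(AE x in lborel. u x = 0) \<longleftrightarrow> (AE x in lborel. v x = 0)"
proof
  note [measurable] = has_fourierD(1,2)[OF assms]
  assume u: "AE x in lborel. u x = 0"
  show "AE x in lborel. v x = 0"
  proof (rule schwartz_separates)
    fix \<phi> :: "'a \<Rightarrow> complex" assume s: "schwartz \<phi>"
    have "(LINT x|lborel. u x * fourier \<phi> x) = 0"
      by (rule integral_eq_zero_AE) (use u in eventually_elim, simp)
    then show "(LINT x|lborel. v x * \<phi> x) = 0" using has_fourierD(5)[OF assms s] by simp
  qed (use has_fourierD[OF assms] in auto)
next
  note [measurable] = has_fourierD(1,2)[OF assms]
  assume v: "AE x in lborel. v x = 0"
  show "AE x in lborel. u x = 0"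
  proof (rule schwartz_fourier_separates)
    fix \<phi> :: "'a \<Rightarrow> complex" assume s: "schwartz \<phi>"
    have "(LINT x|lborel. v x * \<phi> x) = 0"
      by (rule integral_eq_zero_AE) (use v in eventually_elim, simp)
    then show "(LINT x|lborel. u x * fourier \<phi> x) = 0" using has_fourierD(5)[OF assms s] by simp
  qed (use has_fourierD[OF assms] in auto)
qed

text \<open>The weighted hypotheses concern the differences to the limit: integrability of F g is
  inherited from that of \<open>f 0 z * g z\<close> by subtracting the pairing of one
  difference.\<close>

lemma weighted_L2_pairing_tendsto:
  fixes f :: "nat \<Rightarrow> 'a::euclidean_space \<Rightarrow> complex"
  assumes w: "\<And>z. w z \<ge> 0" "w \<in> borel_measurable borel" "AE z in lborel. w z > 0"
    and f: "\<And>m. (\<lambda>z. f m z - F z) \<in> weighted_L2 w" "(\<lambda>m. weighted_L2_norm w (\<lambda>z. f m z - F z)) \<longlonglongrightarrow> 0"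
    and g: "g \<in> borel_measurable borel" "integrable lborel (\<lambda>z. (norm (g z))\<^sup>2 / w z)"
    and i: "\<And>m. integrable lborel (\<lambda>z. f m z * g z)" and F: "F \<in> borel_measurable borel"
  shows "integrable lborel (\<lambda>z. F z * g z)"
    "(\<lambda>m. LINT z|lborel. f m z * g z) \<longlonglongrightarrow> (LINT z|lborel. F z * g z)"
proof -
  note [measurable] = g(1) F
  note CS = weighted_L2_Cauchy_Schwarz[OF w f(1) g]
  have d: "integrable lborel (\<lambda>z. (f m z - F z) * g z)" for m
    by (rule Bochner_Integration.integrable_bound[OF CS(1)[of m]])
       (use weighted_L2D(1)[OF f(1)[of m]] in \<open>auto simp: norm_mult\<close>)
  have e: "F z * g z = f 0 z * g z - (f 0 z - F z) * g z" for z by (simp add: algebra_simps)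
  show I: "integrable lborel (\<lambda>z. F z * g z)"
    by (subst e) (intro Bochner_Integration.integrable_diff i d)
  have b: "norm ((LINT z|lborel. f m z * g z) - (LINT z|lborel. F z * g z)) \<le>
     weighted_L2_norm w (\<lambda>z. f m z - F z) * sqrt (LINT z|lborel. (norm (g z))\<^sup>2 / w z)" for m
  proof -
    have "(LINT z|lborel. f m z * g z) - (LINT z|lborel. F z * g z) = (LINT z|lborel. (f m z - F z) * g z)"
      by (subst Bochner_Integration.integral_diff[symmetric, OF i I]) (simp add: algebra_simps)
    also have "norm \<dots> \<le> (LINT z|lborel. norm ((f m z - F z) * g z))" by (rule integral_norm_bound)
    finally show ?thesis using CS(2)[of m] by (simp add: norm_mult)
  qed
  have "(\<lambda>m. weighted_L2_norm w (\<lambda>z. f m z - F z) * sqrt (LINT z|lborel. (norm (g z))\<^sup>2 / w z)) \<longlonglongrightarrow> 0"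
    using tendsto_mult_right[OF f(2)] by simp
  then have "(\<lambda>m. (LINT z|lborel. f m z * g z) - (LINT z|lborel. F z * g z)) \<longlonglongrightarrow> 0"
    by (rule Lim_null_comparison[OF always_eventually, rotated]) (use b in auto)
  then show "(\<lambda>m. LINT z|lborel. f m z * g z) \<longlonglongrightarrow> (LINT z|lborel. F z * g z)"
    by (simp add: LIM_zero_iff)
qed

text \<open>Closedness of the Fourier relation. Both pairings pass to the limit because Schwartz
  functions and their transforms are rapid and hence, by \<open>iq\<close> and \<open>ip\<close>,
  lie in the duals of the two weighted spaces.\<close>

lemma has_fourier_limit:
  fixes u v :: "nat \<Rightarrow> 'a::euclidean_space \<Rightarrow> complex"
  assumes uv: "\<And>m. has_fourier (u m) (v m)"
    and U: "U \<in> borel_measurable borel" and V: "V \<in> borel_measurable borel"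
    and p: "\<And>z. p z \<ge> 0" "p \<in> borel_measurable borel" "AE z in lborel. p z > 0"
    and q: "\<And>z. q z \<ge> 0" "q \<in> borel_measurable borel" "AE z in lborel. q z > 0"
    and u: "\<And>m. (\<lambda>z. u m z - U z) \<in> weighted_L2 p" "(\<lambda>m. weighted_L2_norm p (\<lambda>z. u m z - U z)) \<longlonglongrightarrow> 0"
    and v: "\<And>m. (\<lambda>z. v m z - V z) \<in> weighted_L2 q" "(\<lambda>m. weighted_L2_norm q (\<lambda>z. v m z - V z)) \<longlonglongrightarrow> 0"
    and ip: "\<And>f::'a \<Rightarrow> complex. rapid f \<Longrightarrow> integrable lborel (\<lambda>z. (norm (f z))\<^sup>2 / p z)"
    and iq: "\<And>f::'a \<Rightarrow> complex. rapid f \<Longrightarrow> integrable lborel (\<lambda>z. (norm (f z))\<^sup>2 / q z)"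
  shows "has_fourier U V"
  unfolding has_fourier_def
proof (intro conjI allI impI)
  fix \<phi> :: "'a \<Rightarrow> complex" assume s: "schwartz \<phi>"
  note r = schwartz_rapid[OF s] schwartz_fourier_rapid[OF s]
  note i = has_fourierD(3-5)[OF uv s]
  note 1 = weighted_L2_pairing_tendsto[OF p u rapid_measurable[OF r(2)] ip[OF r(2)] i(1) U]
  note 2 = weighted_L2_pairing_tendsto[OF q v rapid_measurable[OF r(1)] iq[OF r(1)] i(2) V]
  show "integrable lborel (\<lambda>x. U x * fourier \<phi> x)" "integrable lborel (\<lambda>x. V x * \<phi> x)"
    by (fact 1(1) 2(1))+
  show "(LINT x|lborel. U x * fourier \<phi> x) = (LINT x|lborel. V x * \<phi> x)"
    by (rule LIMSEQ_unique[OF 1(2) 2(2)[folded i(3)]])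
qed (use U V in auto)

subsection \<open>The space \<open>Ds\<close>\<close>

text \<open>A relation in place of the choice in \<open>half_frac_laplacian\<close>: linearity,
  limits and changes of representative are statements about pairs, and the choice is resolved once,
  in \<open>Ds_norm_eq\<close>.\<close>

definition frac_pair :: "real \<Rightarrow> ('a::euclidean_space \<Rightarrow> real) \<Rightarrow> ('a \<Rightarrow> real) \<Rightarrow> bool" where
  "frac_pair s u w \<longleftrightarrow> w \<in> weighted_L2 (\<lambda>_. 1) \<and> has_frac_laplacian (s / 2) u w"

lemma Ds_iff: "u \<in> Ds s \<longleftrightarrow> u \<in> weighted_L2 (\<lambda>x. norm x powr (- 2 * s)) \<and> (\<exists>w. frac_pair s u w)"
  by (auto simp: Ds_def frac_pair_def)

lemma frac_pairD:
  assumes "frac_pair s u w"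
  obtains v where "has_fourier (\<lambda>x. of_real (u x)) v"
    "has_fourier (\<lambda>x. of_real (w x)) (\<lambda>\<xi>. of_real (norm \<xi> powr s) * v \<xi>)"
  using assms unfolding frac_pair_def has_frac_laplacian_def by auto

lemma frac_pair_lin:
  assumes 1: "frac_pair s u w" and 2: "frac_pair s u' w'"
  shows "frac_pair s (\<lambda>x. c * u x + d * u' x) (\<lambda>x. c * w x + d * w' x)"
proof -
  have w: "w \<in> weighted_L2 (\<lambda>_. 1)" "w' \<in> weighted_L2 (\<lambda>_. 1)" using 1 2 by (auto simp: frac_pair_def)
  have "(\<lambda>x. c *\<^sub>R w x + d *\<^sub>R w' x) \<in> weighted_L2 (\<lambda>_. 1)"
    by (intro weighted_L2_add weighted_L2_scale w) auto
  moreover obtain v where v: "has_fourier (\<lambda>x. of_real (u x)) v"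
    "has_fourier (\<lambda>x. of_real (w x)) (\<lambda>\<xi>. of_real (norm \<xi> powr s) * v \<xi>)" using frac_pairD[OF 1] by blast
  obtain v' where v': "has_fourier (\<lambda>x. of_real (u' x)) v'"
    "has_fourier (\<lambda>x. of_real (w' x)) (\<lambda>\<xi>. of_real (norm \<xi> powr s) * v' \<xi>)" using frac_pairD[OF 2] by blast
  have "has_fourier (\<lambda>x. of_real (c * u x + d * u' x)) (\<lambda>\<xi>. of_real c * v \<xi> + of_real d * v' \<xi>)"
    using has_fourier_lin[OF v(1) v'(1), of "of_real c" "of_real d"] by simp
  moreover have "has_fourier (\<lambda>x. of_real (c * w x + d * w' x)) (\<lambda>\<xi>. of_real (norm \<xi> powr s) * (of_real c * v \<xi> + of_real d * v' \<xi>))"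
    using has_fourier_lin[OF v(2) v'(2), of "of_real c" "of_real d"] by (simp add: algebra_simps)
  ultimately show ?thesis unfolding frac_pair_def has_frac_laplacian_def by auto
qed

text \<open>The multiplier \<open>norm \<xi> powr s\<close> vanishes at most at the origin, a null
  set, so u, its transform, the multiplied transform and w vanish together. This yields uniqueness
  of w, and that \<open>Ds_norm\<close> separates points.\<close>

lemma frac_pair_zero_iff:
  assumes "frac_pair s u w"
  shows "(AE x in lborel. u x = 0) \<longleftrightarrow> (AE x in lborel. w x = 0)"
proof -
  obtain v where v: "has_fourier (\<lambda>x. of_real (u x)) v"
    "has_fourier (\<lambda>x. of_real (w x)) (\<lambda>\<xi>. of_real (norm \<xi> powr s) * v \<xi>)" using frac_pairD[OF assms] by blast
  have "(AE x in lborel. u x = 0) \<longleftrightarrow> (AE x in lborel. v x = 0)"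
    using has_fourier_zero_iff[OF v(1)] by simp
  also have "\<dots> \<longleftrightarrow> (AE x in lborel. of_real (norm x powr s) * v x = 0)"
  proof
    assume "AE x in lborel. of_real (norm x powr s) * v x = 0"
    then show "AE x in lborel. v x = 0"
      using AE_lborel_singleton[of 0] by eventually_elim auto
  qed (auto elim: AE_mp)
  also have "\<dots> \<longleftrightarrow> (AE x in lborel. w x = 0)"
    using has_fourier_zero_iff[OF v(2)] by simp
  finally show ?thesis .
qed

lemma frac_pair_unique:
  assumes "frac_pair s u w" "frac_pair s u' w'"
  shows "ae_eq u u' \<longleftrightarrow> ae_eq w w'"
  using frac_pair_zero_iff[OF frac_pair_lin[OF assms, of 1 "-1"]] by (simp add: ae_eq_def)

lemma Ds_norm_eq:
  assumes "frac_pair s u w"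
  shows "Ds_norm s u = weighted_L2_norm (\<lambda>_. 1) w"
proof -
  have "frac_pair s u (half_frac_laplacian s u)"
    using someI_ex[of "\<lambda>w. w \<in> weighted_L2 (\<lambda>_. 1) \<and> has_frac_laplacian (s / 2) u w"] assms
    unfolding half_frac_laplacian_def frac_pair_def by blast
  note f = this
  have "ae_eq (half_frac_laplacian s u) w"
    using frac_pair_unique[OF f assms] by (simp add: ae_eq_def)
  then have "weighted_L2_norm (\<lambda>_. 1) (half_frac_laplacian s u) = weighted_L2_norm (\<lambda>_. 1) w"
    using f assms by (intro weighted_L2_norm_cong_AE) (auto simp: frac_pair_def weighted_L2_def)
  then show ?thesis
    by (simp add: Ds_norm_def Ds_inner_def weighted_L2_norm_def power2_eq_square)
qed

lemma Ds_norm_zero_imp: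
  assumes "u \<in> Ds s" "Ds_norm s u = 0"
  shows "AE x in lborel. u x = 0"
proof -
  obtain w where w: "frac_pair s u w" using assms(1) by (auto simp: Ds_iff)
  then have "AE x in lborel. w x = 0"
    using assms(2) Ds_norm_eq[OF w] by (intro weighted_L2_norm_eq_0[of "\<lambda>_. 1"]) (auto simp: frac_pair_def)
  then show ?thesis using frac_pair_zero_iff[OF w] by simp
qed

lemma Ds_lin:
  assumes u: "u \<in> Ds s" and u': "u' \<in> Ds s"
  shows "(\<lambda>x. c * u x + d * u' x) \<in> Ds s"
proof -
  have "(\<lambda>x. c *\<^sub>R u x + d *\<^sub>R u' x) \<in> weighted_L2 (\<lambda>x. norm x powr (- 2 * s))"
    using u u' by (intro weighted_L2_add weighted_L2_scale) (auto simp: Ds_iff)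
  then show ?thesis using u u' frac_pair_lin unfolding Ds_iff by fastforce
qed

lemma Ds_norm_diff_le:
  assumes u: "u \<in> Ds s" and u': "u' \<in> Ds s"
  shows "Ds_norm s (\<lambda>x. u x - u' x) \<le> Ds_norm s u + Ds_norm s u'"
proof -
  obtain w w' where w: "frac_pair s u w" "frac_pair s u' w'" using u u' by (auto simp: Ds_iff)
  have "frac_pair s (\<lambda>x. u x - u' x) (\<lambda>x. w x - w' x)" using frac_pair_lin[OF w, of 1 "-1"] by simp
  from Ds_norm_eq[OF this] show ?thesis
    unfolding Ds_norm_eq[OF w(1)] Ds_norm_eq[OF w(2)]
    using w by (simp add: weighted_L2_diff frac_pair_def)
qed

lemma frac_pair_cong:
  assumes "frac_pair s u w" "u' \<in> borel_measurable borel" "ae_eq u u'"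
  shows "frac_pair s u' w"
proof -
  obtain v where v: "has_fourier (\<lambda>x. of_real (u x)) v"
    "has_fourier (\<lambda>x. of_real (w x)) (\<lambda>\<xi>. of_real (norm \<xi> powr s) * v \<xi>)" using frac_pairD[OF assms(1)] by blast
  note [measurable] = has_fourierD(1)[OF v(1)] assms(2)
  have "has_fourier (\<lambda>x. of_real (u' x)) v"
    unfolding has_fourier_def
  proof (intro conjI allI impI)
    fix \<phi> :: "'a \<Rightarrow> complex" assume s: "schwartz \<phi>"
    note [measurable] = rapid_measurable[OF schwartz_rapid[OF s]]
    have e: "AE x in lborel. of_real (u x) * fourier \<phi> x = of_real (u' x) * fourier \<phi> x"
      using assms(3) unfolding ae_eq_def by eventually_elim simp
    show "integrable lborel (\<lambda>x. of_real (u' x) * fourier \<phi> x)"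
      by (rule integrable_cong_AE[THEN iffD1, OF _ _ e has_fourierD(3)[OF v(1) s]]) measurable
    show "integrable lborel (\<lambda>x. v x * \<phi> x)" by (rule has_fourierD(4)[OF v(1) s])
    have "(LINT x|lborel. of_real (u x) * fourier \<phi> x) = (LINT x|lborel. of_real (u' x) * fourier \<phi> x)"
      by (rule integral_cong_AE) (use e in auto)
    then show "(LINT x|lborel. of_real (u' x) * fourier \<phi> x) = (LINT x|lborel. v x * \<phi> x)"
      using has_fourierD(5)[OF v(1) s] by simp
  qed (use has_fourierD(2)[OF v(1)] in auto)
  then show ?thesis using v assms(1) unfolding frac_pair_def has_frac_laplacian_def by auto
qed

subsection \<open>Trace estimates\<close>

lemma nn_integral_powr_0:
  fixes a r :: real
  assumes a: "a > -1" and r: "r \<ge> 0"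
  shows "(\<integral>\<^sup>+t. ennreal (indicator {0<..<r} t * t powr a) \<partial>lborel) = ennreal (r powr (a + 1) / (a + 1))"
proof -
  have "((\<lambda>t. t powr a) has_integral r powr (a + 1) / (a + 1)) {0..r}"
    by (rule has_integral_powr_from_0[OF a r])
  then have "((\<lambda>t. if t \<in> {0..r} then t powr a else 0) has_integral r powr (a + 1) / (a + 1)) UNIV"
    by (simp only: has_integral_restrict_UNIV)
  then have "(\<integral>\<^sup>+t. ennreal (if t \<in> {0..r} then t powr a else 0) \<partial>lborel) = ennreal (r powr (a + 1) / (a + 1))"
    by (intro nn_integral_has_integral_lborel) auto
  moreover have "(\<integral>\<^sup>+t. ennreal (indicator {0<..<r} t * t powr a) \<partial>lborel) = (\<integral>\<^sup>+t. ennreal (if t \<in> {0..r} then t powr a else 0) \<partial>lborel)"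
    by (rule nn_integral_cong_AE, use AE_lborel_singleton[of 0] AE_lborel_singleton[of r] in eventually_elim)
       (auto simp: indicator_def)
  ultimately show ?thesis by simp
qed

lemma norm_diff_le_nn_integral:
  fixes f f' :: "real \<Rightarrow> 'a::euclidean_space"
  assumes d: "\<And>t. (f has_vector_derivative f' t) (at t)" and c: "continuous_on UNIV f'" and y: "y \<ge> 0"
  shows "ennreal (norm (f y - f 0)) \<le> (\<integral>\<^sup>+t. ennreal (indicator {0<..<y} t * norm (f' t)) \<partial>lborel)"
proof -
  have "(f' has_integral f y - f 0) {0..y}"
    by (rule fundamental_theorem_of_calculus) (use y d in \<open>auto intro: has_vector_derivative_at_within\<close>)
  moreover have "f' integrable_on {0..y}" "(\<lambda>t. norm (f' t)) integrable_on {0..y}"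
    by (intro integrable_continuous_interval continuous_on_subset[OF c] continuous_intros; simp)+
  ultimately have le: "norm (f y - f 0) \<le> integral {0..y} (\<lambda>t. norm (f' t))"
    by (metis integral_norm_bound_integral integral_unique order_refl)
  have "((\<lambda>t. if t \<in> {0..y} then norm (f' t) else 0) has_integral integral {0..y} (\<lambda>t. norm (f' t))) UNIV"
    unfolding has_integral_restrict_UNIV using \<open>(\<lambda>t. norm (f' t)) integrable_on {0..y}\<close> by (rule integrable_integral)
  then have "(\<integral>\<^sup>+t. ennreal (if t \<in> {0..y} then norm (f' t) else 0) \<partial>lborel) = ennreal (integral {0..y} (\<lambda>t. norm (f' t)))"
    using borel_measurable_continuous_onI[OF c] by (intro nn_integral_has_integral_lborel) auto
  moreover have "(\<integral>\<^sup>+t. ennreal (indicator {0<..<y} t * norm (f' t)) \<partial>lborel) = (\<integral>\<^sup>+t. ennreal (if t \<in> {0..y} then norm (f' t) else 0) \<partial>lborel)"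
    by (rule nn_integral_cong_AE, use AE_lborel_singleton[of 0] AE_lborel_singleton[of y] in eventually_elim)
       (auto simp: indicator_def)
  ultimately show ?thesis using le by (simp add: ennreal_leI)
qed

lemma ennreal_mult_assoc:
  assumes "0 \<le> a" "0 \<le> b"
  shows "ennreal a * (ennreal b * X) = ennreal (a * b) * X"
  using assms by (simp add: ennreal_mult mult.assoc)

lemma ennreal_mult_lin:
  assumes "0 \<le> c" "0 \<le> p" "0 \<le> q"
  shows "ennreal c * (ennreal p * X + ennreal q * Y) = ennreal (c * p) * X + ennreal (c * q) * Y"
  using assms by (simp only: distrib_left ennreal_mult_assoc)

text \<open>The difference f(y) - f(0) is estimated by Cauchy-Schwarz with the factors t^(-b/2) and
  t^(b/2), the first being square integrable near 0 since b < 1. Multiplying the bound for |f(0)|^2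
  by y^b and integrating over 0 < y < r gives r^(1+b) / (1 + b) on the left, which explains the
  factors 1 + b.\<close>

lemma trace_1d:
  fixes f f' :: "real \<Rightarrow> 'a::euclidean_space"
  assumes d: "\<And>t. (f has_vector_derivative f' t) (at t)" and c: "continuous_on UNIV f'"
    and b: "-1 < b" "b < 1" and r: "r > 0"
  shows "ennreal ((norm (f 0))\<^sup>2 * r powr (1 + b)) \<le>
    ennreal (2 * (1 + b)) * (\<integral>\<^sup>+y. ennreal (indicator {0<..<r} y * y powr b * (norm (f y))\<^sup>2) \<partial>lborel) +
    ennreal ((1 + b) / (1 - b) * r\<^sup>2) * (\<integral>\<^sup>+y. ennreal (indicator {0<..<r} y * y powr b * (norm (f' y))\<^sup>2) \<partial>lborel)"
proof -
  have cf: "continuous_on UNIV f"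
    using d by (auto simp: continuous_on_eq_continuous_at intro: has_vector_derivative_continuous)
  note [measurable] = borel_measurable_continuous_onI[OF c] borel_measurable_continuous_onI[OF cf]
  define E where "E = (\<integral>\<^sup>+y. ennreal (indicator {0<..<r} y * y powr b * (norm (f' y))\<^sup>2) \<partial>lborel)"
  define F where "F = (\<integral>\<^sup>+y. ennreal (indicator {0<..<r} y * y powr b * (norm (f y))\<^sup>2) \<partial>lborel)"
  have E0: "ennreal ((norm (f y - f 0))\<^sup>2) \<le> ennreal (y powr (1 - b) / (1 - b)) * E" if y: "0 < y" "y < r" for y
  proof -
    let ?g = "\<lambda>t. indicator {0<..<y} t * t powr (- b / 2)"
    let ?h = "\<lambda>t. indicator {0<..<y} t * t powr (b / 2) * norm (f' t)"
    have sq: "(t powr (a / 2))\<^sup>2 = t powr a" for t a :: real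
      by (simp add: power2_eq_square flip: powr_add)
    have "ennreal ((norm (f y - f 0))\<^sup>2) = (ennreal (norm (f y - f 0)))\<^sup>2" by (simp add: ennreal_power)
    also have "\<dots> \<le> (\<integral>\<^sup>+t. ennreal (indicator {0<..<y} t * norm (f' t)) \<partial>lborel)\<^sup>2"
      by (intro power_mono norm_diff_le_nn_integral[OF d c]) (use y in auto)
    also have "(\<integral>\<^sup>+t. ennreal (indicator {0<..<y} t * norm (f' t)) \<partial>lborel) = (\<integral>\<^sup>+t. ennreal (?g t) * ennreal (?h t) \<partial>lborel)"
    proof (rule nn_integral_cong)
      fix t
      have "?g t * ?h t = indicator {0<..<y} t * norm (f' t)"
        by (auto simp: indicator_def powr_minus)
      then show "ennreal (indicator {0<..<y} t * norm (f' t)) = ennreal (?g t) * ennreal (?h t)"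
        by (simp flip: ennreal_mult)
    qed
    also have "\<dots>\<^sup>2 \<le> (\<integral>\<^sup>+t. (ennreal (?g t))\<^sup>2 \<partial>lborel) * (\<integral>\<^sup>+t. (ennreal (?h t))\<^sup>2 \<partial>lborel)"
      by (rule Cauchy_Schwarz_nn_integral) measurable
    also have "(\<integral>\<^sup>+t. (ennreal (?g t))\<^sup>2 \<partial>lborel) = (\<integral>\<^sup>+t. ennreal (indicator {0<..<y} t * t powr (- b)) \<partial>lborel)"
      by (intro nn_integral_cong) (auto simp: ennreal_power power_mult_distrib indicator_def sq[of _ "- b", simplified])
    also have "\<dots> = ennreal (y powr (1 - b) / (1 - b))"
      using nn_integral_powr_0[of "- b" y] b y by (simp add: add.commute)
    also have "(\<integral>\<^sup>+t. (ennreal (?h t))\<^sup>2 \<partial>lborel) \<le> E"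
      unfolding E_def using y
      by (intro nn_integral_mono) (auto simp: ennreal_power power_mult_distrib indicator_def sq intro!: ennreal_leI)
    finally show ?thesis by (simp add: mult_left_mono)
  qed
  \<comment> \<open>Since y^b y^(1-b) = y, the increment term carries the plain factor y, whose
    integral over the interval is r^2 / 2.\<close>
  have pw: "ennreal (indicator {0<..<r} y * y powr b) * ennreal ((norm (f 0))\<^sup>2) \<le>
     ennreal 2 * ennreal (indicator {0<..<r} y * y powr b * (norm (f y))\<^sup>2) + ennreal (indicator {0<..<r} y * y powr 1) * (ennreal (2 / (1 - b)) * E)" for y
  proof (cases "y \<in> {0<..<r}")
    case True
    then have y: "0 < y" "y < r" by auto
    have "(norm (f 0))\<^sup>2 \<le> 2 * (norm (f y))\<^sup>2 + 2 * (norm (f y - f 0))\<^sup>2"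
    proof -
      have "norm (f 0) \<le> norm (f y) + norm (f y - f 0)" by (metis norm_triangle_sub norm_minus_commute)
      then have "(norm (f 0))\<^sup>2 \<le> (norm (f y) + norm (f y - f 0))\<^sup>2" by (intro power_mono) auto
      also have "\<dots> \<le> 2 * (norm (f y))\<^sup>2 + 2 * (norm (f y - f 0))\<^sup>2"
        using sum_squares_bound[of "norm (f y)" "norm (f y - f 0)"] by (simp add: power2_sum)
      finally show ?thesis .
    qed
    then have "ennreal ((norm (f 0))\<^sup>2) \<le> ennreal (2 * (norm (f y))\<^sup>2 + 2 * (norm (f y - f 0))\<^sup>2)"
      by (rule ennreal_leI)
    also have "\<dots> = ennreal 2 * ennreal ((norm (f y))\<^sup>2) + ennreal 2 * ennreal ((norm (f y - f 0))\<^sup>2)"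
      by (simp add: ennreal_mult)
    also have "\<dots> \<le> ennreal 2 * ennreal ((norm (f y))\<^sup>2) + ennreal 2 * (ennreal (y powr (1 - b) / (1 - b)) * E)"
      by (intro add_mono mult_left_mono E0[OF y]) auto
    finally have "ennreal (y powr b) * ennreal ((norm (f 0))\<^sup>2) \<le> ennreal (y powr b) * (ennreal 2 * ennreal ((norm (f y))\<^sup>2) + ennreal 2 * (ennreal (y powr (1 - b) / (1 - b)) * E))"
      by (intro mult_left_mono) auto
    also have "\<dots> = ennreal (y powr b * 2) * ennreal ((norm (f y))\<^sup>2) + ennreal (y powr b * (2 * (y powr (1 - b) / (1 - b)))) * E"
      using b by (subst ennreal_mult_assoc[of 2]; (subst ennreal_mult_lin)?) auto
    also have "ennreal (y powr b * 2) * ennreal ((norm (f y))\<^sup>2) = ennreal 2 * ennreal (y powr b * (norm (f y))\<^sup>2)"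
      by (simp only: ennreal_mult[symmetric] powr_ge_zero zero_le_power2 mult_nonneg_nonneg zero_le_numeral mult.left_commute mult.commute mult.assoc)
    also have "y powr b * (2 * (y powr (1 - b) / (1 - b))) = y powr 1 * (2 / (1 - b))"
    proof -
      have "y powr b * y powr (1 - b) = y powr 1" by (simp flip: powr_add)
      then show ?thesis by (simp add: field_simps)
    qed
    also have "ennreal (y powr 1 * (2 / (1 - b))) = ennreal (y powr 1) * ennreal (2 / (1 - b))"
      using b by (intro ennreal_mult) auto
    finally show ?thesis using True by (simp add: mult.assoc)
  qed auto
  have "ennreal (r powr (b + 1) / (b + 1)) * ennreal ((norm (f 0))\<^sup>2) =
     (\<integral>\<^sup>+y. ennreal (indicator {0<..<r} y * y powr b) * ennreal ((norm (f 0))\<^sup>2) \<partial>lborel)"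
    using nn_integral_powr_0[OF b(1), of r] r by (subst nn_integral_multc) auto
  also have "\<dots> \<le> (\<integral>\<^sup>+y. ennreal 2 * ennreal (indicator {0<..<r} y * y powr b * (norm (f y))\<^sup>2) + ennreal (indicator {0<..<r} y * y powr 1) * (ennreal (2 / (1 - b)) * E) \<partial>lborel)"
    by (rule nn_integral_mono) (rule pw)
  also have "\<dots> = ennreal 2 * F + ennreal (r powr (1 + 1) / (1 + 1)) * (ennreal (2 / (1 - b)) * E)"
    unfolding F_def using nn_integral_powr_0[of 1 r] r
    by (subst nn_integral_add; (measurable)?) (simp add: nn_integral_cmult nn_integral_multc)
  finally have "ennreal (1 + b) * (ennreal (r powr (b + 1) / (b + 1)) * ennreal ((norm (f 0))\<^sup>2)) \<le>
     ennreal (1 + b) * (ennreal 2 * F + ennreal (r powr (1 + 1) / (1 + 1)) * (ennreal (2 / (1 - b)) * E))"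
    by (rule mult_left_mono) simp
  also have "\<dots> = ennreal (2 * (1 + b)) * F + ennreal ((1 + b) * ((r powr (1 + 1) / (1 + 1)) * (2 / (1 - b)))) * E"
    using b by (subst ennreal_mult_assoc; (subst ennreal_mult_lin)?) (auto simp: mult.commute)
  also have "(1 + b) * ((r powr (1 + 1) / (1 + 1)) * (2 / (1 - b))) = (1 + b) / (1 - b) * r\<^sup>2"
    using r b by (simp add: divide_simps powr_numeral)
  also have "ennreal (1 + b) * (ennreal (r powr (b + 1) / (b + 1)) * ennreal ((norm (f 0))\<^sup>2)) = ennreal ((norm (f 0))\<^sup>2 * r powr (1 + b))"
  proof -
    have "(1 + b) * (r powr (b + 1) / (b + 1) * (norm (f 0))\<^sup>2) = (norm (f 0))\<^sup>2 * r powr (1 + b)"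
      using b by (simp add: divide_simps add.commute)
    then show ?thesis using b by (simp flip: ennreal_mult)
  qed
  finally show ?thesis unfolding E_def F_def .
qed

section \<open>The weights and the Hardy-type trace inequality\<close>

lemma borel_measurable_weight [measurable]:
  "weight b i \<in> borel_measurable (borel :: ((real^'n) \<times> real) measure)"
proof -
  have [measurable]: "snd \<in> borel_measurable (borel :: ((real^'n) \<times> real) measure)"
    by (intro borel_measurable_continuous_onI continuous_intros)
  have [measurable]: "norm \<in> borel_measurable (borel :: ((real^'n) \<times> real) measure)"
    by (intro borel_measurable_continuous_onI continuous_intros)
  show ?thesis unfolding weight_def[abs_def] by measurable
qed

lemma weight_nonneg [simp]: "weight b i z \<ge> 0"
  by (simp add: weight_def)

lemma AE_snd_nonzero: "AE z in lborel. snd (z :: (real^'n) \<times> real) \<noteq> 0"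
  using AE_lborel_inner_neq[of "(0,1) :: (real^'n) \<times> real" 0] by (simp add: inner_prod_def)

lemma weight_pos: "AE z in lborel. weight b i z > 0"
  using AE_snd_nonzero by eventually_elim
    (auto simp: weight_def zero_prod_def intro!: divide_pos_pos zero_less_power)

lemma AE_norm_powr_pos: "AE x in lborel. norm (x::'a::euclidean_space) powr a > 0"
  using AE_lborel_singleton[of 0] by eventually_elim auto

lemma nn_integral_lborel_pair:
  fixes h :: "'a::euclidean_space \<times> 'b::euclidean_space \<Rightarrow> ennreal"
  assumes "h \<in> borel_measurable borel"
  shows "(\<integral>\<^sup>+x. \<integral>\<^sup>+y. h (x, y) \<partial>lborel \<partial>lborel) = (\<integral>\<^sup>+z. h z \<partial>lborel)"
    "(\<integral>\<^sup>+y. \<integral>\<^sup>+x. h (x, y) \<partial>lborel \<partial>lborel) = (\<integral>\<^sup>+z. h z \<partial>lborel)"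
proof -
  have h: "h \<in> borel_measurable (lborel \<Otimes>\<^sub>M lborel)" using assms by (simp add: lborel_prod)
  show "(\<integral>\<^sup>+x. \<integral>\<^sup>+y. h (x, y) \<partial>lborel \<partial>lborel) = (\<integral>\<^sup>+z. h z \<partial>lborel)"
    by (subst lborel.nn_integral_fst[OF h]) (simp add: lborel_prod)
  show "(\<integral>\<^sup>+y. \<integral>\<^sup>+x. h (x, y) \<partial>lborel \<partial>lborel) = (\<integral>\<^sup>+z. h z \<partial>lborel)"
    by (subst lborel_pair.nn_integral_snd[OF h]) (simp add: lborel_prod)
qed

text \<open>On the line over x, \<open>trace_1d\<close> is applied with the length \<theta> norm x.
  There |(x, y)|^2 \<le> 2 |x|^2, so powers of |x| may be traded for the weights at the price of 2^k
  and 2^(k-1). A small \<theta> makes the gradient coefficient small, its exponent 1 - b being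
  positive, while the other coefficient grows.\<close>

lemma trace_Hardy:
  fixes f :: "(real^'n) \<times> real \<Rightarrow> real"
  assumes f: "Ck 1 f" and b: "-1 < b" "b < 1" and k: "k \<ge> 1" and \<theta>: "0 < \<theta>" "\<theta> \<le> 1"
  shows "(\<integral>\<^sup>+x. ennreal (norm x powr (- 2 * (real k - (1 + b) / 2)) * (norm (trace_map f x))\<^sup>2) \<partial>lborel) \<le>
     ennreal (2 * (1 + b) * \<theta> powr (- 1 - b) * 2 ^ k) * (\<integral>\<^sup>+z. ennreal (weight b k z * (norm (f z))\<^sup>2) \<partial>lborel) +
     ennreal ((1 + b) / (1 - b) * \<theta> powr (1 - b) * 2 ^ (k - 1)) *
       (\<integral>\<^sup>+z. ennreal (weight b (k - 1) z * (norm (grad f z))\<^sup>2) \<partial>lborel)"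
proof -
  let ?dy = "partial_deriv (0, 1) f"
  have cf: "continuous_on UNIV f" and cdy: "continuous_on UNIV ?dy"
    using f by (auto intro: Ck_continuous Ck_1_continuous_partial[of 1] simp del: Ck.simps One_nat_def)
  have [measurable]: "f \<in> borel_measurable borel" "?dy \<in> borel_measurable borel"
    using cf cdy by (auto intro: borel_measurable_continuous_onI)
  define A where "A = 2 * (1 + b) * \<theta> powr (- 1 - b) * 2 ^ k"
  define B where "B = (1 + b) / (1 - b) * \<theta> powr (1 - b) * 2 ^ (k - 1)"
  have AB: "A \<ge> 0" "B \<ge> 0" using b by (auto simp: A_def B_def)
  let ?F = "\<lambda>x y. weight b k (x, y) * (norm (f (x, y)))\<^sup>2"
  let ?G = "\<lambda>x y. weight b (k - 1) (x, y) * (norm (?dy (x, y)))\<^sup>2"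
  have pw: "ennreal (norm x powr (- 2 * (real k - (1 + b) / 2)) * (norm (trace_map f x))\<^sup>2) \<le>
     ennreal A * (\<integral>\<^sup>+y. ennreal (?F x y) \<partial>lborel) + ennreal B * (\<integral>\<^sup>+y. ennreal (?G x y) \<partial>lborel)"
    if x: "x \<noteq> 0" for x
  proof -
    define r where "r = \<theta> * norm x"
    have r: "r > 0" "r \<le> norm x" using x \<theta> by (auto simp: r_def mult_le_cancel_right1)
    \<comment> \<open>Chosen so that c r^(1+b) is the target weight: \<theta> cancels, and norm x is
      left with the exponent - 2 k + 1 + b.\<close>
    define c where "c = \<theta> powr (- 1 - b) * norm x powr (- 2 * real k)"
    have c: "c \<ge> 0" by (simp add: c_def)
    have wt: "indicator {0<..<r} y * (y powr b * norm x powr (- 2 * real i)) \<le> 2 ^ i * weight b i (x, y)" for i y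
    proof (cases "y \<in> {0<..<r}")
      case True
      then have y: "0 < y" "y \<le> norm x" using r by auto
      have "(norm (x, y))\<^sup>2 = (norm x)\<^sup>2 + y\<^sup>2" by (simp add: norm_prod_def)
      also have "\<dots> \<le> 2 * (norm x)\<^sup>2" using y by (simp add: power_mono)
      finally have "((norm (x, y))\<^sup>2) ^ i \<le> (2 * (norm x)\<^sup>2) ^ i" by (intro power_mono) auto
      then have le: "norm (x, y) ^ (2 * i) \<le> 2 ^ i * norm x ^ (2 * i)"
        by (simp add: power_mult_distrib flip: power_mult)
      have p: "norm x ^ (2 * i) > 0" "norm (x, y) ^ (2 * i) > 0"
        using x by (auto simp: zero_prod_def intro!: zero_less_power)
      have "norm x powr (- 2 * real i) = 1 / norm x ^ (2 * i)"
        using x powr_realpow[of "norm x" "2 * i"] by (simp add: powr_minus divide_inverse)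
      also have "\<dots> \<le> 2 ^ i / norm (x, y) ^ (2 * i)"
        using le p by (simp add: field_simps)
      finally have "y powr b * norm x powr (- 2 * real i) \<le> y powr b * (2 ^ i / norm (x, y) ^ (2 * i))"
        by (intro mult_left_mono) auto
      then show ?thesis using True y by (simp add: weight_def mult_ac)
    qed auto
    have "ennreal ((norm (f (x, 0)))\<^sup>2 * r powr (1 + b)) \<le>
      ennreal (2 * (1 + b)) * (\<integral>\<^sup>+y. ennreal (indicator {0<..<r} y * y powr b * (norm (f (x, y)))\<^sup>2) \<partial>lborel) +
      ennreal ((1 + b) / (1 - b) * r\<^sup>2) * (\<integral>\<^sup>+y. ennreal (indicator {0<..<r} y * y powr b * (norm (?dy (x, y)))\<^sup>2) \<partial>lborel)"
    proof (rule trace_1d[of "\<lambda>y. f (x, y)", OF _ _ b r(1)])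
      show "((\<lambda>y. f (x, y)) has_vector_derivative ?dy (x, t)) (at t)" for t
        using has_vector_derivative_slice[OF Ck_1_differentiable[OF f, of "(x, t)"]]
        by (simp add: has_real_derivative_iff_has_vector_derivative)
      show "continuous_on UNIV (\<lambda>t. ?dy (x, t))"
        by (rule continuous_on_compose2[OF cdy]) (auto intro!: continuous_intros)
    qed
    then have "ennreal c * ennreal ((norm (f (x, 0)))\<^sup>2 * r powr (1 + b)) \<le>
      ennreal c * (ennreal (2 * (1 + b)) * (\<integral>\<^sup>+y. ennreal (indicator {0<..<r} y * y powr b * (norm (f (x, y)))\<^sup>2) \<partial>lborel) +
      ennreal ((1 + b) / (1 - b) * r\<^sup>2) * (\<integral>\<^sup>+y. ennreal (indicator {0<..<r} y * y powr b * (norm (?dy (x, y)))\<^sup>2) \<partial>lborel))"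
      by (rule mult_left_mono) simp
    also have "\<dots> = ennreal (c * (2 * (1 + b))) * (\<integral>\<^sup>+y. ennreal (indicator {0<..<r} y * y powr b * (norm (f (x, y)))\<^sup>2) \<partial>lborel) +
      ennreal (c * ((1 + b) / (1 - b) * r\<^sup>2)) * (\<integral>\<^sup>+y. ennreal (indicator {0<..<r} y * y powr b * (norm (?dy (x, y)))\<^sup>2) \<partial>lborel)"
      using b c by (intro ennreal_mult_lin) auto
    also have "\<dots> \<le> ennreal A * (\<integral>\<^sup>+y. ennreal (?F x y) \<partial>lborel) + ennreal B * (\<integral>\<^sup>+y. ennreal (?G x y) \<partial>lborel)"
    proof (intro add_mono)
      have "c * (2 * (1 + b)) * (indicator {0<..<r} y * y powr b * (norm (f (x, y)))\<^sup>2) \<le> A * ?F x y" for y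
      proof -
        have "c * (2 * (1 + b)) * (indicator {0<..<r} y * y powr b * (norm (f (x, y)))\<^sup>2) =
          (2 * (1 + b) * \<theta> powr (- 1 - b) * (norm (f (x, y)))\<^sup>2) * (indicator {0<..<r} y * (y powr b * norm x powr (- 2 * real k)))"
          by (simp add: c_def mult_ac)
        also have "\<dots> \<le> (2 * (1 + b) * \<theta> powr (- 1 - b) * (norm (f (x, y)))\<^sup>2) * (2 ^ k * weight b k (x, y))"
          using b by (intro mult_left_mono wt) auto
        finally show ?thesis by (simp add: A_def mult_ac)
      qed
      then show "ennreal (c * (2 * (1 + b))) * (\<integral>\<^sup>+y. ennreal (indicator {0<..<r} y * y powr b * (norm (f (x, y)))\<^sup>2) \<partial>lborel)
         \<le> ennreal A * (\<integral>\<^sup>+y. ennreal (?F x y) \<partial>lborel)"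
        using b c AB
        by (subst (1 2) nn_integral_cmult[symmetric]; (measurable)?)
           (intro nn_integral_mono, simp add: ennreal_leI flip: ennreal_mult)
      have "c * ((1 + b) / (1 - b) * r\<^sup>2) * (indicator {0<..<r} y * y powr b * (norm (?dy (x, y)))\<^sup>2) \<le> B * ?G x y" for y
      proof -
        have "norm x powr (- 2 * real k) * (norm x)\<^sup>2 = norm x powr (- 2 * real k) * norm x powr 2"
          using x by (simp add: powr_numeral)
        also have "\<dots> = norm x powr (- 2 * real (k - 1))"
          using k by (subst powr_add[symmetric], intro arg_cong[where f="\<lambda>t. norm x powr t"]) (simp add: of_nat_diff)
        finally have 1: "norm x powr (- 2 * real k) * (norm x)\<^sup>2 = norm x powr (- 2 * real (k - 1))" .
        have "\<theta> powr (- 1 - b) * \<theta>\<^sup>2 = \<theta> powr (- 1 - b) * \<theta> powr 2" using \<theta> by (simp add: powr_numeral)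
        also have "\<dots> = \<theta> powr (1 - b)" by (simp flip: powr_add)
        finally have 2: "\<theta> powr (- 1 - b) * \<theta>\<^sup>2 = \<theta> powr (1 - b)" .
        have "c * ((1 + b) / (1 - b) * r\<^sup>2) = (1 + b) / (1 - b) * (\<theta> powr (- 1 - b) * \<theta>\<^sup>2) * (norm x powr (- 2 * real k) * (norm x)\<^sup>2)"
          by (simp add: c_def r_def power_mult_distrib mult_ac)
        then have "c * ((1 + b) / (1 - b) * r\<^sup>2) = (1 + b) / (1 - b) * \<theta> powr (1 - b) * norm x powr (- 2 * real (k - 1))"
          unfolding 1 2 .
        then have "c * ((1 + b) / (1 - b) * r\<^sup>2) * (indicator {0<..<r} y * y powr b * (norm (?dy (x, y)))\<^sup>2) =
          ((1 + b) / (1 - b) * \<theta> powr (1 - b) * (norm (?dy (x, y)))\<^sup>2) * (indicator {0<..<r} y * (y powr b * norm x powr (- 2 * real (k - 1))))"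
          by (simp only: mult_ac)
        also have "\<dots> \<le> ((1 + b) / (1 - b) * \<theta> powr (1 - b) * (norm (?dy (x, y)))\<^sup>2) * (2 ^ (k - 1) * weight b (k - 1) (x, y))"
          using b by (intro mult_left_mono wt) auto
        finally show ?thesis by (simp add: B_def mult_ac)
      qed
      then show "ennreal (c * ((1 + b) / (1 - b) * r\<^sup>2)) * (\<integral>\<^sup>+y. ennreal (indicator {0<..<r} y * y powr b * (norm (?dy (x, y)))\<^sup>2) \<partial>lborel)
         \<le> ennreal B * (\<integral>\<^sup>+y. ennreal (?G x y) \<partial>lborel)"
        using b c AB
        by (subst (1 2) nn_integral_cmult[symmetric]; (measurable)?)
           (intro nn_integral_mono, simp add: ennreal_leI flip: ennreal_mult)
    qed
    finally have "ennreal c * ennreal ((norm (f (x, 0)))\<^sup>2 * r powr (1 + b)) \<le> \<dots>" .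
    moreover have "c * ((norm (f (x, 0)))\<^sup>2 * r powr (1 + b)) = norm x powr (- 2 * (real k - (1 + b) / 2)) * (norm (trace_map f x))\<^sup>2"
    proof -
      have "\<theta> powr (- 1 - b) * \<theta> powr (1 + b) = 1" using \<theta> by (simp flip: powr_add)
      moreover have "norm x powr (- 2 * real k) * norm x powr (1 + b) = norm x powr (- 2 * (real k - (1 + b) / 2))"
        by (subst powr_add[symmetric], intro arg_cong[where f="\<lambda>t. norm x powr t"]) (simp add: field_simps)
      ultimately show ?thesis
        using \<theta> by (simp add: c_def r_def powr_mult trace_map_def mult_ac)
    qed
    ultimately show ?thesis using c by (simp flip: ennreal_mult)
  qed
  have "(\<integral>\<^sup>+x. ennreal (norm x powr (- 2 * (real k - (1 + b) / 2)) * (norm (trace_map f x))\<^sup>2) \<partial>lborel) \<le>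
     (\<integral>\<^sup>+x. ennreal A * (\<integral>\<^sup>+y. ennreal (?F x y) \<partial>lborel) + ennreal B * (\<integral>\<^sup>+y. ennreal (?G x y) \<partial>lborel) \<partial>lborel)"
    by (rule nn_integral_mono_AE, use AE_lborel_singleton[of 0] in eventually_elim) (rule pw)
  also have "\<dots> = ennreal A * (\<integral>\<^sup>+x. \<integral>\<^sup>+y. ennreal (?F x y) \<partial>lborel \<partial>lborel) + ennreal B * (\<integral>\<^sup>+x. \<integral>\<^sup>+y. ennreal (?G x y) \<partial>lborel \<partial>lborel)"
    by (subst nn_integral_add; (measurable)?) (simp add: nn_integral_cmult)
  also have "(\<integral>\<^sup>+x. \<integral>\<^sup>+y. ennreal (?F x y) \<partial>lborel \<partial>lborel) = (\<integral>\<^sup>+z. ennreal (weight b k z * (norm (f z))\<^sup>2) \<partial>lborel)"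
    by (rule nn_integral_lborel_pair) measurable
  also have "(\<integral>\<^sup>+x. \<integral>\<^sup>+y. ennreal (?G x y) \<partial>lborel \<partial>lborel) = (\<integral>\<^sup>+z. ennreal (weight b (k - 1) z * (norm (?dy z))\<^sup>2) \<partial>lborel)"
    by (rule nn_integral_lborel_pair) measurable
  also have "\<dots> \<le> (\<integral>\<^sup>+z. ennreal (weight b (k - 1) z * (norm (grad f z))\<^sup>2) \<partial>lborel)"
  proof (intro nn_integral_mono ennreal_leI mult_left_mono weight_nonneg)
    fix z
    have "(?dy z)\<^sup>2 \<le> (\<Sum>e\<in>Basis. (partial_deriv e f z)\<^sup>2)"
      by (rule member_le_sum) auto
    then show "(norm (?dy z))\<^sup>2 \<le> (norm (grad f z))\<^sup>2" by (simp add: norm_grad)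
  qed
  finally show ?thesis unfolding A_def B_def by (simp add: mult_left_mono)
qed

subsection \<open>A one-dimensional inequality\<close>

lemma integrable_powr_continuous:
  fixes h :: "real \<Rightarrow> real"
  assumes b: "b > -1" and h: "continuous_on UNIV h"
  shows "integrable lborel (\<lambda>y. indicator {0..R} y * (y powr b * h y))"
proof -
  have "bounded (h ` {0..R})"
    by (intro compact_imp_bounded compact_continuous_image continuous_on_subset[OF h]) auto
  then obtain B where B: "\<And>y. y \<in> {0..R} \<Longrightarrow> norm (h y) \<le> B" unfolding bounded_iff by (metis imageI)
  have [measurable]: "h \<in> borel_measurable borel" using h by (rule borel_measurable_continuous_onI)
  show ?thesis
  proof (rule Bochner_Integration.integrable_bound[OF integrable_mult_right[OF integrable_powr_interval[OF b, of R], of "\<bar>B\<bar>"]])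
    show "AE y in lborel. norm (indicator {0..R} y * (y powr b * h y)) \<le> norm (\<bar>B\<bar> * (indicator {- R..R} y * \<bar>y\<bar> powr b))"
    proof (rule AE_I2)
      fix y
      show "norm (indicator {0..R} y * (y powr b * h y)) \<le> norm (\<bar>B\<bar> * (indicator {- R..R} y * \<bar>y\<bar> powr b))"
      proof (cases "y \<in> {0..R}")
        case True
        have "\<bar>h y\<bar> \<le> \<bar>B\<bar>" using B[OF True] by simp
        then have "y powr b * \<bar>h y\<bar> \<le> y powr b * \<bar>B\<bar>" by (intro mult_left_mono) auto
        then show ?thesis using True by (simp add: abs_mult indicator_def mult.commute)
      qed simp
    qed
  qed measurable
qed

text \<open>The integrand is the derivative of y^b times the inner product of f' and f. That product
  vanishes at R with f; at 0 the condition \<open>f1 0 = 0\<close> makes f' of order y, and y^(1+b)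
  tends to 0.\<close>

lemma weighted_energy_identity:
  fixes f f1 f2 A :: "real \<Rightarrow> complex"
  assumes b: "-1 < b" and R: "R > 0"
    and f: "\<And>y. (f has_vector_derivative f1 y) (at y)"
    and f1: "\<And>y. (f1 has_vector_derivative f2 y) (at y)"
    and f10: "f1 0 = 0" and fR: "f R = 0"
    and A: "continuous_on UNIV A" "\<And>y. y > 0 \<Longrightarrow> A y = f2 y + (b / y) *\<^sub>R f1 y"
  shows "(LINT y|lborel. indicator {0..R} y * (y powr b * (A y \<bullet> f y + f1 y \<bullet> f1 y))) = 0"
proof -
  have c: "continuous_on UNIV f" "continuous_on UNIV f1"
    using f f1 by (auto simp: continuous_on_eq_continuous_at intro: has_vector_derivative_continuous)
  let ?G = "\<lambda>y. y powr b * (f1 y \<bullet> f y)"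
  let ?H = "\<lambda>y. y powr b * (A y \<bullet> f y + f1 y \<bullet> f1 y)"
  have G0: "(?G \<longlongrightarrow> 0) (at 0 within {0..R})"
  proof -
    have "((\<lambda>y. norm (f1 y - f1 0 - (y - 0) *\<^sub>R f2 0) / norm (y - 0)) \<longlongrightarrow> 0) (at 0 within {0..R})"
      using f1[of 0, THEN has_vector_derivative_at_within, of "{0..R}"]
      by (simp add: has_vector_derivative_def has_derivative_iff_norm)
    then have "((\<lambda>y. norm (f1 y /\<^sub>R y - f2 0)) \<longlongrightarrow> 0) (at 0 within {0..R})"
    proof (rule Lim_transform_eventually)
      show "\<forall>\<^sub>F y in at 0 within {0..R}. norm (f1 y - f1 0 - (y - 0) *\<^sub>R f2 0) / norm (y - 0) = norm (f1 y /\<^sub>R y - f2 0)"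
        unfolding eventually_at_filter
      proof (intro always_eventually allI impI)
        fix y assume "y \<noteq> (0::real)" "y \<in> {0..R}"
        then have "f1 y - y *\<^sub>R f2 0 = y *\<^sub>R (f1 y /\<^sub>R y - f2 0)" by (simp add: algebra_simps)
        then show "norm (f1 y - f1 0 - (y - 0) *\<^sub>R f2 0) / norm (y - 0) = norm (f1 y /\<^sub>R y - f2 0)"
          using \<open>y \<noteq> 0\<close> by (simp add: f10)
      qed
    qed
    then have 1: "((\<lambda>y. f1 y /\<^sub>R y) \<longlongrightarrow> f2 0) (at 0 within {0..R})"
      by (simp add: tendsto_norm_zero_iff LIM_zero_iff)
    have 2: "((\<lambda>y::real. y powr (1 + b)) \<longlongrightarrow> 0 powr (1 + b)) (at 0 within {0..R})"
      by (rule tendsto_powr') (use b in \<open>auto intro!: tendsto_intros simp: eventually_at_filter\<close>)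
    have 3: "(f \<longlongrightarrow> f 0) (at 0 within {0..R})"
      using c(1) by (metis continuous_on_def UNIV_I tendsto_within_subset subset_UNIV)
    have "((\<lambda>y. y powr (1 + b) * ((f1 y /\<^sub>R y) \<bullet> f y)) \<longlongrightarrow> 0 powr (1 + b) * (f2 0 \<bullet> f 0)) (at 0 within {0..R})"
      by (intro tendsto_intros 1 2 3)
    then have "((\<lambda>y. y powr (1 + b) * ((f1 y /\<^sub>R y) \<bullet> f y)) \<longlongrightarrow> 0) (at 0 within {0..R})" by simp
    then show ?thesis
    proof (rule Lim_transform_eventually)
      show "\<forall>\<^sub>F y in at 0 within {0..R}. y powr (1 + b) * ((f1 y /\<^sub>R y) \<bullet> f y) = ?G y"
        unfolding eventually_at_filter
        by (rule always_eventually) (auto simp: powr_add)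
    qed
  qed
  have "(?H has_integral ?G R - ?G 0) {0..R}"
  \<comment> \<open>The interior form is used: y^b is in general not differentiable at 0, where
    continuity of the whole product has to do.\<close>
  proof (rule fundamental_theorem_of_calculus_interior)
    show "continuous_on {0..R} ?G"
      unfolding continuous_on_def
    proof
      fix y assume y: "y \<in> {0..R}"
      show "(?G \<longlongrightarrow> ?G y) (at y within {0..R})"
      proof (cases "y = 0")
        case True then show ?thesis using G0 by (simp add: f10)
      next
        case False
        then have "isCont ?G y"
          using y c by (intro continuous_intros) (auto simp: continuous_on_eq_continuous_at)
        then show ?thesis by (simp add: isCont_def tendsto_within_subset[OF _ subset_UNIV])
      qed
    qed
    fix y assume y: "y \<in> {0<..<R}"
    have "(?G has_vector_derivative (y powr b * (f1 y \<bullet> f1 y + f2 y \<bullet> f y) + (b * y powr (b - 1)) * (f1 y \<bullet> f y))) (at y)"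
    proof -
      have p: "((\<lambda>y. y powr b) has_vector_derivative b * y powr (b - 1)) (at y)"
        using y has_real_derivative_powr[of y b] by (simp add: has_real_derivative_iff_has_vector_derivative)
      have i: "((\<lambda>y. f1 y \<bullet> f y) has_vector_derivative f1 y \<bullet> f1 y + f2 y \<bullet> f y) (at y)"
        by (rule bounded_bilinear.has_vector_derivative[OF bounded_bilinear_inner f1 f])
      show ?thesis
        using bounded_bilinear.has_vector_derivative[OF bounded_bilinear_mult p i] by simp
    qed
    moreover have "y powr b * (f1 y \<bullet> f1 y + f2 y \<bullet> f y) + (b * y powr (b - 1)) * (f1 y \<bullet> f y) = ?H y"
      using y by (simp add: A(2) powr_diff inner_add_left algebra_simps)
    ultimately show "(?G has_vector_derivative ?H y) (at y)" by simp
  qed (use R in auto)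
  then have 1: "((\<lambda>y. if y \<in> {0..R} then ?H y else 0) has_integral 0) UNIV"
    unfolding has_integral_restrict_UNIV by (simp add: f10 fR)
  have "integrable lborel (\<lambda>y. indicator {0..R} y * ?H y)"
    by (intro integrable_powr_continuous b continuous_intros A(1) c)
  from has_integral_integral_lborel[OF this]
  have "((\<lambda>y. if y \<in> {0..R} then ?H y else 0) has_integral (LINT y|lborel. indicator {0..R} y * ?H y)) UNIV"
    by (rule has_integral_eq[rotated]) (auto simp: indicator_def)
  from has_integral_unique[OF this 1] show ?thesis .
qed

text \<open>With A = g + L f one has |g|^2 = |A|^2 - 2 L <A, f> + L^2 |f|^2. After integration the
  energy identity replaces - <A, f> by |f'|^2; then |A|^2 and one of the two terms L |f'|^2 are
  dropped.\<close>

lemma weighted_coercivity: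
  fixes f f1 f2 g :: "real \<Rightarrow> complex"
  assumes b: "-1 < b" and L: "L \<ge> 0"
    and f: "\<And>y. (f has_vector_derivative f1 y) (at y)"
    and f1: "\<And>y. (f1 has_vector_derivative f2 y) (at y)"
    and f10: "f1 0 = 0" and fR: "\<And>y. y \<ge> R \<Longrightarrow> f y = 0" "\<And>y. y \<ge> R \<Longrightarrow> f1 y = 0"
    and g: "continuous_on UNIV g" "\<And>y. y > 0 \<Longrightarrow> g y = f2 y + (b / y) *\<^sub>R f1 y - L *\<^sub>R f y"
  shows "ennreal L * ((\<integral>\<^sup>+y. ennreal (indicator {0<..} y * y powr b * (norm (f1 y))\<^sup>2) \<partial>lborel)
      + ennreal L * (\<integral>\<^sup>+y. ennreal (indicator {0<..} y * y powr b * (norm (f y))\<^sup>2) \<partial>lborel))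
    \<le> (\<integral>\<^sup>+y. ennreal (indicator {0<..} y * y powr b * (norm (g y))\<^sup>2) \<partial>lborel)"
proof -
  \<comment> \<open>The endpoint has to be positive for the energy identity and to lie beyond the
    support.\<close>
  define S where "S = max R 1"
  have S: "S > 0" "S \<ge> R" by (auto simp: S_def)
  have c: "continuous_on UNIV f" "continuous_on UNIV f1"
    using f f1 by (auto simp: continuous_on_eq_continuous_at intro: has_vector_derivative_continuous)
  note [measurable] = c[THEN borel_measurable_continuous_onI] g(1)[THEN borel_measurable_continuous_onI]
  let ?A = "\<lambda>y. g y + L *\<^sub>R f y"
  let ?I = "\<lambda>h. LINT y|lborel. indicator {0..S} y * (y powr b * h y)"
  have int: "integrable lborel (\<lambda>y. indicator {0..S} y * (y powr b * h y))" if "continuous_on UNIV h" for h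
    using b that by (rule integrable_powr_continuous)
  have id: "?I (\<lambda>y. ?A y \<bullet> f y + f1 y \<bullet> f1 y) = 0"
    by (rule weighted_energy_identity[OF b S(1) f f1 f10]) (use S fR g c in \<open>auto intro!: continuous_intros\<close>)
  have ci: "continuous_on UNIV (\<lambda>y. ?A y \<bullet> f y + f1 y \<bullet> f1 y)" "continuous_on UNIV (\<lambda>y. (norm (g y))\<^sup>2)"
     "continuous_on UNIV (\<lambda>y. L * ((norm (f1 y))\<^sup>2 + L * (norm (f y))\<^sup>2))"
    by (intro continuous_intros c g)+
  \<comment> \<open>The added multiple of the energy identity has integral zero; it makes the
    inequality hold pointwise, so that monotonicity of the integral applies.\<close>
  have "?I (\<lambda>y. L * ((norm (f1 y))\<^sup>2 + L * (norm (f y))\<^sup>2)) = 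
     (LINT y|lborel. indicator {0..S} y * (y powr b * (L * ((norm (f1 y))\<^sup>2 + L * (norm (f y))\<^sup>2)))
        + (- 2 * L) * (indicator {0..S} y * (y powr b * (?A y \<bullet> f y + f1 y \<bullet> f1 y))))"
    by (subst Bochner_Integration.integral_add) (use int[OF ci(1)] int[OF ci(3)] id in simp_all)
  also have "\<dots> \<le> ?I (\<lambda>y. (norm (g y))\<^sup>2)"
  proof (rule integral_mono)
    fix y
    have "L * ((norm (f1 y))\<^sup>2 + L * (norm (f y))\<^sup>2) + (- 2 * L) * (?A y \<bullet> f y + f1 y \<bullet> f1 y) \<le> (norm (g y))\<^sup>2"
    proof -
      have "(norm (g y))\<^sup>2 = (norm (?A y - L *\<^sub>R f y))\<^sup>2" by simp
      also have "\<dots> = (norm (?A y))\<^sup>2 - 2 * L * (?A y \<bullet> f y) + L\<^sup>2 * (norm (f y))\<^sup>2"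
        unfolding power2_norm_eq_inner by (simp add: inner_diff_left inner_diff_right inner_add_left inner_add_right inner_commute power2_eq_square algebra_simps)
      finally have "(norm (g y))\<^sup>2 = (norm (?A y))\<^sup>2 - 2 * L * (?A y \<bullet> f y) + L\<^sup>2 * (norm (f y))\<^sup>2" .
      moreover have "f1 y \<bullet> f1 y = (norm (f1 y))\<^sup>2" by (simp add: power2_norm_eq_inner)
      moreover have "L * (n + L * F) + (- 2 * L) * (x + n) \<le> N"
        if "N = P - 2 * L * x + L\<^sup>2 * F" "0 \<le> P" "0 \<le> L * n" for N P x F n :: real
        using that by (simp add: algebra_simps power2_eq_square)
      ultimately show ?thesis using L by simp
    qed
    then have "indicator {0..S} y * (y powr b * (L * ((norm (f1 y))\<^sup>2 + L * (norm (f y))\<^sup>2) + (- 2 * L) * (?A y \<bullet> f y + f1 y \<bullet> f1 y)))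
      \<le> indicator {0..S} y * (y powr b * (norm (g y))\<^sup>2)"
      by (intro mult_left_mono) auto
    then show "indicator {0..S} y * (y powr b * (L * ((norm (f1 y))\<^sup>2 + L * (norm (f y))\<^sup>2)))
        + (- 2 * L) * (indicator {0..S} y * (y powr b * (?A y \<bullet> f y + f1 y \<bullet> f1 y))) \<le> indicator {0..S} y * (y powr b * (norm (g y))\<^sup>2)"
      by (simp only: distrib_left mult.left_commute)
  qed (use int[OF ci(1)] int[OF ci(2)] int[OF ci(3)] in simp_all)
  finally have le: "?I (\<lambda>y. L * ((norm (f1 y))\<^sup>2 + L * (norm (f y))\<^sup>2)) \<le> ?I (\<lambda>y. (norm (g y))\<^sup>2)" .
  have n0: "(\<integral>\<^sup>+y. ennreal (indicator {0..S} y * (y powr b * h y)) \<partial>lborel) = ennreal (?I h)" if "continuous_on UNIV h" "\<And>y. h y \<ge> 0" for h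
    by (rule nn_integral_eq_integral[OF int[OF that(1)]]) (use that in auto)
  have "ennreal L * ((\<integral>\<^sup>+y. ennreal (indicator {0<..} y * y powr b * (norm (f1 y))\<^sup>2) \<partial>lborel)
      + ennreal L * (\<integral>\<^sup>+y. ennreal (indicator {0<..} y * y powr b * (norm (f y))\<^sup>2) \<partial>lborel))
     = (\<integral>\<^sup>+y. ennreal L * (ennreal (indicator {0<..} y * y powr b * (norm (f1 y))\<^sup>2) + ennreal L * ennreal (indicator {0<..} y * y powr b * (norm (f y))\<^sup>2)) \<partial>lborel)"
    by (simp add: nn_integral_add nn_integral_cmult)
  also have "\<dots> \<le> (\<integral>\<^sup>+y. ennreal (indicator {0..S} y * (y powr b * (L * ((norm (f1 y))\<^sup>2 + L * (norm (f y))\<^sup>2)))) \<partial>lborel)"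
  proof (rule nn_integral_mono)
    fix y
    have "L * (indicator {0<..} y * y powr b * (norm (f1 y))\<^sup>2 + L * (indicator {0<..} y * y powr b * (norm (f y))\<^sup>2))
      \<le> indicator {0..S} y * (y powr b * (L * ((norm (f1 y))\<^sup>2 + L * (norm (f y))\<^sup>2)))"
      using fR[of y] S by (cases "y \<le> S") (auto simp: indicator_def algebra_simps)
    then show "ennreal L * (ennreal (indicator {0<..} y * y powr b * (norm (f1 y))\<^sup>2) + ennreal L * ennreal (indicator {0<..} y * y powr b * (norm (f y))\<^sup>2))
      \<le> ennreal (indicator {0..S} y * (y powr b * (L * ((norm (f1 y))\<^sup>2 + L * (norm (f y))\<^sup>2))))"
      using L by (simp add: ennreal_leI flip: ennreal_mult ennreal_plus)
  qed
  also have "\<dots> = ennreal (?I (\<lambda>y. L * ((norm (f1 y))\<^sup>2 + L * (norm (f y))\<^sup>2)))"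
    by (rule n0[OF ci(3)]) (use L in auto)
  also have "\<dots> \<le> ennreal (?I (\<lambda>y. (norm (g y))\<^sup>2))" by (rule ennreal_leI[OF le])
  also have "\<dots> = (\<integral>\<^sup>+y. ennreal (indicator {0..S} y * (y powr b * (norm (g y))\<^sup>2)) \<partial>lborel)"
    by (rule n0[OF ci(2), symmetric]) auto
  also have "\<dots> \<le> (\<integral>\<^sup>+y. ennreal (indicator {0<..} y * y powr b * (norm (g y))\<^sup>2) \<partial>lborel)"
    by (rule nn_integral_mono) (auto simp: indicator_def intro!: ennreal_leI)
  finally show ?thesis .
qed

subsection \<open>The partial Fourier transform\<close>

definition pf :: "('a::euclidean_space \<times> real \<Rightarrow> real) \<Rightarrow> 'a \<Rightarrow> real \<Rightarrow> complex" where
  "pf W \<xi> y = fourier (\<lambda>x. of_real (W (x, y))) \<xi>"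

lemma continuous_slice:
  assumes "continuous_on UNIV W"
  shows "continuous_on UNIV (\<lambda>x. complex_of_real (W (x, y)))"
  by (intro continuous_on_of_real continuous_on_compose2[OF assms]) (auto intro!: continuous_intros)

lemma rapid_slice:
  fixes W :: "'a::euclidean_space \<times> real \<Rightarrow> real"
  assumes c: "continuous_on UNIV W" and K: "compact (closure {z. W z \<noteq> 0})"
  shows "rapid (\<lambda>x. of_real (W (x, y)))"
proof (rule rapid_compact[OF continuous_slice[OF c]])
  have "compact (fst ` closure {z. W z \<noteq> 0})"
    by (rule compact_continuous_image[OF _ K]) (auto intro!: continuous_intros)
  moreover have "{x. complex_of_real (W (x, y)) \<noteq> 0} \<subseteq> fst ` closure {z. W z \<noteq> 0}"
    using closure_subset[of "{z. W z \<noteq> 0}"] by force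
  ultimately show "compact (closure {x. complex_of_real (W (x, y)) \<noteq> 0})"
    by (metis closure_minimal compact_imp_closed compact_closure_subset closure_closed)
qed

lemma support_bounds:
  fixes W :: "'a::euclidean_space \<times> real \<Rightarrow> real"
  assumes K: "compact (closure {z. W z \<noteq> 0})"
  obtains l u R where "\<And>x y. W (x, y) \<noteq> 0 \<Longrightarrow> x \<in> cbox l u \<and> \<bar>y\<bar> < R"
proof -
  obtain B where B: "\<And>z. z \<in> closure {z. W z \<noteq> 0} \<Longrightarrow> norm z \<le> B"
    using compact_imp_bounded[OF K] unfolding bounded_iff by blast
  obtain l u :: 'a where lu: "cball 0 B \<subseteq> cbox l u"
    using bounded_subset_cbox_symmetric[OF bounded_cball] by metis
  have "x \<in> cbox l u \<and> \<bar>y\<bar> < B + 1" if "W (x, y) \<noteq> 0" for x y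
  proof -
    have "norm (x, y) \<le> B" using that B closure_subset[of "{z. W z \<noteq> 0}"] by auto
    then have "norm x \<le> B" "\<bar>y\<bar> \<le> B"
      using norm_fst_le[of x y] norm_snd_le[of y x] by (auto intro: order_trans)
    then show ?thesis using lu by auto
  qed
  then show thesis by (rule that)
qed

text \<open>Restricting to one box that works for all y gives a parameter integral over a compact
  set, to which the Leibniz rule applies.\<close>

lemma pf_integral:
  fixes W :: "'a::euclidean_space \<times> real \<Rightarrow> real"
  assumes c: "continuous_on UNIV W" and K: "compact (closure {z. W z \<noteq> 0})"
    and lu: "\<And>x y. W (x, y) \<noteq> 0 \<Longrightarrow> x \<in> cbox l u"
  shows "pf W \<xi> y = of_real (fconst TYPE('a)) * integral (cbox l u) (\<lambda>x. cis (- (\<xi> \<bullet> x)) * of_real (W (x, y)))"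
proof -
  have "integrable lborel (\<lambda>x. cis (- (\<xi> \<bullet> x)) * of_real (W (x, y)))"
    by (intro integrable_fourier_kernel rapid_integrable rapid_slice c K)
  from integral_lborel[OF this]
  have "(LINT x|lborel. cis (- (\<xi> \<bullet> x)) * of_real (W (x, y))) = integral UNIV (\<lambda>x. cis (- (\<xi> \<bullet> x)) * of_real (W (x, y)))"
    by simp
  also have "\<dots> = integral UNIV (\<lambda>x. if x \<in> cbox l u then cis (- (\<xi> \<bullet> x)) * of_real (W (x, y)) else 0)"
    by (rule arg_cong[where f="integral UNIV"]) (use lu in fastforce)
  also have "\<dots> = integral (cbox l u) (\<lambda>x. cis (- (\<xi> \<bullet> x)) * of_real (W (x, y)))"
    by (rule integral_restrict_UNIV)
  finally show ?thesis by (simp add: pf_def fourier_eq)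
qed

lemma compact_support_partial:
  "compact (closure {z. W z \<noteq> 0}) \<Longrightarrow> compact (closure {z. partial_deriv e W z \<noteq> 0})"
  by (erule compact_closure_subset) (rule order_trans[OF closure_subset closure_partial_support])

lemma pf_has_vector_derivative:
  fixes W :: "'a::euclidean_space \<times> real \<Rightarrow> real"
  assumes W: "Ck 1 W" and K: "compact (closure {z. W z \<noteq> 0})"
  shows "(pf W \<xi> has_vector_derivative pf (partial_deriv (0, 1) W) \<xi> y) (at y)"
proof -
  let ?D = "partial_deriv (0, 1) W"
  have c: "continuous_on UNIV W" "continuous_on UNIV ?D"
    using W by (auto intro: Ck_continuous Ck_1_continuous_partial[of 1] simp del: Ck.simps One_nat_def)
  obtain l u R where lu: "\<And>x y. W (x, y) \<noteq> 0 \<Longrightarrow> x \<in> cbox l u \<and> \<bar>y\<bar> < R" using support_bounds[OF K] by blast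
  \<comment> \<open>A derivative may be nonzero at points where W vanishes, but only within the
    closure of the support, which the closed box still contains.\<close>
  have luD: "x \<in> cbox l u" if "?D (x, y) \<noteq> 0" for x y
  proof -
    have "closure {z. W z \<noteq> 0} \<subseteq> fst -` cbox l u"
      by (rule closure_minimal) (use lu in \<open>auto intro!: closed_vimage_fst\<close>)
    moreover have "(x, y) \<in> closure {z. W z \<noteq> 0}"
      using that partial_deriv_support by blast
    ultimately have "(x, y) \<in> fst -` cbox l u" by (rule subsetD)
    then show ?thesis by simp
  qed
  let ?g = "\<lambda>y x. cis (- (\<xi> \<bullet> x)) * complex_of_real (W (x, y))"
  let ?g' = "\<lambda>y x. cis (- (\<xi> \<bullet> x)) * complex_of_real (?D (x, y))"
  have "((\<lambda>y. integral (cbox l u) (?g y)) has_vector_derivative integral (cbox l u) (?g' y)) (at y within UNIV)"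
  proof (rule leibniz_rule_vector_derivative)
    show "((\<lambda>y. ?g y t) has_vector_derivative ?g' y t) (at y within UNIV)" for y t
    proof -
      have "((\<lambda>y. W (t, y)) has_vector_derivative ?D (t, y)) (at y)"
        using has_vector_derivative_slice[OF Ck_1_differentiable[OF W, of "(t, y)"]]
        by (simp add: has_real_derivative_iff_has_vector_derivative)
      then show ?thesis
        by (rule has_vector_derivative_at_within[OF has_vector_derivative_mult_right[OF
            bounded_linear.has_vector_derivative[OF bounded_linear_of_real]]])
    qed
    show "?g y integrable_on cbox l u" for y
      by (intro integrable_continuous continuous_on_mult continuous_on_subset[OF continuous_slice[OF c(1)]] continuous_on_cis continuous_intros) auto
    have "continuous_on (UNIV \<times> cbox l u) (\<lambda>p. ?D (snd p, fst p))"
      by (rule continuous_on_compose2[OF c(2)]) (auto intro!: continuous_intros)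
    then show "continuous_on (UNIV \<times> cbox l u) (\<lambda>(y, x). ?g' y x)"
      unfolding case_prod_beta by (intro continuous_intros)
  qed auto
  then have "((\<lambda>y. of_real (fconst TYPE('a)) * integral (cbox l u) (?g y)) has_vector_derivative of_real (fconst TYPE('a)) * integral (cbox l u) (?g' y)) (at y)"
    by (intro has_vector_derivative_mult_right) simp
  moreover have "(\<lambda>y. of_real (fconst TYPE('a)) * integral (cbox l u) (?g y)) = pf W \<xi>"
    by (rule ext, rule pf_integral[symmetric, OF c(1) K]) (use lu in blast)
  moreover have "of_real (fconst TYPE('a)) * integral (cbox l u) (?g' y) = pf ?D \<xi> y"
    using pf_integral[OF c(2) compact_support_partial[OF K] luD] by simp
  ultimately show ?thesis by simp
qed

lemma pf_partial:
  fixes W :: "'a::euclidean_space \<times> real \<Rightarrow> real"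
  assumes W: "Ck 1 W" and K: "compact (closure {z. W z \<noteq> 0})" and i: "i \<in> Basis"
  shows "pf (partial_deriv (i, 0) W) \<xi> y = \<i> * of_real (\<xi> \<bullet> i) * pf W \<xi> y"
proof -
  have iB: "(i, 0) \<in> (Basis :: ('a \<times> real) set)" using i by (auto simp: Basis_prod_def)
  have dW: "W differentiable at z" for z by (rule Ck_1_differentiable[OF W]) simp
  have A: "bounded_linear (\<lambda>x::'a. (x, 0::real))" by (intro bounded_linear_intros)
  have D: "((\<lambda>x. W (x, y)) has_derivative (\<lambda>h. \<Sum>b\<in>Basis. ((h, 0) \<bullet> b) *\<^sub>R partial_deriv b W (x, y))) (at x)" for x
    using partial_deriv_affine(1)[OF A, of W "(0, y)" x] dW by simp
  have dS: "(\<lambda>x. W (x, y)) differentiable at x" for x using D unfolding differentiable_def by blast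
  have "partial_deriv i (\<lambda>x. W (x, y)) x = partial_deriv (i, 0) W (x, y)" for x
  proof -
    have "partial_deriv i (\<lambda>x. W (x, y)) x = (\<Sum>b\<in>Basis. ((i, 0) \<bullet> b) *\<^sub>R partial_deriv b W (x, y))"
      by (rule partial_deriv_eqI[OF D])
    also have "\<dots> = (\<Sum>b\<in>Basis. if b = (i, 0) then partial_deriv b W (x, y) else 0)"
      using iB by (intro sum.cong refl) (simp add: inner_Basis del: inner_Pair)
    finally show ?thesis using iB by (simp add: sum.delta)
  qed
  then have e: "partial_deriv i (\<lambda>x. complex_of_real (W (x, y))) = (\<lambda>x. of_real (partial_deriv (i, 0) W (x, y)))"
    by (auto simp: partial_deriv_linear[OF bounded_linear_of_real dS])
  have "fourier (partial_deriv i (\<lambda>x. complex_of_real (W (x, y)))) \<xi> = \<i> * of_real (\<xi> \<bullet> i) * fourier (\<lambda>x. of_real (W (x, y))) \<xi>"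
  proof (rule fourier_partial[OF _ _ _ i])
    show "(\<lambda>x. complex_of_real (W (x, y))) differentiable at x" for x
      using bounded_linear.has_derivative[OF bounded_linear_of_real D[of x]] unfolding differentiable_def by blast
    show "rapid (\<lambda>x. complex_of_real (W (x, y)))"
      by (rule rapid_slice[OF Ck_continuous[OF W] K])
    show "rapid (partial_deriv i (\<lambda>x. complex_of_real (W (x, y))))"
      unfolding e by (rule rapid_slice[OF Ck_1_continuous_partial[OF W] compact_support_partial[OF K]]) (use iB in auto)
  qed
  then show ?thesis unfolding pf_def e .
qed

lemma pf_support:
  assumes "\<And>x. W (x, y) = 0"
  shows "pf W \<xi> y = 0"
  by (simp add: pf_def assms fourier_eq)

lemma sum_Basis_prod:
  "(\<Sum>e\<in>(Basis::('a::euclidean_space \<times> real) set). f e) = (\<Sum>i\<in>Basis. f (i, 0)) + f (0, 1)"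
proof -
  have "(Basis::('a \<times> real) set) = (\<lambda>i. (i, 0)) ` Basis \<union> {(0, 1)}" by (auto simp: Basis_prod_def)
  moreover have "(0, 1) \<notin> (\<lambda>i::'a. (i, 0::real)) ` Basis" by auto
  ultimately have "(\<Sum>e\<in>(Basis::('a \<times> real) set). f e) = (\<Sum>e\<in>(\<lambda>i. (i, 0)) ` Basis. f e) + f (0, 1)"
    by (metis (no_types, lifting) Un_insert_right add.commute finite_Basis finite_imageI sum.insert sup_bot.right_neutral)
  also have "(\<Sum>e\<in>(\<lambda>i::'a. (i, 0)) ` Basis. f e) = (\<Sum>i\<in>Basis. f (i, 0))"
    by (subst sum.reindex) (auto simp: inj_on_def)
  finally show ?thesis .
qed

lemma Cinfe_partial2:
  assumes U: "U \<in> Cinfe" and e: "e \<in> Basis"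
  shows "Ck k (partial_deriv e U)" "compact (closure {z. partial_deriv e U z \<noteq> 0})"
    "Ck k (partial_deriv e (partial_deriv e U))" "compact (closure {z. partial_deriv e (partial_deriv e U) z \<noteq> 0})"
proof -
  note C = CinfeD(1,2)[OF U]
  show 1: "Ck k (partial_deriv e U)" for k by (rule Ck_partial[OF C(1) e])
  show 2: "compact (closure {z. partial_deriv e U z \<noteq> 0})" by (rule compact_support_partial[OF C(2)])
  show "Ck k (partial_deriv e (partial_deriv e U))" by (rule Ck_partial[OF 1 e])
  show "compact (closure {z. partial_deriv e (partial_deriv e U) z \<noteq> 0})" by (rule compact_support_partial[OF 2])
qed

lemma pf_Lap_b:
  assumes U: "U \<in> Cinfe" and y: "y \<noteq> 0"
  shows "pf (Lap_b b U) \<xi> y = pf (partial_deriv (0, 1) (partial_deriv (0, 1) U)) \<xi> y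
     + (b / y) *\<^sub>R pf (partial_deriv (0, 1) U) \<xi> y - (norm \<xi>)\<^sup>2 *\<^sub>R pf U \<xi> y"
proof -
  let ?D = "\<lambda>e. partial_deriv e (partial_deriv e U)"
  have int: "integrable lborel (\<lambda>x. cis (- (\<xi> \<bullet> x)) * of_real (W (x, y)))" if "continuous_on UNIV W" "compact (closure {z. W z \<noteq> 0})" for W :: "(real^'a) \<times> real \<Rightarrow> real"
    by (intro integrable_fourier_kernel rapid_integrable rapid_slice that)
  have ct: "continuous_on UNIV (?D e)" "continuous_on UNIV (partial_deriv e U)" "continuous_on UNIV U" if "e \<in> Basis" for e
    using Cinfe_partial2[OF U that] CinfeD(1)[OF U, of 0] by (auto intro: Ck_continuous simp del: Ck.simps)
  have iB: "(i, 0) \<in> (Basis :: ((real^'a) \<times> real) set)" if "i \<in> Basis" for i using that by (auto simp: Basis_prod_def)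
  have "Lap_b b U (x, y) = (\<Sum>i\<in>Basis. ?D (i, 0) (x, y)) + ?D (0, 1) (x, y) + (b / y) * partial_deriv (0, 1) U (x, y)" for x
    using y by (simp add: Lap_b_def laplacian_def sum_Basis_prod)
  then have e: "cis (- (\<xi> \<bullet> x)) * complex_of_real (Lap_b b U (x, y)) =
    (\<Sum>i\<in>Basis. cis (- (\<xi> \<bullet> x)) * of_real (?D (i, 0) (x, y))) + cis (- (\<xi> \<bullet> x)) * of_real (?D (0, 1) (x, y))
      + of_real (b / y) * (cis (- (\<xi> \<bullet> x)) * of_real (partial_deriv (0, 1) U (x, y)))" for x
    by (simp add: distrib_left sum_distrib_left mult_ac)
  have iS: "integrable lborel (\<lambda>x. \<Sum>i\<in>Basis. cis (- (\<xi> \<bullet> x)) * complex_of_real (?D (i, 0) (x, y)))"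
    by (intro Bochner_Integration.integrable_sum int ct Cinfe_partial2(4)[OF U] iB)
  have i1: "integrable lborel (\<lambda>x. cis (- (\<xi> \<bullet> x)) * complex_of_real (?D (0, 1) (x, y)))"
    by (intro int ct Cinfe_partial2(4)[OF U]) auto
  have i2: "integrable lborel (\<lambda>x. of_real (b / y) * (cis (- (\<xi> \<bullet> x)) * complex_of_real (partial_deriv (0, 1) U (x, y))))"
    by (intro integrable_mult_right int ct Cinfe_partial2(2)[OF U]) auto
  have "(LINT x|lborel. cis (- (\<xi> \<bullet> x)) * complex_of_real (Lap_b b U (x, y))) =
    (\<Sum>i\<in>Basis. LINT x|lborel. cis (- (\<xi> \<bullet> x)) * of_real (?D (i, 0) (x, y))) + (LINT x|lborel. cis (- (\<xi> \<bullet> x)) * of_real (?D (0, 1) (x, y)))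
      + of_real (b / y) * (LINT x|lborel. cis (- (\<xi> \<bullet> x)) * of_real (partial_deriv (0, 1) U (x, y)))"
    unfolding e
    apply (subst Bochner_Integration.integral_add[OF Bochner_Integration.integrable_add[OF iS i1] i2])
    apply (subst Bochner_Integration.integral_add[OF iS i1])
    apply (subst Bochner_Integration.integral_sum)
     apply (intro int ct Cinfe_partial2(4)[OF U] iB; assumption)
    apply (simp only: integral_mult_right_zero)
    done
  then have "pf (Lap_b b U) \<xi> y = (\<Sum>i\<in>Basis. pf (?D (i, 0)) \<xi> y) + pf (?D (0, 1)) \<xi> y + of_real (b / y) * pf (partial_deriv (0, 1) U) \<xi> y"
    unfolding pf_def fourier_eq by (simp only: distrib_left sum_distrib_left mult.left_commute)
  also have "(\<Sum>i\<in>Basis. pf (?D (i, 0)) \<xi> y) = (\<Sum>i\<in>Basis. - of_real ((\<xi> \<bullet> i)\<^sup>2) * pf U \<xi> y)"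
  proof (rule sum.cong[OF refl])
    fix i :: "real^'a" assume i: "i \<in> Basis"
    have "pf (?D (i, 0)) \<xi> y = \<i> * of_real (\<xi> \<bullet> i) * (\<i> * of_real (\<xi> \<bullet> i) * pf U \<xi> y)"
      using Cinfe_partial2(1,2)[OF U iB[OF i]] CinfeD(1,2)[OF U] by (simp only: pf_partial i)
    also have "\<dots> = (\<i> * \<i>) * (of_real (\<xi> \<bullet> i) * of_real (\<xi> \<bullet> i) * pf U \<xi> y)"
      by (simp only: mult.assoc mult.left_commute)
    finally show "pf (?D (i, 0)) \<xi> y = - of_real ((\<xi> \<bullet> i)\<^sup>2) * pf U \<xi> y"
      by (simp add: power2_eq_square)
  qed
  also have "\<dots> = - ((norm \<xi>)\<^sup>2 *\<^sub>R pf U \<xi> y)"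
    by (simp add: norm_sq_eq_sum scaleR_conv_of_real sum_distrib_right sum_negf)
  finally show ?thesis by (simp add: scaleR_conv_of_real)
qed

lemma borel_measurable_pf [measurable]:
  fixes W :: "'a::euclidean_space \<times> real \<Rightarrow> real"
  assumes [measurable]: "W \<in> borel_measurable borel"
  shows "(\<lambda>p. pf W (fst p) (snd p)) \<in> borel_measurable borel"
proof -
  have W: "W \<in> borel_measurable (borel \<Otimes>\<^sub>M borel)" using assms by (simp add: borel_prod)
  have "(\<lambda>p. LINT x|lborel. cis (- (fst p \<bullet> x)) * complex_of_real (W (x, snd p))) \<in> borel_measurable (borel \<Otimes>\<^sub>M borel)"
  proof (rule sigma_finite_measure.borel_measurable_lebesgue_integral[OF sigma_finite_lborel])
    have [measurable]: "(\<lambda>q::('a \<times> real) \<times> 'a. (snd q, snd (fst q))) \<in> (borel \<Otimes>\<^sub>M borel) \<Otimes>\<^sub>M lborel \<rightarrow>\<^sub>M borel \<Otimes>\<^sub>M borel"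
      by measurable
    have [measurable]: "(\<lambda>q::('a \<times> real) \<times> 'a. W (snd q, snd (fst q))) \<in> borel_measurable ((borel \<Otimes>\<^sub>M borel) \<Otimes>\<^sub>M lborel)"
      using measurable_compose[OF _ W, of "\<lambda>q. (snd q, snd (fst q))"] by measurable
    show "(\<lambda>(p, x). cis (- (fst p \<bullet> x)) * complex_of_real (W (x, snd p))) \<in> borel_measurable ((borel \<Otimes>\<^sub>M borel) \<Otimes>\<^sub>M lborel)"
      unfolding case_prod_beta by measurable
  qed
  then show ?thesis unfolding pf_def fourier_eq by (simp add: borel_prod)
qed

lemma bessel_slice:
  fixes W :: "'a::euclidean_space \<times> real \<Rightarrow> real"
  assumes c: "continuous_on UNIV W" and K: "compact (closure {z. W z \<noteq> 0})"
  shows "(\<integral>\<^sup>+\<xi>. ennreal ((norm (pf W \<xi> y))\<^sup>2) \<partial>lborel) \<le> (\<integral>\<^sup>+x. ennreal ((norm (W (x, y)))\<^sup>2) \<partial>lborel)"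
  using bessel[OF rapid_integrable[OF rapid_slice[OF c K, of y]]] by (simp add: pf_def)

section \<open>Weighted half-line energies at a fixed frequency\<close>

definition pfE :: "real \<Rightarrow> ('a::euclidean_space \<times> real \<Rightarrow> real) \<Rightarrow> 'a \<Rightarrow> ennreal" where
  "pfE b W \<xi> = (\<integral>\<^sup>+y. ennreal (indicator {0<..} y * y powr b * (norm (pf W \<xi> y))\<^sup>2) \<partial>lborel)"

lemma borel_measurable_fst_snd_borel:
  "fst \<in> borel_measurable (borel :: ('a::euclidean_space \<times> 'b::euclidean_space) measure)"
  "snd \<in> borel_measurable (borel :: ('a::euclidean_space \<times> 'b::euclidean_space) measure)"
  by (intro borel_measurable_continuous_onI continuous_intros)+

lemma pfE_measurable_pair:
  fixes W :: "'a::euclidean_space \<times> real \<Rightarrow> real"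
  assumes c: "continuous_on UNIV W"
  shows "(\<lambda>p. ennreal (indicator {0<..} (snd p) * snd p powr b * (norm (pf W (fst p) (snd p)))\<^sup>2)) \<in> borel_measurable borel"
proof -
  note [measurable] = borel_measurable_pf[OF borel_measurable_continuous_onI[OF c]]
    borel_measurable_fst_snd_borel(2)[where 'a='a and 'b=real]
  show ?thesis by measurable
qed

lemma borel_measurable_pfE [measurable]:
  assumes c: "continuous_on UNIV W"
  shows "pfE b W \<in> borel_measurable borel"
  unfolding pfE_def
  using lborel.borel_measurable_nn_integral_fst[of _ lborel, simplified lborel_prod, of "\<lambda>p. ennreal (indicator {0<..} (snd p) * snd p powr b * (norm (pf W (fst p) (snd p)))\<^sup>2)"]
    pfE_measurable_pair[OF c] by simp

text \<open>Tonelli reduces the claim to Bessel's inequality on each slice y > 0; on the right the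
  other half of the line is added.\<close>

lemma pfE_integral_le:
  fixes W :: "'a::euclidean_space \<times> real \<Rightarrow> real"
  assumes c: "continuous_on UNIV W" and K: "compact (closure {z. W z \<noteq> 0})"
  shows "(\<integral>\<^sup>+\<xi>. pfE b W \<xi> \<partial>lborel) \<le> (\<integral>\<^sup>+z. ennreal (\<bar>snd z\<bar> powr b * (norm (W z))\<^sup>2) \<partial>lborel)"
proof -
  note [measurable] = borel_measurable_continuous_onI[OF c] borel_measurable_fst_snd_borel(2)[where 'a='a and 'b=real]
  have W1 [measurable]: "(\<lambda>x. W (x, y)) \<in> borel_measurable borel" for y
    by (rule borel_measurable_continuous_onI, rule continuous_on_compose2[OF c]) (auto intro!: continuous_intros)
  have pf1 [measurable]: "(\<lambda>\<xi>. pf W \<xi> y) \<in> borel_measurable borel" for y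
    unfolding pf_def by measurable
  have "(\<integral>\<^sup>+\<xi>. pfE b W \<xi> \<partial>lborel) = (\<integral>\<^sup>+y. \<integral>\<^sup>+\<xi>. ennreal (indicator {0<..} y * y powr b * (norm (pf W \<xi> y))\<^sup>2) \<partial>lborel \<partial>lborel)"
    unfolding pfE_def
    using nn_integral_lborel_pair[OF pfE_measurable_pair[OF c, of b]] by simp
  also have "\<dots> \<le> (\<integral>\<^sup>+y. \<integral>\<^sup>+x. ennreal (\<bar>y\<bar> powr b * (norm (W (x, y)))\<^sup>2) \<partial>lborel \<partial>lborel)"
  proof (rule nn_integral_mono)
    fix y :: real
    have "(\<integral>\<^sup>+\<xi>. ennreal (indicator {0<..} y * y powr b * (norm (pf W \<xi> y))\<^sup>2) \<partial>lborel) =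
      ennreal (indicator {0<..} y * y powr b) * (\<integral>\<^sup>+\<xi>. ennreal ((norm (pf W \<xi> y))\<^sup>2) \<partial>lborel)"
      by (subst nn_integral_cmult[symmetric]) (auto simp: ennreal_mult)
    also have "\<dots> \<le> ennreal (\<bar>y\<bar> powr b) * (\<integral>\<^sup>+x. ennreal ((norm (W (x, y)))\<^sup>2) \<partial>lborel)"
      by (intro mult_mono bessel_slice c K ennreal_leI) (auto simp: indicator_def)
    also have "\<dots> = (\<integral>\<^sup>+x. ennreal (\<bar>y\<bar> powr b * (norm (W (x, y)))\<^sup>2) \<partial>lborel)"
      by (subst nn_integral_cmult[symmetric]) (auto simp: ennreal_mult)
    finally show "(\<integral>\<^sup>+\<xi>. ennreal (indicator {0<..} y * y powr b * (norm (pf W \<xi> y))\<^sup>2) \<partial>lborel) \<le> \<dots>" .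
  qed
  also have "\<dots> = (\<integral>\<^sup>+z. ennreal (\<bar>snd z\<bar> powr b * (norm (W z))\<^sup>2) \<partial>lborel)"
  proof -
    have m: "(\<lambda>z. ennreal (\<bar>snd z\<bar> powr b * (norm (W z))\<^sup>2)) \<in> borel_measurable borel" by measurable
    from nn_integral_lborel_pair(2)[OF m] show ?thesis by simp
  qed
  finally show ?thesis .
qed

lemma pfE_coercivity:
  assumes U: "U \<in> Cinfe" and b: "-1 < b"
  shows "ennreal ((norm \<xi>)\<^sup>2) * (pfE b (partial_deriv (0, 1) U) \<xi> + ennreal ((norm \<xi>)\<^sup>2) * pfE b U \<xi>) \<le> pfE b (Lap_b b U) \<xi>"
proof -
  let ?D = "partial_deriv (0, 1) U"
  note U2 = Cinfe_partial2[OF U e_y_Basis]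
  note C = CinfeD(1,2)[OF U]
  obtain l u R where lu: "\<And>x y. U (x, y) \<noteq> 0 \<Longrightarrow> x \<in> cbox l u \<and> \<bar>y\<bar> < R" using support_bounds[OF C(2)] by blast
  obtain l' u' R' where lu': "\<And>x y. ?D (x, y) \<noteq> 0 \<Longrightarrow> x \<in> cbox l' u' \<and> \<bar>y\<bar> < R'" using support_bounds[OF U2(2)] by blast
  have LC: "Lap_b b U \<in> Cinfe" by (rule Lap_b_Cinfe[OF U])
  show ?thesis
    unfolding pfE_def
  proof (rule weighted_coercivity[where R="max R R'", OF b])
    show "(pf U \<xi> has_vector_derivative pf ?D \<xi> y) (at y)" for y
      by (rule pf_has_vector_derivative[OF C])
    show "(pf ?D \<xi> has_vector_derivative pf (partial_deriv (0, 1) ?D) \<xi> y) (at y)" for y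
      by (rule pf_has_vector_derivative[OF U2(1,2)])
    \<comment> \<open>Evenness of U: the function being transformed is identically zero on y =
      0.\<close>
    show "pf ?D \<xi> 0 = 0"
      by (rule pf_support) (use partial_y_odd[OF Cinfe_Cke[OF U, of 1]] in auto)
    show "pf U \<xi> y = 0" if "y \<ge> max R R'" for y
      by (rule pf_support) (use lu that in force)
    show "pf ?D \<xi> y = 0" if "y \<ge> max R R'" for y
      by (rule pf_support) (use lu' that in force)
    show "continuous_on UNIV (pf (Lap_b b U) \<xi>)"
      using pf_has_vector_derivative[OF CinfeD(1,2)[OF LC]]
      by (auto simp: continuous_on_eq_continuous_at intro: has_vector_derivative_continuous)
    show "pf (Lap_b b U) \<xi> y = pf (partial_deriv (0, 1) ?D) \<xi> y + (b / y) *\<^sub>R pf ?D \<xi> y - (norm \<xi>)\<^sup>2 *\<^sub>R pf U \<xi> y" if "y > 0" for y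
      using pf_Lap_b[OF U, of y b \<xi>] that by simp
  qed auto
qed

text \<open>Turns the factor |\<xi>|^2 back into tangential derivatives. For odd k the top-order
  quantity is a gradient, and this identifies its energy with the bracket in
  \<open>pfE_coercivity\<close>.\<close>

lemma pfE_partial:
  fixes W :: "'a::euclidean_space \<times> real \<Rightarrow> real"
  assumes W: "Ck 1 W" and K: "compact (closure {z. W z \<noteq> 0})"
  shows "ennreal ((norm \<xi>)\<^sup>2) * pfE b W \<xi> = (\<Sum>i\<in>Basis. pfE b (partial_deriv (i, 0) W) \<xi>)"
proof -
  have [measurable]: "(\<lambda>y. pf W \<xi> y) \<in> borel_measurable borel"
    using pf_has_vector_derivative[OF W K]
    by (intro borel_measurable_continuous_onI)
       (auto simp: continuous_on_eq_continuous_at intro: has_vector_derivative_continuous)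
  let ?h = "\<lambda>y. indicator {0<..} y * y powr b * (norm (pf W \<xi> y))\<^sup>2"
  have "(\<Sum>i\<in>Basis. pfE b (partial_deriv (i, 0) W) \<xi>) = (\<Sum>i\<in>Basis. ennreal ((\<xi> \<bullet> i)\<^sup>2) * (\<integral>\<^sup>+y. ennreal (?h y) \<partial>lborel))"
  proof (rule sum.cong[OF refl])
    fix i :: 'a assume i: "i \<in> Basis"
    have e: "indicator {0<..} y * y powr b * (norm (pf (partial_deriv (i, 0) W) \<xi> y))\<^sup>2 = (\<xi> \<bullet> i)\<^sup>2 * ?h y" for y :: real
      by (simp add: pf_partial[OF W K i] norm_mult power_mult_distrib)
    show "pfE b (partial_deriv (i, 0) W) \<xi> = ennreal ((\<xi> \<bullet> i)\<^sup>2) * (\<integral>\<^sup>+y. ennreal (?h y) \<partial>lborel)"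
      unfolding pfE_def e by (subst nn_integral_cmult[symmetric]) (auto simp: ennreal_mult')
  qed
  also have "\<dots> = (\<Sum>i\<in>Basis. ennreal ((\<xi> \<bullet> i)\<^sup>2)) * pfE b W \<xi>"
    by (simp only: pfE_def sum_distrib_right)
  also have "(\<Sum>i\<in>Basis. ennreal ((\<xi> \<bullet> i)\<^sup>2)) = ennreal ((norm \<xi>)\<^sup>2)"
    by (subst sum_ennreal) (auto simp: norm_sq_eq_sum)
  finally show ?thesis by simp
qed

lemma pfE_trace:
  assumes U: "U \<in> Cinfe" and b: "-1 < b" "b < 1" and \<xi>: "\<xi> \<noteq> 0"
  shows "ennreal (((norm \<xi>)\<^sup>2) powr (1 - (1 + b) / 2) * (norm (pf U \<xi> 0))\<^sup>2) \<le>
    ennreal (max (2 * (1 + b)) ((1 + b) / (1 - b))) * (pfE b (partial_deriv (0, 1) U) \<xi> + ennreal ((norm \<xi>)\<^sup>2) * pfE b U \<xi>)"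
proof -
  let ?D = "partial_deriv (0, 1) U"
  define L where "L = (norm \<xi>)\<^sup>2"
  \<comment> \<open>The length that balances \<open>trace_1d\<close>: multiplied by |\<xi>|^2, its
    two terms become multiples of |\<xi>|^2 \<open>pfE b U \<xi>\<close> and of the energy of
    \<partial>_y U, with constants free of \<xi>.\<close>
  define r where "r = 1 / norm \<xi>"
  define C where "C = max (2 * (1 + b)) ((1 + b) / (1 - b))"
  have L: "L > 0" and r: "r > 0" using \<xi> by (auto simp: L_def r_def)
  have C: "2 * (1 + b) \<le> C" "(1 + b) / (1 - b) \<le> C" "0 \<le> C" using b by (auto simp: C_def max_def)
  note U2 = Cinfe_partial2[OF U e_y_Basis]
  let ?E = "\<integral>\<^sup>+y. ennreal (indicator {0<..<r} y * y powr b * (norm (pf U \<xi> y))\<^sup>2) \<partial>lborel"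
  let ?F = "\<integral>\<^sup>+y. ennreal (indicator {0<..<r} y * y powr b * (norm (pf ?D \<xi> y))\<^sup>2) \<partial>lborel"
  have EF: "?E \<le> pfE b U \<xi>" "?F \<le> pfE b ?D \<xi>"
    unfolding pfE_def by (auto intro!: nn_integral_mono ennreal_leI simp: indicator_def)
  have "ennreal ((norm (pf U \<xi> 0))\<^sup>2 * r powr (1 + b)) \<le> ennreal (2 * (1 + b)) * ?E + ennreal ((1 + b) / (1 - b) * r\<^sup>2) * ?F"
  proof (rule trace_1d[OF _ _ b r])
    show "(pf U \<xi> has_vector_derivative pf ?D \<xi> t) (at t)" for t
      by (rule pf_has_vector_derivative[OF CinfeD(1,2)[OF U]])
    show "continuous_on UNIV (pf ?D \<xi>)"
      using pf_has_vector_derivative[OF U2(1,2)]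
      by (auto simp: continuous_on_eq_continuous_at intro: has_vector_derivative_continuous)
  qed
  then have "ennreal L * ennreal ((norm (pf U \<xi> 0))\<^sup>2 * r powr (1 + b)) \<le> ennreal L * (ennreal (2 * (1 + b)) * ?E + ennreal ((1 + b) / (1 - b) * r\<^sup>2) * ?F)"
    by (rule mult_left_mono) simp
  also have "\<dots> = ennreal (L * (2 * (1 + b))) * ?E + ennreal (L * ((1 + b) / (1 - b) * r\<^sup>2)) * ?F"
    using L b by (intro ennreal_mult_lin) auto
  also have "\<dots> \<le> ennreal (C * L) * pfE b U \<xi> + ennreal C * pfE b ?D \<xi>"
  proof -
    have c1: "L * (2 * (1 + b)) \<le> C * L" using C L by (simp add: mult.commute)
    have "L * ((1 + b) / (1 - b) * r\<^sup>2) = (1 + b) / (1 - b)" using \<xi> by (simp add: L_def r_def power_divide)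
    then have c2: "L * ((1 + b) / (1 - b) * r\<^sup>2) \<le> C" by (simp only: C(2))
    show ?thesis by (intro add_mono mult_mono EF ennreal_leI[OF c1] ennreal_leI[OF c2]) auto
  qed
  also have "\<dots> = ennreal C * (pfE b ?D \<xi> + ennreal L * pfE b U \<xi>)"
    using C L by (simp add: distrib_left ennreal_mult mult.assoc add.commute)
  finally have "ennreal L * ennreal ((norm (pf U \<xi> 0))\<^sup>2 * r powr (1 + b)) \<le> \<dots>" .
  moreover have "L * ((norm (pf U \<xi> 0))\<^sup>2 * r powr (1 + b)) = L powr (1 - (1 + b) / 2) * (norm (pf U \<xi> 0))\<^sup>2"
  proof -
    have "norm \<xi> > 0" using \<xi> by simp
    have "r powr (1 + b) = norm \<xi> powr (- (1 + b))"
    proof -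
      have "r = norm \<xi> powr (- 1)" using \<open>norm \<xi> > 0\<close> by (simp add: r_def powr_minus_divide)
      then show ?thesis by (simp only: powr_powr) simp
    qed
    also have "\<dots> = L powr (- (1 + b) / 2)"
    proof -
      have "L = norm \<xi> powr 2" using \<open>norm \<xi> > 0\<close> by (simp add: L_def)
      then have "L powr (- (1 + b) / 2) = norm \<xi> powr (2 * (- (1 + b) / 2))" by (simp only: powr_powr)
      also have "2 * (- (1 + b) / 2) = - (1 + b)" by simp
      finally show ?thesis ..
    qed
    finally have "L * r powr (1 + b) = L powr 1 * L powr (- (1 + b) / 2)" using L by simp
    also have "\<dots> = L powr (1 - (1 + b) / 2)" by (subst powr_add[symmetric], intro arg_cong[where f="\<lambda>t. L powr t"]) (simp add: field_simps)
    finally show ?thesis by (simp add: mult_ac)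
  qed
  ultimately show ?thesis using L unfolding L_def[symmetric] C_def[symmetric] by (simp flip: ennreal_mult)
qed

text \<open>Each application of \<open>Lap_b\<close> gains two factors |\<xi>|^2: one by coercivity,
  one because the energy of \<open>V (Suc m)\<close> enters \<open>Q (Suc m)\<close> with that
  factor. The first claim serves odd orders, where the top term is a gradient, and the second even
  orders.\<close>

lemma pfE_iterated:
  assumes U: "U \<in> Cinfe" and b: "-1 < b"
  defines "V m \<equiv> (Lap_b b ^^ m) U"
  defines "Q m \<xi> \<equiv> pfE b (partial_deriv (0, 1) (V m)) \<xi> + ennreal ((norm \<xi>)\<^sup>2) * pfE b (V m) \<xi>"
  shows "ennreal ((norm \<xi>)\<^sup>2) ^ (2 * m) * Q 0 \<xi> \<le> Q m \<xi>"
    "ennreal ((norm \<xi>)\<^sup>2) ^ (2 * m + 1) * Q 0 \<xi> \<le> pfE b (V (Suc m)) \<xi>"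
proof -
  let ?L = "ennreal ((norm \<xi>)\<^sup>2)"
  have K: "?L * Q m \<xi> \<le> pfE b (V (Suc m)) \<xi>" for m
    unfolding Q_def using pfE_coercivity[OF Lap_b_iter_Cinfe[OF U, of m b] b, of \<xi>] by (simp add: V_def)
  show 1: "?L ^ (2 * m) * Q 0 \<xi> \<le> Q m \<xi>" for m
  proof (induction m)
    case (Suc m)
    have "?L ^ (2 * Suc m) * Q 0 \<xi> = ?L * (?L * (?L ^ (2 * m) * Q 0 \<xi>))" by (simp add: mult.assoc)
    also have "\<dots> \<le> ?L * (?L * Q m \<xi>)" by (intro mult_left_mono Suc) auto
    also have "\<dots> \<le> ?L * pfE b (V (Suc m)) \<xi>" by (intro mult_left_mono K) auto
    also have "\<dots> \<le> Q (Suc m) \<xi>" unfolding Q_def by simp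
    finally show ?case .
  qed simp
  have "?L ^ (2 * m + 1) * Q 0 \<xi> = ?L * (?L ^ (2 * m) * Q 0 \<xi>)" by (simp add: mult.assoc)
  also have "\<dots> \<le> ?L * Q m \<xi>" by (intro mult_left_mono 1) auto
  also have "\<dots> \<le> pfE b (V (Suc m)) \<xi>" by (rule K)
  finally show "?L ^ (2 * m + 1) * Q 0 \<xi> \<le> pfE b (V (Suc m)) \<xi>" .
qed

text \<open>With L = |\<xi>|^2 the multiplier splits as L^(k-1) times L^(1 - (1+b)/2). The second
  factor belongs to the first-order trace inequality, and the k - 1 remaining factors come from the
  iteration.\<close>

theorem trace_fourier_estimate:
  fixes U :: "(real^'n) \<times> real \<Rightarrow> real"
  assumes U: "U \<in> Cinfe" and b: "-1 < b" "b < 1" and k: "k \<ge> 1"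
  shows "(\<integral>\<^sup>+\<xi>. ennreal (norm \<xi> powr (2 * (real k - (1 + b) / 2)) * (norm (fourier (\<lambda>x. of_real (trace_map U x)) \<xi>))\<^sup>2) \<partial>lborel)
    \<le> ennreal (max (2 * (1 + b)) ((1 + b) / (1 - b))) * (\<integral>\<^sup>+z. ennreal (weight b 0 z * (norm (nabla_b b k U z))\<^sup>2) \<partial>lborel)"
proof -
  define C where "C = max (2 * (1 + b)) ((1 + b) / (1 - b))"
  have C: "0 \<le> C" using b by (auto simp: C_def max_def)
  define V where "V m = (Lap_b b ^^ m) U" for m
  have V: "V m \<in> Cinfe" for m unfolding V_def by (rule Lap_b_iter_Cinfe[OF U])
  define Q where "Q m \<xi> = pfE b (partial_deriv (0, 1) (V m)) \<xi> + ennreal ((norm \<xi>)\<^sup>2) * pfE b (V m) \<xi>" for m \<xi>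
  note it = pfE_iterated[OF U b(1), folded V_def, folded Q_def]
  have cV: "continuous_on UNIV (V m)" "compact (closure {z. V m z \<noteq> 0})" "Ck 1 (V m)" for m
    using CinfeD(1)[OF V, of 0] CinfeD(1)[OF V, of 1] CinfeD(2)[OF V] by simp_all
  have cP: "continuous_on UNIV (partial_deriv e (V m))" "compact (closure {z. partial_deriv e (V m) z \<noteq> 0})" if "e \<in> Basis" for e m
    using Cinfe_partial2(1)[OF V[of m] that, of 0] Cinfe_partial2(2)[OF V[of m] that] by simp_all
  define top where "top \<xi> = (if even k then pfE b (V (k div 2)) \<xi> else Q ((k - 1) div 2) \<xi>)" for \<xi>
  have topb: "ennreal (((norm \<xi>)\<^sup>2) ^ (k - 1)) * Q 0 \<xi> \<le> top \<xi>" for \<xi>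
  proof (cases "even k")
    case True
    then obtain n where n: "k = 2 * n" by (rule evenE)
    define m where "m = n - 1"
    \<comment> \<open>The second iterated bound carries 2 m + 1 factors, which is k - 1 for k = 2 (m
      + 1); in the odd case below, k = 2 m + 1 and the first bound carries 2 m.\<close>
    have "k = 2 * Suc m" using n k by (simp add: m_def)
    then show ?thesis using it(2)[of \<xi> m] by (simp add: top_def ennreal_power ennreal_mult)
  next
    case False
    then obtain m where "k = 2 * m + 1" by (auto elim: oddE)
    then show ?thesis using it(1)[of \<xi> m] by (simp add: top_def ennreal_power)
  qed
  have pw: "ennreal (norm \<xi> powr (2 * (real k - (1 + b) / 2)) * (norm (fourier (\<lambda>x. of_real (trace_map U x)) \<xi>))\<^sup>2) \<le> ennreal C * top \<xi>"
    if \<xi>: "\<xi> \<noteq> 0" for \<xi> :: "real^'n"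
  proof -
    let ?L = "(norm \<xi>)\<^sup>2"
    have L: "?L > 0" using \<xi> by simp
    have "norm \<xi> powr (2 * (real k - (1 + b) / 2)) = ?L powr (real k - (1 + b) / 2)"
      using \<xi> by (simp add: powr_powr flip: powr_numeral)
    also have "\<dots> = ?L powr (real (k - 1)) * ?L powr (1 - (1 + b) / 2)"
      using k by (subst powr_add[symmetric]) (simp add: of_nat_diff)
    also have "?L powr (real (k - 1)) = ?L ^ (k - 1)" by (rule powr_realpow[OF L])
    finally have e: "norm \<xi> powr (2 * (real k - (1 + b) / 2)) = ?L ^ (k - 1) * ?L powr (1 - (1 + b) / 2)" .
    have "ennreal (norm \<xi> powr (2 * (real k - (1 + b) / 2)) * (norm (fourier (\<lambda>x. of_real (trace_map U x)) \<xi>))\<^sup>2) =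
      ennreal (?L ^ (k - 1)) * ennreal (?L powr (1 - (1 + b) / 2) * (norm (pf U \<xi> 0))\<^sup>2)"
    proof -
      have "fourier (\<lambda>x. of_real (trace_map U x)) \<xi> = pf U \<xi> 0" by (simp add: pf_def trace_map_def)
      then show ?thesis unfolding e mult.assoc by (simp only: ennreal_mult zero_le_power zero_le_power2 powr_ge_zero mult_nonneg_nonneg)
    qed
    also have "\<dots> \<le> ennreal (?L ^ (k - 1)) * (ennreal C * Q 0 \<xi>)"
      using pfE_trace[OF U b \<xi>] by (intro mult_left_mono) (simp_all add: C_def Q_def V_def)
    also have "\<dots> = ennreal C * (ennreal (?L ^ (k - 1)) * Q 0 \<xi>)" by (rule mult.left_commute)
    also have "\<dots> \<le> ennreal C * top \<xi>" by (intro mult_left_mono topb) auto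
    finally show ?thesis .
  qed
  have [measurable]: "Q m \<in> borel_measurable borel" for m
    unfolding Q_def[abs_def] using borel_measurable_pfE[OF cV(1)] borel_measurable_pfE[OF cP(1)[OF e_y_Basis]] by measurable
  have [measurable]: "top \<in> borel_measurable borel"
    unfolding top_def[abs_def] using borel_measurable_pfE[OF cV(1)] by measurable
  have w0: "weight b 0 z = \<bar>snd z\<bar> powr b" for z :: "(real^'n) \<times> real" by (simp add: weight_def)
  have "(\<integral>\<^sup>+\<xi>. top \<xi> \<partial>lborel) \<le> (\<integral>\<^sup>+z. ennreal (weight b 0 z * (norm (nabla_b b k U z))\<^sup>2) \<partial>lborel)"
  proof (cases "even k")
    case True
    then have "(\<integral>\<^sup>+\<xi>. top \<xi> \<partial>lborel) = (\<integral>\<^sup>+\<xi>. pfE b (V (k div 2)) \<xi> \<partial>lborel)" by (simp add: top_def)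
    also have "\<dots> \<le> (\<integral>\<^sup>+z. ennreal (\<bar>snd z\<bar> powr b * (norm (V (k div 2) z))\<^sup>2) \<partial>lborel)"
      by (rule pfE_integral_le[OF cV(1,2)])
    finally show ?thesis using True by (simp add: w0 nabla_b_def V_def)
  next
    case False
    define m where "m = (k - 1) div 2"
    let ?P = "\<lambda>e. partial_deriv e (V m)"
    have iB: "(i, 0) \<in> (Basis :: ((real^'n) \<times> real) set)" if "i \<in> Basis" for i :: "real^'n" using that by (auto simp: Basis_prod_def)
    have [measurable]: "pfE b (?P e) \<in> borel_measurable borel" "?P e \<in> borel_measurable borel" if "e \<in> Basis" for e
      using borel_measurable_pfE[OF cP(1)[OF that]] borel_measurable_continuous_onI[OF cP(1)[OF that]] by auto
    note [measurable] = borel_measurable_fst_snd_borel(2)[where 'a="real^'n" and 'b=real]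
    have "(\<integral>\<^sup>+\<xi>. top \<xi> \<partial>lborel) = (\<integral>\<^sup>+\<xi>. (\<Sum>e\<in>Basis. pfE b (?P e) \<xi>) \<partial>lborel)"
      using False unfolding top_def Q_def m_def[symmetric] by (simp add: pfE_partial[OF cV(3,2)] sum_Basis_prod add.commute)
    also have "\<dots> = (\<Sum>e\<in>Basis. \<integral>\<^sup>+\<xi>. pfE b (?P e) \<xi> \<partial>lborel)"
      by (rule nn_integral_sum) simp
    also have "\<dots> \<le> (\<Sum>e\<in>Basis. \<integral>\<^sup>+z. ennreal (\<bar>snd z\<bar> powr b * (norm (?P e z))\<^sup>2) \<partial>lborel)"
      by (intro sum_mono pfE_integral_le cP)
    also have "\<dots> = (\<integral>\<^sup>+z. (\<Sum>e\<in>Basis. ennreal (\<bar>snd z\<bar> powr b * (norm (?P e z))\<^sup>2)) \<partial>lborel)"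
      by (rule nn_integral_sum[symmetric]) measurable
    also have "\<dots> = (\<integral>\<^sup>+z. ennreal (weight b 0 z * (norm (nabla_b b k U z))\<^sup>2) \<partial>lborel)"
      by (intro nn_integral_cong)
         (use False in \<open>simp add: w0 nabla_b_def norm_grad V_def m_def[symmetric] sum_distrib_left sum_nonneg flip: V_def One_nat_def\<close>)
    finally show ?thesis .
  qed
  then have "ennreal C * (\<integral>\<^sup>+\<xi>. top \<xi> \<partial>lborel) \<le> ennreal C * (\<integral>\<^sup>+z. ennreal (weight b 0 z * (norm (nabla_b b k U z))\<^sup>2) \<partial>lborel)"
    by (rule mult_left_mono) simp
  moreover have "(\<integral>\<^sup>+\<xi>. ennreal (norm \<xi> powr (2 * (real k - (1 + b) / 2)) * (norm (fourier (\<lambda>x. of_real (trace_map U x)) \<xi>))\<^sup>2) \<partial>lborel)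
    \<le> (\<integral>\<^sup>+\<xi>. ennreal C * top \<xi> \<partial>lborel)"
    by (rule nn_integral_mono_AE, use AE_lborel_singleton[of 0] in eventually_elim) (rule pw)
  moreover have "(\<integral>\<^sup>+\<xi>. ennreal C * top \<xi> \<partial>lborel) = ennreal C * (\<integral>\<^sup>+\<xi>. top \<xi> \<partial>lborel)"
    by (rule nn_integral_cmult) simp
  ultimately show ?thesis unfolding C_def by simp
qed

subsection \<open>Integrability of the weights\<close>

text \<open>As in \<open>powr_norm_le_prod\<close>, the singular factor is spread over the
  coordinates, but unevenly: the y-direction already carries the exponent b, so its share is
  proportional to 1 + b. Then all exponents exceed -1 together.\<close>

lemma weight_locally_integrable:
  assumes b: "-1 < b" and i: "real CARD('n::finite) + 1 + b > 2 * real i"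
  shows "integrable lborel (\<lambda>z :: (real^'n) \<times> real. indicator (cball 0 R) z * weight b i z)"
proof -
  \<comment> \<open>The common proportion: the shares 1, ..., 1, 1 + b add up to n + 1 + b, and t <
    1 is precisely the dimension hypothesis.\<close>
  define t where "t = 2 * real i / (real CARD('n) + 1 + b)"
  have den: "real CARD('n) + 1 + b > 0" using b by simp
  have t: "0 \<le> t" "t < 1" using i den by (auto simp: t_def)
  define d :: "(real^'n) \<times> real \<Rightarrow> real" where "d e = (if e = (0, 1) then - t * (1 + b) else - t)" for e
  define c where "c e = d e + (if e = (0, 1) then b else 0)" for e
  have d0: "d e \<le> 0" for e using t b by (auto simp: d_def mult_nonneg_nonneg)
  have c1: "c e > - 1" for e
  proof -
    have "t * (1 + b) < 1 * (1 + b)" using t b by (intro mult_strict_right_mono) auto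
    then show ?thesis using t by (auto simp: c_def d_def)
  qed
  have ds: "(\<Sum>e\<in>Basis. d e) = - 2 * real i"
  proof -
    have "(\<Sum>e\<in>Basis. d e) = - t * (real CARD('n) + 1 + b)"
      by (simp add: sum_Basis_prod d_def algebra_simps)
    then show ?thesis using den by (simp add: t_def)
  qed
  have I: "integrable lborel (\<lambda>z :: (real^'n) \<times> real. \<Prod>e\<in>Basis. indicator {-R..R} (z \<bullet> e) * \<bar>z \<bullet> e\<bar> powr c e)"
    by (intro integrable_prod_powr_box c1)
  show ?thesis
  proof (rule Bochner_Integration.integrable_bound[OF I])
    show "(\<lambda>z :: (real^'n) \<times> real. indicator (cball 0 R) z * weight b i z) \<in> borel_measurable lborel"
      using borel_measurable_indicator_cball[of 0 R] by (intro borel_measurable_times) auto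
    show "AE z :: (real^'n) \<times> real in lborel. norm (indicator (cball 0 R) z * weight b i z)
       \<le> norm (\<Prod>e\<in>Basis. indicator {-R..R} (z \<bullet> e) * \<bar>z \<bullet> e\<bar> powr c e)"
      using AE_inner_nonzero
    proof eventually_elim
      case (elim z)
      have z0: "z \<noteq> 0" using elim e_y_Basis by fastforce
      show ?case
      proof (cases "z \<in> cball 0 R")
        case True
        have i1: "indicator {-R..R} (z \<bullet> e) = (1::real)" if "e \<in> Basis" for e
          using Basis_le_norm[OF that, of z] True by (auto simp: indicator_def)
        have sy: "z \<bullet> (0, 1) = snd z" by (cases z) simp
        have "1 / norm z ^ (2 * i) = norm z powr (- 2 * real i)"
          using z0 powr_realpow[of "norm z" "2 * i"] by (simp add: powr_minus divide_inverse)
        also have "\<dots> = (\<Prod>e\<in>Basis. norm z powr d e)"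
          unfolding ds[symmetric] using z0 by (intro powr_sum) auto
        also have "\<dots> \<le> (\<Prod>e\<in>Basis. \<bar>z \<bullet> e\<bar> powr d e)"
          using elim d0 by (intro prod_mono conjI powr_mono2') (auto simp: Basis_le_norm)
        finally have "\<bar>snd z\<bar> powr b * (1 / norm z ^ (2 * i)) \<le> \<bar>snd z\<bar> powr b * (\<Prod>e\<in>Basis. \<bar>z \<bullet> e\<bar> powr d e)"
          by (intro mult_left_mono) auto
        also have "\<dots> = (\<Prod>e\<in>Basis. indicator {-R..R} (z \<bullet> e) * \<bar>z \<bullet> e\<bar> powr c e)"
        proof -
          have "(\<Prod>e\<in>Basis. \<bar>z \<bullet> e\<bar> powr (if e = (0, 1) then b else 0)) = (\<Prod>e\<in>(Basis :: ((real^'n) \<times> real) set). if e = (0, 1) then \<bar>snd z\<bar> powr b else 1)"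
            using elim by (intro prod.cong refl) (auto simp: sy)
          then have "\<bar>snd z\<bar> powr b = (\<Prod>e\<in>Basis. \<bar>z \<bullet> e\<bar> powr (if e = (0, 1) then b else 0))"
            by (simp add: prod.delta)
          then have "\<bar>snd z\<bar> powr b * (\<Prod>e\<in>Basis. \<bar>z \<bullet> e\<bar> powr d e) =
            (\<Prod>e\<in>Basis. \<bar>z \<bullet> e\<bar> powr (if e = (0, 1) then b else 0) * \<bar>z \<bullet> e\<bar> powr d e)"
            by (simp only: prod.distrib)
          also have "\<dots> = (\<Prod>e\<in>Basis. indicator {-R..R} (z \<bullet> e) * \<bar>z \<bullet> e\<bar> powr c e)"
            by (intro prod.cong refl) (simp add: i1 c_def add.commute flip: powr_add)
          finally show ?thesis .
        qed
        finally have le: "weight b i z \<le> (\<Prod>e\<in>Basis. indicator {-R..R} (z \<bullet> e) * \<bar>z \<bullet> e\<bar> powr c e)" (is "_ \<le> ?P")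
          by (simp add: weight_def)
        have "norm (indicator (cball 0 R) z * weight b i z) = weight b i z" using True by simp
        also have "\<dots> \<le> norm ?P" using le by (rule order_trans[OF _ norm_ge_self])
        finally show ?thesis .
      qed simp
    qed
  qed
qed

lemma weighted_L2_compact_support:
  fixes f :: "(real^'n) \<times> real \<Rightarrow> 'b::euclidean_space"
  assumes b: "-1 < b" and i: "real CARD('n) + 1 + b > 2 * real i"
    and c: "continuous_on UNIV f" and S: "{z. f z \<noteq> 0} \<subseteq> K" and K: "compact K"
  shows "f \<in> weighted_L2 (weight b i)"
proof -
  note [measurable] = borel_measurable_continuous_onI[OF c]
  obtain R where "\<And>z. z \<in> K \<Longrightarrow> norm z \<le> R"
    using compact_imp_bounded[OF K] unfolding bounded_iff by blast
  then have R: "K \<subseteq> cball 0 R" by auto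
  have "bounded (f ` cball 0 R)"
    by (intro compact_imp_bounded compact_continuous_image continuous_on_subset[OF c]) auto
  then obtain B where B: "\<And>z. z \<in> cball 0 R \<Longrightarrow> norm (f z) \<le> B" unfolding bounded_iff by (metis imageI)
  have "integrable lborel (\<lambda>z. weight b i z * (norm (f z))\<^sup>2)"
  proof (rule Bochner_Integration.integrable_bound[OF integrable_mult_right[OF weight_locally_integrable[OF b i, of R], of "B\<^sup>2"]])
    show "AE z in lborel. norm (weight b i z * (norm (f z))\<^sup>2) \<le> norm (B\<^sup>2 * (indicator (cball 0 R) z * weight b i z))"
    proof (rule AE_I2)
      fix z
      show "norm (weight b i z * (norm (f z))\<^sup>2) \<le> norm (B\<^sup>2 * (indicator (cball 0 R) z * weight b i z))"
      proof (cases "z \<in> cball 0 R")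
        case True
        have "(norm (f z))\<^sup>2 \<le> B\<^sup>2" using B[OF True] by (intro power_mono) auto
        then have "weight b i z * (norm (f z))\<^sup>2 \<le> weight b i z * B\<^sup>2" by (intro mult_left_mono) auto
        then show ?thesis using True by (simp add: abs_mult mult.commute)
      next
        case False
        then have "f z = 0" using S R by auto
        then show ?thesis by simp
      qed
    qed
  qed measurable
  then show ?thesis by (simp add: weighted_L2_def)
qed

lemma nabla_b_weighted_L2:
  fixes U :: "(real^'n) \<times> real \<Rightarrow> real"
  assumes b: "-1 < b" and i: "real CARD('n) + 1 + b > 2 * real i" and U: "U \<in> Cinfe"
  shows "nabla_b b j U \<in> weighted_L2 (weight b i)"
  by (rule weighted_L2_compact_support[OF b i continuous_nabla_b[OF U] nabla_b_support[OF U] CinfeD(2)[OF U]])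

lemma full_norm_nonneg: "full_norm k b U \<ge> 0"
  by (simp add: full_norm_def sum_nonneg integral_nonneg_AE)

lemma full_norm_eq:
  "full_norm k b U = L2_set (\<lambda>j. weighted_L2_norm (weight b (k - j)) (nabla_b b j U)) {..k}"
  by (simp add: full_norm_def L2_set_def weighted_L2_norm_sq)

lemma weighted_norm_le_full_norm:
  "j \<le> k \<Longrightarrow> weighted_L2_norm (weight b (k - j)) (nabla_b b j U) \<le> full_norm k b U"
  unfolding full_norm_eq by (rule member_le_L2_set) auto

subsection \<open>Test functions vanishing on the hyperplane\<close>

definition gauss :: "real \<Rightarrow> 'a::euclidean_space \<Rightarrow> 'a \<Rightarrow> real" where
  "gauss t a z = exp (- t * (norm (z - a))\<^sup>2)"

lemma gauss_has_derivative:
  "(gauss t a has_derivative (\<lambda>h. - 2 * t * ((z - a) \<bullet> h) * gauss t a z)) (at z)"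
  unfolding gauss_def[abs_def] power2_norm_eq_inner
  by (rule derivative_eq_intros refl | simp)+ (simp add: inner_commute algebra_simps fun_eq_iff)

lemma continuous_gauss: "continuous_on S (gauss t a)"
  unfolding gauss_def[abs_def] by (intro continuous_intros)

lemma gauss_decay:
  fixes a :: "'a::euclidean_space"
  assumes "t > 0"
  obtains C where "C \<ge> 0" "\<And>z. (1 + norm z) ^ N * gauss t a z \<le> C"
proof -
  obtain C where C: "\<And>z::'a. (1 + norm z) ^ N * norm (cgauss t ((2 * t) *\<^sub>R a) 0 z) \<le> C"
    using cgauss_decay[OF assms] by blast
  have "gauss t a z = exp (- t * (norm a)\<^sup>2) * norm (cgauss t ((2 * t) *\<^sub>R a) 0 z)" for z
    unfolding gauss_def cgauss_def power2_norm_eq_inner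
    by (simp add: exp_add[symmetric] inner_diff_left inner_diff_right inner_commute algebra_simps)
  then have e: "(1 + norm z) ^ N * gauss t a z = exp (- t * (norm a)\<^sup>2) * ((1 + norm z) ^ N * norm (cgauss t ((2 * t) *\<^sub>R a) 0 z))" for z
    by (simp only: mult.left_commute)
  have "(1 + norm z) ^ N * gauss t a z \<le> exp (- t * (norm a)\<^sup>2) * \<bar>C\<bar>" for z
    unfolding e by (intro mult_left_mono order_trans[OF C abs_ge_self]) simp
  then show thesis by (intro that[of "exp (- t * (norm a)\<^sup>2) * \<bar>C\<bar>"]) auto
qed

text \<open>The explicit factor y gives y^2 |y|^(-b) = |y|^(2-b), which is bounded near y = 0 and at
  most (1 + norm z)^3. The remaining factors grow polynomially and are absorbed by the
  Gaussian.\<close>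

lemma integrable_test_weight:
  fixes p :: "(real^'n) \<times> real \<Rightarrow> real"
  assumes b: "-1 < b" "b < 1" and t: "t > 0" and c: "continuous_on UNIV p"
    and p: "\<And>z. \<bar>p z\<bar> \<le> C * (1 + norm z) ^ M"
  shows "integrable lborel (\<lambda>z. (snd z * p z * gauss t a z)\<^sup>2 / weight b i z)"
proof -
  note [measurable] = borel_measurable_continuous_onI[OF c] borel_measurable_continuous_onI[OF continuous_gauss]
    borel_measurable_fst_snd_borel(2)[where 'a="real^'n" and 'b=real]
  \<comment> \<open>Twice this exponent covers the cube, the squared polynomial, the factor norm z ^
    (2 * i) and the integrable decay of order 2 * DIM.\<close>
  define N where "N = M + 3 + i + DIM((real^'n) \<times> real)"
  obtain D where D: "D \<ge> 0" "\<And>z :: (real^'n) \<times> real. (1 + norm z) ^ N * gauss t a z \<le> D" using gauss_decay[OF t] by blast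
  have C: "C \<ge> 0" using p[of 0] abs_ge_zero[of "p 0"] by simp
  let ?K = "2 * DIM((real^'n) \<times> real)"
  have le: "(snd z * p z * gauss t a z)\<^sup>2 / weight b i z \<le> (C * D)\<^sup>2 * (1 / (1 + norm z) ^ ?K)" for z
  proof (cases "snd z = 0")
    case True then show ?thesis using C D by simp
  next
    case False
    define r where "r = 1 + norm z"
    have r: "r \<ge> 1" by (simp add: r_def)
    have z0: "norm z > 0" using False by auto
    have ys: "\<bar>snd z\<bar> \<le> r" using norm_snd_le[of "snd z" "fst z"] by (simp add: r_def)
    have "(snd z)\<^sup>2 / \<bar>snd z\<bar> powr b = \<bar>snd z\<bar> powr (2 - b)"
      using False by (simp add: powr_diff powr_numeral)
    also have "\<dots> \<le> r powr (2 - b)" using b ys by (intro powr_mono2) auto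
    also have "\<dots> \<le> r powr real 3" using b r by (intro powr_mono) auto
    also have "\<dots> = r ^ 3" using r by (simp add: powr_realpow)
    finally have 1: "(snd z)\<^sup>2 / \<bar>snd z\<bar> powr b \<le> r ^ 3" .
    have 2: "norm z ^ (2 * i) \<le> r ^ (2 * i)" by (intro power_mono) (auto simp: r_def)
    have g: "gauss t a z \<le> D / r ^ N" using D(2)[of z] r by (subst pos_le_divide_eq) (auto simp: r_def mult.commute add_pos_nonneg)
    have 3: "(p z * gauss t a z)\<^sup>2 \<le> (C * r ^ M * (D / r ^ N))\<^sup>2"
    proof (subst abs_le_square_iff[symmetric])
      have "\<bar>p z * gauss t a z\<bar> = \<bar>p z\<bar> * gauss t a z" by (simp add: abs_mult gauss_def)
      also have "\<dots> \<le> (C * r ^ M) * (D / r ^ N)"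
        using p[of z] g C r by (intro mult_mono) (auto simp: r_def gauss_def)
      finally show "\<bar>p z * gauss t a z\<bar> \<le> \<bar>C * r ^ M * (D / r ^ N)\<bar>" by linarith
    qed
    have "(snd z * p z * gauss t a z)\<^sup>2 / weight b i z = ((snd z)\<^sup>2 / \<bar>snd z\<bar> powr b) * norm z ^ (2 * i) * (p z * gauss t a z)\<^sup>2"
      using z0 by (simp add: weight_def power_mult_distrib field_simps)
    also have "\<dots> \<le> r ^ 3 * r ^ (2 * i) * (C * r ^ M * (D / r ^ N))\<^sup>2"
      using 1 2 3 r by (intro mult_mono mult_nonneg_nonneg) auto
    also have "\<dots> = (C * D)\<^sup>2 * (r ^ (3 + 2 * i + 2 * M) / r ^ (2 * N))"
      by (simp add: power_mult_distrib power_divide power_add power_mult[symmetric] mult.commute mult.left_commute)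
    also have "\<dots> \<le> (C * D)\<^sup>2 * (1 / r ^ ?K)"
    proof (rule mult_left_mono)
      have "r ^ (3 + 2 * i + 2 * M) * r ^ ?K = r ^ (3 + 2 * i + 2 * M + ?K)" by (rule power_add[symmetric])
      also have "\<dots> \<le> r ^ (2 * N)" using r by (intro power_increasing) (auto simp: N_def)
      finally show "r ^ (3 + 2 * i + 2 * M) / r ^ (2 * N) \<le> 1 / r ^ ?K" using r by (simp add: field_simps)
    qed simp
    finally show ?thesis by (simp add: r_def)
  qed
  show ?thesis
  proof (rule Bochner_Integration.integrable_bound[OF integrable_mult_right[OF integrable_decay[of ?K], of "(C * D)\<^sup>2"]])
    show "AE z in lborel. norm ((snd z * p z * gauss t a z)\<^sup>2 / weight b i z) \<le> norm ((C * D)\<^sup>2 * (1 / (1 + norm z) ^ ?K))"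
      by (intro AE_I2 order_trans[OF eq_refl[OF norm_of_nonneg] order_trans[OF le norm_ge_self]]) auto
  qed measurable
qed

lemma integral_by_parts_compact:
  fixes F g :: "'a::euclidean_space \<Rightarrow> real"
  assumes F: "Ck 1 F" and K: "compact (closure {z. F z \<noteq> 0})" and g: "Ck 1 g" and e: "e \<in> Basis"
  shows "(LINT z|lborel. g z * partial_deriv e F z) = - (LINT z|lborel. F z * partial_deriv e g z)"
    "integrable lborel (\<lambda>z. g z * partial_deriv e F z)"
proof -
  have d: "F differentiable at z" "g differentiable at z" for z
    using F g by (auto intro!: Ck_1_differentiable[of 1] simp del: One_nat_def)
  have c: "continuous_on UNIV F" "continuous_on UNIV g" "continuous_on UNIV (partial_deriv e F)" "continuous_on UNIV (partial_deriv e g)"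
    using F g e by (auto intro: Ck_continuous Ck_1_continuous_partial[of 1] simp del: Ck.simps One_nat_def)
  let ?P = "\<lambda>z. g z * F z"
  have P: "partial_deriv e ?P z = g z * partial_deriv e F z + partial_deriv e g z * F z" "?P differentiable at z" for z
    using partial_deriv_mult[OF d(2) d(1)] by auto
  let ?H = "\<lambda>z. complex_of_real (?P z)"
  have pH: "partial_deriv e ?H = (\<lambda>z. of_real (g z * partial_deriv e F z + partial_deriv e g z * F z))"
    using partial_deriv_linear[OF bounded_linear_of_real P(2), of e] by (auto simp: P(1))
  have rap: "rapid (\<lambda>z. complex_of_real (h z))" if "continuous_on UNIV h" "{z. h z \<noteq> 0} \<subseteq> closure {z. F z \<noteq> 0}" for h
    using that compact_closure_subset[OF K, of "{z. complex_of_real (h z) \<noteq> 0}"]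
    by (intro rapid_compact continuous_on_of_real) auto
  have sub: "{z. F z \<noteq> 0} \<subseteq> closure {z. F z \<noteq> 0}" "{z. partial_deriv e F z \<noteq> 0} \<subseteq> closure {z. F z \<noteq> 0}"
    using closure_subset closure_partial_support[of e F] by (auto intro: closure_subset[THEN subsetD])
  have ih: "integrable lborel h" if "continuous_on UNIV h" "{z. h z \<noteq> 0} \<subseteq> closure {z. F z \<noteq> 0}" for h :: "'a \<Rightarrow> real"
    using rapid_integrable[OF rap[OF that]] by (simp only: complex_of_real_integrable_eq)
  have i1: "integrable lborel (\<lambda>z. g z * partial_deriv e F z)"
    by (rule ih) (use sub in \<open>auto intro!: continuous_on_mult c\<close>)
  have i2: "integrable lborel (\<lambda>z. partial_deriv e g z * F z)"
    by (rule ih) (use sub in \<open>auto intro!: continuous_on_mult c\<close>)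
  show "integrable lborel (\<lambda>z. g z * partial_deriv e F z)" by (rule i1)
  have "(LINT z|lborel. partial_deriv e ?H z) = 0"
  proof (rule integral_partial_zero[OF _ _ _ e])
    show "?H differentiable at z" for z
      using bounded_linear.has_derivative[OF bounded_linear_of_real] P(2)[of z] unfolding differentiable_def by blast
    show "integrable lborel ?H"
      by (intro rapid_integrable rap continuous_intros c) (use sub in auto)
    show "rapid (partial_deriv e ?H)"
      unfolding pH
    proof (rule rap)
      show "{z. g z * partial_deriv e F z + partial_deriv e g z * F z \<noteq> 0} \<subseteq> closure {z. F z \<noteq> 0}"
        by (rule order_trans[OF _ Un_least[OF sub]]) auto
    qed (intro continuous_intros c)
  qed
  then have "(LINT z|lborel. g z * partial_deriv e F z + partial_deriv e g z * F z) = 0"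
    unfolding pH integral_complex_of_real by simp
  then show "(LINT z|lborel. g z * partial_deriv e F z) = - (LINT z|lborel. F z * partial_deriv e g z)"
    using i1 i2 by (simp add: mult.commute)
qed

lemma weighted_pairing_integrable:
  fixes f :: "'a::euclidean_space \<Rightarrow> 'b::euclidean_space" and g :: "'a \<Rightarrow> real"
  assumes w: "\<And>z. w z \<ge> 0" "w \<in> borel_measurable borel" "AE z in lborel. w z > 0"
    and f: "f \<in> weighted_L2 w"
    and g: "g \<in> borel_measurable borel" "integrable lborel (\<lambda>z. (g z)\<^sup>2 / w z)"
  shows "integrable lborel (\<lambda>z. g z * (f z \<bullet> E))"
    "norm (LINT z|lborel. g z * (f z \<bullet> E)) \<le> norm E * (weighted_L2_norm w f * sqrt (LINT z|lborel. (g z)\<^sup>2 / w z))"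
proof -
  have g2: "integrable lborel (\<lambda>z. (norm (g z))\<^sup>2 / w z)" using g(2) by simp
  note CS = weighted_L2_Cauchy_Schwarz[OF w f g(1) g2]
  have b: "norm (g z * (f z \<bullet> E)) \<le> norm E * (norm (f z) * norm (g z))" for z
    using mult_left_mono[OF Cauchy_Schwarz_ineq2[of "f z" E], of "\<bar>g z\<bar>"] by (simp add: abs_mult mult_ac)
  show i: "integrable lborel (\<lambda>z. g z * (f z \<bullet> E))"
    by (rule Bochner_Integration.integrable_bound[OF integrable_mult_right[OF CS(1), of "norm E"]])
       (use weighted_L2D(1)[OF f] g(1) b in \<open>auto intro!: AE_I2 order_trans[OF b norm_ge_self]\<close>)
  have "norm (LINT z|lborel. g z * (f z \<bullet> E)) \<le> (LINT z|lborel. norm (g z * (f z \<bullet> E)))"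
    by (rule integral_norm_bound)
  also have "\<dots> \<le> (LINT z|lborel. norm E * (norm (f z) * norm (g z)))"
    by (rule integral_mono[OF integrable_norm[OF i] integrable_mult_right[OF CS(1)] b])
  also have "\<dots> = norm E * (LINT z|lborel. norm (f z) * norm (g z))" by simp
  also have "\<dots> \<le> norm E * (weighted_L2_norm w f * sqrt (LINT z|lborel. (norm (g z))\<^sup>2 / w z))"
    by (intro mult_left_mono CS(2)) auto
  finally show "norm (LINT z|lborel. g z * (f z \<bullet> E)) \<le> norm E * (weighted_L2_norm w f * sqrt (LINT z|lborel. (g z)\<^sup>2 / w z))"
    by simp
qed

lemma weighted_pairing_tendsto_0:
  fixes f :: "nat \<Rightarrow> 'a::euclidean_space \<Rightarrow> 'b::euclidean_space" and g :: "'a \<Rightarrow> real"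
  assumes w: "\<And>z. w z \<ge> 0" "w \<in> borel_measurable borel" "AE z in lborel. w z > 0"
    and f: "\<And>m. f m \<in> weighted_L2 w" "(\<lambda>m. weighted_L2_norm w (f m)) \<longlonglongrightarrow> 0"
    and g: "g \<in> borel_measurable borel" "integrable lborel (\<lambda>z. (g z)\<^sup>2 / w z)"
  shows "(\<lambda>m. LINT z|lborel. g z * (f m z \<bullet> E)) \<longlonglongrightarrow> 0"
proof -
  have "(\<lambda>m. norm E * (weighted_L2_norm w (f m) * sqrt (LINT z|lborel. (g z)\<^sup>2 / w z))) \<longlonglongrightarrow> norm E * (0 * sqrt (LINT z|lborel. (g z)\<^sup>2 / w z))"
    by (intro tendsto_intros f(2))
  then have "(\<lambda>m. norm E * (weighted_L2_norm w (f m) * sqrt (LINT z|lborel. (g z)\<^sup>2 / w z))) \<longlonglongrightarrow> 0" by simp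
  then show ?thesis
    by (rule Lim_null_comparison[OF always_eventually, rotated])
       (use weighted_pairing_integrable(2)[OF w f(1) g] in blast)
qed

subsection \<open>Closability of \<open>\<nabla>_b^k\<close>\<close>

definition ytest :: "real \<Rightarrow> 'a::euclidean_space \<times> real \<Rightarrow> 'a \<times> real \<Rightarrow> real" where
  "ytest t a z = (snd z)\<^sup>2 * gauss t a z"

text \<open>The cofactor of \<open>snd z * gauss t a z\<close> in the derivative of
  \<open>ytest\<close> in direction e. One factor y survives the differentiation, so
  \<open>integrable_test_weight\<close> applies to the derivative as well.\<close>

definition ytest_factor :: "real \<Rightarrow> 'a::euclidean_space \<times> real \<Rightarrow> 'a \<times> real \<Rightarrow> 'a \<times> real \<Rightarrow> real" where
  "ytest_factor t a e z = 2 * (e \<bullet> (0, 1)) - 2 * t * snd z * ((z - a) \<bullet> e)"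

lemma ytest_has_derivative:
  "(ytest t a has_derivative (\<lambda>h. snd z * ytest_factor t a h z * gauss t a z)) (at z)"
proof -
  have s: "(snd has_derivative snd) (at z)" by (rule bounded_linear_imp_has_derivative[OF bounded_linear_snd])
  have "((\<lambda>z. snd z * snd z * gauss t a z) has_derivative
     (\<lambda>h. snd z * snd z * (- 2 * t * ((z - a) \<bullet> h) * gauss t a z) + (snd z * snd h + snd h * snd z) * gauss t a z)) (at z)"
    by (intro has_derivative_mult s gauss_has_derivative)
  moreover have "snd z * snd z * (- 2 * t * ((z - a) \<bullet> h) * gauss t a z) + (snd z * snd h + snd h * snd z) * gauss t a z
     = snd z * ytest_factor t a h z * gauss t a z" for h
    by (cases h) (simp add: ytest_factor_def algebra_simps)
  ultimately show ?thesis by (simp add: ytest_def[abs_def] power2_eq_square)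
qed

lemma ytest_partial: "partial_deriv e (ytest t a) = (\<lambda>z. snd z * ytest_factor t a e z * gauss t a z)"
  by (rule ext) (rule partial_deriv_eqI[OF ytest_has_derivative])

lemma continuous_ytest_factor: "continuous_on UNIV (ytest_factor t a e)"
  unfolding ytest_factor_def[abs_def] by (intro continuous_intros)

lemma Ck_ytest: "Ck 1 (ytest t a)"
  unfolding One_nat_def
proof (rule Ck_SucI)
  show "ytest t a differentiable at z" for z using ytest_has_derivative unfolding differentiable_def by blast
  show "Ck 0 (partial_deriv e (ytest t a))" for e
    unfolding ytest_partial by (simp, intro continuous_intros continuous_ytest_factor continuous_gauss)
qed

lemma ytest_factor_bound:
  assumes t: "t > 0" and e: "e \<in> Basis"
  shows "\<bar>ytest_factor t a e z\<bar> \<le> (2 + 2 * t * (1 + norm a)) * (1 + norm z) ^ 2"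
proof -
  have 1: "\<bar>e \<bullet> (0, 1)\<bar> \<le> 1" using Basis_le_norm[OF e, of "(0, 1)"] by (simp add: inner_commute)
  have "\<bar>(z - a) \<bullet> e\<bar> \<le> norm (z - a)" by (rule Basis_le_norm[OF e])
  also have "\<dots> \<le> norm z + norm a" by (rule norm_triangle_ineq4)
  also have "\<dots> \<le> (1 + norm z) * (1 + norm a)" by (simp add: algebra_simps)
  finally have "\<bar>(z - a) \<bullet> e\<bar> \<le> (1 + norm z) * (1 + norm a)" .
  moreover have "\<bar>snd z\<bar> \<le> 1 + norm z" using norm_snd_le[of "snd z" "fst z"] by simp
  ultimately have "\<bar>snd z\<bar> * \<bar>(z - a) \<bullet> e\<bar> \<le> (1 + norm z) * ((1 + norm z) * (1 + norm a))"
    by (intro mult_mono) auto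
  then have 2: "2 * t * (\<bar>snd z\<bar> * \<bar>(z - a) \<bullet> e\<bar>) \<le> 2 * t * ((1 + norm z) * ((1 + norm z) * (1 + norm a)))"
    using t by (intro mult_left_mono) auto
  have 3: "1 \<le> (1 + norm z) ^ 2" by (intro one_le_power) simp
  have "\<bar>ytest_factor t a e z\<bar> \<le> 2 * \<bar>e \<bullet> (0, 1)\<bar> + 2 * t * (\<bar>snd z\<bar> * \<bar>(z - a) \<bullet> e\<bar>)"
    using t unfolding ytest_factor_def by (intro order_trans[OF abs_triangle_ineq4]) (simp add: abs_mult)
  also have "\<dots> \<le> 2 * (1 + norm z) ^ 2 + 2 * t * (1 + norm a) * (1 + norm z) ^ 2"
  proof (rule add_mono)
    show "2 * \<bar>e \<bullet> (0, 1)\<bar> \<le> 2 * (1 + norm z) ^ 2" using 1 3 by linarith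
    have "2 * t * ((1 + norm z) * ((1 + norm z) * (1 + norm a))) = 2 * t * (1 + norm a) * (1 + norm z) ^ 2"
      by (simp only: power2_eq_square mult_ac)
    with 2 show "2 * t * (\<bar>snd z\<bar> * \<bar>(z - a) \<bullet> e\<bar>) \<le> 2 * t * (1 + norm a) * (1 + norm z) ^ 2" by (simp only:)
  qed
  finally show ?thesis by (simp add: distrib_right)
qed

lemma ytest_weight_integrable:
  fixes a :: "(real^'n) \<times> real"
  assumes b: "-1 < b" "b < 1" and t: "t > 0"
  shows "integrable lborel (\<lambda>z. (ytest t a z)\<^sup>2 / weight b i z)"
    "e \<in> Basis \<Longrightarrow> integrable lborel (\<lambda>z. (partial_deriv e (ytest t a) z)\<^sup>2 / weight b i z)"
    "integrable lborel (\<lambda>z. (snd z * gauss t a z)\<^sup>2 / weight b i z)"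
proof -
  have "\<bar>snd z\<bar> \<le> 1 * (1 + norm z) ^ 1" for z :: "(real^'n) \<times> real"
    using norm_snd_le[of "snd z" "fst z"] by simp
  from integrable_test_weight[OF b t continuous_on_snd[OF continuous_on_id] this, of a i]
  show "integrable lborel (\<lambda>z. (ytest t a z)\<^sup>2 / weight b i z)"
    by (simp add: ytest_def power2_eq_square[of "snd _"])
  show "integrable lborel (\<lambda>z. (partial_deriv e (ytest t a) z)\<^sup>2 / weight b i z)" if e: "e \<in> Basis"
    unfolding ytest_partial by (rule integrable_test_weight[OF b t continuous_ytest_factor ytest_factor_bound[OF t e]])
  have "\<bar>1\<bar> \<le> 1 * (1 + norm z) ^ 0" for z :: "(real^'n) \<times> real" by simp
  from integrable_test_weight[OF b t continuous_on_const this, of a i]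
  show "integrable lborel (\<lambda>z. (snd z * gauss t a z)\<^sup>2 / weight b i z)" by simp
qed

lemma borel_measurable_ytest:
  "ytest t a \<in> borel_measurable borel" "partial_deriv e (ytest t a) \<in> borel_measurable borel"
  "(\<lambda>z. snd z * gauss t a z) \<in> borel_measurable borel"
  using Ck_continuous[OF Ck_ytest, of t a] unfolding ytest_partial
  by (auto intro!: borel_measurable_continuous_onI continuous_intros continuous_ytest_factor continuous_gauss)

lemma grad_inner: "e \<in> Basis \<Longrightarrow> grad f z \<bullet> e = partial_deriv e f z"
  by (simp add: grad_def inner_sum_left inner_Basis if_distrib sum.delta cong: if_cong)

text \<open>One integration by parts passes from order j + 1 to order j. For odd j the term (b / y)
  \<partial>_y is not in divergence form, but against y^2 it becomes b y \<partial>_y, a pairing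
  with the gradient that is already controlled.\<close>

lemma ytest_pairing_step:
  fixes X :: "nat \<Rightarrow> (real^'n) \<times> real \<Rightarrow> real"
  assumes b: "-1 < b" "b < 1" and t: "t > 0" and X: "\<And>m. X m \<in> Cinfe"
    and i: "real CARD('n) + 1 + b > 2 * real i"
    and lim: "(\<lambda>m. weighted_L2_norm (weight b i) (nabla_b b j (X m))) \<longlonglongrightarrow> 0" and E: "E \<in> Basis"
  shows "(\<lambda>m. LINT z|lborel. ytest t a z * (nabla_b b (Suc j) (X m) z \<bullet> E)) \<longlonglongrightarrow> 0"
proof -
  have L: "nabla_b b j (X m) \<in> weighted_L2 (weight b i)" for m
    by (rule nabla_b_weighted_L2[OF b(1) i X])
  note P = weighted_pairing_tendsto_0[OF weight_nonneg borel_measurable_weight weight_pos L lim]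
  note P1 = P[OF borel_measurable_ytest(2) ytest_weight_integrable(2)[OF b t]]
  note P2 = P[OF borel_measurable_ytest(3) ytest_weight_integrable(3)[OF b t]]
  \<comment> \<open>Basis vectors of the sum of the two target spaces: the scalar slot is occupied
    for even order, the vector slot for odd order, and pairings with the empty slot vanish.\<close>
  have EB: "E = (1, 0) \<or> (\<exists>e\<in>Basis. E = (0, e))" using E by (auto simp: Basis_prod_def)
  show ?thesis
  proof (cases "even j")
    case True
    define F where "F m = (Lap_b b ^^ (j div 2)) (X m)" for m
    have F: "F m \<in> Cinfe" for m unfolding F_def by (rule Lap_b_iter_Cinfe[OF X])
    have n1: "nabla_b b j (X m) z = (F m z, 0)" "nabla_b b (Suc j) (X m) z = (0, grad (F m) z)" for m z
      using True by (simp_all add: nabla_b_def F_def)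
    show ?thesis
    proof (cases "E = (1, 0)")
      case True then show ?thesis by (simp add: n1)
    next
      case False
      then obtain e where e: "e \<in> Basis" "E = (0, e)" using EB by auto
      have "(LINT z|lborel. ytest t a z * (nabla_b b (Suc j) (X m) z \<bullet> E)) =
         - (LINT z|lborel. partial_deriv e (ytest t a) z * (nabla_b b j (X m) z \<bullet> (1, 0)))" for m
        using integral_by_parts_compact(1)[OF CinfeD(1,2)[OF F[of m]] Ck_ytest e(1), of t a]
        by (simp add: n1 e grad_inner mult.commute)
      then show ?thesis using tendsto_minus[OF P1[OF e(1), of a "(1, 0)"]] by simp
    qed
  next
    case False
    define F where "F m = (Lap_b b ^^ ((j - 1) div 2)) (X m)" for m
    have F: "F m \<in> Cinfe" for m unfolding F_def by (rule Lap_b_iter_Cinfe[OF X])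
    have j2: "Suc j div 2 = Suc ((j - 1) div 2)" using False by (auto elim!: oddE)
    have n1: "nabla_b b j (X m) z = (0, grad (F m) z)" "nabla_b b (Suc j) (X m) z = (Lap_b b (F m) z, 0)" for m z
      using False by (simp_all add: nabla_b_def F_def j2 del: One_nat_def)
    show ?thesis
    proof (cases "E = (1, 0)")
      case True
      have "(LINT z|lborel. ytest t a z * (nabla_b b (Suc j) (X m) z \<bullet> E)) =
         (\<Sum>e\<in>Basis. - (LINT z|lborel. partial_deriv e (ytest t a) z * (nabla_b b j (X m) z \<bullet> (0, e))))
           + b * (LINT z|lborel. (snd z * gauss t a z) * (nabla_b b j (X m) z \<bullet> (0, (0, 1))))" for m
      proof -
        let ?D = "\<lambda>e. partial_deriv e (F m)"
        have e: "ytest t a z * (nabla_b b (Suc j) (X m) z \<bullet> E) =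
          (\<Sum>e\<in>Basis. ytest t a z * partial_deriv e (?D e) z) + b * ((snd z * gauss t a z) * (nabla_b b j (X m) z \<bullet> (0, (0, 1))))" for z
          \<comment> \<open>On y = 0 both sides vanish, \<open>ytest\<close> and
            \<open>snd z\<close> being zero; elsewhere the quotient by y cancels one power of
            y.\<close>
          by (cases "snd z = 0")
             (simp_all add: n1 True grad_inner Lap_b_def laplacian_def ytest_def distrib_left sum_distrib_left power2_eq_square)
        note ibp = integral_by_parts_compact[OF Cinfe_partial2(1,2)[OF F[of m]] Ck_ytest, of _ _ t a]
        have i2: "integrable lborel (\<lambda>z. (snd z * gauss t a z) * (nabla_b b j (X m) z \<bullet> (0, (0, 1))))"
          by (rule weighted_pairing_integrable(1)[OF weight_nonneg borel_measurable_weight weight_pos L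
              borel_measurable_ytest(3) ytest_weight_integrable(3)[OF b t]])
        have "(LINT z|lborel. ytest t a z * (nabla_b b (Suc j) (X m) z \<bullet> E)) =
          (\<Sum>e\<in>Basis. LINT z|lborel. ytest t a z * partial_deriv e (?D e) z) + b * (LINT z|lborel. (snd z * gauss t a z) * (nabla_b b j (X m) z \<bullet> (0, (0, 1))))"
          unfolding e using ibp(2) i2
          by (subst Bochner_Integration.integral_add) (auto simp: Bochner_Integration.integral_sum)
        also have "(\<Sum>e\<in>Basis. LINT z|lborel. ytest t a z * partial_deriv e (?D e) z) =
          (\<Sum>e\<in>Basis. - (LINT z|lborel. partial_deriv e (ytest t a) z * (nabla_b b j (X m) z \<bullet> (0, e))))"
          using ibp(1) by (intro sum.cong refl) (simp add: n1 grad_inner mult.commute)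
        finally show ?thesis .
      qed
      moreover have "(\<lambda>m. (\<Sum>e\<in>Basis. - (LINT z|lborel. partial_deriv e (ytest t a) z * (nabla_b b j (X m) z \<bullet> (0, e))))
           + b * (LINT z|lborel. (snd z * gauss t a z) * (nabla_b b j (X m) z \<bullet> (0, (0, 1))))) \<longlonglongrightarrow> (\<Sum>e\<in>(Basis :: ((real^'n) \<times> real) set). - 0) + b * 0"
        by (intro tendsto_intros P1 P2)
      ultimately show ?thesis by simp
    next
      case False
      then obtain e where "E = (0, e)" using EB by auto
      then show ?thesis by (simp add: n1)
    qed
  qed
qed

lemma nabla_b_diff:
  assumes "U \<in> Cinfe" "V \<in> Cinfe"
  shows "nabla_b b j (\<lambda>z. U z - V z) = (\<lambda>z. nabla_b b j U z - nabla_b b j V z)"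
  using nabla_b_lin[OF assms, of b j 1 "-1"] by auto

text \<open>Induction on the order. The derivatives of order j + 1 are Cauchy, since
  \<open>full_norm\<close> contains every order, and have a limit G. Their pairings with
  \<open>ytest\<close> tend to zero by the induction hypothesis and to the pairing with G, so y^2 G
  has vanishing Gaussian averages and G = 0 off the null set y = 0.\<close>

theorem nabla_b_closable:
  fixes X :: "nat \<Rightarrow> (real^'n) \<times> real \<Rightarrow> real"
  assumes b: "-1 < b" "b < 1" and k: "real CARD('n) + 1 + b > 2 * real k" and X: "\<And>m. X m \<in> Cinfe"
    and Cauchy: "\<And>\<epsilon>. \<epsilon> > 0 \<Longrightarrow> \<exists>N. \<forall>m\<ge>N. \<forall>p\<ge>N. full_norm k b (\<lambda>z. X m z - X p z) < \<epsilon>"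
    and lim: "(\<lambda>m. weighted_L2_norm (weight b k) (X m)) \<longlonglongrightarrow> 0"
  shows "j \<le> k \<Longrightarrow> (\<lambda>m. weighted_L2_norm (weight b (k - j)) (nabla_b b j (X m))) \<longlonglongrightarrow> 0"
proof (induction j)
  case 0
  then show ?case using lim by (simp add: weighted_L2_norm_def nabla_b_def)
next
  case (Suc j)
  let ?w = "weight b (k - Suc j) :: (real^'n) \<times> real \<Rightarrow> real"
  have ik: "real CARD('n) + 1 + b > 2 * real i" if "i \<le> k" for i
    using k that by (meson le_less_trans mult_left_mono of_nat_le_iff zero_le_numeral)
  have D: "nabla_b b (Suc j) (X m) \<in> weighted_L2 ?w" for m
    by (rule nabla_b_weighted_L2[OF b(1) ik X]) simp
  obtain G where G: "G \<in> weighted_L2 ?w"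
    "(\<lambda>m. weighted_L2_norm ?w (\<lambda>z. nabla_b b (Suc j) (X m) z - G z)) \<longlonglongrightarrow> 0"
  proof (rule weighted_L2_complete[where w="?w" and F="\<lambda>m. nabla_b b (Suc j) (X m)"])
    fix \<epsilon> :: real assume "\<epsilon> > 0"
    then obtain N where N: "\<forall>m\<ge>N. \<forall>p\<ge>N. full_norm k b (\<lambda>z. X m z - X p z) < \<epsilon>" using Cauchy by blast
    show "\<exists>N. \<forall>m\<ge>N. \<forall>p\<ge>N. weighted_L2_norm ?w (\<lambda>z. nabla_b b (Suc j) (X m) z - nabla_b b (Suc j) (X p) z) < \<epsilon>"
    proof (intro exI allI impI)
      fix m p assume "m \<ge> N" "p \<ge> N"
      then have "full_norm k b (\<lambda>z. X m z - X p z) < \<epsilon>" using N by blast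
      then show "weighted_L2_norm ?w (\<lambda>z. nabla_b b (Suc j) (X m) z - nabla_b b (Suc j) (X p) z) < \<epsilon>"
        using weighted_norm_le_full_norm[OF Suc.prems, of b "\<lambda>z. X m z - X p z"] nabla_b_diff[OF X X, of b "Suc j" m p] by simp
    qed
  qed (use D in auto)
  have "AE z in lborel. \<forall>E\<in>Basis. G z \<bullet> E = 0"
  proof (rule AE_finite_allI[OF finite_Basis])
    fix E :: "real \<times> ((real^'n) \<times> real)" assume E: "E \<in> Basis"
    note [measurable] = weighted_L2D(1)[OF G(1)] borel_measurable_fst_snd_borel(2)[where 'a="real^'n" and 'b=real]
    have "AE z in lborel. (snd z)\<^sup>2 * (G z \<bullet> E) = 0"
    proof (rule gaussian_uniqueness)
      fix t :: real and a :: "(real^'n) \<times> real" assume t: "t > 0"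
      have e: "exp (- t * (norm (z - a))\<^sup>2) *\<^sub>R ((snd z)\<^sup>2 * (G z \<bullet> E)) = ytest t a z * (G z \<bullet> E)" for z
        by (simp add: ytest_def gauss_def)
      note WP = weighted_pairing_integrable(1)[OF weight_nonneg borel_measurable_weight weight_pos _
          borel_measurable_ytest(1) ytest_weight_integrable(1)[OF b t]]
      have dG: "(\<lambda>z. nabla_b b (Suc j) (X m) z - G z) \<in> weighted_L2 ?w" for m
        by (intro weighted_L2_diff D G(1)) auto
      show I: "integrable lborel (\<lambda>z. exp (- t * (norm (z - a))\<^sup>2) *\<^sub>R ((snd z)\<^sup>2 * (G z \<bullet> E)))"
        unfolding e by (rule WP[OF G(1)])
      have "(\<lambda>m. LINT z|lborel. ytest t a z * (nabla_b b (Suc j) (X m) z \<bullet> E)) \<longlonglongrightarrow> 0"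
        by (rule ytest_pairing_step[OF b t X ik Suc.IH E]) (use Suc.prems in auto)
      moreover have "(\<lambda>m. LINT z|lborel. ytest t a z * ((nabla_b b (Suc j) (X m) z - G z) \<bullet> E)) \<longlonglongrightarrow> 0"
        by (rule weighted_pairing_tendsto_0[OF weight_nonneg borel_measurable_weight weight_pos dG G(2)
            borel_measurable_ytest(1) ytest_weight_integrable(1)[OF b t]])
      ultimately have "(\<lambda>m. (LINT z|lborel. ytest t a z * (nabla_b b (Suc j) (X m) z \<bullet> E)) -
          (LINT z|lborel. ytest t a z * ((nabla_b b (Suc j) (X m) z - G z) \<bullet> E))) \<longlonglongrightarrow> 0 - 0"
        by (rule tendsto_diff)
      moreover have "(LINT z|lborel. ytest t a z * (nabla_b b (Suc j) (X m) z \<bullet> E)) -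
          (LINT z|lborel. ytest t a z * ((nabla_b b (Suc j) (X m) z - G z) \<bullet> E)) = (LINT z|lborel. ytest t a z * (G z \<bullet> E))" for m
        by (subst Bochner_Integration.integral_diff[symmetric, OF WP[OF D] WP[OF dG]]) (simp add: inner_diff_left algebra_simps)
      ultimately show "(LINT z|lborel. exp (- t * (norm (z - a))\<^sup>2) *\<^sub>R ((snd z)\<^sup>2 * (G z \<bullet> E))) = 0"
        unfolding e by (simp add: LIMSEQ_const_iff)
    qed measurable
    then show "AE z in lborel. G z \<bullet> E = 0"
      using AE_snd_nonzero by eventually_elim auto
  qed
  then have "AE z in lborel. G z = 0" by eventually_elim (simp add: euclidean_all_zero_iff)
  then have "weighted_L2_norm ?w (\<lambda>z. nabla_b b (Suc j) (X m) z - G z) = weighted_L2_norm ?w (nabla_b b (Suc j) (X m))" for m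
    using weighted_L2D(1)[OF D[of m]] weighted_L2D(1)[OF G(1)]
    by (intro weighted_L2_norm_cong_AE) (auto simp: ae_eq_def)
  with G(2) show ?case by simp
qed

subsection \<open>Traces of test functions\<close>

lemma Ck_foldr_partial:
  "(\<And>k. Ck k f) \<Longrightarrow> set es \<subseteq> Basis \<Longrightarrow> Ck k (foldr partial_deriv es f)"
proof (induction es arbitrary: k)
  case (Cons e es)
  then have "Ck (Suc k) (foldr partial_deriv es f)" by auto
  from Ck_SucD(2)[OF this, of e] Cons.prems(2) show ?case by simp
qed simp

lemma closure_foldr_partial_support:
  "closure {z. foldr partial_deriv es f z \<noteq> 0} \<subseteq> closure {z. f z \<noteq> 0}"
proof (induction es)
  case (Cons e es)
  then show ?case using closure_partial_support[of e "foldr partial_deriv es f"] by simp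
qed simp

lemma schwartz_compact_support:
  fixes f :: "'a::euclidean_space \<Rightarrow> complex"
  assumes f: "\<And>k. Ck k f" and K: "compact (closure {x. f x \<noteq> 0})"
  shows "schwartz f"
  unfolding schwartz_def
proof (intro conjI allI impI f)
  fix N and es :: "'a list" assume es: "set es \<subseteq> Basis"
  have "continuous_on UNIV (foldr partial_deriv es f)"
    using Ck_foldr_partial[OF f es, of 0] by simp
  moreover have "compact (closure {x. foldr partial_deriv es f x \<noteq> 0})"
    by (rule compact_closure_subset[OF K order_trans[OF closure_subset closure_foldr_partial_support]])
  ultimately have "rapid (foldr partial_deriv es f)" by (rule rapid_compact)
  then obtain C where "\<And>x. norm (foldr partial_deriv es f x) * (1 + norm x) ^ N \<le> C"
    unfolding rapid_def by blast
  then show "bounded (range (\<lambda>x. (1 + norm x) ^ N *\<^sub>R foldr partial_deriv es f x))"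
    unfolding bounded_iff by (auto simp: mult.commute)
qed

definition trf :: "((real^'n) \<times> real \<Rightarrow> real) \<Rightarrow> real^'n \<Rightarrow> complex" where
  "trf U = fourier (\<lambda>x. of_real (trace_map U x))"

definition trh :: "real \<Rightarrow> ((real^'n) \<times> real \<Rightarrow> real) \<Rightarrow> real^'n \<Rightarrow> complex" where
  "trh s U \<xi> = of_real (norm \<xi> powr s) * trf U \<xi>"

text \<open>This is (-\<Delta>)^(s/2) of the trace, written as the inverse transform of
  \<open>trh s U\<close>, that is, its transform at -x. The real part provides the type; by
  \<open>trw_real\<close> nothing is lost.\<close>

definition trw :: "real \<Rightarrow> ((real^'n) \<times> real \<Rightarrow> real) \<Rightarrow> real^'n \<Rightarrow> real" where
  "trw s U x = Re (fourier (trh s U) (- x))"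

lemma schwartz_trace:
  assumes U: "U \<in> Cinfe"
  shows "schwartz (\<lambda>x. complex_of_real (trace_map U x))"
proof (rule schwartz_compact_support)
  have A: "bounded_linear (\<lambda>x::real^'a. (x, 0::real))" by (intro bounded_linear_intros)
  have "Ck k (\<lambda>x. U ((0, 0) + (x, 0)))" for k by (rule Ck_affine[OF A CinfeD(1)[OF U]])
  then show "Ck k (\<lambda>x. complex_of_real (trace_map U x))" for k
    unfolding trace_map_def by (intro Ck_linear[OF bounded_linear_of_real]) simp
  have "compact (fst ` closure {z. U z \<noteq> 0})"
    by (rule compact_continuous_image[OF _ CinfeD(2)[OF U]]) (auto intro!: continuous_intros)
  moreover have "{x. complex_of_real (trace_map U x) \<noteq> 0} \<subseteq> fst ` closure {z. U z \<noteq> 0}"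
    using closure_subset[of "{z. U z \<noteq> 0}"] by (force simp: trace_map_def)
  ultimately show "compact (closure {x. complex_of_real (trace_map U x) \<noteq> 0})"
    by (metis compact_imp_closed compact_closure_subset closure_closed)
qed

text \<open>An integer not below s bounds the multiplier by a polynomial factor, which costs
  finitely many orders of decay.\<close>

lemma rapid_powr_mult:
  fixes f :: "'a::euclidean_space \<Rightarrow> complex"
  assumes f: "rapid f"
  shows "rapid (\<lambda>x. of_real (norm x powr s) * f x) \<or> s \<le> 0"
proof (cases "s > 0")
  case True
  have "rapid (\<lambda>x. of_real (norm x powr s) * f x)"
    unfolding rapid_def
  proof (intro conjI allI)
    note [measurable] = rapid_measurable[OF f]
    show "(\<lambda>x. of_real (norm x powr s) * f x) \<in> borel_measurable borel" by measurable
    fix N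
    define M where "M = nat \<lceil>s\<rceil>"
    have M: "s \<le> real M" unfolding M_def by linarith
    obtain C where C: "\<And>x. norm (f x) * (1 + norm x) ^ (M + N) \<le> C" using f unfolding rapid_def by blast
    have "norm (of_real (norm x powr s) * f x) * (1 + norm x) ^ N \<le> C" for x
    proof -
      have "norm x powr s \<le> (1 + norm x) powr s" using True by (intro powr_mono2) auto
      also have "\<dots> \<le> (1 + norm x) powr real M" using M by (intro powr_mono) auto
      also have "\<dots> = (1 + norm x) ^ M" by (simp add: powr_realpow add_pos_nonneg)
      finally have "norm x powr s * norm (f x) * (1 + norm x) ^ N \<le> (1 + norm x) ^ M * norm (f x) * (1 + norm x) ^ N"
        by (intro mult_right_mono) auto
      also have "\<dots> = norm (f x) * (1 + norm x) ^ (M + N)" by (simp add: power_add mult_ac)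
      finally show ?thesis using C[of x] by (simp add: norm_mult)
    qed
    then show "\<exists>C. \<forall>x. norm (of_real (norm x powr s) * f x) * (1 + norm x) ^ N \<le> C" by blast
  qed
  then show ?thesis ..
qed simp

lemma fourier_cnj_real:
  assumes "integrable lborel (\<lambda>x. complex_of_real (u x))"
  shows "cnj (fourier (\<lambda>x. of_real (u x)) \<xi>) = fourier (\<lambda>x. of_real (u x)) (- \<xi>)"
  unfolding fourier_eq
  using lebesgue_integral_cnj[OF integrable_fourier_kernel[OF assms, of \<xi>]] by (simp add: cis_cnj)

lemma integrable_mult_bounded:
  fixes f g :: "'a::euclidean_space \<Rightarrow> complex"
  assumes f: "integrable lborel f" and g: "g \<in> borel_measurable borel" "\<And>x. norm (g x) \<le> B"
  shows "integrable lborel (\<lambda>x. f x * g x)"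
proof (rule Bochner_Integration.integrable_bound[OF integrable_mult_right[OF f, of "of_real B"]])
  show "AE x in lborel. norm (f x * g x) \<le> norm (of_real B * f x)"
  proof (rule AE_I2)
    fix x
    have "norm (f x) * norm (g x) \<le> norm (f x) * \<bar>B\<bar>"
      by (intro mult_left_mono order_trans[OF g(2) abs_ge_self]) auto
    then show "norm (f x * g x) \<le> norm (of_real B * f x)" by (simp add: norm_mult mult.commute)
  qed
qed (use f g borel_measurable_integrable[OF f] in auto)

context
  fixes s :: real
  assumes s: "s > 0"
begin

lemma rapid_trf: "U \<in> Cinfe \<Longrightarrow> rapid (trf U)"
  unfolding trf_def by (rule schwartz_fourier_rapid[OF schwartz_trace])

lemma rapid_trh: "U \<in> Cinfe \<Longrightarrow> rapid (trh s U)"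
  unfolding trh_def[abs_def] using rapid_powr_mult[OF rapid_trf, of U s] s by auto

lemma integrable_trace: "U \<in> Cinfe \<Longrightarrow> integrable lborel (\<lambda>x. complex_of_real (trace_map U x))"
  by (rule rapid_integrable[OF schwartz_rapid[OF schwartz_trace]])

text \<open>The transform of a real function is Hermitian, a real radial multiplier preserves this,
  and the transform of a Hermitian function is real.\<close>

lemma trw_real:
  assumes U: "U \<in> Cinfe"
  shows "complex_of_real (trw s U x) = fourier (trh s U) (- x)"
proof -
  let ?h = "trh s U"
  have hi: "integrable lborel ?h" by (rule rapid_integrable[OF rapid_trh[OF U]])
  have hc: "cnj (?h \<xi>) = ?h (- \<xi>)" for \<xi>
    using fourier_cnj_real[OF integrable_trace[OF U], of \<xi>] by (simp add: trh_def trf_def)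
  have "cnj (fourier ?h (- x)) = of_real (fconst TYPE(real^'a)) * (LINT \<xi>|lborel. cnj (cis (- (- x \<bullet> \<xi>)) * ?h \<xi>))"
    unfolding fourier_eq using lebesgue_integral_cnj[OF integrable_fourier_kernel[OF hi, of "- x"]] by simp
  also have "(LINT \<xi>|lborel. cnj (cis (- (- x \<bullet> \<xi>)) * ?h \<xi>)) = (LINT \<xi>|lborel. cis (- (- x \<bullet> (- \<xi>))) * ?h (- \<xi>))"
    by (intro Bochner_Integration.integral_cong refl) (simp add: hc cis_cnj)
  also have "\<dots> = (LINT \<xi>|lborel. cis (- (- x \<bullet> \<xi>)) * ?h \<xi>)"
    using rapid_measurable[OF rapid_trh[OF U]]
    by (intro integral_reflect(1)[of "\<lambda>\<xi>. cis (- (- x \<bullet> \<xi>)) * ?h \<xi>"]) measurable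
  finally have "cnj (fourier ?h (- x)) = fourier ?h (- x)" by (simp only: fourier_eq)
  then have "fourier ?h (- x) \<in> \<real>" by (simp add: Reals_cnj_iff)
  then show ?thesis by (simp add: trw_def)
qed

lemma has_fourier_trace:
  assumes U: "U \<in> Cinfe"
  shows "has_fourier (\<lambda>x. of_real (trace_map U x)) (trf U)"
  unfolding has_fourier_def
proof (intro conjI allI impI)
  show "(\<lambda>x. complex_of_real (trace_map U x)) \<in> borel_measurable lborel" "trf U \<in> borel_measurable lborel"
    using rapid_measurable[OF schwartz_rapid[OF schwartz_trace[OF U]]] rapid_measurable[OF rapid_trf[OF U]] by auto
  fix \<phi> :: "real^'a \<Rightarrow> complex" assume \<phi>: "schwartz \<phi>"
  note r = schwartz_rapid[OF \<phi>] schwartz_fourier_rapid[OF \<phi>]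
  obtain B where B: "\<And>x. norm (\<phi> x) \<le> B" using rapid_bounded[OF r(1)] by blast
  obtain B' where B': "\<And>x. norm (fourier \<phi> x) \<le> B'" using rapid_bounded[OF r(2)] by blast
  show "integrable lborel (\<lambda>x. complex_of_real (trace_map U x) * fourier \<phi> x)"
    by (rule integrable_mult_bounded[OF integrable_trace[OF U] rapid_measurable[OF r(2)] B'])
  show "integrable lborel (\<lambda>x. trf U x * \<phi> x)"
    by (rule integrable_mult_bounded[OF rapid_integrable[OF rapid_trf[OF U]] rapid_measurable[OF r(1)] B])
  show "(LINT x|lborel. complex_of_real (trace_map U x) * fourier \<phi> x) = (LINT x|lborel. trf U x * \<phi> x)"
    unfolding trf_def by (rule fourier_multiplication[OF integrable_trace[OF U] rapid_integrable[OF r(1)]])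
qed

lemma has_fourier_trw:
  assumes U: "U \<in> Cinfe"
  shows "has_fourier (\<lambda>x. of_real (trw s U x)) (trh s U)"
  unfolding has_fourier_def trw_real[OF U]
proof (intro conjI allI impI)
  have hi: "integrable lborel (trh s U)" by (rule rapid_integrable[OF rapid_trh[OF U]])
  note [measurable] = rapid_measurable[OF rapid_trh[OF U]]
  show m: "(\<lambda>x. fourier (trh s U) (- x)) \<in> borel_measurable lborel" "trh s U \<in> borel_measurable lborel"
    by measurable
  fix \<phi> :: "real^'a \<Rightarrow> complex" assume \<phi>: "schwartz \<phi>"
  note r = schwartz_rapid[OF \<phi>] schwartz_fourier_rapid[OF \<phi>]
  obtain B where B: "\<And>x. norm (\<phi> x) \<le> B" using rapid_bounded[OF r(1)] by blast
  have "integrable lborel (\<lambda>x. fourier \<phi> x * fourier (trh s U) (- x))"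
    by (rule integrable_mult_bounded[OF rapid_integrable[OF r(2)] _ norm_fourier_le]) (use m in simp)
  then show "integrable lborel (\<lambda>x. fourier (trh s U) (- x) * fourier \<phi> x)" by (simp add: mult.commute)
  show "integrable lborel (\<lambda>x. trh s U x * \<phi> x)"
    by (rule integrable_mult_bounded[OF hi rapid_measurable[OF r(1)] B])
  show "(LINT x|lborel. fourier (trh s U) (- x) * fourier \<phi> x) = (LINT x|lborel. trh s U x * \<phi> x)"
    by (rule inverse_fourier_pairing[OF hi \<phi>])
qed

text \<open>Bessel's inequality for \<open>trh s U\<close>; the reflection in \<open>trw\<close>
  does not change the integral.\<close>

lemma trw_norm_le:
  assumes U: "U \<in> Cinfe"
  shows "(\<integral>\<^sup>+x. ennreal (1 * (norm (trw s U x))\<^sup>2) \<partial>lborel) \<le> (\<integral>\<^sup>+\<xi>. ennreal (norm \<xi> powr (2 * s) * (norm (trf U \<xi>))\<^sup>2) \<partial>lborel)"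
proof -
  have hi: "integrable lborel (trh s U)" by (rule rapid_integrable[OF rapid_trh[OF U]])
  note [measurable] = rapid_measurable[OF rapid_trh[OF U]]
  have "norm (trw s U x) = norm (fourier (trh s U) (- x))" for x
    by (metis trw_real[OF U] norm_of_real real_norm_def)
  then have "(\<integral>\<^sup>+x. ennreal (1 * (norm (trw s U x))\<^sup>2) \<partial>lborel) = (\<integral>\<^sup>+x. ennreal ((norm (fourier (trh s U) (- x)))\<^sup>2) \<partial>lborel)"
    by simp
  also have "\<dots> = (\<integral>\<^sup>+x. ennreal ((norm (fourier (trh s U) x))\<^sup>2) \<partial>lborel)"
    by (rule nn_integral_reflect[of "\<lambda>x. ennreal ((norm (fourier (trh s U) x))\<^sup>2)"]) measurable
  also have "\<dots> \<le> (\<integral>\<^sup>+x. ennreal ((norm (trh s U x))\<^sup>2) \<partial>lborel)" by (rule bessel[OF hi])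
  also have "\<dots> = (\<integral>\<^sup>+\<xi>. ennreal (norm \<xi> powr (2 * s) * (norm (trf U \<xi>))\<^sup>2) \<partial>lborel)"
  proof (intro nn_integral_cong arg_cong[where f=ennreal])
    fix \<xi> :: "real^'a"
    have "(norm \<xi> powr s)\<^sup>2 = norm \<xi> powr (2 * s)" by (simp add: power2_eq_square flip: powr_add)
    then show "(norm (trh s U \<xi>))\<^sup>2 = norm \<xi> powr (2 * s) * (norm (trf U \<xi>))\<^sup>2"
      by (simp add: trh_def norm_mult power_mult_distrib)
  qed
  finally show ?thesis .
qed

lemma trf_diff:
  assumes "U \<in> Cinfe" "V \<in> Cinfe"
  shows "trf (\<lambda>z. U z - V z) \<xi> = trf U \<xi> - trf V \<xi>"
  using fourier_lin[OF integrable_trace[OF assms(1)] integrable_trace[OF assms(2)], of 1 "-1" \<xi>]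
  by (simp add: trf_def trace_map_def)

lemma trw_diff:
  assumes U: "U \<in> Cinfe" and V: "V \<in> Cinfe"
  shows "trw s (\<lambda>z. U z - V z) x = trw s U x - trw s V x"
proof -
  have "trh s (\<lambda>z. U z - V z) = (\<lambda>\<xi>. 1 * trh s U \<xi> + (- 1) * trh s V \<xi>)"
    by (auto simp: fun_eq_iff trh_def trf_diff[OF U V] algebra_simps)
  then show ?thesis unfolding trw_def
    using fourier_lin[OF rapid_integrable[OF rapid_trh[OF U]] rapid_integrable[OF rapid_trh[OF V]], of 1 "-1" "- x"] by simp
qed

end

subsection \<open>The trace operator\<close>

text \<open>\<open>dim_type\<close> makes the type 'n, and with it the dimension, a parameter that
  an interpretation can set.\<close>

locale admissible =
  fixes k :: nat and b :: real and dim_type :: "'n::finite itself"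
  assumes k: "k \<ge> 1" and b: "-1 < b" "b < 1"
    and dim: "real CARD('n) + 1 + b > 2 * real k"
begin

abbreviation s :: real where "s \<equiv> real k - (1 + b) / 2"

abbreviation p :: "real^'n \<Rightarrow> real" where "p \<equiv> \<lambda>x. norm x powr (- 2 * s)"

abbreviation Nk :: "((real^'n) \<times> real \<Rightarrow> real) \<Rightarrow> real" where "Nk \<equiv> weighted_L2_norm (weight b k)"

text \<open>Positivity of s keeps \<open>norm \<xi> powr s\<close> bounded near the origin, and 2 s
  < n, a restatement of the dimension condition, makes \<open>norm \<xi> powr (- 2 * s)\<close>
  locally integrable. The first is used for test functions, the second for dual weights.\<close>

lemma s_pos: "s > 0" and s_dim: "2 * s < real CARD('n)"
proof -
  have "real k \<ge> 1" using k by simp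
  then show "s > 0" "2 * s < real CARD('n)" using b dim by (simp_all add: field_simps)
qed

lemma dim_le: "i \<le> k \<Longrightarrow> real CARD('n) + 1 + b > 2 * real i"
  using dim by (meson le_less_trans mult_left_mono of_nat_le_iff zero_le_numeral)

lemma p: "p x \<ge> 0" "p \<in> borel_measurable borel" "AE x in lborel. p x > 0"
  using AE_norm_powr_pos[of "- 2 * s", where 'a="real^'n"] by auto

lemma Cke_Ck1:
  assumes "U \<in> Cke k"
  shows "Ck 1 U"
  using assms k Ck_mono[of k U 1] by (simp add: Cke_iff del: Ck.simps)

lemma Cke_weighted_L2:
  fixes U :: "(real^'n) \<times> real \<Rightarrow> real"
  assumes U: "U \<in> Cke k"
  shows "U \<in> weighted_L2 (weight b k)" "grad U \<in> weighted_L2 (weight b (k - 1))"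
proof -
  have K: "compact (closure {z. U z \<noteq> 0})" using U by (simp add: Cke_iff)
  show "U \<in> weighted_L2 (weight b k)"
    by (rule weighted_L2_compact_support[OF b(1) dim_le Ck_continuous[OF Cke_Ck1[OF U]] closure_subset K]) simp
  have "{z. grad U z \<noteq> 0} \<subseteq> closure {z. U z \<noteq> 0}"
  proof (rule subsetI, rule ccontr)
    fix z assume z: "z \<in> {z. grad U z \<noteq> 0}" "z \<notin> closure {z. U z \<noteq> 0}"
    have "partial_deriv e U z = 0" for e by (rule partial_deriv_support[OF z(2)])
    then have "grad U z = 0" unfolding grad_def by simp
    then show False using z(1) by simp
  qed
  then show "grad U \<in> weighted_L2 (weight b (k - 1))"
    by (intro weighted_L2_compact_support[OF b(1) dim_le continuous_grad[OF Cke_Ck1[OF U]] _ K]) auto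
qed

text \<open>Compact support and the dimension condition make both integrals on the right of
  \<open>trace_Hardy\<close> finite, which gives a bound between norms; \<theta> is kept free for
  \<open>trace_closable\<close>.\<close>

lemma trace_Hardy_norm:
  fixes U :: "(real^'n) \<times> real \<Rightarrow> real"
  assumes U: "U \<in> Cke k" and \<theta>: "0 < \<theta>" "\<theta> \<le> 1"
  shows "trace_map U \<in> weighted_L2 p"
    "(weighted_L2_norm p (trace_map U))\<^sup>2 \<le> 2 * (1 + b) * \<theta> powr (- 1 - b) * 2 ^ k * (Nk U)\<^sup>2 +
      (1 + b) / (1 - b) * \<theta> powr (1 - b) * 2 ^ (k - 1) * (weighted_L2_norm (weight b (k - 1)) (grad U))\<^sup>2"
      (is "_ \<le> ?R")
proof -
  have c: "continuous_on UNIV (trace_map U)"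
    unfolding trace_map_def[abs_def]
    by (rule continuous_on_compose2[OF Ck_continuous[OF Cke_Ck1[OF U]]]) (auto intro!: continuous_intros)
  have R: "0 \<le> ?R" using b by (intro add_nonneg_nonneg[of "_ * _"]) (auto intro!: mult_nonneg_nonneg)
  have "(\<integral>\<^sup>+x. ennreal (p x * (norm (trace_map U x))\<^sup>2) \<partial>lborel) \<le> ennreal ?R"
  proof -
    have e: "ennreal A * ennreal x + ennreal B * ennreal y = ennreal (A * x + B * y)"
      if "A \<ge> 0" "B \<ge> 0" "x \<ge> 0" "y \<ge> 0" for A B x y :: real
      using that by (simp add: ennreal_mult ennreal_plus)
    show ?thesis
      using trace_Hardy[OF Cke_Ck1[OF U] b k \<theta>]
      unfolding nn_integral_weighted_L2[OF weight_nonneg Cke_weighted_L2(1)[OF U]]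
        nn_integral_weighted_L2[OF weight_nonneg Cke_weighted_L2(2)[OF U]]
      by (subst (asm) e) (use b in auto)
  qed
  note * = weighted_L2_boundI[OF p(1,2) borel_measurable_continuous_onI[OF c] this R]
  show "trace_map U \<in> weighted_L2 p" "(weighted_L2_norm p (trace_map U))\<^sup>2 \<le> ?R" by (rule *)+
qed

lemma grad_le_full_norm:
  "weighted_L2_norm (weight b (k - 1)) (grad U) \<le> full_norm k b U"
  using weighted_norm_le_full_norm[OF k, of b U] by (simp add: weighted_L2_norm_def nabla_b_def)

lemma Nk_le_full_norm: "Nk U \<le> full_norm k b U"
  using weighted_norm_le_full_norm[of 0 k b U] by (simp add: weighted_L2_norm_def nabla_b_def)

text \<open>The value \<theta> = 1 gives boundedness, which supplies limits of traces along Cauchy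
  sequences.\<close>

lemma trace_norm_le_full_norm:
  obtains C where "C \<ge> 0" "\<And>U :: (real^'n) \<times> real \<Rightarrow> real. U \<in> Cinfe \<Longrightarrow> weighted_L2_norm p (trace_map U) \<le> C * full_norm k b U"
proof -
  define A where "A = 2 * (1 + b) * 1 powr (- 1 - b) * 2 ^ k"
  define B where "B = (1 + b) / (1 - b) * 1 powr (1 - b) * 2 ^ (k - 1)"
  have AB: "A \<ge> 0" "B \<ge> 0" using b by (auto simp: A_def B_def)
  have "weighted_L2_norm p (trace_map U) \<le> sqrt (A + B) * full_norm k b U" if U: "U \<in> Cinfe" for U :: "(real^'n) \<times> real \<Rightarrow> real"
  proof (rule power2_le_imp_le)
    have "(weighted_L2_norm p (trace_map U))\<^sup>2 \<le> A * (Nk U)\<^sup>2 + B * (weighted_L2_norm (weight b (k - 1)) (grad U))\<^sup>2"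
      unfolding A_def B_def by (rule trace_Hardy_norm(2)[OF Cinfe_Cke[OF U]]) auto
    also have "\<dots> \<le> A * (full_norm k b U)\<^sup>2 + B * (full_norm k b U)\<^sup>2"
      by (intro add_mono mult_left_mono power_mono Nk_le_full_norm grad_le_full_norm AB weighted_L2_norm_nonneg) auto
    also have "\<dots> = (sqrt (A + B) * full_norm k b U)\<^sup>2" using AB by (simp add: power_mult_distrib distrib_right)
    finally show "(weighted_L2_norm p (trace_map U))\<^sup>2 \<le> (sqrt (A + B) * full_norm k b U)\<^sup>2" .
    show "0 \<le> sqrt (A + B) * full_norm k b U" using AB full_norm_nonneg by (intro mult_nonneg_nonneg) auto
  qed
  then show thesis using AB by (intro that[of "sqrt (A + B)"]) auto
qed

text \<open>A small \<theta> makes the bounded gradient term negligible uniformly in m; then the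
  weighted norms, though multiplied by a large constant, tend to 0. The sequence is taken in
  \<open>Cke k\<close>, so that it may consist of differences between test functions and a given
  element of \<open>Cke k\<close>.\<close>

lemma trace_closable:
  fixes X :: "nat \<Rightarrow> (real^'n) \<times> real \<Rightarrow> real"
  assumes X: "\<And>m. X m \<in> Cke k" and N: "(\<lambda>m. Nk (X m)) \<longlonglongrightarrow> 0"
    and M: "\<And>m. m \<ge> m0 \<Longrightarrow> weighted_L2_norm (weight b (k - 1)) (grad (X m)) \<le> M"
    and u: "u \<in> weighted_L2 p" "(\<lambda>m. weighted_L2_norm p (\<lambda>x. trace_map (X m) x - u x)) \<longlonglongrightarrow> 0"
  shows "AE x in lborel. u x = 0"
proof -
  let ?t = "\<lambda>m. weighted_L2_norm p (trace_map (X m))"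
  have t0: "?t m \<ge> 0" for m by (intro weighted_L2_norm_nonneg p)
  define B where "B = (1 + b) / (1 - b) * 2 ^ (k - 1) * M\<^sup>2"
  have B: "B \<ge> 0" using b by (auto simp: B_def)
  have "(\<lambda>m. (?t m)\<^sup>2) \<longlonglongrightarrow> 0"
  proof (rule LIMSEQ_I)
    fix \<epsilon> :: real assume \<epsilon>: "\<epsilon> > 0"
    \<comment> \<open>The value wanted for \<theta> powr (1 - b): it brings the gradient term below
      \<epsilon> / 2, B + 1 avoids division by zero, and the cap 1 ensures \<theta> \<le> 1.\<close>
    define d where "d = min 1 (\<epsilon> / (2 * (B + 1)))"
    have d: "0 < d" "d \<le> 1" "d * B < \<epsilon> / 2"
    proof -
      have "0 < \<epsilon> / (2 * (B + 1))" using \<epsilon> B by simp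
      then show "0 < d" "d \<le> 1" by (auto simp: d_def)
      have "d * B \<le> \<epsilon> / (2 * (B + 1)) * B" using B by (intro mult_right_mono) (auto simp: d_def)
      also have "\<dots> < \<epsilon> / 2" using \<epsilon> B by (simp add: field_simps)
      finally show "d * B < \<epsilon> / 2" .
    qed
    define \<theta> where "\<theta> = d powr (1 / (1 - b))"
    have \<theta>: "0 < \<theta>" "\<theta> \<le> 1" "\<theta> powr (1 - b) = d"
      using d b by (auto simp: \<theta>_def powr_powr powr_le1)
    define A where "A = 2 * (1 + b) * \<theta> powr (- 1 - b) * 2 ^ k"
    have "(\<lambda>m. A * (Nk (X m))\<^sup>2) \<longlonglongrightarrow> A * 0\<^sup>2" by (intro tendsto_intros N)
    then have "\<forall>\<^sub>F m in sequentially. A * (Nk (X m))\<^sup>2 < \<epsilon> / 2"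
      by (rule order_tendstoD) (use \<epsilon> in simp)
    then obtain m1 where m1: "\<And>m. m \<ge> m1 \<Longrightarrow> A * (Nk (X m))\<^sup>2 < \<epsilon> / 2" unfolding eventually_sequentially by blast
    have "(?t m)\<^sup>2 < \<epsilon>" if m: "m \<ge> max m0 m1" for m
    proof -
      have g: "(weighted_L2_norm (weight b (k - 1)) (grad (X m)))\<^sup>2 \<le> M\<^sup>2"
        using M[of m] m by (intro power_mono weighted_L2_norm_nonneg) auto
      have "(?t m)\<^sup>2 \<le> A * (Nk (X m))\<^sup>2 + (1 + b) / (1 - b) * d * 2 ^ (k - 1) * (weighted_L2_norm (weight b (k - 1)) (grad (X m)))\<^sup>2"
        using trace_Hardy_norm(2)[OF X \<theta>(1,2), of m] unfolding \<theta>(3) A_def .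
      also have "(1 + b) / (1 - b) * d * 2 ^ (k - 1) * (weighted_L2_norm (weight b (k - 1)) (grad (X m)))\<^sup>2 \<le> (1 + b) / (1 - b) * d * 2 ^ (k - 1) * M\<^sup>2"
        using b d g by (intro mult_left_mono) auto
      also have "\<dots> = d * B" by (simp add: B_def mult_ac)
      finally show ?thesis using m1[of m] m d by simp
    qed
    then show "\<exists>no. \<forall>n\<ge>no. norm ((?t n)\<^sup>2 - 0) < \<epsilon>" by (intro exI[of _ "max m0 m1"]) simp
  qed
  then have "(\<lambda>m. sqrt ((?t m)\<^sup>2)) \<longlonglongrightarrow> sqrt 0" by (rule tendsto_real_sqrt)
  then have "?t \<longlonglongrightarrow> 0" using t0 by simp
  from tendsto_add[OF this u(2)]
  have lim: "(\<lambda>m. ?t m + weighted_L2_norm p (\<lambda>x. trace_map (X m) x - u x)) \<longlonglongrightarrow> 0" by simp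
  have "weighted_L2_norm p u \<le> ?t m + weighted_L2_norm p (\<lambda>x. trace_map (X m) x - u x)" for m
  proof -
    have T: "trace_map (X m) \<in> weighted_L2 p" by (rule trace_Hardy_norm(1)[OF X, of 1]) auto
    have "weighted_L2_norm p (\<lambda>x. trace_map (X m) x - (trace_map (X m) x - u x)) \<le> ?t m + weighted_L2_norm p (\<lambda>x. trace_map (X m) x - u x)"
      by (intro weighted_L2_diff p T u)
    then show ?thesis by simp
  qed
  then have "weighted_L2_norm p u \<le> 0" using lim by (intro LIMSEQ_le_const[OF lim]) auto
  then have "weighted_L2_norm p u = 0" using weighted_L2_norm_nonneg[of p u] p(1) by simp
  then show ?thesis by (rule weighted_L2_norm_eq_0[OF p(1) p(3) u(1)])
qed

end

lemma LIMSEQ_0_squeeze: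
  fixes f g :: "nat \<Rightarrow> real"
  assumes "\<And>m. f m \<le> g m" "g \<longlonglongrightarrow> L" "L = 0" "\<And>m. 0 \<le> f m"
  shows "f \<longlonglongrightarrow> 0"
  by (rule tendsto_sandwich[OF _ _ tendsto_const assms(2)[unfolded assms(3)]]) (simp_all add: assms)

section \<open>Traces as limits along approximating sequences\<close>

context admissible
begin

abbreviation N0 :: "((real^'n) \<times> real \<Rightarrow> real) \<Rightarrow> real" where
  "N0 U \<equiv> weighted_L2_norm (weight b 0) (nabla_b b k U)"

text \<open>The square root of the constant in \<open>trace_fourier_estimate\<close>, so that norms
  are compared instead of their squares.\<close>

definition K :: real where "K = sqrt (max (2 * (1 + b)) ((1 + b) / (1 - b)))"

lemma K_nonneg: "K \<ge> 0" and K_sq: "K\<^sup>2 = max (2 * (1 + b)) ((1 + b) / (1 - b))"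
  using b by (auto simp: K_def max_def)

lemma N0_le_full_norm: "N0 U \<le> full_norm k b U"
  using weighted_norm_le_full_norm[of k k b U] by simp

lemma nabla_weighted_L2: "U \<in> Cinfe \<Longrightarrow> nabla_b b k U \<in> weighted_L2 (weight b 0 :: (real^'n) \<times> real \<Rightarrow> real)"
  by (rule nabla_b_weighted_L2[OF b(1) dim_le]) simp

lemma trf_estimate:
  fixes U :: "(real^'n) \<times> real \<Rightarrow> real"
  assumes U: "U \<in> Cinfe"
  shows "(\<integral>\<^sup>+\<xi>. ennreal (norm \<xi> powr (2 * s) * (norm (trf U \<xi>))\<^sup>2) \<partial>lborel) \<le> ennreal ((K * N0 U)\<^sup>2)"
  using trace_fourier_estimate[OF U b k]
  unfolding trf_def nn_integral_weighted_L2[OF weight_nonneg nabla_weighted_L2[OF U]] K_sq[symmetric]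
  by (simp add: power_mult_distrib ennreal_mult)

lemma trf_weighted_L2:
  fixes U :: "(real^'n) \<times> real \<Rightarrow> real"
  assumes U: "U \<in> Cinfe"
  shows "trf U \<in> weighted_L2 (\<lambda>\<xi>. norm \<xi> powr (2 * s))" "weighted_L2_norm (\<lambda>\<xi>. norm \<xi> powr (2 * s)) (trf U) \<le> K * N0 U"
proof -
  have m: "trf U \<in> borel_measurable borel" by (rule rapid_measurable[OF rapid_trf[OF s_pos U]])
  note * = weighted_L2_boundI[OF _ _ m trf_estimate[OF U]]
  show "trf U \<in> weighted_L2 (\<lambda>\<xi>. norm \<xi> powr (2 * s))" by (rule *) auto
  have "(weighted_L2_norm (\<lambda>\<xi>. norm \<xi> powr (2 * s)) (trf U))\<^sup>2 \<le> (K * N0 U)\<^sup>2" by (rule *) auto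
  then show "weighted_L2_norm (\<lambda>\<xi>. norm \<xi> powr (2 * s)) (trf U) \<le> K * N0 U"
    by (rule power2_le_imp_le) (intro mult_nonneg_nonneg K_nonneg weighted_L2_norm_nonneg weight_nonneg)
qed

lemma trw_weighted_L2:
  fixes U :: "(real^'n) \<times> real \<Rightarrow> real"
  assumes U: "U \<in> Cinfe"
  shows "trw s U \<in> weighted_L2 (\<lambda>_. 1)" "weighted_L2_norm (\<lambda>_. 1) (trw s U) \<le> K * N0 U"
proof -
  note [measurable] = rapid_measurable[OF rapid_trh[OF s_pos U]]
  have m: "trw s U \<in> borel_measurable borel" unfolding trw_def[abs_def] by measurable
  note * = weighted_L2_boundI[OF _ _ m order_trans[OF trw_norm_le[OF s_pos U] trf_estimate[OF U]]]
  show "trw s U \<in> weighted_L2 (\<lambda>_. 1)" by (rule *) auto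
  have "(weighted_L2_norm (\<lambda>_. 1) (trw s U))\<^sup>2 \<le> (K * N0 U)\<^sup>2" by (rule *) auto
  then show "weighted_L2_norm (\<lambda>_. 1) (trw s U) \<le> K * N0 U"
    by (rule power2_le_imp_le) (intro mult_nonneg_nonneg K_nonneg weighted_L2_norm_nonneg weight_nonneg)
qed

text \<open>The approximating sequence is part of the relation because independence of it is proved
  only afterwards, in \<open>tr_lim_unique\<close>.\<close>

definition tr_lim :: "((real^'n) \<times> real \<Rightarrow> real) \<Rightarrow> (nat \<Rightarrow> (real^'n) \<times> real \<Rightarrow> real) \<Rightarrow> (real^'n \<Rightarrow> real) \<Rightarrow> bool" where
  "tr_lim U \<phi> u \<longleftrightarrow> approximates k b \<phi> U \<and> u \<in> weighted_L2 p \<and>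
     (\<lambda>m. weighted_L2_norm p (\<lambda>x. trace_map (\<phi> m) x - u x)) \<longlonglongrightarrow> 0"

lemma approximatesD:
  fixes U :: "(real^'n) \<times> real \<Rightarrow> real"
  assumes "approximates k b \<phi> U"
  shows "\<phi> m \<in> Cinfe" "\<epsilon> > 0 \<Longrightarrow> \<exists>N. \<forall>m\<ge>N. \<forall>p\<ge>N. full_norm k b (\<lambda>z. \<phi> m z - \<phi> p z) < \<epsilon>"
    "U \<in> weighted_L2 (weight b k)" "(\<lambda>m. Nk (\<lambda>z. \<phi> m z - U z)) \<longlonglongrightarrow> 0"
  using assms unfolding approximates_def by auto

text \<open>One argument for all the limits: traces, their transforms, their half Laplacians and
  \<open>nabla_b b k\<close> are each compatible with differences and bounded by
  \<open>full_norm\<close>. Dividing by C + 1 covers C = 0.\<close>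

lemma Cauchy_from_full_norm:
  fixes F :: "((real^'n) \<times> real \<Rightarrow> real) \<Rightarrow> 'c::euclidean_space \<Rightarrow> 'd::euclidean_space"
  assumes \<phi>: "approximates k b \<phi> U"
    and le: "\<And>V. V \<in> Cinfe \<Longrightarrow> weighted_L2_norm w (F V) \<le> C * full_norm k b V" and C: "C \<ge> 0"
    and F: "\<And>m p. F (\<lambda>z. \<phi> m z - \<phi> p z) = (\<lambda>z. F (\<phi> m) z - F (\<phi> p) z)" and \<epsilon>: "\<epsilon> > 0"
  shows "\<exists>N. \<forall>m\<ge>N. \<forall>p\<ge>N. weighted_L2_norm w (\<lambda>z. F (\<phi> m) z - F (\<phi> p) z) < \<epsilon>"
proof -
  obtain N where N: "\<forall>m\<ge>N. \<forall>p\<ge>N. full_norm k b (\<lambda>z. \<phi> m z - \<phi> p z) < \<epsilon> / (C + 1)"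
    using approximatesD(2)[OF \<phi>, of "\<epsilon> / (C + 1)"] \<epsilon> C by auto
  have "weighted_L2_norm w (\<lambda>z. F (\<phi> m) z - F (\<phi> p) z) < \<epsilon>" if "m \<ge> N" "p \<ge> N" for m p
  proof -
    have "weighted_L2_norm w (\<lambda>z. F (\<phi> m) z - F (\<phi> p) z) \<le> C * full_norm k b (\<lambda>z. \<phi> m z - \<phi> p z)"
      unfolding F[symmetric] by (intro le Cinfe_diff approximatesD(1)[OF \<phi>])
    also have "\<dots> \<le> C * (\<epsilon> / (C + 1))" using N that C by (intro mult_left_mono[OF less_imp_le]) auto
    also have "\<dots> < \<epsilon>" using C \<epsilon> by (simp add: field_simps)
    finally show ?thesis .
  qed
  then show ?thesis by blast
qed

lemma nabla_limit:
  fixes U :: "(real^'n) \<times> real \<Rightarrow> real"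
  assumes \<phi>: "approximates k b \<phi> U"
  obtains G where "G \<in> weighted_L2 (weight b 0)" "(\<lambda>m. weighted_L2_norm (weight b 0) (\<lambda>z. nabla_b b k (\<phi> m) z - G z)) \<longlonglongrightarrow> 0"
proof (rule weighted_L2_complete[where w="weight b 0" and F="\<lambda>m. nabla_b b k (\<phi> m)"])
  show "nabla_b b k (\<phi> m) \<in> weighted_L2 (weight b 0)" for m by (rule nabla_weighted_L2[OF approximatesD(1)[OF \<phi>]])
  show "\<exists>N. \<forall>m\<ge>N. \<forall>p\<ge>N. weighted_L2_norm (weight b 0) (\<lambda>z. nabla_b b k (\<phi> m) z - nabla_b b k (\<phi> p) z) < \<epsilon>" if "\<epsilon> > 0" for \<epsilon>
    by (rule Cauchy_from_full_norm[OF \<phi>, where C=1 and F="nabla_b b k"])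
       (use that N0_le_full_norm nabla_b_diff[OF approximatesD(1)[OF \<phi>] approximatesD(1)[OF \<phi>]] in auto)
qed (use that in auto)

text \<open>Completeness provides a candidate for the choice in the definition, so the chosen
  function comes with some approximating sequence of its own.\<close>

lemma nabla_ext:
  fixes U :: "(real^'n) \<times> real \<Rightarrow> real"
  assumes "U \<in> Dkb k b"
  obtains \<phi> where "approximates k b \<phi> U" "nabla_ext k b U \<in> weighted_L2 (weight b 0)"
    "(\<lambda>m. weighted_L2_norm (weight b 0) (\<lambda>z. nabla_b b k (\<phi> m) z - nabla_ext k b U z)) \<longlonglongrightarrow> 0"
proof -
  obtain \<phi> where \<phi>: "approximates k b \<phi> U" using assms unfolding Dkb_def by blast
  let ?P = "\<lambda>G. G \<in> weighted_L2 (weight b 0) \<and> (\<exists>\<phi>. approximates k b \<phi> U \<and>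
          (\<lambda>m. weighted_L2_norm (weight b 0) (\<lambda>z. nabla_b b k (\<phi> m) z - G z)) \<longlonglongrightarrow> 0)"
  obtain G where "G \<in> weighted_L2 (weight b 0)" "(\<lambda>m. weighted_L2_norm (weight b 0) (\<lambda>z. nabla_b b k (\<phi> m) z - G z)) \<longlonglongrightarrow> 0"
    by (rule nabla_limit[OF \<phi>])
  then have "?P G" using \<phi> by (intro conjI exI[of _ \<phi>])
  then have "?P (nabla_ext k b U)" unfolding nabla_ext_def by (rule someI[of ?P])
  then show thesis using that by blast
qed

text \<open>The trace, its transform and its half fractional Laplacian converge in three weighted
  spaces, to u, v and w; closedness of the Fourier relation shows that v is the transform of u, and
  |\<xi>|^s v that of w. The bound is stated for any limit G of \<open>nabla_b b k\<close> along the
  same sequence, so that G can later be the function chosen in \<open>nabla_ext\<close>.\<close>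

lemma trace_limit:
  fixes U :: "(real^'n) \<times> real \<Rightarrow> real"
  assumes \<phi>: "approximates k b \<phi> U"
  obtains u w where "tr_lim U \<phi> u" "frac_pair s u w"
    "\<And>G. G \<in> weighted_L2 (weight b 0) \<Longrightarrow> (\<lambda>m. weighted_L2_norm (weight b 0) (\<lambda>z. nabla_b b k (\<phi> m) z - G z)) \<longlonglongrightarrow> 0 \<Longrightarrow>
      weighted_L2_norm (\<lambda>_. 1) w \<le> K * weighted_L2_norm (weight b 0) G"
proof -
  let ?q = "\<lambda>\<xi>::real^'n. norm \<xi> powr (2 * s)"
  note C = approximatesD(1)[OF \<phi>]
  obtain C1 where C1: "C1 \<ge> 0" "\<And>U :: (real^'n) \<times> real \<Rightarrow> real. U \<in> Cinfe \<Longrightarrow> weighted_L2_norm p (trace_map U) \<le> C1 * full_norm k b U"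
    using trace_norm_le_full_norm by blast
  have KN: "K * N0 V \<le> K * full_norm k b V" for V by (intro mult_left_mono N0_le_full_norm K_nonneg)
  have T: "trace_map (\<phi> m) \<in> weighted_L2 p" for m by (rule trace_Hardy_norm(1)[OF Cinfe_Cke[OF C], of 1]) auto
  obtain u where u: "u \<in> weighted_L2 p" "(\<lambda>m. weighted_L2_norm p (\<lambda>x. trace_map (\<phi> m) x - u x)) \<longlonglongrightarrow> 0"
  proof (rule weighted_L2_complete[OF p(1,2), where F="\<lambda>m. trace_map (\<phi> m)"])
    show "\<exists>N. \<forall>m\<ge>N. \<forall>pa\<ge>N. weighted_L2_norm p (\<lambda>z. trace_map (\<phi> m) z - trace_map (\<phi> pa) z) < \<epsilon>" if "\<epsilon> > 0" for \<epsilon>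
      by (rule Cauchy_from_full_norm[OF \<phi> C1(2) C1(1)]) (use that in \<open>auto simp: trace_map_def\<close>)
  qed (use T in auto)
  obtain w where w: "w \<in> weighted_L2 (\<lambda>_. 1)" "(\<lambda>m. weighted_L2_norm (\<lambda>_. 1) (\<lambda>x. trw s (\<phi> m) x - w x)) \<longlonglongrightarrow> 0"
  proof (rule weighted_L2_complete[where w="\<lambda>_. 1" and F="\<lambda>m. trw s (\<phi> m)"])
    show "\<exists>N. \<forall>m\<ge>N. \<forall>pa\<ge>N. weighted_L2_norm (\<lambda>_. 1) (\<lambda>z. trw s (\<phi> m) z - trw s (\<phi> pa) z) < \<epsilon>" if "\<epsilon> > 0" for \<epsilon>
    proof (rule Cauchy_from_full_norm[OF \<phi>, where C=K and F="trw s"])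
      show "weighted_L2_norm (\<lambda>_. 1) (trw s V) \<le> K * full_norm k b V" if "V \<in> Cinfe" for V :: "(real^'n) \<times> real \<Rightarrow> real"
        by (rule order_trans[OF trw_weighted_L2(2)[OF that] KN])
    qed (rule K_nonneg ext trw_diff[OF s_pos C C] that)+
  qed (use trw_weighted_L2(1)[OF C] in auto)
  obtain v where v: "v \<in> weighted_L2 ?q" "(\<lambda>m. weighted_L2_norm ?q (\<lambda>x. trf (\<phi> m) x - v x)) \<longlonglongrightarrow> 0"
  proof (rule weighted_L2_complete[where w="?q" and F="\<lambda>m. trf (\<phi> m)"])
    show "\<exists>N. \<forall>m\<ge>N. \<forall>pa\<ge>N. weighted_L2_norm ?q (\<lambda>z. trf (\<phi> m) z - trf (\<phi> pa) z) < \<epsilon>" if "\<epsilon> > 0" for \<epsilon>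
    proof (rule Cauchy_from_full_norm[OF \<phi>, where C=K and F="trf"])
      show "weighted_L2_norm ?q (trf V) \<le> K * full_norm k b V" if "V \<in> Cinfe" for V :: "(real^'n) \<times> real \<Rightarrow> real"
        by (rule order_trans[OF trf_weighted_L2(2)[OF that] KN])
    qed (rule K_nonneg ext trf_diff[OF s_pos C C] that)+
  qed (use trf_weighted_L2(1)[OF C] in auto)
  note m = weighted_L2D(1)[OF u(1)] weighted_L2D(1)[OF w(1)] weighted_L2D(1)[OF v(1)]
  have n1: "weighted_L2_norm r (\<lambda>x. complex_of_real (f x) - complex_of_real (g x)) = weighted_L2_norm r (\<lambda>x. f x - g x)" for r and f g :: "real^'n \<Rightarrow> real"
    unfolding weighted_L2_norm_def of_real_diff[symmetric] by (simp only: norm_of_real real_norm_def)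
  have n2: "(\<lambda>x. complex_of_real (f x) - complex_of_real (g x)) \<in> weighted_L2 r" if "(\<lambda>x. f x - g x) \<in> weighted_L2 r" for r and f g :: "real^'n \<Rightarrow> real"
  proof -
    note [measurable] = weighted_L2D(1)[OF that]
    have "(\<lambda>x. complex_of_real (f x - g x)) \<in> borel_measurable lborel" by measurable
    then show ?thesis
      using that unfolding weighted_L2_def of_real_diff[symmetric] mem_Collect_eq norm_of_real real_norm_def power2_abs by blast
  qed
  have dv: "x / y powr a = y powr (- a) * x" for x y a :: real
    by (simp add: powr_minus divide_inverse mult.commute)
  have half: "2 * (r / 2) = r" for r :: real by simp
  have dn: "real DIM(real^'n) = real CARD('n)" by simp
  \<comment> \<open>The exponent conditions that place rapid functions in the duals of the weighted
    spaces: 2 s > -n for the space of traces and, below, - 2 s > -n for that of transforms.\<close>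
  have ex1: "- real DIM(real^'n) < - (- 2 * s)"
  proof -
    have "- c < - (- 2 * r)" if "c \<ge> 0" "r > 0" for c r :: real using that by simp
    then show ?thesis using of_nat_0_le_iff s_pos by blast
  qed
  have ex2: "- real DIM(real^'n) < - (2 * s)"
    unfolding dn using s_dim by (simp only: neg_less_iff_less)
  have "has_fourier (\<lambda>x. of_real (u x)) v"
  proof (rule has_fourier_limit[where u="\<lambda>m x. of_real (trace_map (\<phi> m) x)" and v="\<lambda>m. trf (\<phi> m)" and p=p and q="?q"])
    show "has_fourier (\<lambda>x. complex_of_real (trace_map (\<phi> m) x)) (trf (\<phi> m))" for m by (rule has_fourier_trace[OF s_pos C])
    show "(\<lambda>z. complex_of_real (trace_map (\<phi> m) z) - complex_of_real (u z)) \<in> weighted_L2 p" for m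
      by (intro n2 weighted_L2_diff p T u(1))
    show "(\<lambda>z. trf (\<phi> m) z - v z) \<in> weighted_L2 ?q" for m
      by (intro weighted_L2_diff trf_weighted_L2(1)[OF C] v(1)) auto
    show "integrable lborel (\<lambda>z. (norm (f z))\<^sup>2 / p z)" if "rapid f" for f :: "real^'n \<Rightarrow> complex"
      unfolding dv by (rule rapid_integrable_sq[OF that]) (rule ex1)
    show "integrable lborel (\<lambda>z. (norm (f z))\<^sup>2 / ?q z)" if "rapid f" for f :: "real^'n \<Rightarrow> complex"
      unfolding dv by (rule rapid_integrable_sq[OF that]) (rule ex2)
    show "(\<lambda>m. weighted_L2_norm p (\<lambda>z. complex_of_real (trace_map (\<phi> m) z) - complex_of_real (u z))) \<longlonglongrightarrow> 0"
      unfolding n1 by (rule u(2))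
    show "(\<lambda>x. complex_of_real (u x)) \<in> borel_measurable borel" using m(1) by measurable
    show "?q \<in> borel_measurable borel" by measurable
  qed (rule m(3) p v(2) AE_norm_powr_pos powr_ge_zero)+
  moreover have "has_fourier (\<lambda>x. of_real (w x)) (\<lambda>\<xi>. of_real (norm \<xi> powr s) * v \<xi>)"
  proof (rule has_fourier_limit[where u="\<lambda>m x. of_real (trw s (\<phi> m) x)" and v="\<lambda>m. trh s (\<phi> m)" and p="\<lambda>_. 1" and q="\<lambda>_. 1"])
    show "(\<lambda>m. weighted_L2_norm (\<lambda>_. 1) (\<lambda>z. complex_of_real (trw s (\<phi> m) z) - complex_of_real (w z))) \<longlonglongrightarrow> 0"
      unfolding n1 by (rule w(2))
    show "(\<lambda>x. complex_of_real (w x)) \<in> borel_measurable borel" using m(2) by measurable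
    show "(\<lambda>\<xi>. of_real (norm \<xi> powr s) * v \<xi>) \<in> borel_measurable borel" using m(3) by measurable
    \<comment> \<open>The multiplier converts the weighted distance between the transforms into the
      plain one, so convergence is inherited from that to v.\<close>
    have e: "1 * (norm (trh s (\<phi> m) z - of_real (norm z powr s) * v z))\<^sup>2 = ?q z * (norm (trf (\<phi> m) z - v z))\<^sup>2" for m z
    proof -
      have sq: "(y powr r)\<^sup>2 = y powr (2 * r)" for y r :: real
        by (simp add: power2_eq_square flip: powr_add)
      have "trh s (\<phi> m) z - of_real (norm z powr s) * v z = of_real (norm z powr s) * (trf (\<phi> m) z - v z)"
        by (simp add: trh_def algebra_simps)
      then show ?thesis by (simp only: norm_mult power_mult_distrib norm_of_real power2_abs mult_1 sq)
    qed
    have tv: "(\<lambda>z. trf (\<phi> m) z - v z) \<in> weighted_L2 ?q" for m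
      by (intro weighted_L2_diff trf_weighted_L2(1)[OF C] v(1)) auto
    show "has_fourier (\<lambda>x. complex_of_real (trw s (\<phi> m) x)) (trh s (\<phi> m))" for m by (rule has_fourier_trw[OF s_pos C])
    show "(\<lambda>z. complex_of_real (trw s (\<phi> m) z) - complex_of_real (w z)) \<in> weighted_L2 (\<lambda>_. 1)" for m
      by (intro n2 weighted_L2_diff trw_weighted_L2(1)[OF C] w(1)) auto
    have mh: "trh s (\<phi> m) \<in> borel_measurable borel" for m by (rule rapid_measurable[OF rapid_trh[OF s_pos C]])
    show "(\<lambda>z. trh s (\<phi> m) z - of_real (norm z powr s) * v z) \<in> weighted_L2 (\<lambda>_. 1)" for m
      unfolding weighted_L2_def mem_Collect_eq e
    proof
      note [measurable] = mh m(3)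
      show "(\<lambda>z. trh s (\<phi> m) z - complex_of_real (norm z powr s) * v z) \<in> borel_measurable lborel" by measurable
      show "integrable lborel (\<lambda>z. ?q z * (norm (trf (\<phi> m) z - v z))\<^sup>2)" by (rule weighted_L2D(2)[OF tv])
    qed
    show "(\<lambda>m. weighted_L2_norm (\<lambda>_. 1) (\<lambda>z. trh s (\<phi> m) z - of_real (norm z powr s) * v z)) \<longlonglongrightarrow> 0"
      using v(2) unfolding weighted_L2_norm_def e .
    show "integrable lborel (\<lambda>z. (norm (f z))\<^sup>2 / 1)" if "rapid f" for f :: "real^'n \<Rightarrow> complex"
    proof -
      \<comment> \<open>At the origin \<open>norm z powr 0\<close> is 0 rather than 1, so the
        constant weight agrees with this power only almost everywhere.\<close>
      have "AE z in lborel. norm z powr 0 * (norm (f z))\<^sup>2 = (norm (f z))\<^sup>2 / 1"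
        using AE_lborel_singleton[of "0 :: real^'n"] by eventually_elim auto
      moreover have "integrable lborel (\<lambda>z. norm z powr 0 * (norm (f z))\<^sup>2)" by (rule rapid_integrable_sq[OF that]) simp
      moreover have "f \<in> borel_measurable borel" by (rule rapid_measurable[OF that])
      ultimately show ?thesis by (subst (asm) integrable_cong_AE) auto
    qed
    then show "integrable lborel (\<lambda>z. (norm (f z))\<^sup>2 / 1)" if "rapid f" for f :: "real^'n \<Rightarrow> complex" using that .
  qed auto
  ultimately have fp: "frac_pair s u w"
    using w(1) unfolding frac_pair_def has_frac_laplacian_def half by blast
  have "weighted_L2_norm (\<lambda>_. 1) w \<le> K * weighted_L2_norm (weight b 0) G"
    if G: "G \<in> weighted_L2 (weight b 0)" "(\<lambda>m. weighted_L2_norm (weight b 0) (\<lambda>z. nabla_b b k (\<phi> m) z - G z)) \<longlonglongrightarrow> 0" for G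
  proof -
    let ?R = "\<lambda>m. weighted_L2_norm (\<lambda>_. 1) (\<lambda>x. trw s (\<phi> m) x - w x) + K * (weighted_L2_norm (weight b 0) G + weighted_L2_norm (weight b 0) (\<lambda>z. nabla_b b k (\<phi> m) z - G z))"
    have "weighted_L2_norm (\<lambda>_. 1) w \<le> ?R m" for m
    proof -
      have "weighted_L2_norm (\<lambda>_. 1) (\<lambda>x. trw s (\<phi> m) x - (trw s (\<phi> m) x - w x)) \<le>
        weighted_L2_norm (\<lambda>_. 1) (trw s (\<phi> m)) + weighted_L2_norm (\<lambda>_. 1) (\<lambda>x. trw s (\<phi> m) x - w x)"
        by (intro weighted_L2_diff trw_weighted_L2(1)[OF C] w(1)) auto
      moreover have "weighted_L2_norm (\<lambda>_. 1) (trw s (\<phi> m)) \<le> K * N0 (\<phi> m)" by (rule trw_weighted_L2(2)[OF C])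
      moreover have "N0 (\<phi> m) \<le> weighted_L2_norm (weight b 0) G + weighted_L2_norm (weight b 0) (\<lambda>z. nabla_b b k (\<phi> m) z - G z)"
      proof -
        have "weighted_L2_norm (weight b 0) (\<lambda>z. G z + (nabla_b b k (\<phi> m) z - G z)) \<le>
          weighted_L2_norm (weight b 0) G + weighted_L2_norm (weight b 0) (\<lambda>z. nabla_b b k (\<phi> m) z - G z)"
          by (intro weighted_L2_add weighted_L2_diff weight_nonneg borel_measurable_weight nabla_weighted_L2[OF C] G(1))
        then show ?thesis by simp
      qed
      then have "K * N0 (\<phi> m) \<le> K * (weighted_L2_norm (weight b 0) G + weighted_L2_norm (weight b 0) (\<lambda>z. nabla_b b k (\<phi> m) z - G z))"
        by (rule mult_left_mono[OF _ K_nonneg])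
      ultimately show ?thesis by simp
    qed
    moreover have "?R \<longlonglongrightarrow> 0 + K * (weighted_L2_norm (weight b 0) G + 0)"
      by (intro tendsto_intros w(2) G(2))
    ultimately show ?thesis by (intro LIMSEQ_le_const[of ?R]) auto
  qed
  then show thesis using that[OF _ fp] \<phi> u unfolding tr_lim_def by blast
qed

lemma approximates_lin:
  fixes U :: "(real^'n) \<times> real \<Rightarrow> real"
  assumes \<phi>: "approximates k b \<phi> U" and \<psi>: "approximates k b \<psi> V"
  shows "approximates k b (\<lambda>m z. c * \<phi> m z + d * \<psi> m z) (\<lambda>z. c * U z + d * V z)"
  unfolding approximates_def
proof (intro conjI allI impI)
  note C = approximatesD(1)[OF \<phi>] approximatesD(1)[OF \<psi>]
  show "(\<lambda>z. c * \<phi> m z + d * \<psi> m z) \<in> Cinfe" for m by (rule Cinfe_lin[OF C])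
  show "(\<lambda>z. c * U z + d * V z) \<in> weighted_L2 (weight b k)"
    using weighted_L2_add[OF weight_nonneg borel_measurable_weight weighted_L2_scale(1)[OF weight_nonneg approximatesD(3)[OF \<phi>], of c]
      weighted_L2_scale(1)[OF weight_nonneg approximatesD(3)[OF \<psi>], of d]] by simp
  have W: "(\<lambda>z. \<phi> m z - U z) \<in> weighted_L2 (weight b k)" "(\<lambda>z. \<psi> m z - V z) \<in> weighted_L2 (weight b k)" for m
    by (intro weighted_L2_diff weight_nonneg borel_measurable_weight Cke_weighted_L2(1)[OF Cinfe_Cke] C
        approximatesD(3)[OF \<phi>] approximatesD(3)[OF \<psi>])+
  have "Nk (\<lambda>z. c * \<phi> m z + d * \<psi> m z - (c * U z + d * V z)) \<le> \<bar>c\<bar> * Nk (\<lambda>z. \<phi> m z - U z) + \<bar>d\<bar> * Nk (\<lambda>z. \<psi> m z - V z)" for m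
  proof -
    have "Nk (\<lambda>z. c *\<^sub>R (\<phi> m z - U z) + d *\<^sub>R (\<psi> m z - V z)) \<le> Nk (\<lambda>z. c *\<^sub>R (\<phi> m z - U z)) + Nk (\<lambda>z. d *\<^sub>R (\<psi> m z - V z))"
      by (intro weighted_L2_add weighted_L2_scale W weight_nonneg borel_measurable_weight)
    moreover have "(\<lambda>z. c *\<^sub>R (\<phi> m z - U z) + d *\<^sub>R (\<psi> m z - V z)) = (\<lambda>z. c * \<phi> m z + d * \<psi> m z - (c * U z + d * V z))"
      by (auto simp: fun_eq_iff algebra_simps)
    ultimately show ?thesis using weighted_L2_scale(2)[OF weight_nonneg W(1)] weighted_L2_scale(2)[OF weight_nonneg W(2)] by simp
  qed
  moreover have "(\<lambda>m. \<bar>c\<bar> * Nk (\<lambda>z. \<phi> m z - U z) + \<bar>d\<bar> * Nk (\<lambda>z. \<psi> m z - V z)) \<longlonglongrightarrow> \<bar>c\<bar> * 0 + \<bar>d\<bar> * 0"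
    by (intro tendsto_intros approximatesD(4)[OF \<phi>] approximatesD(4)[OF \<psi>])
  ultimately show "(\<lambda>m. Nk (\<lambda>z. c * \<phi> m z + d * \<psi> m z - (c * U z + d * V z))) \<longlonglongrightarrow> 0"
    by (rule LIMSEQ_0_squeeze) (simp, intro weighted_L2_norm_nonneg weight_nonneg p(1))
  have tri: "full_norm k b (\<lambda>z. c * f z + d * g z) \<le> \<bar>c\<bar> * full_norm k b f + \<bar>d\<bar> * full_norm k b g"
    if f: "f \<in> Cinfe" and g: "g \<in> Cinfe" for f g :: "(real^'n) \<times> real \<Rightarrow> real"
  proof -
    let ?N = "\<lambda>f j. weighted_L2_norm (weight b (k - j)) (nabla_b b j f)"
    have mem: "nabla_b b j h \<in> weighted_L2 (weight b (k - j) :: (real^'n) \<times> real \<Rightarrow> real)" if "h \<in> Cinfe" for h j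
      by (rule nabla_b_weighted_L2[OF b(1) dim_le that]) simp
    have "?N (\<lambda>z. c * f z + d * g z) j \<le> \<bar>c\<bar> * ?N f j + \<bar>d\<bar> * ?N g j" for j
    proof -
      have "nabla_b b j (\<lambda>z. c * f z + d * g z) = (\<lambda>z. c *\<^sub>R nabla_b b j f z + d *\<^sub>R nabla_b b j g z)"
        using nabla_b_lin[OF f g] by auto
      then show ?thesis
        using weighted_L2_add(2)[OF weight_nonneg borel_measurable_weight weighted_L2_scale(1)[OF weight_nonneg mem[OF f]] weighted_L2_scale(1)[OF weight_nonneg mem[OF g]], of j c d]
        by (simp add: weighted_L2_scale(2)[OF weight_nonneg mem[OF f]] weighted_L2_scale(2)[OF weight_nonneg mem[OF g]])
    qed
    then have "full_norm k b (\<lambda>z. c * f z + d * g z) \<le> L2_set (\<lambda>j. \<bar>c\<bar> * ?N f j + \<bar>d\<bar> * ?N g j) {..k}"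
      unfolding full_norm_eq by (intro L2_set_mono weighted_L2_norm_nonneg weight_nonneg) auto
    also have "\<dots> \<le> L2_set (\<lambda>j. \<bar>c\<bar> * ?N f j) {..k} + L2_set (\<lambda>j. \<bar>d\<bar> * ?N g j) {..k}" by (rule L2_set_triangle_ineq)
    also have "\<dots> = \<bar>c\<bar> * full_norm k b f + \<bar>d\<bar> * full_norm k b g"
      unfolding full_norm_eq by (simp add: L2_set_right_distrib)
    finally show ?thesis .
  qed
  fix \<epsilon> :: real assume \<epsilon>: "\<epsilon> > 0"
  \<comment> \<open>The extra 1 makes the final inequality strict and covers c = d = 0.\<close>
  define \<delta> where "\<delta> = \<epsilon> / (\<bar>c\<bar> + \<bar>d\<bar> + 1)"
  have pos: "\<bar>c\<bar> + \<bar>d\<bar> + 1 > 0" by (simp add: add_nonneg_pos)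
  have \<delta>: "\<delta> > 0" unfolding \<delta>_def using \<epsilon> pos by (rule divide_pos_pos)
  obtain N1 N2 where N: "\<forall>m\<ge>N1. \<forall>p\<ge>N1. full_norm k b (\<lambda>z. \<phi> m z - \<phi> p z) < \<delta>"
    "\<forall>m\<ge>N2. \<forall>p\<ge>N2. full_norm k b (\<lambda>z. \<psi> m z - \<psi> p z) < \<delta>"
    using approximatesD(2)[OF \<phi> \<delta>] approximatesD(2)[OF \<psi> \<delta>] by blast
  have "full_norm k b (\<lambda>z. c * \<phi> m z + d * \<psi> m z - (c * \<phi> p z + d * \<psi> p z)) < \<epsilon>" if "m \<ge> max N1 N2" "p \<ge> max N1 N2" for m p
  proof -
    have "(\<lambda>z. c * \<phi> m z + d * \<psi> m z - (c * \<phi> p z + d * \<psi> p z)) = (\<lambda>z. c * (\<phi> m z - \<phi> p z) + d * (\<psi> m z - \<psi> p z))"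
      by (auto simp: fun_eq_iff algebra_simps)
    then have "full_norm k b (\<lambda>z. c * \<phi> m z + d * \<psi> m z - (c * \<phi> p z + d * \<psi> p z)) \<le>
      \<bar>c\<bar> * full_norm k b (\<lambda>z. \<phi> m z - \<phi> p z) + \<bar>d\<bar> * full_norm k b (\<lambda>z. \<psi> m z - \<psi> p z)"
      using tri[OF Cinfe_diff[OF C(1) C(1)] Cinfe_diff[OF C(2) C(2)], of m p m p] by simp
    also have "\<dots> \<le> \<bar>c\<bar> * \<delta> + \<bar>d\<bar> * \<delta>"
      using N that by (intro add_mono mult_left_mono[OF less_imp_le]) auto
    also have "\<dots> = (\<bar>c\<bar> + \<bar>d\<bar> + 1) * \<delta> - \<delta>" by (simp add: algebra_simps)
    also have "(\<bar>c\<bar> + \<bar>d\<bar> + 1) * \<delta> = \<epsilon>" using pos by (simp add: \<delta>_def)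
    also have "\<epsilon> - \<delta> < \<epsilon>" using \<delta> by simp
    finally show ?thesis .
  qed
  then show "\<exists>N. \<forall>m\<ge>N. \<forall>p\<ge>N. full_norm k b (\<lambda>z. c * \<phi> m z + d * \<psi> m z - (c * \<phi> p z + d * \<psi> p z)) < \<epsilon>" by blast
qed

lemma Dkb_lin: "(U :: (real^'n) \<times> real \<Rightarrow> real) \<in> Dkb k b \<Longrightarrow> V \<in> Dkb k b \<Longrightarrow> (\<lambda>z. c * U z + d * V z) \<in> Dkb k b"
  unfolding Dkb_def using approximates_lin by blast

lemma Dkb_diff: "(U :: (real^'n) \<times> real \<Rightarrow> real) \<in> Dkb k b \<Longrightarrow> V \<in> Dkb k b \<Longrightarrow> (\<lambda>z. U z - V z) \<in> Dkb k b"
  using Dkb_lin[of U V 1 "-1"] by simp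

lemma Cinfe_approximates:
  fixes U :: "(real^'n) \<times> real \<Rightarrow> real"
  assumes "U \<in> Cinfe"
  shows "approximates k b (\<lambda>_. U) U"
proof -
  have "full_norm k b (\<lambda>z. U z - U z) = 0"
    using nabla_b_lin[OF assms assms, of b _ 0 0] by (simp add: full_norm_eq L2_set_def weighted_L2_norm_def)
  then show ?thesis
    using assms Cke_weighted_L2(1)[OF Cinfe_Cke[OF assms]] by (simp add: approximates_def weighted_L2_norm_def)
qed

lemma Cinfe_Dkb: "(U :: (real^'n) \<times> real \<Rightarrow> real) \<in> Cinfe \<Longrightarrow> U \<in> Dkb k b"
  unfolding Dkb_def using Cinfe_approximates by blast

text \<open>Cauchy sequences are bounded from some index on; this provides the bound
  \<open>M\<close> in \<open>trace_closable\<close>.\<close>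

lemma grad_bounded:
  fixes U :: "(real^'n) \<times> real \<Rightarrow> real"
  assumes \<phi>: "approximates k b \<phi> U"
  obtains m0 M where "\<And>m. m \<ge> m0 \<Longrightarrow> weighted_L2_norm (weight b (k - 1)) (grad (\<phi> m)) \<le> M"
proof -
  note C = approximatesD(1)[OF \<phi>]
  obtain N where N: "\<forall>m\<ge>N. \<forall>p\<ge>N. full_norm k b (\<lambda>z. \<phi> m z - \<phi> p z) < 1" using approximatesD(2)[OF \<phi> zero_less_one] by blast
  have G: "grad (\<phi> m) \<in> weighted_L2 (weight b (k - 1))" for m by (rule Cke_weighted_L2(2)[OF Cinfe_Cke[OF C]])
  have "weighted_L2_norm (weight b (k - 1)) (grad (\<phi> m)) \<le> weighted_L2_norm (weight b (k - 1)) (grad (\<phi> N)) + 1" if "m \<ge> N" for m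
  proof -
    have e: "grad (\<lambda>z. \<phi> m z - \<phi> N z) = (\<lambda>z. grad (\<phi> m) z - grad (\<phi> N) z)"
    proof
      fix z
      have "grad (\<lambda>z. 1 * \<phi> m z + (- 1) * \<phi> N z) z = 1 *\<^sub>R grad (\<phi> m) z + (- 1) *\<^sub>R grad (\<phi> N) z"
        by (rule grad_lin[OF Cinfe_differentiable[OF C] Cinfe_differentiable[OF C]])
      then show "grad (\<lambda>z. \<phi> m z - \<phi> N z) z = grad (\<phi> m) z - grad (\<phi> N) z" by simp
    qed
    have "weighted_L2_norm (weight b (k - 1)) (\<lambda>z. grad (\<phi> N) z + (grad (\<phi> m) z - grad (\<phi> N) z)) \<le>
      weighted_L2_norm (weight b (k - 1)) (grad (\<phi> N)) + weighted_L2_norm (weight b (k - 1)) (\<lambda>z. grad (\<phi> m) z - grad (\<phi> N) z)"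
      by (intro weighted_L2_add weighted_L2_diff G weight_nonneg borel_measurable_weight)
    moreover have "weighted_L2_norm (weight b (k - 1)) (\<lambda>z. grad (\<phi> m) z - grad (\<phi> N) z) \<le> 1"
      using grad_le_full_norm[of "\<lambda>z. \<phi> m z - \<phi> N z"] N that unfolding e by (meson less_imp_le order_refl order_trans)
    ultimately show ?thesis by simp
  qed
  then show thesis by (rule that)
qed

text \<open>The difference of the two sequences tends to 0 in the ambient space, since U and V agree
  almost everywhere, and its gradients are bounded; so \<open>trace_closable\<close> applies to the
  difference of the limits.\<close>

lemma tr_lim_unique:
  assumes u: "tr_lim U \<phi> u" and v: "tr_lim V \<psi> v" and UV: "ae_eq U V"
  shows "ae_eq u v"
proof -
  have \<phi>: "approximates k b \<phi> U" and \<psi>: "approximates k b \<psi> V" using u v unfolding tr_lim_def by blast+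
  note C = approximatesD(1)[OF \<phi>] approximatesD(1)[OF \<psi>]
  let ?X = "\<lambda>m z. 1 * \<phi> m z + (- 1) * \<psi> m z"
  note X = approximates_lin[OF \<phi> \<psi>, of 1 "-1"]
  have uv: "u \<in> weighted_L2 p" "v \<in> weighted_L2 p" using u v unfolding tr_lim_def by blast+
  have T: "trace_map (\<phi> m) \<in> weighted_L2 p" "trace_map (\<psi> m) \<in> weighted_L2 p" for m
    by (rule trace_Hardy_norm(1)[OF Cinfe_Cke[OF C(1)], of 1], simp, simp)
       (rule trace_Hardy_norm(1)[OF Cinfe_Cke[OF C(2)], of 1], simp, simp)
  obtain m0 M where M: "\<And>m. m \<ge> m0 \<Longrightarrow> weighted_L2_norm (weight b (k - 1)) (grad (?X m)) \<le> M"
    using grad_bounded[OF X] by blast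
  have "AE x in lborel. u x - v x = 0"
  proof (rule trace_closable[where X="?X", OF _ _ M])
    show "?X m \<in> Cke k" for m by (intro Cke_lin Cinfe_Cke C)
    have "ae_eq (\<lambda>z. ?X m z - (1 * U z + (- 1) * V z)) (?X m)" for m
      using UV unfolding ae_eq_def by eventually_elim simp
    then have "Nk (\<lambda>z. ?X m z - (1 * U z + (- 1) * V z)) = Nk (?X m)" for m
      using weighted_L2D(1)[OF Cke_weighted_L2(1)[OF Cinfe_Cke[OF approximatesD(1)[OF X]]], of m] weighted_L2D(1)[OF approximatesD(3)[OF X]]
      by (intro weighted_L2_norm_cong_AE) auto
    then show "(\<lambda>m. Nk (?X m)) \<longlonglongrightarrow> 0" using approximatesD(4)[OF X] by simp
    show "(\<lambda>x. u x - v x) \<in> weighted_L2 p" by (intro weighted_L2_diff p uv)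
    have "weighted_L2_norm p (\<lambda>x. trace_map (?X m) x - (u x - v x)) \<le>
      weighted_L2_norm p (\<lambda>x. trace_map (\<phi> m) x - u x) + weighted_L2_norm p (\<lambda>x. trace_map (\<psi> m) x - v x)" for m
    proof -
      have "weighted_L2_norm p (\<lambda>x. (trace_map (\<phi> m) x - u x) - (trace_map (\<psi> m) x - v x)) \<le>
        weighted_L2_norm p (\<lambda>x. trace_map (\<phi> m) x - u x) + weighted_L2_norm p (\<lambda>x. trace_map (\<psi> m) x - v x)"
        by (intro weighted_L2_diff p T uv)
      moreover have "(\<lambda>x. (trace_map (\<phi> m) x - u x) - (trace_map (\<psi> m) x - v x)) = (\<lambda>x. trace_map (?X m) x - (u x - v x))"
        by (auto simp: trace_map_def)
      ultimately show ?thesis by simp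
    qed
    moreover have "(\<lambda>m. weighted_L2_norm p (\<lambda>x. trace_map (\<phi> m) x - u x) + weighted_L2_norm p (\<lambda>x. trace_map (\<psi> m) x - v x)) \<longlonglongrightarrow> 0 + 0"
      using u v unfolding tr_lim_def by (intro tendsto_add) blast+
    ultimately show "(\<lambda>m. weighted_L2_norm p (\<lambda>x. trace_map (?X m) x - (u x - v x))) \<longlonglongrightarrow> 0"
      by (rule LIMSEQ_0_squeeze) (simp, intro weighted_L2_norm_nonneg weight_nonneg p(1))
  qed
  then show ?thesis by (simp add: ae_eq_def)
qed

text \<open>\<open>trace_closable\<close> is applied to \<phi> m - U, whose gradients stay bounded
  because U contributes one fixed gradient. Convergence in the ambient space is all that relates U
  to its sequence here.\<close>

lemma tr_lim_Cke:
  assumes u: "tr_lim U \<phi> u" and U: "U \<in> Cke k"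
  shows "ae_eq u (trace_map U)"
proof -
  have \<phi>: "approximates k b \<phi> U" using u unfolding tr_lim_def by blast
  note C = approximatesD(1)[OF \<phi>]
  let ?X = "\<lambda>m z. 1 * \<phi> m z + (- 1) * U z"
  have u': "u \<in> weighted_L2 p" using u unfolding tr_lim_def by blast
  have TU: "trace_map U \<in> weighted_L2 p" by (rule trace_Hardy_norm(1)[OF U, of 1]) auto
  have X: "?X m \<in> Cke k" for m by (intro Cke_lin Cinfe_Cke C U)
  obtain m0 M where M: "\<And>m. m \<ge> m0 \<Longrightarrow> weighted_L2_norm (weight b (k - 1)) (grad (\<phi> m)) \<le> M"
    using grad_bounded[OF \<phi>] by blast
  have dU: "U differentiable at z" for z by (rule Ck_1_differentiable[OF Cke_Ck1[OF U]]) simp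
  have "AE x in lborel. u x - trace_map U x = 0"
  proof (rule trace_closable[where X="?X", OF X])
    show "(\<lambda>m. Nk (?X m)) \<longlonglongrightarrow> 0" using approximatesD(4)[OF \<phi>] by simp
    show "weighted_L2_norm (weight b (k - 1)) (grad (?X m)) \<le> M + weighted_L2_norm (weight b (k - 1)) (grad U)" if "m \<ge> m0" for m
    proof -
      have e: "grad (?X m) = (\<lambda>z. grad (\<phi> m) z - grad U z)"
      proof
        fix z
        have "grad (?X m) z = 1 *\<^sub>R grad (\<phi> m) z + (- 1) *\<^sub>R grad U z"
          by (rule grad_lin[OF Cinfe_differentiable[OF C] dU])
        then show "grad (?X m) z = grad (\<phi> m) z - grad U z" by simp
      qed
      have "weighted_L2_norm (weight b (k - 1)) (grad (?X m)) \<le> weighted_L2_norm (weight b (k - 1)) (grad (\<phi> m)) + weighted_L2_norm (weight b (k - 1)) (grad U)"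
        unfolding e by (intro weighted_L2_diff weight_nonneg borel_measurable_weight Cke_weighted_L2(2) Cinfe_Cke C U)
      then show ?thesis using M[OF that] by simp
    qed
    show "(\<lambda>x. u x - trace_map U x) \<in> weighted_L2 p" by (intro weighted_L2_diff p u' TU)
    have "(\<lambda>x. trace_map (?X m) x - (u x - trace_map U x)) = (\<lambda>x. trace_map (\<phi> m) x - u x)" for m
      by (auto simp: trace_map_def)
    then show "(\<lambda>m. weighted_L2_norm p (\<lambda>x. trace_map (?X m) x - (u x - trace_map U x))) \<longlonglongrightarrow> 0"
      using u by (simp add: tr_lim_def)
  qed
  then show ?thesis by (simp add: ae_eq_def)
qed

text \<open>Outside \<open>Dkb k b\<close> the trace is set to the restriction, so that the extension property on
  \<open>Cke k\<close> does not require \<open>Cke k\<close> to be contained in \<open>Dkb k b\<close>.\<close>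

definition Tr :: "((real^'n) \<times> real \<Rightarrow> real) \<Rightarrow> real^'n \<Rightarrow> real" where
  "Tr U = (if U \<in> Dkb k b then SOME u. \<exists>\<phi>. tr_lim U \<phi> u else trace_map U)"

lemma Tr_lim:
  fixes U :: "(real^'n) \<times> real \<Rightarrow> real"
  assumes "U \<in> Dkb k b"
  obtains \<phi> where "tr_lim U \<phi> (Tr U)"
proof -
  obtain \<phi> where "approximates k b \<phi> U" using assms unfolding Dkb_def by blast
  then obtain u where "tr_lim U \<phi> u" using trace_limit by blast
  then have "\<exists>\<phi>. tr_lim U \<phi> (SOME u. \<exists>\<phi>. tr_lim U \<phi> u)" by (intro someI[of "\<lambda>u. \<exists>\<phi>. tr_lim U \<phi> u"] exI)
  then show thesis using that assms by (auto simp: Tr_def)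
qed

lemma Tr_eqI:
  assumes "tr_lim U \<phi> u"
  shows "ae_eq (Tr U) u"
proof -
  have "U \<in> Dkb k b" using assms unfolding tr_lim_def Dkb_def by blast
  then obtain \<psi> where "tr_lim U \<psi> (Tr U)" by (rule Tr_lim)
  from tr_lim_unique[OF this assms] show ?thesis by (simp add: ae_eq_def)
qed

text \<open>\<open>Tr U\<close> is a limit along some sequence; \<open>trace_limit\<close> along
  that sequence may return another representative, and membership is carried over by equality almost
  everywhere.\<close>

lemma Tr_Ds:
  fixes U :: "(real^'n) \<times> real \<Rightarrow> real"
  assumes "U \<in> Dkb k b"
  shows "Tr U \<in> Ds s"
proof -
  obtain \<phi> where \<phi>: "tr_lim U \<phi> (Tr U)" using Tr_lim[OF assms] by blast
  then have "approximates k b \<phi> U" unfolding tr_lim_def by blast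
  then obtain u w where u: "tr_lim U \<phi> u" "frac_pair s u w" using trace_limit by blast
  have T: "Tr U \<in> weighted_L2 p" using \<phi> unfolding tr_lim_def by blast
  have "ae_eq u (Tr U)" using Tr_eqI[OF u(1)] by (auto simp: ae_eq_def elim: eventually_mono)
  from frac_pair_cong[OF u(2) weighted_L2D(1)[OF T] this] show ?thesis
    using T by (auto simp: Ds_iff)
qed

lemma Tr_cong:
  fixes U :: "(real^'n) \<times> real \<Rightarrow> real"
  assumes "U \<in> Dkb k b" "V \<in> Dkb k b" "ae_eq U V"
  shows "ae_eq (Tr U) (Tr V)"
proof -
  obtain \<phi> where \<phi>: "tr_lim U \<phi> (Tr U)" by (rule Tr_lim[OF assms(1)])
  obtain \<psi> where \<psi>: "tr_lim V \<psi> (Tr V)" by (rule Tr_lim[OF assms(2)])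
  show ?thesis by (rule tr_lim_unique[OF \<phi> \<psi> assms(3)])
qed

lemma Tr_lin:
  fixes U :: "(real^'n) \<times> real \<Rightarrow> real"
  assumes U: "U \<in> Dkb k b" and V: "V \<in> Dkb k b"
  shows "ae_eq (Tr (\<lambda>z. c * U z + d * V z)) (\<lambda>x. c * Tr U x + d * Tr V x)"
proof -
  obtain \<phi> where \<phi>: "tr_lim U \<phi> (Tr U)" using Tr_lim[OF U] by blast
  obtain \<psi> where \<psi>: "tr_lim V \<psi> (Tr V)" using Tr_lim[OF V] by blast
  have a: "approximates k b \<phi> U" "approximates k b \<psi> V" using \<phi> \<psi> unfolding tr_lim_def by blast+
  have w: "Tr U \<in> weighted_L2 p" "Tr V \<in> weighted_L2 p" using \<phi> \<psi> unfolding tr_lim_def by blast+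
  have t: "trace_map (\<phi> m) \<in> weighted_L2 p" "trace_map (\<psi> m) \<in> weighted_L2 p" for m
    by (rule trace_Hardy_norm(1)[OF Cinfe_Cke[OF approximatesD(1)[OF a(1)]], of 1], simp, simp)
       (rule trace_Hardy_norm(1)[OF Cinfe_Cke[OF approximatesD(1)[OF a(2)]], of 1], simp, simp)
  have T: "(\<lambda>x. trace_map (\<phi> m) x - Tr U x) \<in> weighted_L2 p" "(\<lambda>x. trace_map (\<psi> m) x - Tr V x) \<in> weighted_L2 p" for m
    by (intro weighted_L2_diff p w t)+
  show ?thesis
  proof (rule Tr_eqI, unfold tr_lim_def, intro conjI)
    show "approximates k b (\<lambda>m z. c * \<phi> m z + d * \<psi> m z) (\<lambda>z. c * U z + d * V z)" by (rule approximates_lin[OF a])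
    show "(\<lambda>x. c * Tr U x + d * Tr V x) \<in> weighted_L2 p"
      using weighted_L2_add(1)[OF p(1,2) weighted_L2_scale(1)[OF p(1) w(1), of c] weighted_L2_scale(1)[OF p(1) w(2), of d]] by simp
    have "weighted_L2_norm p (\<lambda>x. trace_map (\<lambda>z. c * \<phi> m z + d * \<psi> m z) x - (c * Tr U x + d * Tr V x)) \<le>
      \<bar>c\<bar> * weighted_L2_norm p (\<lambda>x. trace_map (\<phi> m) x - Tr U x) + \<bar>d\<bar> * weighted_L2_norm p (\<lambda>x. trace_map (\<psi> m) x - Tr V x)" for m
    proof -
      have "(\<lambda>x. c *\<^sub>R (trace_map (\<phi> m) x - Tr U x) + d *\<^sub>R (trace_map (\<psi> m) x - Tr V x)) = (\<lambda>x. trace_map (\<lambda>z. c * \<phi> m z + d * \<psi> m z) x - (c * Tr U x + d * Tr V x))"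
        by (auto simp: trace_map_def algebra_simps)
      then show ?thesis
        using weighted_L2_add(2)[OF p(1,2) weighted_L2_scale(1)[OF p(1) T(1)[of m], of c] weighted_L2_scale(1)[OF p(1) T(2)[of m], of d]]
        unfolding weighted_L2_scale(2)[OF p(1) T(1)] weighted_L2_scale(2)[OF p(1) T(2)] by simp
    qed
    moreover have "(\<lambda>m. \<bar>c\<bar> * weighted_L2_norm p (\<lambda>x. trace_map (\<phi> m) x - Tr U x) + \<bar>d\<bar> * weighted_L2_norm p (\<lambda>x. trace_map (\<psi> m) x - Tr V x)) \<longlonglongrightarrow> \<bar>c\<bar> * 0 + \<bar>d\<bar> * 0"
      using \<phi> \<psi> unfolding tr_lim_def by (intro tendsto_add tendsto_mult tendsto_const) blast+
    ultimately show "(\<lambda>m. weighted_L2_norm p (\<lambda>x. trace_map (\<lambda>z. c * \<phi> m z + d * \<psi> m z) x - (c * Tr U x + d * Tr V x))) \<longlonglongrightarrow> 0"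
      by (rule LIMSEQ_0_squeeze) (simp, intro weighted_L2_norm_nonneg weight_nonneg p(1))
  qed
qed

lemma Ds_norm_cong:
  assumes "u \<in> Ds s" "u' \<in> borel_measurable borel" "ae_eq u u'"
  shows "Ds_norm s u = Ds_norm s u'"
proof -
  obtain w where w: "frac_pair s u w" using assms(1) by (auto simp: Ds_iff)
  show ?thesis using Ds_norm_eq[OF w] Ds_norm_eq[OF frac_pair_cong[OF w assms(2,3)]] by simp
qed

lemma Ds_measurable: "u \<in> Ds s \<Longrightarrow> u \<in> borel_measurable borel" for u :: "real^'n \<Rightarrow> real"
  using weighted_L2D(1) by (auto simp: Ds_iff)

text \<open>The sequence is the one behind \<open>nabla_ext\<close>, along which the estimate of
  \<open>trace_limit\<close> applies; the trace computed there agrees with \<open>Tr U\<close>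
  almost everywhere, whichever sequence defined \<open>Tr U\<close>.\<close>

lemma Tr_bound:
  fixes U :: "(real^'n) \<times> real \<Rightarrow> real"
  assumes U: "U \<in> Dkb k b"
  shows "Ds_norm s (Tr U) \<le> K * Dkb_norm k b U"
proof -
  obtain \<phi> where \<phi>: "approximates k b \<phi> U" "nabla_ext k b U \<in> weighted_L2 (weight b 0)"
    "(\<lambda>m. weighted_L2_norm (weight b 0) (\<lambda>z. nabla_b b k (\<phi> m) z - nabla_ext k b U z)) \<longlonglongrightarrow> 0"
    using nabla_ext[OF U] by blast
  obtain u w where u: "tr_lim U \<phi> u" "frac_pair s u w" and le: "weighted_L2_norm (\<lambda>_. 1) w \<le> K * weighted_L2_norm (weight b 0) (nabla_ext k b U)"
  proof (rule trace_limit[OF \<phi>(1)], goal_cases)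
    case (1 u w)
    show ?case by (rule 1(1)[OF 1(2,3) 1(4)[OF \<phi>(2,3)]])
  qed
  have "ae_eq u (Tr U)" using Tr_eqI[OF u(1)] by (auto simp: ae_eq_def elim: eventually_mono)
  from Ds_norm_eq[OF frac_pair_cong[OF u(2) Ds_measurable[OF Tr_Ds[OF U]] this]] le
  show ?thesis by (simp add: Dkb_norm_def)
qed

lemma Tr_diff_bound:
  fixes U :: "(real^'n) \<times> real \<Rightarrow> real"
  assumes U: "U \<in> Dkb k b" and V: "V \<in> Dkb k b"
  shows "Ds_norm s (\<lambda>x. Tr V x - Tr U x) \<le> K * Dkb_norm k b (\<lambda>z. V z - U z)"
proof -
  have D: "(\<lambda>z. V z - U z) \<in> Dkb k b" by (rule Dkb_diff[OF V U])
  have "ae_eq (Tr (\<lambda>z. V z - U z)) (\<lambda>x. Tr V x - Tr U x)" using Tr_lin[OF V U, of 1 "-1"] by simp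
  then have "Ds_norm s (Tr (\<lambda>z. V z - U z)) = Ds_norm s (\<lambda>x. Tr V x - Tr U x)"
    using Ds_measurable[OF Tr_Ds[OF U]] Ds_measurable[OF Tr_Ds[OF V]] by (intro Ds_norm_cong Tr_Ds D) auto
  with Tr_bound[OF D] show ?thesis by simp
qed

lemma trace_extension_Tr: "trace_extension k b Tr"
  unfolding trace_extension_def continuous_operator_def
proof (intro conjI ballI allI impI)
  show "ae_eq (Tr U) (trace_map U)" if "U \<in> Cke k" for U
  proof (cases "U \<in> Dkb k b")
    case True
    then obtain \<phi> where "tr_lim U \<phi> (Tr U)" using Tr_lim by blast
    then show ?thesis using that by (rule tr_lim_Cke)
  qed (simp add: Tr_def ae_eq_def)
  show "\<exists>\<delta>>0. \<forall>V\<in>Dkb k b. Dkb_norm k b (\<lambda>z. V z - U z) < \<delta> \<longrightarrow> Ds_norm s (\<lambda>x. Tr V x - Tr U x) < \<epsilon>"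
    if U: "U \<in> Dkb k b" and \<epsilon>: "\<epsilon> > 0" for U \<epsilon>
  proof (intro exI[of _ "\<epsilon> / (K + 1)"] conjI ballI impI)
    show "\<epsilon> / (K + 1) > 0" using \<epsilon> K_nonneg by simp
    fix V assume V: "V \<in> Dkb k b" and lt: "Dkb_norm k b (\<lambda>z. V z - U z) < \<epsilon> / (K + 1)"
    have "Ds_norm s (\<lambda>x. Tr V x - Tr U x) \<le> K * Dkb_norm k b (\<lambda>z. V z - U z)" by (rule Tr_diff_bound[OF U V])
    also have "\<dots> \<le> K * (\<epsilon> / (K + 1))" using lt K_nonneg by (intro mult_left_mono) auto
    also have "\<dots> < \<epsilon>" using \<epsilon> K_nonneg by (simp add: field_simps)
    finally show "Ds_norm s (\<lambda>x. Tr V x - Tr U x) < \<epsilon>" .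
  qed
qed (use Tr_Ds Tr_cong Tr_lin in auto)

text \<open>The norm of \<phi> m - U refers to a top-order derivative chosen along an unknown
  sequence \<psi>. By closability this is also the limit of the derivatives of \<phi> m - \<phi> p
  as p grows, and these are small by the Cauchy property.\<close>

lemma approximates_Dkb_norm:
  fixes U :: "(real^'n) \<times> real \<Rightarrow> real"
  assumes \<phi>: "approximates k b \<phi> U"
  shows "(\<lambda>m. Dkb_norm k b (\<lambda>z. \<phi> m z - U z)) \<longlonglongrightarrow> 0"
proof (rule LIMSEQ_I)
  fix \<epsilon> :: real assume \<epsilon>: "\<epsilon> > 0"
  note C = approximatesD(1)[OF \<phi>]
  let ?N = "weighted_L2_norm (weight b 0)"
  obtain N where N: "\<forall>m\<ge>N. \<forall>p\<ge>N. full_norm k b (\<lambda>z. \<phi> m z - \<phi> p z) < \<epsilon> / 2"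
    using approximatesD(2)[OF \<phi>, of "\<epsilon> / 2"] \<epsilon> by auto
  have "Dkb_norm k b (\<lambda>z. \<phi> m z - U z) \<le> \<epsilon> / 2" if m: "m \<ge> N" for m
  proof -
    have U: "U \<in> Dkb k b" using \<phi> unfolding Dkb_def by blast
    have "(\<lambda>z. \<phi> m z - U z) \<in> Dkb k b" by (rule Dkb_diff[OF Cinfe_Dkb[OF C] U])
    then obtain \<psi> where \<psi>: "approximates k b \<psi> (\<lambda>z. \<phi> m z - U z)" and G: "nabla_ext k b (\<lambda>z. \<phi> m z - U z) \<in> weighted_L2 (weight b 0)"
      "(\<lambda>p. ?N (\<lambda>z. nabla_b b k (\<psi> p) z - nabla_ext k b (\<lambda>z. \<phi> m z - U z) z)) \<longlonglongrightarrow> 0"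
      by (rule nabla_ext)
    note C' = approximatesD(1)[OF \<psi>]
    let ?G = "nabla_ext k b (\<lambda>z. \<phi> m z - U z)"
    have A: "approximates k b (\<lambda>p z. \<phi> m z - \<phi> p z) (\<lambda>z. \<phi> m z - U z)"
      using approximates_lin[OF Cinfe_approximates[OF C[of m]] \<phi>, of 1 "-1"] by simp
    \<comment> \<open>Both sequences approximate \<phi> m - U, so their difference approximates 0
      and closability applies to it.\<close>
    define X where "X p z = \<psi> p z - (\<phi> m z - \<phi> p z)" for p z
    have X: "approximates k b X (\<lambda>z. 0)"
    proof -
      have "approximates k b (\<lambda>p z. 1 * \<psi> p z + (- 1) * (\<phi> m z - \<phi> p z)) (\<lambda>z. 1 * (\<phi> m z - U z) + (- 1) * (\<phi> m z - U z))"
        by (rule approximates_lin[OF \<psi> A])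
      moreover have "(\<lambda>p z. 1 * \<psi> p z + (- 1) * (\<phi> m z - \<phi> p z)) = X" by (simp add: X_def fun_eq_iff)
      moreover have "(\<lambda>z. 1 * (\<phi> m z - U z) + (- 1) * (\<phi> m z - U z)) = (\<lambda>z. 0)" by simp
      ultimately show ?thesis by (simp only:)
    qed
    have "(\<lambda>p. ?N (nabla_b b k (X p))) \<longlonglongrightarrow> 0"
      using nabla_b_closable[OF b dim approximatesD(1)[OF X] approximatesD(2)[OF X], of k] approximatesD(4)[OF X] by simp
    with G(2) have lim: "(\<lambda>p. ?N (\<lambda>z. nabla_b b k (\<psi> p) z - ?G z) + ?N (nabla_b b k (X p)) + \<epsilon> / 2) \<longlonglongrightarrow> 0 + 0 + \<epsilon> / 2"
      by (intro tendsto_add tendsto_const)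
    have "?N ?G \<le> ?N (\<lambda>z. nabla_b b k (\<psi> p) z - ?G z) + ?N (nabla_b b k (X p)) + \<epsilon> / 2" if p: "p \<ge> N" for p
    proof -
      let ?D = "\<lambda>z. \<phi> m z - \<phi> p z"
      have D: "?D \<in> Cinfe" by (rule Cinfe_diff[OF C C])
      have nX: "nabla_b b k (X p) = (\<lambda>z. nabla_b b k (\<psi> p) z - nabla_b b k ?D z)"
        unfolding X_def[abs_def] by (rule nabla_b_diff[OF C' D])
      have L: "(\<lambda>z. nabla_b b k (\<psi> p) z - ?G z) \<in> weighted_L2 (weight b 0)" "nabla_b b k (X p) \<in> weighted_L2 (weight b 0)" "nabla_b b k ?D \<in> weighted_L2 (weight b 0)"
        by (intro weighted_L2_diff nabla_weighted_L2 C' G weight_nonneg borel_measurable_weight D approximatesD(1)[OF X])+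
      have XD: "(\<lambda>z. nabla_b b k (X p) z + nabla_b b k ?D z) \<in> weighted_L2 (weight b 0)"
        "?N (\<lambda>z. nabla_b b k (X p) z + nabla_b b k ?D z) \<le> ?N (nabla_b b k (X p)) + ?N (nabla_b b k ?D)"
        by (intro weighted_L2_add L weight_nonneg borel_measurable_weight)+
      have "?N (\<lambda>z. (nabla_b b k (X p) z + nabla_b b k ?D z) - (nabla_b b k (\<psi> p) z - ?G z)) \<le>
        ?N (\<lambda>z. nabla_b b k (X p) z + nabla_b b k ?D z) + ?N (\<lambda>z. nabla_b b k (\<psi> p) z - ?G z)"
        by (intro weighted_L2_diff XD L weight_nonneg borel_measurable_weight)
      moreover have "(\<lambda>z. (nabla_b b k (X p) z + nabla_b b k ?D z) - (nabla_b b k (\<psi> p) z - ?G z)) = ?G" by (simp add: nX)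
      moreover have "?N (nabla_b b k ?D) \<le> \<epsilon> / 2" using N0_le_full_norm[of ?D] N m p by (meson less_imp_le order_trans)
      ultimately show ?thesis using XD(2) by simp
    qed
    then have "?N ?G \<le> \<epsilon> / 2" using lim by (intro LIMSEQ_le_const[OF lim[simplified]]) auto
    then show ?thesis by (simp add: Dkb_norm_def)
  qed
  moreover have "0 \<le> Dkb_norm k b V" for V :: "(real^'n) \<times> real \<Rightarrow> real"
    unfolding Dkb_norm_def by (intro weighted_L2_norm_nonneg weight_nonneg)
  ultimately show "\<exists>no. \<forall>n\<ge>no. norm (Dkb_norm k b (\<lambda>z. \<phi> n z - U z) - 0) < \<epsilon>"
    using \<epsilon> by (intro exI[of _ N]) (force simp: abs_of_nonneg)
qed

lemma trace_extension_tendsto: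
  fixes U :: "(real^'n) \<times> real \<Rightarrow> real"
  assumes T: "trace_extension k b T" and \<phi>: "approximates k b \<phi> U"
  shows "(\<lambda>m. Ds_norm s (\<lambda>x. T (\<phi> m) x - T U x)) \<longlonglongrightarrow> 0"
proof (rule LIMSEQ_I)
  fix \<epsilon> :: real assume \<epsilon>: "\<epsilon> > 0"
  have U: "U \<in> Dkb k b" using \<phi> unfolding Dkb_def by blast
  obtain \<delta> where \<delta>: "\<delta> > 0" "\<And>V. V \<in> Dkb k b \<Longrightarrow> Dkb_norm k b (\<lambda>z. V z - U z) < \<delta> \<Longrightarrow> Ds_norm s (\<lambda>x. T V x - T U x) < \<epsilon>"
    using T U \<epsilon> unfolding trace_extension_def continuous_operator_def by blast
  have "\<forall>\<^sub>F m in sequentially. Dkb_norm k b (\<lambda>z. \<phi> m z - U z) < \<delta>"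
    using approximates_Dkb_norm[OF \<phi>] \<delta>(1) by (rule order_tendstoD)
  then have "\<forall>\<^sub>F m in sequentially. Ds_norm s (\<lambda>x. T (\<phi> m) x - T U x) < \<epsilon>"
    by eventually_elim (intro \<delta>(2) Cinfe_Dkb approximatesD(1)[OF \<phi>])
  moreover have "Ds_norm s v \<ge> 0" for v :: "real^'n \<Rightarrow> real"
    by (simp add: Ds_norm_def Ds_inner_def integral_nonneg_AE)
  ultimately show "\<exists>no. \<forall>n\<ge>no. norm (Ds_norm s (\<lambda>x. T (\<phi> n) x - T U x) - 0) < \<epsilon>"
    unfolding eventually_sequentially by simp
qed

text \<open>Both extensions agree with the restriction on the test functions \<phi> m, and
  continuity at U makes \<open>T (\<phi> m)\<close> and \<open>T' (\<phi> m)\<close> converge in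
  \<open>Ds_norm\<close>; a vanishing \<open>Ds_norm\<close> of the difference then forces equality
  almost everywhere.\<close>

lemma trace_extension_unique:
  fixes U :: "(real^'n) \<times> real \<Rightarrow> real"
  assumes T: "trace_extension k b T" and T': "trace_extension k b T'" and U: "U \<in> Dkb k b"
  shows "ae_eq (T' U) (T U)"
proof -
  obtain \<phi> where \<phi>: "approximates k b \<phi> U" using U unfolding Dkb_def by blast
  note C = approximatesD(1)[OF \<phi>]
  have Ds: "T V \<in> Ds s" "T' V \<in> Ds s" if "V \<in> Dkb k b" for V
    using T T' that unfolding trace_extension_def continuous_operator_def by auto
  note D\<phi> = Cinfe_Dkb[OF C]
  have d: "(\<lambda>x. c * f x + e * g x) \<in> Ds s" if "f \<in> Ds s" "g \<in> Ds s" for f g :: "real^'n \<Rightarrow> real" and c e by (rule Ds_lin[OF that])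
  have diff: "(\<lambda>x. f x - g x) \<in> Ds s" if "f \<in> Ds s" "g \<in> Ds s" for f g :: "real^'n \<Rightarrow> real"
    using d[OF that, of 1 "-1"] by simp
  let ?W = "\<lambda>x. T' U x - T U x"
  have W: "?W \<in> Ds s" by (intro diff Ds U)
  have le: "Ds_norm s ?W \<le> Ds_norm s (\<lambda>x. T (\<phi> m) x - T U x) + Ds_norm s (\<lambda>x. T' (\<phi> m) x - T' U x)" for m
  proof -
    have a: "(\<lambda>x. T (\<phi> m) x - T U x) \<in> Ds s" "(\<lambda>x. T' (\<phi> m) x - T' U x) \<in> Ds s" by (intro diff Ds U D\<phi>)+
    have "ae_eq (T (\<phi> m)) (trace_map (\<phi> m))" "ae_eq (T' (\<phi> m)) (trace_map (\<phi> m))"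
      using T T' Cinfe_Cke[OF C] unfolding trace_extension_def by auto
    then have "ae_eq (\<lambda>x. (T (\<phi> m) x - T U x) - (T' (\<phi> m) x - T' U x)) ?W"
      unfolding ae_eq_def by eventually_elim simp
    then have "Ds_norm s ?W = Ds_norm s (\<lambda>x. (T (\<phi> m) x - T U x) - (T' (\<phi> m) x - T' U x))"
      by (intro Ds_norm_cong[symmetric] diff a Ds_measurable[OF W])
    also have "\<dots> \<le> Ds_norm s (\<lambda>x. T (\<phi> m) x - T U x) + Ds_norm s (\<lambda>x. T' (\<phi> m) x - T' U x)"
      by (rule Ds_norm_diff_le[OF a])
    finally show ?thesis .
  qed
  have "(\<lambda>m. Ds_norm s (\<lambda>x. T (\<phi> m) x - T U x) + Ds_norm s (\<lambda>x. T' (\<phi> m) x - T' U x)) \<longlonglongrightarrow> 0 + 0"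
    by (intro tendsto_add trace_extension_tendsto T T' \<phi>)
  then have "Ds_norm s ?W \<le> 0" using le by (intro LIMSEQ_le_const[where a="Ds_norm s ?W" and x=0]) auto
  moreover have "0 \<le> Ds_norm s ?W" by (simp add: Ds_norm_def Ds_inner_def integral_nonneg_AE)
  ultimately have "Ds_norm s ?W = 0" by simp
  from Ds_norm_zero_imp[OF W this] show ?thesis by (simp add: ae_eq_def)
qed

end

theorem theorem3p8:
  fixes k :: nat and b :: real
  assumes "k \<ge> 1" and "-1 < b" and "b < 1"
    and "real CARD('n::finite) + 1 + b > 2 * real k"
  shows "\<exists>T :: ((real^'n) \<times> real \<Rightarrow> real) \<Rightarrow> (real^'n \<Rightarrow> real).
           trace_extension k b T \<and>
           (\<forall>T'. trace_extension k b T' \<longrightarrow> (\<forall>U \<in> Dkb k b. ae_eq (T' U) (T U)))"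
proof -
  interpret admissible k b "TYPE('n)" using assms by unfold_locales
  show ?thesis using trace_extension_Tr trace_extension_unique by blast
qed

end
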